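(* There exists a data structure for the ANN problem for the discrete Fréchet distance of polygonal curves ($n$ curves in $\mathbb{R}^d$), with space and preprocessing time in \[ \tilde{O}(dm^2n)\times\left(\frac{d}{\log m}+2\right)^{O\left(m^{O(1/\epsilon)}\cdot d\cdot\log(1/\epsilon)\right)}, \] and query time $\tilde{O}(d\,m^{O(1/\epsilon)}\cdot 2^{4m}\log n)$, where $m$ denotes the maximum length of a polygonal curve, and $\epsilon\in(0,1/2]$. The data structure succeeds with probability $1/2$, which can be amplified by repetition.
   Context: A polygonal curve of length $m_1$ in $\mathbb{R}^d$ is a finite sequence $V=v_1,\dots,v_{m_1}$ of points of $\mathbb{R}^d$. Traversal: given polygonal curves $V=v_1,\dots,v_{m_1}$ and $U=u_1,\dots,u_{m_2}$, a traversal $T=[(i_1,j_1),\dots,(i_t,j_t)]$ is a sequence of pairs of indices such that $i_1=j_1=1$, $i_t=m_1$, $j_t=m_2$; for all $k$, $i_{k+1}-i_k\in\{0,1\}$ and $j_{k+1}-j_k\in\{0,1\}$; and for all $k$, $(i_{k+1}-i_k)+(j_{k+1}-j_k)\ge 1$. Discrete Fréchet distance (DFD): $\mathrm{d}_\infty(V,U)=\min_{T\in\mathcal{T}}\max_{(i,j)\in T}\|v_i-u_j\|_2$, where $\mathcal{T}$ is the set of all traversals of $V$ and $U$. ANN problem for a distance function $\mathrm{d}$ and approximation parameter $\epsilon$: preprocess $n$ given curves $V_1,\dots,V_n$ into a data structure such that, for any query curve $Q$, the data structure reports some $V_j$ with $\mathrm{d}(Q,V_j)\le(1+\epsilon)\,\mathrm{d}(Q,V_i)$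 for all $i\in\{1,\dots,n\}$. $\tilde{O}(f(d,m,n))$ hides polylogarithmic factors in $f(d,m,n)$ and polynomial factors in $1/\epsilon$. *)

theory Defs
  imports "HOL-Probability.Probability"
begin

section \<open>Polygonal curves and the discrete Frechet distance\<close>

text \<open>
  The dimension is a parameter of the data structure, so points are coordinate lists rather
  than elements of a type-indexed space.
\<close>

type_synonym point = "real list"
type_synonym curve = "point list"

definition is_curve :: "nat \<Rightarrow> curve \<Rightarrow> bool" where
  "is_curve d V \<longleftrightarrow> V \<noteq> [] \<and> (\<forall>p \<in> set V. length p = d)"

definition point_dist :: "point \<Rightarrow> point \<Rightarrow> real" where
  "point_dist p q = L2_set (\<lambda>c. p ! c - q ! c) {..<length p}"

text \<open>Index pairs are 1-based. The differences are taken in \<^typ>\<open>int\<close>, where they do not truncate.\<close>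

definition is_traversal :: "nat \<Rightarrow> nat \<Rightarrow> (nat \<times> nat) list \<Rightarrow> bool" where
  "is_traversal m1 m2 T \<longleftrightarrow>
     T \<noteq> [] \<and> hd T = (1, 1) \<and> last T = (m1, m2) \<and>
     (\<forall>k. Suc k < length T \<longrightarrow>
        int (fst (T ! Suc k)) - int (fst (T ! k)) \<in> {0, 1} \<and>
        int (snd (T ! Suc k)) - int (snd (T ! k)) \<in> {0, 1} \<and>
        (int (fst (T ! Suc k)) - int (fst (T ! k))) +
          (int (snd (T ! Suc k)) - int (snd (T ! k))) \<ge> 1)"

definition discrete_frechet :: "curve \<Rightarrow> curve \<Rightarrow> real" where
  "discrete_frechet V U =
     Min ((\<lambda>T. Max ((\<lambda>(i, j). point_dist (V ! (i - 1)) (U ! (j - 1))) ` set T)) `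
          {T. is_traversal (length V) (length U) T})"

text \<open>The minimum above ranges over a finite nonempty set.\<close>

lemma finite_traversals: "finite {T. is_traversal m1 m2 T}"
proof (rule finite_subset)
  show "finite {T. set T \<subseteq> {..m1} \<times> {..m2} \<and> length T \<le> m1 + m2}"
    by (rule finite_lists_length_le) simp
  show "{T. is_traversal m1 m2 T} \<subseteq> {T. set T \<subseteq> {..m1} \<times> {..m2} \<and> length T \<le> m1 + m2}"
  proof
    fix T assume "T \<in> {T. is_traversal m1 m2 T}"
    then have T: "T \<noteq> []" "hd T = (1, 1)" "last T = (m1, m2)"
      and step: "\<And>k. Suc k < length T \<Longrightarrow>
        fst (T ! k) \<le> fst (T ! Suc k) \<and> snd (T ! k) \<le> snd (T ! Suc k) \<and>
        fst (T ! k) + snd (T ! k) < fst (T ! Suc k) + snd (T ! Suc k)"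
      by (force simp: is_traversal_def)+
    have low: "k < length T \<Longrightarrow> k + 2 \<le> fst (T ! k) + snd (T ! k)" for k
    proof (induction k)
      case 0
      then show ?case using T by (simp add: hd_conv_nth)
    next
      case (Suc k)
      then show ?case using step[of k] by simp
    qed
    have last: "T ! (length T - 1) = (m1, m2)" using T by (simp add: last_conv_nth)
    have len: "length T \<le> m1 + m2" using low[of "length T - 1"] last T(1) by simp
    have up: "r < length T \<Longrightarrow>
        fst (T ! (length T - 1 - r)) \<le> m1 \<and> snd (T ! (length T - 1 - r)) \<le> m2" for r
    proof (induction r)
      case 0
      then show ?case using last by simp
    next
      case (Suc r)
      define q where "q = length T - 1 - Suc r"
      have q: "length T - 1 - r = Suc q" "Suc q < length T"
        using Suc.prems by (simp_all add: q_def)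
      have "fst (T ! Suc q) \<le> m1 \<and> snd (T ! Suc q) \<le> m2"
        using Suc q(1) by simp
      with step[OF q(2)] show ?case
        unfolding q_def[symmetric] by linarith
    qed
    have "set T \<subseteq> {..m1} \<times> {..m2}"
    proof
      fix x assume "x \<in> set T"
      then obtain k where k: "k < length T" "x = T ! k" by (auto simp: in_set_conv_nth)
      then show "x \<in> {..m1} \<times> {..m2}"
        using up[of "length T - 1 - k"] by (simp add: mem_Times_iff)
    qed
    with len show "T \<in> {T. set T \<subseteq> {..m1} \<times> {..m2} \<and> length T \<le> m1 + m2}" by simp
  qed
qed

lemma is_traversal_snoc:
  assumes "is_traversal m1 m2 T"
    and "(a, b) = (Suc m1, m2) \<or> (a, b) = (m1, Suc m2)"
  shows "is_traversal a b (T @ [(a, b)])"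
proof -
  let ?T = "T @ [(a, b)]"
  define ok where "ok x y \<longleftrightarrow>
    int (fst y) - int (fst x) \<in> {0, 1} \<and> int (snd y) - int (snd x) \<in> {0, 1} \<and>
    (int (fst y) - int (fst x)) + (int (snd y) - int (snd x)) \<ge> 1" for x y :: "nat \<times> nat"
  have T: "T \<noteq> []" "hd T = (1, 1)" "last T = (m1, m2)"
    and step: "\<And>k. Suc k < length T \<Longrightarrow> ok (T ! k) (T ! Suc k)"
    using assms(1) unfolding is_traversal_def ok_def by blast+
  have "ok (?T ! k) (?T ! Suc k)" if "Suc k < length ?T" for k
  proof (cases "Suc k < length T")
    case True
    then show ?thesis using step[OF True] by (simp add: nth_append)
  next
    case False
    with that have k: "k = length T - 1" "Suc k = length T" by auto
    then have "T ! k = (m1, m2)" using T by (simp add: last_conv_nth)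
    moreover have "?T ! k = T ! k" "?T ! Suc k = (a, b)" using k T(1) by (simp_all add: nth_append)
    ultimately show ?thesis using assms(2) by (auto simp: ok_def)
  qed
  then show ?thesis
    using T unfolding is_traversal_def ok_def by simp
qed

lemma ex_traversal:
  assumes "1 \<le> m1" "1 \<le> m2"
  shows "\<exists>T. is_traversal m1 m2 T"
  using assms(1)
proof (induction m1 rule: dec_induct)
  case base
  show ?case using assms(2)
  proof (induction m2 rule: dec_induct)
    case base
    show ?case by (rule exI[of _ "[(1, 1)]"]) (simp add: is_traversal_def)
  next
    case (step j)
    then show ?case using is_traversal_snoc by blast
  qed
next
  case (step i)
  then show ?case using is_traversal_snoc by blast
qed

section \<open>A randomized real RAM\<close>

text \<open>
  The model of computation is the real RAM, as a small imperative language: a program has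
  finitely many registers and finitely many arrays, whose cells hold exact reals. Every
  elementary command and every test costs one time unit; expressions involve registers only and
  have bounded size for a fixed program. Available are field arithmetic, square root, floor,
  comparison, integer constants (arbitrary real constants could carry non-uniform advice),
  indirect addressing, and drawing from the uniform distribution on [0,1] and from the standard
  normal distribution.
\<close>

datatype aexp = Const int | Reg string | Add aexp aexp | Sub aexp aexp | Mul aexp aexp
  | Quot aexp aexp | Sqrt aexp | Floor aexp

datatype bexp = Less aexp aexp | Neg bexp | Conj bexp bexp

datatype com =
    Skip
  | Assign string aexp
  | Load string string aexp
  | Store string aexp aexp
  | Uniform string
  | Gauss string
  | Seq com com
  | Cond bexp com com
  | While bexp com

record state =
  reg :: "string \<Rightarrow> real"
  arr :: "string \<Rightarrow> nat \<Rightarrow> real"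
  drawn :: nat

primrec aval :: "aexp \<Rightarrow> (string \<Rightarrow> real) \<Rightarrow> real" where
  "aval (Const i) r = of_int i"
| "aval (Reg x) r = r x"
| "aval (Add a b) r = aval a r + aval b r"
| "aval (Sub a b) r = aval a r - aval b r"
| "aval (Mul a b) r = aval a r * aval b r"
| "aval (Quot a b) r = aval a r / aval b r"
| "aval (Sqrt a) r = sqrt (aval a r)"
| "aval (Floor a) r = of_int \<lfloor>aval a r\<rfloor>"

primrec bval :: "bexp \<Rightarrow> (string \<Rightarrow> real) \<Rightarrow> bool" where
  "bval (Less a b) r \<longleftrightarrow> aval a r < aval b r"
| "bval (Neg p) r \<longleftrightarrow> \<not> bval p r"
| "bval (Conj p q) r \<longleftrightarrow> bval p r \<and> bval q r"

definition addr :: "aexp \<Rightarrow> state \<Rightarrow> nat" where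
  "addr e s = nat \<lfloor>aval e (reg s)\<rfloor>"

definition set_reg :: "string \<Rightarrow> real \<Rightarrow> state \<Rightarrow> state" where
  "set_reg x v s = s\<lparr>reg := (reg s)(x := v)\<rparr>"

text \<open>
  A random tape supplies for the k-th draw a uniform and a normal variate, of which the drawing
  command uses one.
\<close>

type_synonym tape = "nat \<Rightarrow> real \<times> real"

definition tape_measure :: "tape measure" where
  "tape_measure = Pi\<^sub>M UNIV
     (\<lambda>_. uniform_measure lborel {0..1} \<Otimes>\<^sub>M density lborel std_normal_density)"

text \<open>
  \<open>run \<omega> c s t a s'\<close>: started in \<open>s\<close> with random tape \<open>\<omega>\<close>, the program \<open>c\<close> halts in \<open>s'\<close> after
  \<open>t\<close> time units, and every array access, reading or writing, is to an address below \<open>a\<close>.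
  Space is thus the extent of the memory in use, not the number of occupied cells: with the
  latter, sparsely used huge addresses would act as a free dictionary.
\<close>

inductive run :: "tape \<Rightarrow> com \<Rightarrow> state \<Rightarrow> nat \<Rightarrow> nat \<Rightarrow> state \<Rightarrow> bool" for \<omega> :: tape where
  Skip: "run \<omega> Skip s 1 0 s"
| Assign: "run \<omega> (Assign x e) s 1 0 (set_reg x (aval e (reg s)) s)"
| Load: "run \<omega> (Load x A e) s 1 (addr e s + 1) (set_reg x (arr s A (addr e s)) s)"
| Store: "run \<omega> (Store A e e') s 1 (addr e s + 1)
    (s\<lparr>arr := (arr s)(A := (arr s A)(addr e s := aval e' (reg s)))\<rparr>)"
| Uniform: "run \<omega> (Uniform x) s 1 0
    ((set_reg x (fst (\<omega> (drawn s))) s)\<lparr>drawn := drawn s + 1\<rparr>)"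
| Gauss: "run \<omega> (Gauss x) s 1 0
    ((set_reg x (snd (\<omega> (drawn s))) s)\<lparr>drawn := drawn s + 1\<rparr>)"
| Seq: "run \<omega> c1 s t1 a1 s1 \<Longrightarrow> run \<omega> c2 s1 t2 a2 s2 \<Longrightarrow>
    run \<omega> (Seq c1 c2) s (t1 + t2) (max a1 a2) s2"
| CondTrue: "bval b (reg s) \<Longrightarrow> run \<omega> c1 s t a s' \<Longrightarrow> run \<omega> (Cond b c1 c2) s (t + 1) a s'"
| CondFalse: "\<not> bval b (reg s) \<Longrightarrow> run \<omega> c2 s t a s' \<Longrightarrow> run \<omega> (Cond b c1 c2) s (t + 1) a s'"
| WhileFalse: "\<not> bval b (reg s) \<Longrightarrow> run \<omega> (While b c) s 1 0 s"
| WhileTrue: "bval b (reg s) \<Longrightarrow> run \<omega> c s t1 a1 s1 \<Longrightarrow> run \<omega> (While b c) s1 t2 a2 s2 \<Longrightarrow>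
    run \<omega> (While b c) s (t1 + t2 + 1) (max a1 a2) s2"

lemma run_deterministic:
  "run \<omega> c s t a s' \<Longrightarrow> run \<omega> c s t' a' s'' \<Longrightarrow> t' = t \<and> a' = a \<and> s'' = s'"
proof (induction arbitrary: t' a' s'' rule: run.induct)
  case (Seq c1 s t1 a1 s1 c2 t2 a2 s2)
  from Seq.prems show ?case by cases (use Seq.IH in blast)
next
  case (CondTrue b s c1 t a s' c2)
  from CondTrue.prems show ?case by cases (use CondTrue in blast)+
next
  case (CondFalse b s c2 t a s' c1)
  from CondFalse.prems show ?case by cases (use CondFalse in blast)+
next
  case (WhileTrue b s c t1 a1 s1 t2 a2 s2)
  from WhileTrue.prems show ?case by cases (use WhileTrue in blast)+
qed (erule run.cases; simp)+

lemma prob_space_tape_measure: "prob_space tape_measure"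
proof -
  interpret u: prob_space "uniform_measure lborel {0..1::real}"
    by (rule prob_space_uniform_measure) simp_all
  interpret g: prob_space "density lborel std_normal_density"
    by (rule prob_space_normal_density) simp
  interpret p: pair_prob_space "uniform_measure lborel {0..1::real}"
    "density lborel std_normal_density" ..
  show ?thesis
    unfolding tape_measure_def by (rule prob_space_PiM) (rule p.prob_space_axioms)
qed

section \<open>Data structures for approximate nearest neighbours\<close>

definition ann_answer ::
  "(curve \<Rightarrow> curve \<Rightarrow> real) \<Rightarrow> real \<Rightarrow> curve list \<Rightarrow> curve \<Rightarrow> nat \<Rightarrow> bool" where
  "ann_answer \<delta> \<epsilon> Vs Q j \<longleftrightarrow>
     j < length Vs \<and> (\<forall>i < length Vs. \<delta> Q (Vs ! j) \<le> (1 + \<epsilon>) * \<delta> Q (Vs ! i))"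

definition array_of :: "real list \<Rightarrow> nat \<Rightarrow> real" where
  "array_of xs a = (if a < length xs then xs ! a else 0)"

text \<open>
  The coordinates of all curves are stored consecutively. The parameter \<open>k\<close> is the number of
  repetitions used to amplify the success probability.
\<close>

definition data_state :: "nat \<Rightarrow> nat \<Rightarrow> nat \<Rightarrow> real \<Rightarrow> curve list \<Rightarrow> state" where
  "data_state d m k \<epsilon> Vs = \<lparr>
     reg = (\<lambda>_. 0)(''n'' := real (length Vs), ''m'' := real m, ''d'' := real d,
                   ''k'' := real k, ''eps'' := \<epsilon>),
     arr = (\<lambda>_ _. 0)(''len'' := array_of (map (real \<circ> length) Vs),
                     ''V'' := array_of (concat (concat Vs))),
     drawn = 0\<rparr>"

text \<open>
  A query starts in the state left by the preprocessing; it can use fresh random values, as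
  \<^const>\<open>drawn\<close> is kept.
\<close>

definition with_query :: "curve \<Rightarrow> state \<Rightarrow> state" where
  "with_query Q s = s\<lparr>
     reg := (reg s)(''qlen'' := real (length Q)),
     arr := (arr s)(''Q'' := array_of (concat Q))\<rparr>"

definition preprocessing_within ::
  "tape \<Rightarrow> com \<Rightarrow> state \<Rightarrow> real \<Rightarrow> real \<Rightarrow> bool" where
  "preprocessing_within \<omega> pre s0 T S \<longleftrightarrow>
     (\<exists>t a s. run \<omega> pre s0 t a s \<and> real t \<le> T \<and> real a \<le> S)"

definition query_within ::
  "tape \<Rightarrow> com \<Rightarrow> com \<Rightarrow> state \<Rightarrow> curve \<Rightarrow> real \<Rightarrow> real \<Rightarrow> bool" where
  "query_within \<omega> pre qry s0 Q T S \<longleftrightarrow>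
     (\<exists>t a s t' a' s'. run \<omega> pre s0 t a s \<and> run \<omega> qry (with_query Q s) t' a' s' \<and>
        real t' \<le> T \<and> real a' \<le> S)"

definition reports :: "tape \<Rightarrow> com \<Rightarrow> com \<Rightarrow> state \<Rightarrow> curve \<Rightarrow> nat \<Rightarrow> bool" where
  "reports \<omega> pre qry s0 Q j \<longleftrightarrow>
     (\<exists>t a s t' a' s'. run \<omega> pre s0 t a s \<and> run \<omega> qry (with_query Q s) t' a' s' \<and>
        reg s' ''out'' = real j)"

section \<open>Resource bounds\<close>

text \<open>
  The constant \<open>c\<close> stands for all constants hidden in the O-notation; each bound is increasing in
  it. With \<open>n + 1\<close> instead of \<open>n\<close> the logarithm is positive also for a single curve.
\<close>

definition soft_O :: "real \<Rightarrow> real \<Rightarrow> real \<Rightarrow> real" where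
  "soft_O c \<epsilon> f = c * f * (log 2 (f + 2)) powr c * (1 / \<epsilon>) powr c"

definition preprocessing_bound :: "real \<Rightarrow> nat \<Rightarrow> nat \<Rightarrow> nat \<Rightarrow> real \<Rightarrow> real" where
  "preprocessing_bound c d m n \<epsilon> =
     soft_O c \<epsilon> (real d * real m ^ 2 * real n) *
     (real d / log 2 (real m) + 2) powr
       (c * (real m powr (c / \<epsilon>) * real d * log 2 (1 / \<epsilon>)))"

definition query_bound :: "real \<Rightarrow> nat \<Rightarrow> nat \<Rightarrow> nat \<Rightarrow> real \<Rightarrow> real" where
  "query_bound c d m n \<epsilon> =
     soft_O c \<epsilon> (real d * real m powr (c / \<epsilon>) * 2 ^ (4 * m) * log 2 (real n + 1))"

end

theory Submission imports Defs begin

text \<open>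
  Replace a curve of length at most \<open>m\<close> by the \<open>4 ^ m\<close> vectors that list the points visited in
  \<open>3 * m\<close> steps along it. The discrete Frechet distance of two curves is the least distance
  between their vectors, in the norm that is the maximum over the steps of the Euclidean norms.

  Near neighbours of a vector are found in two stages. With probability at least \<open>1 - 2 ^ -k\<close> a
  random linear form preserves all relevant distances up to a factor \<open>De\<close>, so the two neighbours
  of the query in the order of the projections yield an estimate \<open>\<rho>\<close> of the distance that is
  correct up to a factor polynomial in \<open>De\<close>. Either \<open>\<rho>\<close> is already a good answer, or one of
  the gaps between consecutive projections is comparable with \<open>\<rho>\<close> up to such factors and has an
  endpoint that is nearly optimal. Around the endpoints of every gap, the cells of grids at a
  geometric ladder of scales in a window relative to the gap are stored in a dictionary, and a
  binary search over the scales, starting at \<open>\<rho>\<close>, determines the distance up to a factor close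
  to 1. Amplification needs no repetition: \<open>2 ^ k\<close> enters \<open>De\<close>, on which only the
  number of scales depends, and that logarithmically. If \<open>k \<ge> n\<close>, a linear scan is cheap enough.
\<close>

section \<open>Measurability of the outcome\<close>

text \<open>The size of the structure must not depend on the ratio of the largest to the smallest
  distance in the input, so no global range of radii is available; ranges relative to the gaps on
  the projected line replace it, and one decreasing ladder of scales is shared by all gaps. Space is
  the extent of the addressed memory, which rules out hashing into huge addresses: the dictionary is
  a sorted array of real keys searched by bisection, at the price of a logarithm of its size. Time
  and space are bounded on every tape; only the correctness of the answer needs a good tape. Each
  candidate is measured before it counts, so colliding keys on a bad tape cannot falsify the running
  best distance. Correctness is deterministic once a tape is good, and the good tapes form a subset
  of the success event; to conclude from this, the success event must be measurable, since
  \<open>measure\<close> is 0 by convention on other sets.\<close>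

fun exec :: "nat \<Rightarrow> com \<Rightarrow> tape \<Rightarrow> state \<Rightarrow> bool \<times> state" where
  "exec n Skip \<omega> s = (True, s)"
| "exec n (Assign x e) \<omega> s = (True, set_reg x (aval e (reg s)) s)"
| "exec n (Load x A e) \<omega> s = (True, set_reg x (arr s A (addr e s)) s)"
| "exec n (Store A e e') \<omega> s =
     (True, s\<lparr>arr := (arr s)(A := (arr s A)(addr e s := aval e' (reg s)))\<rparr>)"
| "exec n (Uniform x) \<omega> s = (True, (set_reg x (fst (\<omega> (drawn s))) s)\<lparr>drawn := drawn s + 1\<rparr>)"
| "exec n (Gauss x) \<omega> s = (True, (set_reg x (snd (\<omega> (drawn s))) s)\<lparr>drawn := drawn s + 1\<rparr>)"
| "exec n (Seq c1 c2) \<omega> s = (let r1 = exec n c1 \<omega> s; r2 = exec n c2 \<omega> (snd r1) in (fst r1 \<and> fst r2, snd r2))"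
| "exec n (Cond b c1 c2) \<omega> s = (if bval b (reg s) then exec n c1 \<omega> s else exec n c2 \<omega> s)"
| "exec 0 (While b c) \<omega> s = (False, s)"
| "exec (Suc n) (While b c) \<omega> s = (if bval b (reg s)
     then let r1 = exec n c \<omega> s; r2 = exec n (While b c) \<omega> (snd r1) in (fst r1 \<and> fst r2, snd r2)
     else (True, s))"

text \<open>\<open>exec\<close> is the big-step relation with fuel, spent by the iterations of
  \<open>While\<close>. It goes on in some state even after the fuel has run out, so that it is a
  total function of the tape and measurability can be proved by recursion; the Boolean records
  whether the result is genuine.\<close>

lemma exec_imp_run: "fst (exec n c \<omega> s) \<Longrightarrow> \<exists>t a. run \<omega> c s t a (snd (exec n c \<omega> s))"
proof (induction n c \<omega> s rule: exec.induct)
  case (7 n c1 c2 \<omega> s)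
  then show ?case by (auto simp: Let_def intro: run.Seq)
next
  case (10 n b c \<omega> s)
  show ?case
  proof (cases "bval b (reg s)")
    case True
    let ?s = "snd (exec n c \<omega> s)"
    have h: "fst (exec n c \<omega> s)" "fst (exec n (While b c) \<omega> ?s)" using 10(3) True by (simp_all add: Let_def)
    obtain t a where 1: "run \<omega> c s t a ?s" using 10(1)[OF True h(1)] by blast
    obtain t' a' where 2: "run \<omega> (While b c) ?s t' a' (snd (exec n (While b c) \<omega> ?s))"
      using 10(2)[OF True refl h(2)] by blast
    show ?thesis using run.WhileTrue[OF True 1 2] True by (auto simp: Let_def)
  qed (auto intro: run.WhileFalse)
qed (auto intro: run.intros run.Uniform[simplified] run.Gauss[simplified] split: if_splits)

text \<open>All large amounts of fuel must work, not just one, because two commands in sequence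
  share the same fuel.\<close>

lemma run_imp_exec: "run \<omega> c s t a s' \<Longrightarrow> \<exists>N. \<forall>n\<ge>N. exec n c \<omega> s = (True, s')"
proof (induction rule: run.induct)
  case (Seq c1 s t1 a1 s1 c2 t2 a2 s2)
  then obtain N1 N2 where "\<forall>n\<ge>N1. exec n c1 \<omega> s = (True, s1)" "\<forall>n\<ge>N2. exec n c2 \<omega> s1 = (True, s2)"
    by blast
  then show ?case by (intro exI[of _ "max N1 N2"]) auto
next
  case (WhileFalse b s c)
  then show ?case by (intro exI[of _ 1] allI impI) (case_tac n; simp)
next
  case (WhileTrue b s c t1 a1 s1 t2 a2 s2)
  then obtain N1 N2 where N: "\<forall>n\<ge>N1. exec n c \<omega> s = (True, s1)"
    "\<forall>n\<ge>N2. exec n (While b c) \<omega> s1 = (True, s2)"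
    by blast
  show ?case
  proof (intro exI[of _ "Suc (max N1 N2)"] allI impI)
    fix n assume "Suc (max N1 N2) \<le> n"
    then obtain m where "n = Suc m" "N1 \<le> m" "N2 \<le> m" by (cases n) auto
    then show "exec n (While b c) \<omega> s = (True, s2)" using N WhileTrue.hyps(1) by simp
  qed
qed (auto simp del: exec.simps simp add: exec.simps(1-8))

text \<open>Coordinatewise measurability avoids a sigma-algebra on the state record. It suffices
  because expressions and tests read only finitely many registers.\<close>

definition measurable_state :: "tape measure \<Rightarrow> (tape \<Rightarrow> state) \<Rightarrow> bool" where
  "measurable_state M f \<longleftrightarrow> (\<forall>x. (\<lambda>\<omega>. reg (f \<omega>) x) \<in> borel_measurable M) \<and>
     (\<forall>B i. (\<lambda>\<omega>. arr (f \<omega>) B i) \<in> borel_measurable M) \<and>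
     (\<lambda>\<omega>. drawn (f \<omega>)) \<in> measurable M (count_space UNIV)"

lemma measurable_stateD:
  assumes "measurable_state M f"
  shows "(\<lambda>\<omega>. reg (f \<omega>) x) \<in> borel_measurable M" "(\<lambda>\<omega>. arr (f \<omega>) B i) \<in> borel_measurable M"
    "(\<lambda>\<omega>. drawn (f \<omega>)) \<in> measurable M (count_space UNIV)"
  using assms by (auto simp: measurable_state_def)

lemma measurable_aval:
  assumes "measurable_state M f"
  shows "(\<lambda>\<omega>. aval e (reg (f \<omega>))) \<in> borel_measurable M"
proof (induction e)
  case (Floor e)
  then show ?case by simp
qed (use measurable_stateD[OF assms] in auto)

lemma measurable_bval:
  assumes "measurable_state M f"
  shows "Measurable.pred M (\<lambda>\<omega>. bval b (reg (f \<omega>)))"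
proof (induction b)
  case (Less a b)
  have [measurable]: "(\<lambda>\<omega>. aval a (reg (f \<omega>))) \<in> borel_measurable M"
    "(\<lambda>\<omega>. aval b (reg (f \<omega>))) \<in> borel_measurable M"
    using assms by (auto intro: measurable_aval)
  show ?case by simp
qed auto

lemma measurable_addr:
  assumes "measurable_state M f"
  shows "(\<lambda>\<omega>. addr e (f \<omega>)) \<in> measurable M (count_space UNIV)"
proof -
  have [measurable]: "(\<lambda>\<omega>. aval e (reg (f \<omega>))) \<in> borel_measurable M"
    using assms by (rule measurable_aval)
  show ?thesis unfolding addr_def by measurable
qed

lemma measurable_state_If:
  assumes [measurable]: "Measurable.pred M P" and f: "measurable_state M f" and g: "measurable_state M g"
  shows "measurable_state M (\<lambda>\<omega>. if P \<omega> then f \<omega> else g \<omega>)"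
proof -
  note [measurable] = measurable_stateD[OF f] measurable_stateD[OF g]
  have "(\<lambda>\<omega>. reg (if P \<omega> then f \<omega> else g \<omega>) x) = (\<lambda>\<omega>. if P \<omega> then reg (f \<omega>) x else reg (g \<omega>) x)"
    "(\<lambda>\<omega>. arr (if P \<omega> then f \<omega> else g \<omega>) B i) = (\<lambda>\<omega>. if P \<omega> then arr (f \<omega>) B i else arr (g \<omega>) B i)"
    "(\<lambda>\<omega>. drawn (if P \<omega> then f \<omega> else g \<omega>)) = (\<lambda>\<omega>. if P \<omega> then drawn (f \<omega>) else drawn (g \<omega>))" for x B i
    by auto
  then show ?thesis unfolding measurable_state_def by simp
qed

lemma measurable_state_set_reg:
  assumes f: "measurable_state M f" and [measurable]: "v \<in> borel_measurable M"
  shows "measurable_state M (\<lambda>\<omega>. set_reg x (v \<omega>) (f \<omega>))"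
proof -
  note [measurable] = measurable_stateD[OF f]
  show ?thesis unfolding measurable_state_def by (auto simp: set_reg_def fun_upd_apply)
qed

lemma space_tape_measure [simp]: "space tape_measure = UNIV"
  by (simp add: tape_measure_def space_PiM space_pair_measure)

lemma UNIV_tape [simp]: "UNIV \<in> sets tape_measure"
  by (metis sets.top space_tape_measure)

lemma measurable_tape:
  "(\<lambda>\<omega>. fst (\<omega> i)) \<in> borel_measurable tape_measure" "(\<lambda>\<omega>. snd (\<omega> i)) \<in> borel_measurable tape_measure"
proof -
  have "(\<lambda>\<omega>. \<omega> i) \<in> measurable tape_measure (uniform_measure lborel {0..1} \<Otimes>\<^sub>M density lborel std_normal_density)"
    unfolding tape_measure_def by (rule measurable_component_singleton) simp
  from measurable_compose[OF this measurable_fst] measurable_compose[OF this measurable_snd]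
  show "(\<lambda>\<omega>. fst (\<omega> i)) \<in> borel_measurable tape_measure" "(\<lambda>\<omega>. snd (\<omega> i)) \<in> borel_measurable tape_measure"
    by (simp_all cong: measurable_cong_sets)
qed

text \<open>A loop iteration decreases the fuel but not the command, every other construct decreases
  the command; hence induction on the fuel outside and on the command inside.\<close>

lemma measurable_exec:
  assumes "measurable_state tape_measure f"
  shows "measurable_state tape_measure (\<lambda>\<omega>. snd (exec n c \<omega> (f \<omega>))) \<and>
    Measurable.pred tape_measure (\<lambda>\<omega>. fst (exec n c \<omega> (f \<omega>)))"
  using assms
proof (induction n arbitrary: c f rule: less_induct)
  case (less n)
  show ?case using less.prems
  proof (induction c arbitrary: f)
    case (Assign x e)
    then show ?case by (auto intro!: measurable_state_set_reg measurable_aval)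
  next
    case (Load x A e)
    \<comment> \<open>The address is itself random, but it ranges over the countable type
      \<open>nat\<close>, so the composition stays measurable.\<close>
    have "(\<lambda>\<omega>. arr (f \<omega>) A (addr e (f \<omega>))) \<in> borel_measurable tape_measure"
      using measurable_stateD(2)[OF Load] measurable_addr[OF Load]
      by (rule measurable_compose_countable)
    with Load show ?case by (auto intro!: measurable_state_set_reg)
  next
    case (Store A e e')
    note [measurable] = measurable_stateD[OF Store] measurable_addr[OF Store] measurable_aval[OF Store]
    have "(\<lambda>\<omega>. (if B = A then (arr (f \<omega>) A)(addr e (f \<omega>) := aval e' (reg (f \<omega>))) else arr (f \<omega>) B) i)
      \<in> borel_measurable tape_measure" for B i
      by (cases "B = A") (simp_all add: fun_upd_apply)
    then show ?case unfolding measurable_state_def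
      by (auto simp: fun_upd_apply)
  next
    case (Uniform x)
    note [measurable] = measurable_stateD[OF Uniform] measurable_tape
    have [measurable]: "(\<lambda>\<omega>. fst (\<omega> (drawn (f \<omega>)))) \<in> borel_measurable tape_measure"
      by (rule measurable_compose_countable[where f="\<lambda>i \<omega>. fst (\<omega> i)"]) measurable
    show ?case unfolding measurable_state_def
      by (auto simp: fun_upd_apply set_reg_def)
  next
    case (Gauss x)
    note [measurable] = measurable_stateD[OF Gauss] measurable_tape
    have [measurable]: "(\<lambda>\<omega>. snd (\<omega> (drawn (f \<omega>)))) \<in> borel_measurable tape_measure"
      by (rule measurable_compose_countable[where f="\<lambda>i \<omega>. snd (\<omega> i)"]) measurable
    show ?case unfolding measurable_state_def
      by (auto simp: fun_upd_apply set_reg_def)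
  next
    case (Seq c1 c2)
    note 1 = Seq.IH(1)[OF Seq.prems]
    note 2 = Seq.IH(2)[OF conjunct1[OF 1]]
    show ?case using 1 2 by (auto simp: Let_def)
  next
    case (Cond b c1 c2)
    note b [measurable] = measurable_bval[OF Cond.prems, of b]
    note 1 = Cond.IH(1)[OF Cond.prems] and 2 = Cond.IH(2)[OF Cond.prems]
    have "measurable_state tape_measure (\<lambda>\<omega>. if bval b (reg (f \<omega>)) then snd (exec n c1 \<omega> (f \<omega>)) else snd (exec n c2 \<omega> (f \<omega>)))"
      using b 1 2 by (intro measurable_state_If) auto
    moreover have "Measurable.pred tape_measure (\<lambda>\<omega>. if bval b (reg (f \<omega>)) then fst (exec n c1 \<omega> (f \<omega>)) else fst (exec n c2 \<omega> (f \<omega>)))"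
      using 1 2 b by (intro measurable_If) (auto simp: pred_def)
    ultimately show ?case by (simp add: if_distrib cong: if_cong)
  next
    case (While b c)
    show ?case
    proof (cases n)
      case 0
      then show ?thesis using While.prems by simp
    next
      case (Suc n')
      note b [measurable] = measurable_bval[OF While.prems, of b]
      note 1 = less.IH[of n' f c, unfolded Suc, OF _ While.prems, simplified]
      note 2 = less.IH[of n' "\<lambda>\<omega>. snd (exec n' c \<omega> (f \<omega>))" "While b c", unfolded Suc, simplified]
      have "measurable_state tape_measure (\<lambda>\<omega>. if bval b (reg (f \<omega>))
          then snd (exec n' (While b c) \<omega> (snd (exec n' c \<omega> (f \<omega>)))) else f \<omega>)"
        using b 1 2 While.prems by (intro measurable_state_If) auto
      moreover have "Measurable.pred tape_measure (\<lambda>\<omega>. if bval b (reg (f \<omega>))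
          then fst (exec n' c \<omega> (f \<omega>)) \<and> fst (exec n' (While b c) \<omega> (snd (exec n' c \<omega> (f \<omega>)))) else True)"
        using 1 2 b by (intro measurable_If pred_intros_logic) (use b in \<open>simp_all add: pred_def\<close>)
      ultimately show ?thesis by (simp add: Suc if_distrib Let_def cong: if_cong)
    qed
  qed simp
qed

text \<open>Success is a countable union, over the fuel and the reported index, of measurable
  events. This permits comparing it with the good tapes by monotonicity of the measure.\<close>

lemma measurable_success:
  "{\<omega> \<in> space tape_measure. \<exists>j. reports \<omega> pre qry s0 Q j \<and> P j} \<in> sets tape_measure"
proof -
  have R: "reports \<omega> pre qry s0 Q j \<longleftrightarrow>
    (\<exists>n. fst (exec n pre \<omega> s0) \<and> fst (exec n qry \<omega> (with_query Q (snd (exec n pre \<omega> s0)))) \<and>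
      reg (snd (exec n qry \<omega> (with_query Q (snd (exec n pre \<omega> s0))))) ''out'' = real j)" (is "?l \<longleftrightarrow> ?r") for \<omega> j
  proof
    assume ?l
    then obtain t a s t' a' s' where 1: "run \<omega> pre s0 t a s" "run \<omega> qry (with_query Q s) t' a' s'"
      "reg s' ''out'' = real j" unfolding reports_def by blast
    then obtain N1 N2 where "\<forall>n\<ge>N1. exec n pre \<omega> s0 = (True, s)" "\<forall>n\<ge>N2. exec n qry \<omega> (with_query Q s) = (True, s')"
      using run_imp_exec by metis
    with 1 show ?r by (intro exI[of _ "max N1 N2"]) auto
  next
    assume ?r
    then show ?l unfolding reports_def by (elim exE conjE) (frule exec_imp_run, blast dest: exec_imp_run)
  qed
  have m: "measurable_state tape_measure (\<lambda>\<omega>. s0)" by (simp add: measurable_state_def)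
  have q: "measurable_state tape_measure (\<lambda>\<omega>. with_query Q (f \<omega>))" if f: "measurable_state tape_measure f" for f
  proof -
    note [measurable] = measurable_stateD[OF f]
    have "(\<lambda>\<omega>. (if B = ''Q'' then array_of (concat Q) else arr (f \<omega>) B) i) \<in> borel_measurable tape_measure" for B i
      by (cases "B = ''Q''") auto
    then show ?thesis
      unfolding measurable_state_def with_query_def by (auto simp: fun_upd_apply)
  qed
  note 1 = measurable_exec[OF m, of _ pre]
  note 2 = measurable_exec[OF q[OF conjunct1[OF 1]], of _ qry]
  have [measurable]: "Measurable.pred tape_measure (\<lambda>\<omega>. fst (exec n pre \<omega> s0))"
    "Measurable.pred tape_measure (\<lambda>\<omega>. fst (exec n qry \<omega> (with_query Q (snd (exec n pre \<omega> s0)))))"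
    "(\<lambda>\<omega>. reg (snd (exec n qry \<omega> (with_query Q (snd (exec n pre \<omega> s0))))) ''out'') \<in> borel_measurable tape_measure" for n
    using 1 2 measurable_stateD(1)[OF conjunct1[OF 2]] by auto
  have "Measurable.pred tape_measure (\<lambda>\<omega>. \<exists>j. (\<exists>n. fst (exec n pre \<omega> s0) \<and> fst (exec n qry \<omega> (with_query Q (snd (exec n pre \<omega> s0)))) \<and>
      reg (snd (exec n qry \<omega> (with_query Q (snd (exec n pre \<omega> s0))))) ''out'' = real j) \<and> P j)"
    by measurable
  then show ?thesis unfolding R by (simp add: pred_def)
qed

section \<open>Random projections to a line\<close>

interpretation tape: prob_space tape_measure
  by (rule prob_space_tape_measure)

definition uni :: "tape \<Rightarrow> nat \<Rightarrow> real" where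
  "uni \<omega> i = fst (\<omega> i)"

lemma uni_measurable [measurable]: "(\<lambda>\<omega>. uni \<omega> i) \<in> borel_measurable tape_measure"
  unfolding uni_def by (rule measurable_tape)

lemma prob_space_tape_factor:
  "prob_space (uniform_measure lborel {0..1::real} \<Otimes>\<^sub>M density lborel std_normal_density)"
proof -
  interpret u: prob_space "uniform_measure lborel {0..1::real}"
    by (rule prob_space_uniform_measure) simp_all
  interpret g: prob_space "density lborel std_normal_density"
    by (rule prob_space_normal_density) simp
  interpret p: pair_prob_space "uniform_measure lborel {0..1::real}"
    "density lborel std_normal_density" ..
  show ?thesis by (rule p.prob_space_axioms)
qed

lemma distr_uni: "distr tape_measure borel (\<lambda>\<omega>. uni \<omega> i) = uniform_measure lborel {0..1}"
proof -
  let ?U = "uniform_measure lborel {0..1::real}" and ?N = "density lborel std_normal_density"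
  interpret g: prob_space ?N by (rule prob_space_normal_density) simp
  have m: "(\<lambda>\<omega>. \<omega> i) \<in> measurable tape_measure (?U \<Otimes>\<^sub>M ?N)"
    unfolding tape_measure_def by (rule measurable_component_singleton) simp
  have "distr tape_measure (?U \<Otimes>\<^sub>M ?N) (\<lambda>\<omega>. \<omega> i) = ?U \<Otimes>\<^sub>M ?N"
    unfolding tape_measure_def by (rule distr_PiM_component) (auto intro: prob_space_tape_factor)
  then have "distr (distr tape_measure (?U \<Otimes>\<^sub>M ?N) (\<lambda>\<omega>. \<omega> i)) ?U fst = distr (?U \<Otimes>\<^sub>M ?N) ?U fst"
    by simp
  also have "\<dots> = ?U" by (rule g.distr_pair_fst)
  finally have "distr tape_measure ?U (\<lambda>\<omega>. uni \<omega> i) = ?U"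
    using m by (simp add: distr_distr comp_def uni_def)
  then show ?thesis by (metis (no_types) distr_cong sets_lborel sets_uniform_measure)
qed

lemma indep_uni: "tape.indep_vars (\<lambda>_. borel) (\<lambda>i \<omega>. uni \<omega> i) UNIV"
proof -
  let ?M = "uniform_measure lborel {0..1::real} \<Otimes>\<^sub>M density lborel std_normal_density"
  have m: "(\<lambda>\<omega>. \<omega> i) \<in> measurable tape_measure ?M" for i
    unfolding tape_measure_def by (rule measurable_component_singleton) simp
  have "distr tape_measure ?M (\<lambda>\<omega>. \<omega> i) = ?M" for i
    unfolding tape_measure_def by (rule distr_PiM_component) (auto intro: prob_space_tape_factor)
  then have "tape.indep_vars (\<lambda>_. ?M) (\<lambda>i \<omega>. \<omega> i) UNIV"
    using m by (subst tape.indep_vars_iff_distr_eq_PiM') (auto simp: tape_measure_def restrict_UNIV)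
  from tape.indep_vars_compose2[OF this, where N="\<lambda>_. borel" and Y="\<lambda>_. fst"]
  show ?thesis unfolding uni_def by (auto cong: measurable_cong_sets)
qed

text \<open>Conditioning on all coordinates but the largest one leaves an interval of length \<open>2\<delta>\<close>.\<close>

lemma anticoncentration:
  assumes F: "finite F" "c \<in> F" and x: "x c \<noteq> 0" and \<delta>: "0 \<le> \<delta>"
  shows "measure tape_measure {\<omega> \<in> space tape_measure. \<bar>\<Sum>i\<in>F. uni \<omega> i * x i\<bar> \<le> \<delta> * \<bar>x c\<bar>} \<le> 2 * \<delta>"
proof -
  define Y where "Y \<omega> = (\<Sum>i\<in>F - {c}. uni \<omega> i * x i)" for \<omega>
  have [measurable]: "Y \<in> borel_measurable tape_measure" unfolding Y_def by measurable
  let ?U = "uniform_measure lborel {0..1::real}" and ?Y = "distr tape_measure borel Y"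
  interpret U: prob_space ?U by (rule prob_space_uniform_measure) simp_all
  interpret Y: prob_space ?Y by (rule tape.prob_space_distr) measurable
  interpret P: pair_sigma_finite ?U ?Y ..
  have "tape.indep_vars (\<lambda>_. borel) (\<lambda>i \<omega>. uni \<omega> i) (insert c (F - {c}))"
    by (rule tape.indep_vars_subset[OF indep_uni]) simp
  \<comment> \<open>All coordinates but \<open>c\<close> are scaled before they are summed; leaving
    \<open>c\<close> unscaled keeps its law uniform.\<close>
  from tape.indep_vars_compose2[OF this, where N="\<lambda>_. borel" and Y="\<lambda>i u. u * (if i = c then 1 else x i)"]
  have "tape.indep_vars (\<lambda>_. borel) (\<lambda>i \<omega>. uni \<omega> i * (if i = c then 1 else x i)) (insert c (F - {c}))"
    by simp
  from tape.indep_vars_sum[OF _ _ this] F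
  have "tape.indep_var borel (\<lambda>\<omega>. uni \<omega> c) borel (\<lambda>\<omega>. \<Sum>i\<in>F - {c}. uni \<omega> i * (if i = c then 1 else x i))"
    by simp
  also have "(\<lambda>\<omega>. \<Sum>i\<in>F - {c}. uni \<omega> i * (if i = c then 1 else x i)) = Y"
    by (auto simp: Y_def intro!: ext sum.cong)
  finally have ind: "?U \<Otimes>\<^sub>M ?Y = distr tape_measure (borel \<Otimes>\<^sub>M borel) (\<lambda>\<omega>. (uni \<omega> c, Y \<omega>))"
    by (simp add: tape.indep_var_distribution_eq distr_uni)
  define S where "S = {p :: real \<times> real. \<bar>fst p * x c + snd p\<bar> \<le> \<delta> * \<bar>x c\<bar>}"
  have S: "S \<in> sets (borel \<Otimes>\<^sub>M borel)"
  proof -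
    have "{p \<in> space (borel \<Otimes>\<^sub>M borel). \<bar>fst p * x c + snd p\<bar> \<le> \<delta> * \<bar>x c\<bar>} \<in> sets (borel \<Otimes>\<^sub>M (borel :: real measure))"
      by measurable
    then show ?thesis by (simp add: S_def space_pair_measure)
  qed
  have sum: "(\<Sum>i\<in>F. uni \<omega> i * x i) = uni \<omega> c * x c + Y \<omega>" for \<omega>
    using F by (simp add: Y_def sum.remove)
  have "emeasure tape_measure {\<omega> \<in> space tape_measure. \<bar>\<Sum>i\<in>F. uni \<omega> i * x i\<bar> \<le> \<delta> * \<bar>x c\<bar>}
     = emeasure (?U \<Otimes>\<^sub>M ?Y) S"
    unfolding ind using S by (subst emeasure_distr) (auto simp: sum S_def intro!: arg_cong[where f="emeasure _"])
  also have "\<dots> = (\<integral>\<^sup>+ y. emeasure ?U ((\<lambda>a. (a, y)) -` S) \<partial>?Y)"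
    using S by (intro P.emeasure_pair_measure_alt2) (simp cong: sets_pair_measure_cong)
  also have "\<dots> \<le> (\<integral>\<^sup>+ y. ennreal (2 * \<delta>) \<partial>?Y)"
  proof (rule nn_integral_mono)
    fix y
    have "(\<lambda>a. (a, y)) -` S = {- y / x c - \<delta> .. - y / x c + \<delta>}"
    proof -
      have "\<bar>a * x c + y\<bar> \<le> \<delta> * \<bar>x c\<bar> \<longleftrightarrow> \<bar>a + y / x c\<bar> \<le> \<delta>" for a
      proof -
        have "\<bar>a * x c + y\<bar> = \<bar>a + y / x c\<bar> * \<bar>x c\<bar>"
          using x by (simp add: abs_mult[symmetric] field_simps)
        then show ?thesis using x by simp
      qed
      then have "(\<lambda>a. (a, y)) -` S = {a. \<bar>a + y / x c\<bar> \<le> \<delta>}" by (simp add: S_def vimage_def)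
      also have "\<dots> = {- (y / x c) - \<delta> .. - (y / x c) + \<delta>}" by (auto simp: abs_le_iff)
      finally show ?thesis by simp
    qed
    then have "emeasure ?U ((\<lambda>a. (a, y)) -` S) \<le> emeasure lborel {- y / x c - \<delta> .. - y / x c + \<delta>}"
      by (simp add: emeasure_mono divide_ennreal_def)
    then show "emeasure ?U ((\<lambda>a. (a, y)) -` S) \<le> ennreal (2 * \<delta>)"
      using \<delta> by simp
  qed
  also have "\<dots> = ennreal (2 * \<delta>)" by (simp add: Y.emeasure_space_1[simplified])
  finally show ?thesis using \<delta> by (simp add: tape.emeasure_eq_measure)
qed

text \<open>Union bound over the \<open>card Z ^ 2\<close> pairs, with
  \<open>anticoncentration\<close> applied to a coordinate of largest difference;
  \<open>\<delta>\<close> is chosen so that the total is \<open>(1 / 2) ^ k\<close>. The last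
  property is the case of radius 0 for countably many integer vectors and holds almost surely.
  \<open>D\<close> and \<open>E\<close> are separate because keys carry one coordinate more than
  projections.\<close>

lemma good_tapes:
  assumes Z: "finite Z" "Z \<noteq> {}" and \<delta>: "\<delta> = 1 / (2 ^ k * 2 * real (card Z) ^ 2)"
  shows "\<exists>G \<in> sets tape_measure. measure tape_measure G \<ge> 1 - (1 / 2) ^ k \<and> (\<forall>\<omega>\<in>G.
    (\<forall>i. 0 \<le> uni \<omega> i \<and> uni \<omega> i \<le> 1) \<and>
    (\<forall>z\<in>Z. \<forall>z'\<in>Z. \<forall>c<D. \<delta> * \<bar>z c - z' c\<bar> \<le> \<bar>\<Sum>i<D. uni \<omega> i * (z i - z' i)\<bar>) \<and>
    (\<forall>v :: nat \<Rightarrow> int. (\<exists>c<E. v c \<noteq> 0) \<longrightarrow> (\<Sum>i<E. uni \<omega> i * real_of_int (v i)) \<noteq> 0))"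
proof -
  have \<delta>0: "0 \<le> \<delta>" by (simp add: \<delta>)
  have AE1: "AE \<omega> in tape_measure. \<forall>i. 0 \<le> uni \<omega> i \<and> uni \<omega> i \<le> 1"
  proof (subst AE_all_countable, rule allI)
    fix i
    have "AE u in uniform_measure lborel {0..1::real}. 0 \<le> u \<and> u \<le> 1"
      by (rule AE_uniform_measureI) auto
    then have "AE u in distr tape_measure borel (\<lambda>\<omega>. uni \<omega> i). 0 \<le> u \<and> u \<le> 1"
      unfolding distr_uni .
    then show "AE \<omega> in tape_measure. 0 \<le> uni \<omega> i \<and> uni \<omega> i \<le> 1"
      by (subst (asm) AE_distr_iff) auto
  qed
  \<comment> \<open>Only the values below \<open>E\<close> matter, and as extensional functions on a
    finite set the integer vectors are countable.\<close>
  define K where "K = {v \<in> {..<E} \<rightarrow>\<^sub>E (UNIV :: int set). \<exists>c<E. v c \<noteq> 0}"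
  have "countable K" unfolding K_def
    by (rule countable_subset[of _ "{..<E} \<rightarrow>\<^sub>E UNIV"]) (auto intro: countable_PiE)
  moreover have "AE \<omega> in tape_measure. (\<Sum>i<E. uni \<omega> i * real_of_int (v i)) \<noteq> 0" if "v \<in> K" for v
  proof -
    from that obtain c where c: "c < E" "v c \<noteq> 0" by (auto simp: K_def)
    have "measure tape_measure {\<omega> \<in> space tape_measure. \<bar>\<Sum>i<E. uni \<omega> i * real_of_int (v i)\<bar> \<le> 0 * \<bar>real_of_int (v c)\<bar>} \<le> 2 * 0"
      by (rule anticoncentration) (use c in auto)
    then have "measure tape_measure {\<omega> \<in> space tape_measure. (\<Sum>i<E. uni \<omega> i * real_of_int (v i)) = 0} = 0"
      using measure_nonneg[of tape_measure] by (intro antisym) auto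
    then have "emeasure tape_measure {\<omega> \<in> space tape_measure. \<not> (\<Sum>i<E. uni \<omega> i * real_of_int (v i)) \<noteq> 0} = 0"
      by (simp add: tape.emeasure_eq_measure)
    moreover have "{\<omega> \<in> space tape_measure. (\<Sum>i<E. uni \<omega> i * real_of_int (v i)) = 0} \<in> sets tape_measure"
      by measurable
    ultimately show ?thesis by (subst AE_iff_measurable[OF _ refl]) auto
  qed
  ultimately have "AE \<omega> in tape_measure. \<forall>v\<in>K. (\<Sum>i<E. uni \<omega> i * real_of_int (v i)) \<noteq> 0"
    by (simp add: AE_ball_countable)
  then have "AE \<omega> in tape_measure. \<forall>v :: nat \<Rightarrow> int. (\<exists>c<E. v c \<noteq> 0) \<longrightarrow> (\<Sum>i<E. uni \<omega> i * real_of_int (v i)) \<noteq> 0"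
  proof (rule AE_mp, intro AE_I2 impI allI)
    fix \<omega> and v :: "nat \<Rightarrow> int"
    assume *: "\<forall>v\<in>K. (\<Sum>i<E. uni \<omega> i * real_of_int (v i)) \<noteq> 0" "\<exists>c<E. v c \<noteq> 0"
    then have "restrict v {..<E} \<in> K" by (auto simp: K_def)
    with * show "(\<Sum>i<E. uni \<omega> i * real_of_int (v i)) \<noteq> 0" by fastforce
  qed
  with AE1 have "AE \<omega> in tape_measure. (\<forall>i. 0 \<le> uni \<omega> i \<and> uni \<omega> i \<le> 1) \<and>
    (\<forall>v :: nat \<Rightarrow> int. (\<exists>c<E. v c \<noteq> 0) \<longrightarrow> (\<Sum>i<E. uni \<omega> i * real_of_int (v i)) \<noteq> 0)"
    by eventually_elim blast
  then obtain N where N: "N \<in> null_sets tape_measure"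
    "\<And>\<omega>. \<omega> \<notin> N \<Longrightarrow> (\<forall>i. 0 \<le> uni \<omega> i \<and> uni \<omega> i \<le> 1) \<and>
      (\<forall>v :: nat \<Rightarrow> int. (\<exists>c<E. v c \<noteq> 0) \<longrightarrow> (\<Sum>i<E. uni \<omega> i * real_of_int (v i)) \<noteq> 0)"
    by (elim AE_E3) auto
  define m where "m p = (ARG_MAX (\<lambda>c. \<bar>fst p c - snd p c\<bar>) c. c < D)" for p :: "(nat \<Rightarrow> real) \<times> (nat \<Rightarrow> real)"
  have m: "m p < D \<and> (\<forall>c<D. \<bar>fst p c - snd p c\<bar> \<le> \<bar>fst p (m p) - snd p (m p)\<bar>)" if "0 < D" for p
  proof -
    have fin: "finite ((\<lambda>c. \<bar>fst p c - snd p c\<bar>) ` {..<D})" by simp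
    from Max_in[OF fin] that obtain c where c: "c < D" "\<bar>fst p c - snd p c\<bar> = Max ((\<lambda>c. \<bar>fst p c - snd p c\<bar>) ` {..<D})"
      by (metis (mono_tags, lifting) empty_iff image_iff image_is_empty lessThan_iff)
    have "is_arg_max (\<lambda>c. \<bar>fst p c - snd p c\<bar>) (\<lambda>c. c < D) c"
      using c by (auto simp: is_arg_max_linorder)
    then have "is_arg_max (\<lambda>c. \<bar>fst p c - snd p c\<bar>) (\<lambda>c. c < D) (m p)"
      unfolding m_def arg_max_def by (rule someI)
    then show ?thesis by (auto simp: is_arg_max_linorder)
  qed
  \<comment> \<open>If the two vectors agree at a coordinate of largest difference, they agree
    everywhere below \<open>D\<close> and there is nothing to avoid; otherwise this coordinate has
    the nonzero coefficient that \<open>anticoncentration\<close> asks for.\<close>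
  define B where "B p = (if 0 < D \<and> fst p (m p) \<noteq> snd p (m p) then {\<omega> \<in> space tape_measure.
      \<bar>\<Sum>i<D. uni \<omega> i * (fst p i - snd p i)\<bar> \<le> \<delta> * \<bar>fst p (m p) - snd p (m p)\<bar>} else {})" for p
  have Bs: "B p \<in> sets tape_measure" for p
  proof -
    have "{\<omega> \<in> space tape_measure. \<bar>\<Sum>i<D. uni \<omega> i * (fst p i - snd p i)\<bar> \<le> \<delta> * \<bar>fst p (m p) - snd p (m p)\<bar>}
        \<in> sets tape_measure" by measurable
    then show ?thesis by (simp add: B_def)
  qed
  have Bp: "measure tape_measure (B p) \<le> 2 * \<delta>" for p
    using anticoncentration[of "{..<D}" "m p" "\<lambda>i. fst p i - snd p i" \<delta>] m[of p] \<delta>0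
    by (auto simp: B_def)
  define G where "G = space tape_measure - (N \<union> (\<Union>p\<in>Z \<times> Z. B p))"
  have Ns: "N \<in> sets tape_measure" using N by auto
  have "measure tape_measure (N \<union> (\<Union>p\<in>Z \<times> Z. B p)) \<le> measure tape_measure N + measure tape_measure (\<Union>p\<in>Z \<times> Z. B p)"
    using Ns Bs Z by (intro measure_Un_le sets.finite_UN) auto
  also have "measure tape_measure N = 0" using N by (simp add: measure_eq_0_null_sets)
  also have "measure tape_measure (\<Union>p\<in>Z \<times> Z. B p) \<le> (\<Sum>p\<in>Z \<times> Z. measure tape_measure (B p))"
    using Z Bs by (intro tape.finite_measure_subadditive_finite) auto
  also have "\<dots> \<le> (\<Sum>p\<in>Z \<times> Z. 2 * \<delta>)" by (rule sum_mono) (rule Bp)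
  also have "\<dots> = (1 / 2) ^ k"
    using Z by (simp add: \<delta> card_cartesian_product power2_eq_square power_one_over field_simps)
  finally have "measure tape_measure (N \<union> (\<Union>p\<in>Z \<times> Z. B p)) \<le> (1 / 2) ^ k" by simp
  moreover have sets: "N \<union> (\<Union>p\<in>Z \<times> Z. B p) \<in> sets tape_measure"
    using Ns Bs Z by (intro sets.Un sets.finite_UN) auto
  ultimately have "measure tape_measure G \<ge> 1 - (1 / 2) ^ k"
    unfolding G_def by (subst tape.prob_compl) auto
  moreover have "\<delta> * \<bar>z c - z' c\<bar> \<le> \<bar>\<Sum>i<D. uni \<omega> i * (z i - z' i)\<bar>"
    if "\<omega> \<in> G" "z \<in> Z" "z' \<in> Z" "c < D" for \<omega> z z' c
  proof (cases "fst (z, z') (m (z, z')) = snd (z, z') (m (z, z'))")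
    case True
    then have "\<bar>z c - z' c\<bar> \<le> 0" using m[of "(z, z')"] that(4) by fastforce
    then show ?thesis by simp
  next
    case False
    have "\<omega> \<notin> B (z, z')" using that by (auto simp: G_def)
    then have "\<delta> * \<bar>z (m (z, z')) - z' (m (z, z'))\<bar> < \<bar>\<Sum>i<D. uni \<omega> i * (z i - z' i)\<bar>"
      using False that(4) by (auto simp: B_def)
    moreover have "\<delta> * \<bar>z c - z' c\<bar> \<le> \<delta> * \<bar>z (m (z, z')) - z' (m (z, z'))\<bar>"
      using m[of "(z, z')"] that(4) \<delta>0 by (intro mult_left_mono) auto
    ultimately show ?thesis by simp
  qed
  moreover have "G \<in> sets tape_measure" unfolding G_def using sets by auto
  ultimately show ?thesis using N(2) by (intro bexI[of _ G]) (auto simp: G_def)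
qed

section \<open>A weakest-precondition calculus with time and space\<close>

abbreviation Sequ :: "com \<Rightarrow> com \<Rightarrow> com" (infixr ";;" 60) where "c ;; c' \<equiv> Seq c c'"
abbreviation R :: "string \<Rightarrow> aexp" where "R \<equiv> Reg"
abbreviation add_aexp (infixl "\<oplus>" 65) where "a \<oplus> b \<equiv> Add a b"
abbreviation sub_aexp (infixl "\<ominus>" 65) where "a \<ominus> b \<equiv> Sub a b"
abbreviation mul_aexp (infixl "\<otimes>" 70) where "a \<otimes> b \<equiv> Mul a b"
abbreviation quot_aexp (infixl "\<oslash>" 70) where "a \<oslash> b \<equiv> Quot a b"

text \<open>The time is handed to the postcondition, while the address bound is a fixed parameter:
  times add up along a program, addresses only take a maximum.\<close>

definition wp :: "tape \<Rightarrow> nat \<Rightarrow> com \<Rightarrow> (nat \<Rightarrow> state \<Rightarrow> bool) \<Rightarrow> state \<Rightarrow> bool" where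
  "wp \<omega> A c Q s \<longleftrightarrow> (\<exists>t a s'. run \<omega> c s t a s' \<and> a \<le> A \<and> Q t s')"

definition set_arr :: "string \<Rightarrow> nat \<Rightarrow> real \<Rightarrow> state \<Rightarrow> state" where
  "set_arr B i v s = s\<lparr>arr := (arr s)(B := (arr s B)(i := v))\<rparr>"

lemma reg_set_reg [simp]: "reg (set_reg x v s) y = (if y = x then v else reg s y)"
  by (simp add: set_reg_def)

lemma reg_set_arr [simp]: "reg (set_arr B i v s) = reg s"
  by (simp add: set_arr_def)

lemma arr_set_reg [simp]: "arr (set_reg x v s) = arr s"
  by (simp add: set_reg_def)

lemma arr_set_arr [simp]:
  "arr (set_arr B i v s) C j = (if C = B \<and> j = i then v else arr s C j)"
  by (simp add: set_arr_def)

lemma arr_set_arr_fun: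
  "arr (set_arr B i v s) C = (if C = B then (arr s C)(i := v) else arr s C)"
  by (simp add: set_arr_def)

lemma drawn_set [simp]: "drawn (set_reg x v s) = drawn s" "drawn (set_arr B i v s) = drawn s"
  by (simp_all add: set_reg_def set_arr_def)

inductive_cases skipE: "run \<omega> Skip s t a s'"
inductive_cases assignE: "run \<omega> (Assign x e) s t a s'"
inductive_cases loadE: "run \<omega> (Load x B e) s t a s'"
inductive_cases storeE: "run \<omega> (Store B e e') s t a s'"
inductive_cases uniformE: "run \<omega> (Uniform x) s t a s'"
inductive_cases seqE: "run \<omega> (Seq c1 c2) s t a s'"
inductive_cases condE: "run \<omega> (Cond b c1 c2) s t a s'"

lemma wp_Skip [simp]: "wp \<omega> A Skip Q = Q 1"
  unfolding wp_def using run.Skip[of \<omega>] by (fastforce elim: skipE)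

lemma wp_Assign [simp]: "wp \<omega> A (Assign x e) Q = (\<lambda>s. Q 1 (set_reg x (aval e (reg s)) s))"
  unfolding wp_def using run.Assign[of \<omega> x e] by (fastforce elim: assignE)

lemma wp_Load [simp]:
  "wp \<omega> A (Load x B e) Q = (\<lambda>s. addr e s < A \<and> Q 1 (set_reg x (arr s B (addr e s)) s))"
  unfolding wp_def using run.Load[of \<omega> x B e] by (fastforce elim: loadE)

lemma wp_Store [simp]:
  "wp \<omega> A (Store B e e') Q = (\<lambda>s. addr e s < A \<and> Q 1 (set_arr B (addr e s) (aval e' (reg s)) s))"
  unfolding wp_def set_arr_def using run.Store[of \<omega> B e e'] by (fastforce elim: storeE)

lemma wp_Uniform [simp]:
  "wp \<omega> A (Uniform x) Q =
    (\<lambda>s. Q 1 ((set_reg x (fst (\<omega> (drawn s))) s)\<lparr>drawn := drawn s + 1\<rparr>))"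
  unfolding wp_def using run.Uniform[of \<omega> x] by (fastforce elim: uniformE)

lemma wp_Seq [simp]:
  "wp \<omega> A (Seq c1 c2) Q = wp \<omega> A c1 (\<lambda>t. wp \<omega> A c2 (\<lambda>t'. Q (t + t')))"
proof (rule ext, rule iffI)
  fix s assume "wp \<omega> A (Seq c1 c2) Q s"
  then obtain t a s1 t' a' s2 where "run \<omega> c1 s t a s1" "run \<omega> c2 s1 t' a' s2"
    "max a a' \<le> A" "Q (t + t') s2" unfolding wp_def by (elim exE conjE seqE) blast
  then show "wp \<omega> A c1 (\<lambda>t. wp \<omega> A c2 (\<lambda>t'. Q (t + t'))) s"
    unfolding wp_def by (metis max.bounded_iff)
next
  fix s assume "wp \<omega> A c1 (\<lambda>t. wp \<omega> A c2 (\<lambda>t'. Q (t + t'))) s"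
  then obtain t a s1 t' a' s2 where "run \<omega> c1 s t a s1" "a \<le> A" "run \<omega> c2 s1 t' a' s2" "a' \<le> A"
    "Q (t + t') s2" unfolding wp_def by auto
  then show "wp \<omega> A (Seq c1 c2) Q s" unfolding wp_def using run.Seq by (metis max.bounded_iff)
qed

lemma wp_Cond [simp]:
  "wp \<omega> A (Cond b c1 c2) Q = (\<lambda>s.
    if bval b (reg s) then wp \<omega> A c1 (\<lambda>t. Q (t + 1)) s else wp \<omega> A c2 (\<lambda>t. Q (t + 1)) s)"
proof (rule ext)
  fix s
  show "wp \<omega> A (Cond b c1 c2) Q s = (if bval b (reg s) then wp \<omega> A c1 (\<lambda>t. Q (t + 1)) s
      else wp \<omega> A c2 (\<lambda>t. Q (t + 1)) s)"
  proof (cases "bval b (reg s)")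
    case True
    then have "run \<omega> (Cond b c1 c2) s t a s' \<longleftrightarrow> (\<exists>u. t = u + 1 \<and> run \<omega> c1 s u a s')" for t a s'
      by (auto elim: condE dest: run.CondTrue)
    with True show ?thesis unfolding wp_def by auto
  next
    case False
    then have "run \<omega> (Cond b c1 c2) s t a s' \<longleftrightarrow> (\<exists>u. t = u + 1 \<and> run \<omega> c2 s u a s')" for t a s'
      by (auto elim: condE dest: run.CondFalse)
    with False show ?thesis unfolding wp_def by auto
  qed
qed

lemma wp_mono: "wp \<omega> A c Q s \<Longrightarrow> (\<And>t s'. Q t s' \<Longrightarrow> Q' t s') \<Longrightarrow> wp \<omega> A c Q' s"
  unfolding wp_def by blast

text \<open>The index \<open>i\<close> counts the iterations already done.\<close>

lemma wp_While:
  assumes "I 0 s"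
    and step: "\<And>i s. I i s \<Longrightarrow> bval b (reg s) \<Longrightarrow> i < n \<and> wp \<omega> A c (\<lambda>t s'. t \<le> T \<and> I (Suc i) s') s"
  shows "wp \<omega> A (While b c) (\<lambda>t s'. t \<le> n * (T + 1) + 1 \<and> (\<exists>i\<le>n. I i s') \<and> \<not> bval b (reg s')) s"
proof -
  have "wp \<omega> A (While b c) (\<lambda>t s'. t \<le> (n - i) * (T + 1) + 1 \<and> (\<exists>i\<le>n. I i s') \<and> \<not> bval b (reg s')) s"
    if "I i s" "i \<le> n" for i s
    using that
  proof (induction "n - i" arbitrary: i s)
    case 0
    then have "\<not> bval b (reg s)" using step[of i s] by auto
    then show ?case unfolding wp_def using 0 run.WhileFalse[of b s \<omega> c] by fastforce
  next
    case (Suc k)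
    show ?case
    proof (cases "bval b (reg s)")
      case False
      then show ?thesis unfolding wp_def using Suc.prems run.WhileFalse[of b s \<omega> c] by fastforce
    next
      case True
      then obtain t a s1 where 1: "run \<omega> c s t a s1" "a \<le> A" "t \<le> T" "I (Suc i) s1" "i < n"
        using step[OF Suc.prems(1)] unfolding wp_def by blast
      then have "wp \<omega> A (While b c) (\<lambda>t s'. t \<le> (n - Suc i) * (T + 1) + 1 \<and> (\<exists>i\<le>n. I i s') \<and> \<not> bval b (reg s')) s1"
        using Suc by auto
      then obtain t' a' s' where 2: "run \<omega> (While b c) s1 t' a' s'" "a' \<le> A"
        "t' \<le> (n - Suc i) * (T + 1) + 1" "\<exists>i\<le>n. I i s'" "\<not> bval b (reg s')"
        unfolding wp_def by blast
      have "n - i = Suc (n - Suc i)" using 1 by simp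
      then have "t + t' + 1 \<le> (n - i) * (T + 1) + 1" using 1 2 by simp
      then show ?thesis unfolding wp_def using run.WhileTrue[OF True 1(1) 2(1)] 1 2
        by (meson max.boundedI)
    qed
  qed
  from this[of 0 s] assms(1) show ?thesis by simp
qed

primrec wr :: "com \<Rightarrow> string set" where
  "wr Skip = {}" | "wr (Assign x e) = {x}" | "wr (Load x B e) = {x}" | "wr (Store B e e') = {}"
| "wr (Uniform x) = {x}" | "wr (Gauss x) = {x}" | "wr (Seq c c') = wr c \<union> wr c'"
| "wr (Cond b c c') = wr c \<union> wr c'" | "wr (While b c) = wr c"

primrec wa :: "com \<Rightarrow> string set" where
  "wa Skip = {}" | "wa (Assign x e) = {}" | "wa (Load x B e) = {}" | "wa (Store B e e') = {B}"
| "wa (Uniform x) = {}" | "wa (Gauss x) = {}" | "wa (Seq c c') = wa c \<union> wa c'"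
| "wa (Cond b c c') = wa c \<union> wa c'" | "wa (While b c) = wa c"

definition same :: "string set \<Rightarrow> string set \<Rightarrow> state \<Rightarrow> state \<Rightarrow> bool" where
  "same X Y s s' \<longleftrightarrow> (\<forall>x. x \<notin> X \<longrightarrow> reg s' x = reg s x) \<and> (\<forall>B. B \<notin> Y \<longrightarrow> arr s' B = arr s B)"

lemma same_refl [simp]: "same X Y s s"
  by (simp add: same_def)

lemma same_trans: "same X Y s s' \<Longrightarrow> same X' Y' s' s'' \<Longrightarrow> X \<union> X' \<subseteq> Z \<Longrightarrow> Y \<union> Y' \<subseteq> W \<Longrightarrow> same Z W s s''"
  unfolding same_def by (metis UnCI subsetD)

lemma same_reg: "same X Y s s' \<Longrightarrow> x \<notin> X \<Longrightarrow> reg s' x = reg s x"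
  and same_arr: "same X Y s s' \<Longrightarrow> B \<notin> Y \<Longrightarrow> arr s' B = arr s B"
  by (auto simp: same_def)

lemma run_same: "run \<omega> c s t a s' \<Longrightarrow> same (wr c) (wa c) s s'"
  by (induction rule: run.induct) (auto simp: same_def set_reg_def)

text \<open>Frame rule: the syntactic write sets enter the postcondition, so a specification has to
  mention only what changes.\<close>

lemma wp_same:
  "wp \<omega> A c Q s \<Longrightarrow> (\<And>t s'. Q t s' \<Longrightarrow> same (wr c) (wa c) s s' \<Longrightarrow> Q' t s') \<Longrightarrow> wp \<omega> A c Q' s"
  unfolding wp_def using run_same by blast

definition For :: "string \<Rightarrow> string \<Rightarrow> com \<Rightarrow> com" where
  "For i n c = Assign i (Const 0) ;; While (Less (R i) (R n)) (c ;; Assign i (R i \<oplus> Const 1))"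

lemma wr_For [simp]: "wr (For i n c) = insert i (wr c)" "wa (For i n c) = wa c"
  by (auto simp: For_def)

text \<open>The invariant is demanded for the state with the counter already advanced. The
  \<open>same\<close> facts relate every iteration to the start of the loop, so invariants do not
  have to carry the frame.\<close>

lemma wp_For:
  assumes n: "reg s x = real n" "x \<noteq> i" "x \<notin> wr c" "i \<notin> wr c"
    and base: "I 0 (set_reg i 0 s)"
    and step: "\<And>j s'. j < n \<Longrightarrow> I j s' \<Longrightarrow> reg s' i = real j \<Longrightarrow> same (insert i (wr c)) (wa c) s s' \<Longrightarrow>
      wp \<omega> A c (\<lambda>t s''. t \<le> T \<and> I (Suc j) (set_reg i (real j + 1) s'')) s'"
    and Q: "\<And>t s'. t \<le> n * (T + 2) + 2 \<Longrightarrow> I n s' \<Longrightarrow> same (insert i (wr c)) (wa c) s s' \<Longrightarrow> Q t s'"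
  shows "wp \<omega> A (For i x c) Q s"
proof -
  define J where "J j s' \<longleftrightarrow> j \<le> n \<and> I j s' \<and> reg s' i = real j \<and> same (insert i (wr c)) (wa c) s s'" for j s'
  have "wp \<omega> A (While (Less (R i) (R x)) (c ;; Assign i (R i \<oplus> Const 1)))
     (\<lambda>t s'. t \<le> n * ((T + 1) + 1) + 1 \<and> (\<exists>j\<le>n. J j s') \<and> \<not> bval (Less (R i) (R x)) (reg s')) (set_reg i 0 s)"
  proof (rule wp_While)
    show "J 0 (set_reg i 0 s)" using base by (simp add: J_def same_def)
  next
    fix j s' assume J: "J j s'" and b: "bval (Less (R i) (R x)) (reg s')"
    have "reg s' x = real n" using J n by (auto simp: J_def same_def)
    then have j: "j < n" using J b by (simp add: J_def)
    have "wp \<omega> A c (\<lambda>t s''. t \<le> T \<and> I (Suc j) (set_reg i (real j + 1) s'')) s'"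
      using J j by (intro step) (auto simp: J_def)
    then have "wp \<omega> A c (\<lambda>t s'. t + 1 \<le> T + 1 \<and> J (Suc j) (set_reg i (reg s' i + 1) s')) s'"
      by (rule wp_same) (use J j n in \<open>auto simp: J_def same_def\<close>)
    with j show "j < n \<and> wp \<omega> A (c ;; Assign i (R i \<oplus> Const 1)) (\<lambda>t s'. t \<le> T + 1 \<and> J (Suc j) s') s'"
      by simp
  qed
  then have "wp \<omega> A (While (Less (R i) (R x)) (c ;; Assign i (R i \<oplus> Const 1))) (\<lambda>t. Q (1 + t)) (set_reg i 0 s)"
  proof (rule wp_mono)
    fix t s' assume "t \<le> n * ((T + 1) + 1) + 1 \<and> (\<exists>j\<le>n. J j s') \<and> \<not> bval (Less (R i) (R x)) (reg s')"
    then obtain j where *: "t \<le> n * (T + 2) + 1" "j \<le> n" "J j s'" "\<not> reg s' i < reg s' x"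
      by auto
    then have "j = n" using n by (auto simp: J_def same_def)
    with * show "Q (1 + t) s'" using Q[of "Suc t" s'] by (simp add: J_def)
  qed
  then show ?thesis by (simp add: For_def)
qed

lemma addrI: "aval e (reg s) = real i \<Longrightarrow> addr e s = i"
  by (simp add: addr_def)

section \<open>Searching and sorting\<close>

definition Binary_Search :: "string \<Rightarrow> string \<Rightarrow> string \<Rightarrow> com" where
  "Binary_Search B nn xx = Assign ''lo'' (Const 0) ;; Assign ''hi'' (R nn) ;;
    While (Less (R ''lo'') (R ''hi'')) (
      Assign ''mi'' (Floor ((R ''lo'' \<oplus> R ''hi'') \<oslash> Const 2)) ;;
      Load ''bx'' B (R ''mi'') ;;
      Cond (Less (R ''bx'') (R xx)) (Assign ''lo'' (R ''mi'' \<oplus> Const 1)) (Assign ''hi'' (R ''mi'')))"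

lemma floor_half: "\<lfloor>real i / 2\<rfloor> = int (i div 2)"
  by (metis floor_divide_of_nat_eq of_nat_numeral)

lemma wr_Binary_Search [simp]: "wr (Binary_Search B nn xx) = {''lo'', ''hi'', ''mi'', ''bx''}" "wa (Binary_Search B nn xx) = {}"
  by (auto simp: Binary_Search_def)

text \<open>After \<open>i\<close> rounds \<open>hi - lo\<close> is below
  \<open>2 ^ (K - i)\<close>, so at most \<open>K\<close> rounds take place.\<close>

lemma wp_Binary_Search:
  assumes n: "reg s nn = real n" "n \<le> A" "n < 2 ^ K"
    and names: "xx \<notin> {''lo'', ''hi'', ''mi'', ''bx''}" "nn \<noteq> ''lo''"
    and sorted: "\<And>i j. i \<le> j \<Longrightarrow> j < n \<Longrightarrow> arr s B i \<le> arr s B j"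
  shows "wp \<omega> A (Binary_Search B nn xx) (\<lambda>t s'. t \<le> 5 * K + 3 \<and> same {''lo'', ''hi'', ''mi'', ''bx''} {} s s' \<and>
      (\<exists>p\<le>n. reg s' ''lo'' = real p \<and> (\<forall>i<p. arr s B i < reg s xx) \<and>
        (\<forall>i. p \<le> i \<longrightarrow> i < n \<longrightarrow> reg s xx \<le> arr s B i))) s"
proof -
  define body where "body = Assign ''mi'' (Floor ((R ''lo'' \<oplus> R ''hi'') \<oslash> Const 2)) ;;
      Load ''bx'' B (R ''mi'') ;;
      Cond (Less (R ''bx'') (R xx)) (Assign ''lo'' (R ''mi'' \<oplus> Const 1)) (Assign ''hi'' (R ''mi''))"
  define J where "J i s' \<longleftrightarrow> (\<exists>lo hi. reg s' ''lo'' = real lo \<and> reg s' ''hi'' = real hi \<and> lo \<le> hi \<and> hi \<le> n \<and>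
      hi - lo < 2 ^ (K - i) \<and> arr s' B = arr s B \<and> reg s' xx = reg s xx \<and>
      (\<forall>i<lo. arr s B i < reg s xx) \<and> (\<forall>i. hi \<le> i \<longrightarrow> i < n \<longrightarrow> reg s xx \<le> arr s B i))"
    for i and s' :: state
  define s0 where "s0 = set_reg ''hi'' (real n) (set_reg ''lo'' 0 s)"
  have "wp \<omega> A (While (Less (R ''lo'') (R ''hi'')) body)
     (\<lambda>t s'. t \<le> K * (4 + 1) + 1 \<and> (\<exists>i\<le>K. J i s') \<and> \<not> bval (Less (R ''lo'') (R ''hi'')) (reg s')) s0"
  proof (rule wp_While)
    show "J 0 s0" unfolding J_def s0_def using n names by (intro exI[of _ 0] exI[of _ n]) auto
  next
    fix i s' assume J: "J i s'" and b: "bval (Less (R ''lo'') (R ''hi'')) (reg s')"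
    then obtain lo hi where 1: "reg s' ''lo'' = real lo" "reg s' ''hi'' = real hi" "lo \<le> hi" "hi \<le> n"
      "hi - lo < 2 ^ (K - i)" "arr s' B = arr s B" "reg s' xx = reg s xx"
      "\<forall>i<lo. arr s B i < reg s xx" "\<forall>i. hi \<le> i \<longrightarrow> i < n \<longrightarrow> reg s xx \<le> arr s B i"
      unfolding J_def by blast
    have lh: "lo < hi" using b 1 by simp
    define mi where "mi = (lo + hi) div 2"
    have mi: "lo \<le> mi" "mi < hi" using lh by (auto simp: mi_def)
    have fl: "\<lfloor>(real lo + real hi) / 2\<rfloor> = int mi"
      using floor_half[of "lo + hi"] by (simp add: mi_def)
    have i: "i < K"
    proof (rule ccontr)
      assume "\<not> i < K" then show False using 1(5) lh by simp
    qed
    then have pow: "2 ^ (K - i) = 2 * (2::nat) ^ (K - Suc i)"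
      by (metis Suc_diff_Suc power_Suc)
    have half: "hi - (mi + 1) < 2 ^ (K - Suc i)" "mi - lo < 2 ^ (K - Suc i)"
      using 1(5) lh unfolding pow mi_def by linarith+
    have addr: "addr (R ''mi'') (set_reg ''mi'' (real mi) s') = mi" by (rule addrI) simp
    have JI: "J (Suc i) s''" if "reg s'' ''lo'' = real lo'" "reg s'' ''hi'' = real hi'" "lo' \<le> hi'" "hi' \<le> n"
      "hi' - lo' < 2 ^ (K - Suc i)" "arr s'' B = arr s B" "reg s'' xx = reg s xx"
      "\<forall>i<lo'. arr s B i < reg s xx" "\<forall>i. hi' \<le> i \<longrightarrow> i < n \<longrightarrow> reg s xx \<le> arr s B i" for s'' lo' hi'
      using that unfolding J_def by blast
    have "wp \<omega> A body (\<lambda>t s'. t \<le> 4 \<and> J (Suc i) s') s'"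
    proof (cases "arr s B mi < reg s xx")
      case True
      have "\<forall>j<mi + 1. arr s B j < reg s xx"
        using sorted[of _ mi] mi 1 True by (metis Suc_eq_plus1 less_Suc_eq_le order.strict_trans1 order_less_le_trans)
      then show ?thesis using 1 mi half names True n
        unfolding body_def by (auto simp: fl addr intro!: JI[of _ "mi + 1" hi])
    next
      case False
      have "\<forall>j. mi \<le> j \<longrightarrow> j < n \<longrightarrow> reg s xx \<le> arr s B j"
        using sorted[of mi] False by (meson leI order_trans)
      then show ?thesis using 1 mi half names False n
        unfolding body_def by (auto simp: fl addr intro!: JI[of _ lo mi])
    qed
    with i show "i < K \<and> wp \<omega> A body (\<lambda>t s'. t \<le> 4 \<and> J (Suc i) s') s'" by simp
  qed
  then have "wp \<omega> A (While (Less (R ''lo'') (R ''hi'')) body) (\<lambda>t s'. t \<le> 5 * K + 1 \<and>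
      (\<exists>p\<le>n. reg s' ''lo'' = real p \<and> (\<forall>i<p. arr s B i < reg s xx) \<and>
        (\<forall>i. p \<le> i \<longrightarrow> i < n \<longrightarrow> reg s xx \<le> arr s B i))) s0"
  proof (rule wp_mono)
    fix t s' assume "t \<le> K * (4 + 1) + 1 \<and> (\<exists>i\<le>K. J i s') \<and> \<not> bval (Less (R ''lo'') (R ''hi'')) (reg s')"
    then obtain i lo hi where 1: "t \<le> 5 * K + 1" "reg s' ''lo'' = real lo" "lo = hi" "hi \<le> n"
      "\<forall>i<lo. arr s B i < reg s xx" "\<forall>i. hi \<le> i \<longrightarrow> i < n \<longrightarrow> reg s xx \<le> arr s B i"
      unfolding J_def by fastforce
    then show "t \<le> 5 * K + 1 \<and>
      (\<exists>p\<le>n. reg s' ''lo'' = real p \<and> (\<forall>i<p. arr s B i < reg s xx) \<and>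
        (\<forall>i. p \<le> i \<longrightarrow> i < n \<longrightarrow> reg s xx \<le> arr s B i))"
      using 1 by auto
  qed
  then have "wp \<omega> A (Binary_Search B nn xx) (\<lambda>t s'. t \<le> 5 * K + 3 \<and>
      (\<exists>p\<le>n. reg s' ''lo'' = real p \<and> (\<forall>i<p. arr s B i < reg s xx) \<and>
        (\<forall>i. p \<le> i \<longrightarrow> i < n \<longrightarrow> reg s xx \<le> arr s B i))) s"
    unfolding Binary_Search_def body_def[symmetric] using n(1)
    by (auto simp: s0_def names elim!: wp_mono)
  then show ?thesis by (rule wp_same) auto
qed

section \<open>Sorting with a tournament tree\<close>

definition Pull :: com where
  "Pull = Load ''ka'' ''TK'' (Const 2 \<otimes> R ''ti'') ;; Load ''kb'' ''TK'' (Const 2 \<otimes> R ''ti'' \<oplus> Const 1) ;;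
    Cond (Less (R ''kb'') (R ''ka''))
      (Load ''ix'' ''TI'' (Const 2 \<otimes> R ''ti'' \<oplus> Const 1) ;;
       Store ''TK'' (R ''ti'') (R ''kb'') ;; Store ''TI'' (R ''ti'') (R ''ix''))
      (Load ''ix'' ''TI'' (Const 2 \<otimes> R ''ti'') ;;
       Store ''TK'' (R ''ti'') (R ''ka'') ;; Store ''TI'' (R ''ti'') (R ''ix''))"

definition pulled :: "state \<Rightarrow> nat \<Rightarrow> bool" where
  "pulled s i \<longleftrightarrow> arr s ''TK'' i \<le> arr s ''TK'' (2 * i) \<and> arr s ''TK'' i \<le> arr s ''TK'' (2 * i + 1) \<and>
    (\<exists>j\<in>{2 * i, 2 * i + 1}. arr s ''TK'' i = arr s ''TK'' j \<and> arr s ''TI'' i = arr s ''TI'' j)"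

lemma pulled_cong:
  "(\<And>j. j \<in> {i, 2 * i, 2 * i + 1} \<Longrightarrow> arr s' ''TK'' j = arr s ''TK'' j \<and> arr s' ''TI'' j = arr s ''TI'' j) \<Longrightarrow>
   pulled s' i = pulled s i"
  by (simp add: pulled_def)

lemma wr_Pull [simp]: "wr Pull = {''ka'', ''kb'', ''ix''}" "wa Pull = {''TK'', ''TI''}"
  by (auto simp: Pull_def)

text \<open>Node 0 is its own left child, hence the exception. The loop that builds the tree visits
  it last, because a \<open>For\<close> loop makes exactly \<open>n\<close> rounds.\<close>

lemma wp_Pull:
  assumes i: "reg s ''ti'' = real i" "2 * i + 1 < A"
  shows "wp \<omega> A Pull (\<lambda>t s'. t \<le> 6 \<and> (i \<noteq> 0 \<longrightarrow> pulled s' i) \<and>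
    (\<forall>j. j \<noteq> i \<longrightarrow> arr s' ''TK'' j = arr s ''TK'' j \<and> arr s' ''TI'' j = arr s ''TI'' j)) s"
proof -
  have [simp]: "addr (Const 2 \<otimes> R ''ti'') s' = 2 * i" "addr (Const 2 \<otimes> R ''ti'' \<oplus> Const 1) s' = 2 * i + 1"
     "addr (R ''ti'') s' = i" if "reg s' ''ti'' = real i" for s'
    using that by (auto intro!: addrI)
  show ?thesis using i unfolding Pull_def by (auto simp: pulled_def)
qed

lemma addr_simps:
  "\<lfloor>real a * real b\<rfloor> = int a * int b" "nat (int a + int b) = a + b"
  "nat (int a * int b + int c) = a * b + c" "nat (int a * int b) = a * b"
  by (simp_all add: nat_int_add nat_mult_distrib nat_add_distrib flip: of_nat_mult)

text \<open>The leaves \<open>n\<close>, ..., \<open>2 * n - 1\<close> hold the keys, and node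
  \<open>i\<close> copies the smaller of \<open>2 * i\<close> and \<open>2 * i + 1\<close>; this
  works for every \<open>n\<close>, not only for powers of two. A key that has been output is
  replaced by \<open>big\<close>, which exceeds all keys, and only its path to the root is
  recomputed.\<close>

definition Sort :: "string \<Rightarrow> string \<Rightarrow> string \<Rightarrow> string \<Rightarrow> com" where
  "Sort K nn SS SI =
    Assign ''big'' (Const 0) ;;
    For ''si'' nn (Load ''kx'' K (R ''si'') ;;
      Cond (Less (R ''big'') (R ''kx'' \<oplus> Const 1)) (Assign ''big'' (R ''kx'' \<oplus> Const 1)) Skip ;;
      Store ''TK'' (R nn \<oplus> R ''si'') (R ''kx'') ;; Store ''TI'' (R nn \<oplus> R ''si'') (R ''si'')) ;;
    For ''si'' nn (Assign ''ti'' (R nn \<ominus> Const 1 \<ominus> R ''si'') ;; Pull) ;;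
    For ''si'' nn (Load ''kx'' ''TK'' (Const 1) ;; Load ''ix'' ''TI'' (Const 1) ;;
      Store SS (R ''si'') (R ''kx'') ;; Store SI (R ''si'') (R ''ix'') ;;
      Assign ''ti'' (R nn \<oplus> R ''ix'') ;; Store ''TK'' (R ''ti'') (R ''big'') ;;
      While (Less (Const 1) (R ''ti'')) (Assign ''ti'' (Floor (R ''ti'' \<oslash> Const 2)) ;; Pull))"

lemma wr_Sort [simp]:
  "wr (Sort K nn SS SI) = {''big'', ''si'', ''kx'', ''ti'', ''ka'', ''kb'', ''ix''}"
  "wa (Sort K nn SS SI) = {''TK'', ''TI'', SS, SI}"
  by (auto simp: Sort_def)

lemma heap_root_le:
  assumes "\<And>i. 1 \<le> i \<Longrightarrow> i < n \<Longrightarrow> pulled s i" "1 \<le> j" "j < 2 * n"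
  shows "arr s ''TK'' 1 \<le> arr s ''TK'' j"
  using assms(2,3)
proof (induction j rule: less_induct)
  case (less j)
  show ?case
  proof (cases "j = 1")
    case False
    then have "1 \<le> j div 2" "j div 2 < n" "j div 2 < j" using less.prems by auto
    then have "arr s ''TK'' 1 \<le> arr s ''TK'' (j div 2)" "pulled s (j div 2)"
      using less.IH[of "j div 2"] assms(1) by auto
    moreover have "j = 2 * (j div 2) \<or> j = 2 * (j div 2) + 1" by presburger
    then have "arr s ''TK'' (j div 2) \<le> arr s ''TK'' j"
      using \<open>pulled s (j div 2)\<close> by (elim disjE) (simp_all add: pulled_def)
    ultimately show ?thesis by linarith
  qed simp
qed

text \<open>Each node copies one of its children together with its index, so the root can be traced
  down to the leaf it comes from.\<close>

lemma heap_root_leaf: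
  assumes "\<And>i. 1 \<le> i \<Longrightarrow> i < n \<Longrightarrow> pulled s i" "1 \<le> n"
  shows "\<exists>l<n. arr s ''TK'' 1 = arr s ''TK'' (n + l) \<and> arr s ''TI'' 1 = arr s ''TI'' (n + l)"
proof -
  have "\<exists>l<n. arr s ''TK'' i = arr s ''TK'' (n + l) \<and> arr s ''TI'' i = arr s ''TI'' (n + l)"
    if "1 \<le> i" "i < 2 * n" for i
    using that
  proof (induction "2 * n - i" arbitrary: i rule: less_induct)
    case less
    show ?case
    proof (cases "i < n")
      case True
      then obtain j where j: "j \<in> {2 * i, 2 * i + 1}" "arr s ''TK'' i = arr s ''TK'' j"
        "arr s ''TI'' i = arr s ''TI'' j" using assms(1)[of i] less.prems unfolding pulled_def by blast
      then have "2 * n - j < 2 * n - i" "1 \<le> j" "j < 2 * n" using less.prems True by auto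
      from less.hyps[OF this] j show ?thesis by simp
    next
      case False
      then show ?thesis using less.prems by (intro exI[of _ "i - n"]) auto
    qed
  qed
  from this[of 1] assms(2) show ?thesis by auto
qed

lemma wp_Sort:
  assumes n: "reg s nn = real n" "2 * n + 1 < A" "2 * n \<le> 2 ^ Kb"
    and nn: "nn \<notin> {''big'', ''si'', ''kx'', ''ti'', ''ka'', ''kb'', ''ix''}"
    and K: "K \<notin> {''TK'', ''TI'', SS, SI}" and S: "SS \<notin> {''TK'', ''TI'', SI}" "SI \<notin> {''TK'', ''TI''}"
  shows "wp \<omega> A (Sort K nn SS SI) (\<lambda>t s'. t \<le> n * (8 * Kb + 30) + 10 \<and>
     same {''big'', ''si'', ''kx'', ''ti'', ''ka'', ''kb'', ''ix''} {''TK'', ''TI'', SS, SI} s s' \<and>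
     (\<exists>p. bij_betw p {..<n} {..<n} \<and> (\<forall>i<n. arr s' SI i = real (p i) \<and> arr s' SS i = arr s K (p i)) \<and>
       (\<forall>i j. i \<le> j \<longrightarrow> j < n \<longrightarrow> arr s' SS i \<le> arr s' SS j))) s"
proof -
  define leaf where "leaf U s' \<longleftrightarrow> (\<forall>l<n. arr s K l < reg s' ''big'' \<and> arr s' ''TI'' (n + l) = real l \<and>
      arr s' ''TK'' (n + l) = (if l \<in> U then reg s' ''big'' else arr s K l))" for U and s' :: state
  define base where "base s' \<longleftrightarrow> reg s' nn = real n \<and> arr s' K = arr s K" for s' :: state
  have base_same: "base s'" if "base s''" "same X Y s'' s'" "nn \<notin> X" "K \<notin> Y" for X Y s' s''
    using that by (auto simp: base_def same_def)
  have leaf_same: "leaf U s'" if "leaf U s''" "same X Y s'' s'" "''big'' \<notin> X"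
    "\<And>l. l < n \<Longrightarrow> arr s' ''TK'' (n + l) = arr s'' ''TK'' (n + l) \<and> arr s' ''TI'' (n + l) = arr s'' ''TI'' (n + l)" for X Y U s' s''
    using that by (auto simp: leaf_def same_def)
  define I1 where "I1 j s' \<longleftrightarrow> (\<forall>l<j. arr s K l < reg s' ''big'' \<and> arr s' ''TI'' (n + l) = real l \<and>
      arr s' ''TK'' (n + l) = arr s K l)" for j and s' :: state
  define I2 where "I2 j s' \<longleftrightarrow> leaf {} s' \<and> (\<forall>i. 1 \<le> i \<longrightarrow> i < n \<longrightarrow> n - j \<le> i \<longrightarrow> pulled s' i)" for j s'
  \<comment> \<open>The last clause makes each output minimal among the keys not taken before it;
    sortedness is read off from it at the end.\<close>
  define P where "P r p s' \<longleftrightarrow> inj_on p {..<r} \<and> p ` {..<r} \<subseteq> {..<n} \<and>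
      (\<forall>i<r. arr s' SI i = real (p i) \<and> arr s' SS i = arr s K (p i) \<and>
        (\<forall>l<n. l \<notin> p ` {..<i} \<longrightarrow> arr s K (p i) \<le> arr s K l))" for r and s' :: state and p :: "nat \<Rightarrow> nat"
  define I3 where "I3 r s' \<longleftrightarrow> (\<forall>i. 1 \<le> i \<longrightarrow> i < n \<longrightarrow> pulled s' i) \<and>
      (\<exists>p. leaf (p ` {..<r}) s' \<and> P r p s')" for r s'
  have I3_set: "I3 r (set_reg ''si'' v s') = I3 r s'" for r v s'
    by (simp add: I3_def leaf_def P_def pulled_def)
  let ?c1 = "Load ''kx'' K (R ''si'') ;;
      Cond (Less (R ''big'') (R ''kx'' \<oplus> Const 1)) (Assign ''big'' (R ''kx'' \<oplus> Const 1)) Skip ;;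
      Store ''TK'' (R nn \<oplus> R ''si'') (R ''kx'') ;; Store ''TI'' (R nn \<oplus> R ''si'') (R ''si'')"
  let ?c2 = "Assign ''ti'' (R nn \<ominus> Const 1 \<ominus> R ''si'') ;; Pull"
  let ?w = "While (Less (Const 1) (R ''ti'')) (Assign ''ti'' (Floor (R ''ti'' \<oslash> Const 2)) ;; Pull)"
  let ?c3 = "Load ''kx'' ''TK'' (Const 1) ;; Load ''ix'' ''TI'' (Const 1) ;;
      Store SS (R ''si'') (R ''kx'') ;; Store SI (R ''si'') (R ''ix'') ;;
      Assign ''ti'' (R nn \<oplus> R ''ix'') ;; Store ''TK'' (R ''ti'') (R ''big'') ;; ?w"
  have 1: "wp \<omega> A (For ''si'' nn ?c1) (\<lambda>t s'. t \<le> n * 8 + 2 \<and> base s' \<and> I2 0 s') s0" if "base s0" for s0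
  proof (rule wp_For[where I=I1 and T=6])
    show "reg s0 nn = real n" using that by (simp add: base_def)
    show "I1 0 (set_reg ''si'' 0 s0)" by (simp add: I1_def)
    fix j s' assume j: "j < n" and I: "I1 j s'" and si: "reg s' ''si'' = real j"
      and same: "same (insert ''si'' (wr ?c1)) (wa ?c1) s0 s'"
    have b: "base s'" by (rule base_same[OF that same]) (use nn K in auto)
    have r: "reg s' nn = real n" "arr s' K = arr s K" using b by (auto simp: base_def)
    have I': "arr s K l < reg s' ''big''" "arr s' ''TI'' (n + l) = real l" "arr s' ''TK'' (n + l) = arr s K l"
      if "l < j" for l using I that by (auto simp: I1_def)
    have I'': "arr s K l < x" if "l < j" "reg s' ''big'' < x" for l x using I'(1)[of l] that by simp
    show "wp \<omega> A ?c1 (\<lambda>t s''. t \<le> 6 \<and> I1 (Suc j) (set_reg ''si'' (real j + 1) s'')) s'"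
      using r si j n(2) nn K I' I'' by (simp add: addr_def addr_simps) (auto simp: I1_def less_Suc_eq)
  next
    fix t s' assume t: "t \<le> n * (6 + 2) + 2" and I: "I1 n s'" and same: "same (insert ''si'' (wr ?c1)) (wa ?c1) s0 s'"
    have b: "base s'" by (rule base_same[OF that same]) (use nn K in auto)
    show "t \<le> n * 8 + 2 \<and> base s' \<and> I2 0 s'" using t I b by (simp add: I2_def I1_def leaf_def)
  qed (use nn in auto)
  have 2: "wp \<omega> A (For ''si'' nn ?c2) (\<lambda>t s'. t \<le> n * 9 + 2 \<and> base s' \<and> I2 n s') s0" if "base s0" "I2 0 s0" for s0
  proof (rule wp_For[where I=I2 and T=7])
    show "reg s0 nn = real n" using that by (simp add: base_def)
    show "I2 0 (set_reg ''si'' 0 s0)" using that by (auto simp: I2_def leaf_def pulled_def)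
    fix j s' assume j: "j < n" and I: "I2 j s'" and si: "reg s' ''si'' = real j"
      and same: "same (insert ''si'' (wr ?c2)) (wa ?c2) s0 s'"
    have b: "base s'" by (rule base_same[OF that(1) same]) (use nn K in auto)
    define i where "i = n - 1 - j"
    define s1 where "s1 = set_reg ''ti'' (real i) s'"
    have "wp \<omega> A Pull (\<lambda>t s''. t \<le> 6 \<and> I2 (Suc j) (set_reg ''si'' (real j + 1) s'')) s1"
    proof (rule wp_same[OF wp_Pull[of s1 i]], goal_cases)
      case (3 t s2)
      then have p: "pulled s2 i" if "i \<noteq> 0" using that by simp
      have eq: "arr s2 ''TK'' l = arr s' ''TK'' l" "arr s2 ''TI'' l = arr s' ''TI'' l" if "l \<noteq> i" for l
        using 3 that by (auto simp: s1_def)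
      have "same (insert ''ti'' (wr Pull)) (wa Pull) s' s2" using 3 by (auto simp: s1_def same_def)
      then have lf: "leaf {} s2" by (rule leaf_same[rotated]) (use I i_def j in \<open>auto simp: I2_def eq\<close>)
      have "pulled s2 l" if "1 \<le> l" "l < n" "n - Suc j \<le> l" for l
      proof (cases "l = i")
        case False
        then have "pulled s' l" using that I by (auto simp: I2_def i_def)
        moreover have "pulled s2 l = pulled s' l"
          by (rule pulled_cong) (use that False in \<open>auto simp: eq i_def\<close>)
        ultimately show ?thesis by simp
      qed (use p that in auto)
      then show ?case using 3 lf by (auto simp: I2_def leaf_def pulled_def)
    qed (use n j in \<open>auto simp: s1_def i_def\<close>)
    moreover have "real i = real n - 1 - real j" using j by (simp add: i_def)
    ultimately show "wp \<omega> A ?c2 (\<lambda>t s''. t \<le> 7 \<and> I2 (Suc j) (set_reg ''si'' (real j + 1) s'')) s'"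
      using b by (simp add: base_def si s1_def)
  next
    fix t s' assume t: "t \<le> n * (7 + 2) + 2" and I: "I2 n s'" and same: "same (insert ''si'' (wr ?c2)) (wa ?c2) s0 s'"
    have b: "base s'" by (rule base_same[OF that(1) same]) (use nn K in auto)
    show "t \<le> n * 9 + 2 \<and> base s' \<and> I2 n s'" using t I b by simp
  qed (use nn in auto)
  have W: "wp \<omega> A ?w (\<lambda>t s'. t \<le> Kb * 8 + 1 \<and> leaf U s' \<and> (\<forall>i. 1 \<le> i \<longrightarrow> i < n \<longrightarrow> pulled s' i)) s0"
    if s0: "reg s0 ''ti'' = real q" "1 \<le> q" "q < 2 * n" "leaf U s0"
      "\<And>i. 1 \<le> i \<Longrightarrow> i < n \<Longrightarrow> i \<noteq> q div 2 \<Longrightarrow> pulled s0 i" for q U s0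
  proof -
    \<comment> \<open>Only the parent of the current node may be out of date. At node 1 this parent
      is 0, so the whole tree is consistent when the loop ends.\<close>
    define J where "J i s' \<longleftrightarrow> leaf U s' \<and> (\<exists>q. reg s' ''ti'' = real q \<and> 1 \<le> q \<and> q < 2 * n \<and> q < 2 ^ (Kb - i) \<and>
       (\<forall>j. 1 \<le> j \<longrightarrow> j < n \<longrightarrow> j \<noteq> q div 2 \<longrightarrow> pulled s' j))" for i and s' :: state
    have "wp \<omega> A ?w (\<lambda>t s'. t \<le> Kb * (7 + 1) + 1 \<and> (\<exists>i\<le>Kb. J i s') \<and> \<not> bval (Less (Const 1) (R ''ti'')) (reg s')) s0"
    proof (rule wp_While)
      show "J 0 s0" using s0 n by (auto simp: J_def intro!: exI[of _ q])
    next
      fix i s' assume J: "J i s'" and bv: "bval (Less (Const 1) (R ''ti'')) (reg s')"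
      then obtain q where q: "leaf U s'" "reg s' ''ti'' = real q" "1 \<le> q" "q < 2 * n" "q < 2 ^ (Kb - i)"
        "\<And>j. 1 \<le> j \<Longrightarrow> j < n \<Longrightarrow> j \<noteq> q div 2 \<Longrightarrow> pulled s' j" unfolding J_def by blast
      have q1: "1 < q" using bv q by simp
      have i: "i < Kb"
      proof (rule ccontr)
        assume "\<not> i < Kb" then show False using q(5) q1 by simp
      qed
      then have pow: "2 ^ (Kb - i) = 2 * (2::nat) ^ (Kb - Suc i)"
        by (metis Suc_diff_Suc power_Suc)
      define h where "h = q div 2"
      have h: "1 \<le> h" "h < n" "h < 2 ^ (Kb - Suc i)" using q q1 pow by (auto simp: h_def)
      define s1 where "s1 = set_reg ''ti'' (real h) s'"
      have "wp \<omega> A Pull (\<lambda>t s''. t \<le> 6 \<and> J (Suc i) s'') s1"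
      proof (rule wp_same[OF wp_Pull[of s1 h]], goal_cases)
        case (3 t s2)
        then have p: "pulled s2 h" using h by simp
        have eq: "arr s2 ''TK'' l = arr s' ''TK'' l" "arr s2 ''TI'' l = arr s' ''TI'' l" if "l \<noteq> h" for l
          using 3 that by (auto simp: s1_def)
        have sm: "same (insert ''ti'' (wr Pull)) (wa Pull) s' s2" using 3 by (auto simp: s1_def same_def)
        then have lf: "leaf U s2" by (rule leaf_same[rotated]) (use q h in \<open>auto simp: eq\<close>)
        have "pulled s2 l" if "1 \<le> l" "l < n" "l \<noteq> h div 2" for l
        proof (cases "l = h")
          case False
          then have "pulled s' l" using that q by (auto simp: h_def)
          moreover have "pulled s2 l = pulled s' l"
            by (rule pulled_cong) (use that False in \<open>auto simp: eq\<close>)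
          ultimately show ?thesis by simp
        qed (use p in auto)
        moreover have "reg s2 ''ti'' = real h" using 3 by (simp add: same_def s1_def)
        ultimately show ?case using 3 lf h unfolding J_def by (auto intro!: exI[of _ h])
      qed (use n h in \<open>auto simp: s1_def\<close>)
      then show "i < Kb \<and> wp \<omega> A (Assign ''ti'' (Floor (R ''ti'' \<oslash> Const 2)) ;; Pull) (\<lambda>t s'. t \<le> 7 \<and> J (Suc i) s') s'"
        using i by (simp add: q(2) floor_half s1_def h_def)
    qed
    then show ?thesis
    proof (rule wp_mono, elim conjE exE)
      fix t s' i assume "t \<le> Kb * (7 + 1) + 1" "J i s'" "\<not> bval (Less (Const 1) (R ''ti'')) (reg s')"
      moreover from this obtain q where "leaf U s'" "reg s' ''ti'' = real q" "1 \<le> q"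
        "\<And>j. 1 \<le> j \<Longrightarrow> j < n \<Longrightarrow> j \<noteq> q div 2 \<Longrightarrow> pulled s' j" unfolding J_def by blast
      moreover from calculation have "q = 1" by simp
      ultimately show "t \<le> Kb * 8 + 1 \<and> leaf U s' \<and> (\<forall>i. 1 \<le> i \<longrightarrow> i < n \<longrightarrow> pulled s' i)" by auto
    qed
  qed
  have 3: "wp \<omega> A (For ''si'' nn ?c3) (\<lambda>t s'. t \<le> n * (Kb * 8 + 9) + 2 \<and> I3 n s') s0" if "base s0" "I2 n s0" for s0
  proof (rule wp_For[where I=I3 and T="Kb * 8 + 7"])
    show "reg s0 nn = real n" using that by (simp add: base_def)
    show "I3 0 (set_reg ''si'' 0 s0)" using that by (auto simp: I2_def I3_def P_def leaf_def pulled_def)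
    fix r s' assume r: "r < n" and I: "I3 r s'" and si: "reg s' ''si'' = real r"
      and same: "same (insert ''si'' (wr ?c3)) (wa ?c3) s0 s'"
    have b: "base s'" by (rule base_same[OF that(1) same]) (use nn K in auto)
    obtain p where hp: "\<And>i. 1 \<le> i \<Longrightarrow> i < n \<Longrightarrow> pulled s' i" and lf: "leaf (p ` {..<r}) s'" and P: "P r p s'"
      using I unfolding I3_def by blast
    from heap_root_leaf[of n s'] hp r obtain l where l: "l < n" "arr s' ''TK'' 1 = arr s' ''TK'' (n + l)"
      "arr s' ''TI'' 1 = arr s' ''TI'' (n + l)" by auto
    have TI: "arr s' ''TI'' 1 = real l" using l lf by (simp add: leaf_def)
    have min: "arr s' ''TK'' 1 \<le> arr s' ''TK'' (n + j)" if "j < n" for j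
      using heap_root_le[of n s' "n + j"] hp that by auto
    have "card (p ` {..<r}) < card {..<n}" using r card_image_le[of "{..<r}" p] by simp
    then have "p ` {..<r} \<noteq> {..<n}" by auto
    \<comment> \<open>A leaf not yet taken carries a key below \<open>big\<close>; hence the root
      cannot stem from an emptied leaf.\<close>
    then obtain f where f: "f < n" "f \<notin> p ` {..<r}" using P unfolding P_def by blast
    have lU: "l \<notin> p ` {..<r}"
    proof
      assume "l \<in> p ` {..<r}"
      then have "arr s' ''TK'' 1 = reg s' ''big''" using l lf by (simp add: leaf_def)
      then show False using min[OF f(1)] f lf by (auto simp: leaf_def)
    qed
    have TK: "arr s' ''TK'' 1 = arr s K l" using l lf lU by (simp add: leaf_def)
    have minK: "arr s K l \<le> arr s K j" if "j < n" "j \<notin> p ` {..<r}" for j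
      using min[OF that(1)] that lf TK by (auto simp: leaf_def)
    define p' where "p' = p(r := l)"
    have img: "p' ` {..<i} = p ` {..<i}" if "i \<le> r" for i
      using that by (auto simp: p'_def)
    have img': "p' ` {..<Suc r} = insert l (p ` {..<r})"
      using img[of r] by (auto simp: lessThan_Suc p'_def)
    define s1 where "s1 = set_arr ''TK'' (n + l) (reg s' ''big'') (set_reg ''ti'' (real (n + l))
       (set_arr SI r (real l) (set_arr SS r (arr s K l) (set_reg ''ix'' (real l) (set_reg ''kx'' (arr s K l) s')))))"
    have E: "wp \<omega> A ?c3 Q s' = wp \<omega> A ?w (\<lambda>t. Q (Suc (Suc (Suc (Suc (Suc (Suc t))))))) s1" for Q
      using b TI TK n(2) r si l(1) nn S K
      by (simp add: addr_def addr_simps s1_def base_def)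
    show "wp \<omega> A ?c3 (\<lambda>t s''. t \<le> Kb * 8 + 7 \<and> I3 (Suc r) (set_reg ''si'' (real r + 1) s'')) s'"
      unfolding E
    proof (rule wp_same[OF W[of s1 "n + l" "p' ` {..<Suc r}"]], goal_cases)
      case 4
      show ?case using lf S unfolding leaf_def s1_def img' by (auto simp: nn)
    next
      case (5 i)
      have "pulled s1 i = pulled s' i"
        by (rule pulled_cong) (use 5 S in \<open>auto simp: s1_def\<close>)
      then show ?case using 5 hp by simp
    next
      case (6 t s2)
      then have sm: "same {''ti'', ''ka'', ''kb'', ''ix''} {''TK'', ''TI''} s1 s2" by (simp add: insert_commute)
      have a: "arr s2 SI = (arr s' SI)(r := real l)" "arr s2 SS = (arr s' SS)(r := arr s K l)"
        using same_arr[OF sm, of SI] same_arr[OF sm, of SS] S by (auto simp: arr_set_arr_fun s1_def)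
      have "P (Suc r) p' s2"
        unfolding P_def img'
      proof (intro conjI allI impI)
        show "inj_on p' {..<Suc r}" using P lU img[of r] by (auto simp: P_def lessThan_Suc p'_def inj_on_fun_updI)
        show "insert l (p ` {..<r}) \<subseteq> {..<n}" using P l by (auto simp: P_def)
        fix i assume i: "i < Suc r"
        show "arr s2 SI i = real (p' i)" "arr s2 SS i = arr s K (p' i)"
          using P i by (auto simp: a p'_def P_def)
        fix j assume j: "j < n" "j \<notin> p' ` {..<i}"
        then have "j \<notin> p ` {..<i}" using img[of i] i by simp
        then show "arr s K (p' i) \<le> arr s K j"
          using P i j minK by (cases "i = r") (auto simp: p'_def P_def)
      qed
      then have "I3 (Suc r) s2" using 6 unfolding I3_def by blast
      then show ?case using 6 by (simp add: I3_set)
    qed (use l in \<open>auto simp: s1_def\<close>)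
  next
    fix t s' assume "t \<le> n * (Kb * 8 + 7 + 2) + 2" "I3 n s'"
    then show "t \<le> n * (Kb * 8 + 9) + 2 \<and> I3 n s'" by (simp add: algebra_simps)
  qed (use nn in simp_all)
  have post: "\<exists>p. bij_betw p {..<n} {..<n} \<and> (\<forall>i<n. arr s' SI i = real (p i) \<and> arr s' SS i = arr s K (p i)) \<and>
       (\<forall>i j. i \<le> j \<longrightarrow> j < n \<longrightarrow> arr s' SS i \<le> arr s' SS j)" if "I3 n s'" for s'
  proof -
    from that obtain p where P: "P n p s'" unfolding I3_def by blast
    have "p ` {..<n} = {..<n}"
      using P by (intro card_subset_eq) (auto simp: P_def card_image)
    moreover have "arr s' SS i \<le> arr s' SS j" if "i \<le> j" "j < n" for i j
    proof -
      have "inj_on p {..<n}" using P by (simp add: P_def)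
      then have "p j \<notin> p ` {..<i}" using that by (subst inj_on_image_mem_iff[of p "{..<n}"]) auto
      moreover have "p j < n" using P that by (auto simp: P_def)
      ultimately show ?thesis using P that by (auto simp: P_def)
    qed
    ultimately show ?thesis using P by (intro exI[of _ p]) (auto simp: P_def bij_betw_def)
  qed
  have "wp \<omega> A (For ''si'' nn ?c1 ;; For ''si'' nn ?c2 ;; For ''si'' nn ?c3)
     (\<lambda>t s'. t \<le> n * (8 * Kb + 26) + 6 \<and> I3 n s') (set_reg ''big'' 0 s)"
    unfolding wp_Seq
  proof (rule wp_mono[OF 1])
    show "base (set_reg ''big'' 0 s)" using n nn by (auto simp: base_def)
    fix t s1 assume s1: "t \<le> n * 8 + 2 \<and> base s1 \<and> I2 0 s1"
    show "wp \<omega> A (For ''si'' nn ?c2) (\<lambda>t'. wp \<omega> A (For ''si'' nn ?c3)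
       (\<lambda>t'' s'. t + (t' + t'') \<le> n * (8 * Kb + 26) + 6 \<and> I3 n s')) s1"
    proof (rule wp_mono[OF 2])
      fix t' s2 assume s2: "t' \<le> n * 9 + 2 \<and> base s2 \<and> I2 n s2"
      show "wp \<omega> A (For ''si'' nn ?c3) (\<lambda>t'' s'. t + (t' + t'') \<le> n * (8 * Kb + 26) + 6 \<and> I3 n s') s2"
        by (rule wp_mono[OF 3]) (use s1 s2 in \<open>auto simp: algebra_simps\<close>)
    qed (use s1 in auto)
  qed
  then have "wp \<omega> A (Sort K nn SS SI) (\<lambda>t s'. t \<le> n * (8 * Kb + 26) + 7 \<and> I3 n s') s"
    unfolding Sort_def by (subst wp_Seq) (simp del: wp_Seq, erule wp_mono, simp)
  then show ?thesis
    by (rule wp_same) (use post in \<open>auto simp: algebra_simps\<close>)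
qed

section \<open>Discrete Frechet distance through expansions\<close>

definition nrm :: "nat \<Rightarrow> nat \<Rightarrow> (nat \<Rightarrow> real) \<Rightarrow> real" where
  "nrm d L x = Max ((\<lambda>t. L2_set (\<lambda>c. x (t * d + c)) {..<d}) ` {..<L})"

lemma nrm_le_iff: "0 < L \<Longrightarrow> nrm d L x \<le> r \<longleftrightarrow> (\<forall>t<L. L2_set (\<lambda>c. x (t * d + c)) {..<d} \<le> r)"
  unfolding nrm_def by (subst Max_le_iff) auto

lemma block_le_nrm: "t < L \<Longrightarrow> L2_set (\<lambda>c. x (t * d + c)) {..<d} \<le> nrm d L x"
  unfolding nrm_def by (rule Max_ge) auto

lemma nrm_nonneg: "0 < L \<Longrightarrow> 0 \<le> nrm d L x"
  by (rule order_trans[OF L2_set_nonneg block_le_nrm])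

lemma nrm_cong: "(\<And>i. i < L * d \<Longrightarrow> x i = y i) \<Longrightarrow> nrm d L x = nrm d L y"
proof -
  assume *: "\<And>i. i < L * d \<Longrightarrow> x i = y i"
  have "t * d + c < L * d" if "t < L" "c < d" for t c
  proof -
    have "t * d + c < Suc t * d" using that by simp
    also have "\<dots> \<le> L * d" using that by (intro mult_le_mono1) simp
    finally show ?thesis .
  qed
  with * show ?thesis unfolding nrm_def
    by (intro arg_cong[where f=Max] image_cong refl L2_set_cong) auto
qed

lemma nrm_triangle: "0 < L \<Longrightarrow> nrm d L (\<lambda>i. x i + y i) \<le> nrm d L x + nrm d L y"
  by (subst nrm_le_iff) (auto intro!: order_trans[OF L2_set_triangle_ineq] add_mono block_le_nrm)

lemma nrm_minus: "nrm d L (\<lambda>i. x i - y i) = nrm d L (\<lambda>i. y i - x i)"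
  unfolding nrm_def L2_set_def by (simp add: power2_commute)

lemma nrm_diff_triangle:
  "0 < L \<Longrightarrow> nrm d L (\<lambda>i. x i - z i) \<le> nrm d L (\<lambda>i. x i - y i) + nrm d L (\<lambda>i. y i - z i)"
  using nrm_triangle[of L d "\<lambda>i. x i - y i" "\<lambda>i. y i - z i"] by simp

lemma abs_le_nrm: assumes "i < L * d" shows "\<bar>x i\<bar> \<le> nrm d L x"
proof -
  have d: "0 < d" using assms by (cases d) auto
  have "i div d < L" using assms by (simp add: less_mult_imp_div_less)
  moreover have "\<bar>x (i div d * d + i mod d)\<bar> \<le> L2_set (\<lambda>c. \<bar>x (i div d * d + c)\<bar>) {..<d}"
    using d by (intro member_le_L2_set) auto
  ultimately show ?thesis using block_le_nrm[of "i div d" L x d] by (simp add: L2_set_def)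
qed

lemma nrm_le_max:
  assumes "0 < L" "\<And>i. i < L * d \<Longrightarrow> \<bar>x i\<bar> \<le> b"
  shows "nrm d L x \<le> real d * b"
  unfolding nrm_le_iff[OF assms(1)]
proof (intro allI impI)
  fix t assume t: "t < L"
  have "L2_set (\<lambda>c. x (t * d + c)) {..<d} \<le> (\<Sum>c<d. \<bar>x (t * d + c)\<bar>)" by (rule L2_set_le_sum_abs)
  also have "\<dots> \<le> (\<Sum>c<d. b)"
  proof (rule sum_mono)
    fix c assume c: "c \<in> {..<d}"
    have "t * d + c < Suc t * d" using c by simp
    also have "\<dots> \<le> L * d" using t by (intro mult_le_mono1) simp
    finally show "\<bar>x (t * d + c)\<bar> \<le> b" by (rule assms(2))
  qed
  finally show "L2_set (\<lambda>c. x (t * d + c)) {..<d} \<le> real d * b" by simp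
qed

text \<open>
  Both indices of a traversal advance by 0 or 1, so each side is a walk driven by a sequence of
  bits; these are the binary digits of \<open>E\<close>. For negative \<open>E\<close> all digits but finitely many are 1,
  which drives every walk to the end of its curve.
\<close>

fun walk :: "nat \<Rightarrow> int \<Rightarrow> nat \<Rightarrow> nat" where
  "walk len E 0 = 0"
| "walk len E (Suc t) = (let j = walk len E t + nat (E div 2 ^ t mod 2) in if j < len then j else walk len E t)"

definition expand :: "nat \<Rightarrow> curve \<Rightarrow> int \<Rightarrow> nat \<Rightarrow> real" where
  "expand d V E i = V ! walk (length V) E (i div d) ! (i mod d)"

lemma walk_less: "0 < len \<Longrightarrow> walk len E t < len"
  by (induction t) (auto simp: Let_def)

lemma walk_step: "walk len E (Suc t) \<in> {walk len E t, Suc (walk len E t)}"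
proof -
  have "nat (E div 2 ^ t mod 2) \<in> {0, 1}" by (cases "E div 2 ^ t mod 2 = 0") (auto simp: not_mod_2_eq_0_eq_1)
  then show ?thesis by (auto simp: Let_def)
qed

text \<open>In two's complement a number in this range has only digits 1 from position
  \<open>N\<close> on.\<close>

lemma div_pow_minus1:
  assumes "- (2 ^ N) \<le> E" "E \<le> (- 1 :: int)" "N \<le> t"
  shows "E div 2 ^ t = - 1"
proof -
  have "(2::int) ^ N \<le> 2 ^ t" using assms(3) by (intro power_increasing) auto
  then have "- (2 ^ t) \<le> E" using assms(1) by linarith
  moreover have "(E + 1 * 2 ^ t) div 2 ^ t = 1 + E div 2 ^ t" by (rule div_mult_self1) simp
  moreover have "(E + 1 * 2 ^ t) div 2 ^ t = 0" using calculation(1) assms(2) by (intro div_pos_pos_trivial) auto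
  ultimately show ?thesis by simp
qed

text \<open>After the \<open>2 * m\<close> free bits, \<open>m - 1\<close> bits equal to 1 are read
  before time \<open>3 * m - 1\<close>; they push the walk to its last vertex from wherever it
  stands. This is the origin of the \<open>3 * m\<close> steps.\<close>

lemma walk_end:
  assumes "0 < len" "len \<le> m" "- (4 ^ m) \<le> E" "E \<le> - 1"
  shows "walk len E (3 * m - 1) = len - 1"
proof -
  have E: "- (2 ^ (2 * m)) \<le> E" using assms(3) by (simp add: power_mult)
  have "min (len - 1) j \<le> walk len E (2 * m + j)" for j
  proof (induction j)
    case (Suc j)
    have "E div 2 ^ (2 * m + j) = - 1" using div_pow_minus1[OF E assms(4)] by simp
    then show ?case using Suc walk_less[OF assms(1), of E "2 * m + j"] by (auto simp: Let_def)
  qed simp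
  from this[of "m - 1"] walk_less[OF assms(1), of E "3 * m - 1"] assms(1,2) show ?thesis
    by (simp add: numeral_3_eq_3)
qed

lemma traversal_snoc:
  assumes T: "is_traversal m1 m2 T"
    and ab: "a \<in> {m1, Suc m1}" "b \<in> {m2, Suc m2}" "(a, b) \<noteq> (m1, m2)"
  shows "is_traversal a b (T @ [(a, b)])"
proof -
  let ?T = "T @ [(a, b)]"
  define ok where "ok x y \<longleftrightarrow>
    int (fst y) - int (fst x) \<in> {0, 1} \<and> int (snd y) - int (snd x) \<in> {0, 1} \<and>
    (int (fst y) - int (fst x)) + (int (snd y) - int (snd x)) \<ge> 1" for x y :: "nat \<times> nat"
  have T': "T \<noteq> []" "hd T = (1, 1)" "last T = (m1, m2)"
    and step: "\<And>k. Suc k < length T \<Longrightarrow> ok (T ! k) (T ! Suc k)"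
    using T unfolding is_traversal_def ok_def by blast+
  have "ok (?T ! k) (?T ! Suc k)" if "Suc k < length ?T" for k
  proof (cases "Suc k < length T")
    case True
    then show ?thesis using step[OF True] by (simp add: nth_append)
  next
    case False
    with that have k: "k = length T - 1" "Suc k = length T" by auto
    then have "T ! k = (m1, m2)" using T' by (simp add: last_conv_nth)
    moreover have "?T ! k = T ! k" "?T ! Suc k = (a, b)" using k T'(1) by (simp_all add: nth_append)
    ultimately show ?thesis using ab by (auto simp: ok_def)
  qed
  then show ?thesis
    using T' unfolding is_traversal_def ok_def by simp
qed

text \<open>Two walks run in parallel trace a traversal once the times at which neither of them
  moves are dropped.\<close>

lemma walks_traversal:
  "\<exists>T. is_traversal (Suc (walk l1 E t)) (Suc (walk l2 E' t)) T \<and>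
     set T \<subseteq> (\<lambda>s. (Suc (walk l1 E s), Suc (walk l2 E' s))) ` {..t}"
proof (induction t)
  case 0
  show ?case by (intro exI[of _ "[(1, 1)]"]) (simp add: is_traversal_def)
next
  case (Suc t)
  then obtain T where T: "is_traversal (Suc (walk l1 E t)) (Suc (walk l2 E' t)) T"
    "set T \<subseteq> (\<lambda>s. (Suc (walk l1 E s), Suc (walk l2 E' s))) ` {..t}" by blast
  let ?p = "(Suc (walk l1 E (Suc t)), Suc (walk l2 E' (Suc t)))"
  show ?case
  proof (cases "?p = (Suc (walk l1 E t), Suc (walk l2 E' t))")
    case True
    then show ?thesis using T by (intro exI[of _ T]) (auto simp del: walk.simps simp: atMost_Suc)
  next
    case False
    have "is_traversal (fst ?p) (snd ?p) (T @ [(fst ?p, snd ?p)])"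
      by (rule traversal_snoc[OF T(1)])
        (use walk_step[of l1 E t] walk_step[of l2 E' t] False in \<open>auto simp del: walk.simps\<close>)
    then show ?thesis using T(2)
      by (intro exI[of _ "T @ [?p]"]) (auto simp del: walk.simps simp: atMost_Suc)
  qed
qed

lemma nrm_expand_diff:
  assumes Q: "is_curve d Q" and V: "is_curve d V" and d: "0 < d"
  shows "L2_set (\<lambda>c. expand d Q E (t * d + c) - expand d V E' (t * d + c)) {..<d} =
    point_dist (Q ! walk (length Q) E t) (V ! walk (length V) E' t)"
proof -
  have "walk (length Q) E t < length Q" using Q by (intro walk_less) (auto simp: is_curve_def)
  then have "length (Q ! walk (length Q) E t) = d" using Q by (auto simp: is_curve_def)
  moreover have "(t * d + c) div d = t" "(t * d + c) mod d = c" if "c < d" for c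
    using that by auto
  ultimately show ?thesis unfolding point_dist_def expand_def by (intro L2_set_cong) auto
qed

text \<open>Every pair of bit patterns induces a traversal, so no pair of expansions can
  underestimate the distance.\<close>

lemma frechet_le:
  assumes Q: "is_curve d Q" "length Q \<le> m" and V: "is_curve d V" "length V \<le> m" and d: "0 < d"
    and E: "- (4 ^ m) \<le> E" "E \<le> - 1" and E': "- (4 ^ m) \<le> E'" "E' \<le> - 1"
  shows "discrete_frechet Q V \<le> nrm d (3 * m) (\<lambda>i. expand d Q E i - expand d V E' i)"
proof -
  have l: "0 < length Q" "0 < length V" using Q V by (auto simp: is_curve_def)
  let ?t = "3 * m - 1"
  obtain T where T: "is_traversal (length Q) (length V) T"
     "set T \<subseteq> (\<lambda>s. (Suc (walk (length Q) E s), Suc (walk (length V) E' s))) ` {..?t}"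
    using walks_traversal[of "length Q" E ?t "length V" E'] walk_end[OF l(1) Q(2) E] walk_end[OF l(2) V(2) E'] l
    by auto
  let ?f = "\<lambda>(i, j). point_dist (Q ! (i - 1)) (V ! (j - 1))"
  have "discrete_frechet Q V \<le> Max (?f ` set T)"
    unfolding discrete_frechet_def using T(1) finite_traversals[of "length Q" "length V"]
    by (intro Min_le) auto
  also have "\<dots> \<le> nrm d (3 * m) (\<lambda>i. expand d Q E i - expand d V E' i)"
  proof (subst Max_le_iff)
    show "?f ` set T \<noteq> {}" using T(1) by (auto simp: is_traversal_def)
    show "\<forall>r\<in>?f ` set T. r \<le> nrm d (3 * m) (\<lambda>i. expand d Q E i - expand d V E' i)"
    proof
      fix r assume "r \<in> ?f ` set T"
      then obtain s where s: "s \<le> ?t" "r = point_dist (Q ! walk (length Q) E s) (V ! walk (length V) E' s)"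
        using T(2) by force
      have "s < 3 * m" using s(1) l Q(2) by linarith
      then show "r \<le> nrm d (3 * m) (\<lambda>i. expand d Q E i - expand d V E' i)"
        unfolding s(2) nrm_expand_diff[OF Q(1) V(1) d, symmetric, of E s E'] by (rule block_le_nrm)
    qed
  qed simp
  finally show ?thesis .
qed

text \<open>Two's complement: starting from -1, all of whose digits are 1, each prescribed bit is
  appended as a new lowest digit.\<close>

lemma bits_exist:
  fixes b :: "nat \<Rightarrow> nat"
  assumes "\<And>t. b t \<in> {0, 1}"
  shows "\<exists>E. - (2 ^ N) \<le> E \<and> E \<le> - 1 \<and> (\<forall>t<N. nat (E div 2 ^ t mod 2) = b t)"
  using assms
proof (induction N arbitrary: b)
  case 0
  show ?case by (intro exI[of _ "-1"]) simp
next
  case (Suc N)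
  from Suc.IH[of "\<lambda>t. b (Suc t)"] Suc.prems obtain E where
    E: "- (2 ^ N) \<le> E" "E \<le> - 1" "\<forall>t<N. nat (E div 2 ^ t mod 2) = b (Suc t)" by blast
  define F where "F = int (b 0) + 2 * E"
  have b0: "int (b 0) \<in> {0, 1}" using Suc.prems[of 0] by auto
  have F2: "F div 2 = E" "F mod 2 = int (b 0)" using b0 by (auto simp: F_def)
  have "nat (F div 2 ^ t mod 2) = b t" if "t < Suc N" for t
  proof (cases t)
    case 0
    then show ?thesis using F2 by simp
  next
    case (Suc t')
    then show ?thesis using F2(1) E(3) that by (simp add: zdiv_zmult2_eq)
  qed
  then show ?case using E b0 by (intro exI[of _ F]) (auto simp: F_def)
qed

text \<open>The increments of \<open>f\<close> serve as bits, followed by zeros up to position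
  \<open>2 * m\<close>. The digits 1 beyond that cannot move the walk, which is at its last vertex
  from step \<open>n\<close> on.\<close>

lemma walk_follows:
  fixes f :: "nat \<Rightarrow> nat"
  assumes f0: "f 0 = 0" and step: "\<And>t. t < n \<Longrightarrow> f (Suc t) \<in> {f t, Suc (f t)}" and last: "Suc (f n) = len"
    and le: "\<And>t. t \<le> n \<Longrightarrow> f t < len" and n: "n \<le> 2 * m"
  shows "\<exists>E. - (4 ^ m) \<le> E \<and> E \<le> - 1 \<and> (\<forall>t. walk len E t = f (min t n))"
proof -
  obtain E where E: "- (2 ^ (2 * m)) \<le> E" "E \<le> - 1"
    "\<forall>t<2 * m. nat (E div 2 ^ t mod 2) = (if t < n then f (Suc t) - f t else 0)"
  proof -
    have "(if t < n then f (Suc t) - f t else 0) \<in> {0, 1}" for t using step[of t] by auto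
    from bits_exist[of "\<lambda>t. if t < n then f (Suc t) - f t else 0", OF this, of "2 * m"] that
    show ?thesis by blast
  qed
  have "walk len E t = f (min t n)" for t
  proof (induction t)
    case (Suc t)
    show ?case
    proof (cases "t < n")
      case True
      then have "walk len E t + nat (E div 2 ^ t mod 2) = f (Suc t)"
        using Suc E(3) n step[OF True] by auto
      then show ?thesis using True le[of "Suc t"] by (simp add: Let_def)
    next
      case False
      then show ?thesis using Suc last by (simp add: Let_def)
    qed
  qed (use f0 in simp)
  with E show ?thesis by (auto simp: power_mult)
qed

text \<open>The two coordinates of an optimal traversal are walks. The index sum grows by at least 1
  per step, so there are at most \<open>2 * m\<close> steps and the free bits suffice to encode
  them.\<close>

lemma frechet_attained:
  assumes Q: "is_curve d Q" "length Q \<le> m" and V: "is_curve d V" "length V \<le> m" and d: "0 < d"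
  shows "\<exists>E E'. - (4 ^ m) \<le> E \<and> E \<le> - 1 \<and> - (4 ^ m) \<le> E' \<and> E' \<le> - 1 \<and>
    nrm d (3 * m) (\<lambda>i. expand d Q E i - expand d V E' i) \<le> discrete_frechet Q V"
proof -
  have l: "1 \<le> length Q" "1 \<le> length V" using Q V by (auto simp: is_curve_def Suc_le_eq)
  let ?f = "\<lambda>(i, j). point_dist (Q ! (i - 1)) (V ! (j - 1))"
  let ?S = "{T. is_traversal (length Q) (length V) T}"
  have "discrete_frechet Q V \<in> (\<lambda>T. Max (?f ` set T)) ` ?S"
    unfolding discrete_frechet_def using finite_traversals ex_traversal[OF l] by (intro Min_in) auto
  then obtain T where T: "is_traversal (length Q) (length V) T" "discrete_frechet Q V = Max (?f ` set T)"
    by auto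
  define n where "n = length T - 1"
  have T': "T \<noteq> []" "T ! 0 = (1, 1)" "T ! n = (length Q, length V)" "length T = Suc n"
    using T(1) by (auto simp: is_traversal_def hd_conv_nth last_conv_nth n_def)
  have step: "fst (T ! Suc t) \<in> {fst (T ! t), Suc (fst (T ! t))} \<and> snd (T ! Suc t) \<in> {snd (T ! t), Suc (snd (T ! t))} \<and>
      fst (T ! t) + snd (T ! t) < fst (T ! Suc t) + snd (T ! Suc t)" if "t < n" for t
    using T(1) T'(4) that by (force simp: is_traversal_def)
  have low: "t \<le> n \<Longrightarrow> 1 \<le> fst (T ! t) \<and> 1 \<le> snd (T ! t) \<and> t + 2 \<le> fst (T ! t) + snd (T ! t)" for t
  proof (induction t)
    case (Suc t)
    then show ?case using step[of t] by auto
  qed (use T' in simp)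
  have up: "s \<le> n \<Longrightarrow> fst (T ! (n - s)) \<le> length Q \<and> snd (T ! (n - s)) \<le> length V" for s
  proof (induction s)
    case (Suc s)
    then have "n - s = Suc (n - Suc s)" by simp
    then show ?case using Suc step[of "n - Suc s"] by auto
  qed (use T' in simp)
  have up: "fst (T ! t) \<le> length Q \<and> snd (T ! t) \<le> length V" if "t \<le> n" for t
    using up[of "n - t"] that by simp
  have n: "n \<le> 2 * m" using low[of n] T' Q V by simp
  obtain E where E: "- (4 ^ m) \<le> E" "E \<le> - 1" "\<And>t. walk (length Q) E t = fst (T ! min t n) - 1"
  proof -
    have "fst (T ! Suc t) - 1 \<in> {fst (T ! t) - 1, Suc (fst (T ! t) - 1)}" if "t < n" for t
      using step[OF that] low[of t] that by auto
    moreover have "fst (T ! t) - 1 < length Q" if "t \<le> n" for t using up[OF that] l by linarith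
    ultimately have "\<exists>E. - (4 ^ m) \<le> E \<and> E \<le> - 1 \<and> (\<forall>t. walk (length Q) E t = fst (T ! min t n) - 1)"
      using T' n l by (intro walk_follows) auto
    then show ?thesis using that by blast
  qed
  obtain E' where E': "- (4 ^ m) \<le> E'" "E' \<le> - 1" "\<And>t. walk (length V) E' t = snd (T ! min t n) - 1"
  proof -
    have "snd (T ! Suc t) - 1 \<in> {snd (T ! t) - 1, Suc (snd (T ! t) - 1)}" if "t < n" for t
      using step[OF that] low[of t] that by auto
    moreover have "snd (T ! t) - 1 < length V" if "t \<le> n" for t using up[OF that] l by linarith
    ultimately have "\<exists>E. - (4 ^ m) \<le> E \<and> E \<le> - 1 \<and> (\<forall>t. walk (length V) E t = snd (T ! min t n) - 1)"
      using T' n l by (intro walk_follows) auto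
    then show ?thesis using that by blast
  qed
  have m0: "0 < 3 * m" using l Q by simp
  have "nrm d (3 * m) (\<lambda>i. expand d Q E i - expand d V E' i) \<le> Max (?f ` set T)"
    unfolding nrm_le_iff[OF m0]
  proof (intro allI impI)
    fix t
    have "T ! min t n \<in> set T" using T'(4) by (intro nth_mem) simp
    then have "?f (T ! min t n) \<le> Max (?f ` set T)" by (intro Max_ge) auto
    then show "L2_set (\<lambda>c. expand d Q E (t * d + c) - expand d V E' (t * d + c)) {..<d} \<le> Max (?f ` set T)"
      unfolding nrm_expand_diff[OF Q(1) V(1) d] E(3) E'(3) by (simp add: case_prod_unfold)
  qed
  with E E' T(2) show ?thesis by metis
qed

section \<open>Vector operations\<close>

text \<open>With the floor, \<open>E - 2 * floor (E / 2)\<close> is the lowest binary digit also for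
  negative \<open>E\<close>, in agreement with \<open>div\<close> and \<open>mod\<close> in
  \<open>walk\<close>.\<close>

definition Expand :: "string \<Rightarrow> com" where
  "Expand src = Assign ''ix'' (Const 0) ;;
    For ''et'' ''L'' (
      For ''ec'' ''d'' (
        Load ''x'' src ((R ''off'' \<oplus> R ''ix'') \<otimes> R ''d'' \<oplus> R ''ec'') ;;
        Store ''q'' (R ''et'' \<otimes> R ''d'' \<oplus> R ''ec'') (R ''x'')) ;;
      Assign ''bt'' (R ''ix'' \<oplus> (R ''E'' \<ominus> Const 2 \<otimes> Floor (R ''E'' \<oslash> Const 2))) ;;
      Assign ''E'' (Floor (R ''E'' \<oslash> Const 2)) ;;
      Cond (Less (R ''bt'') (R ''ln'')) (Assign ''ix'' (R ''bt'')) Skip)"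

lemma wr_Expand [simp]:
  "wr (Expand src) = {''ix'', ''et'', ''ec'', ''x'', ''bt'', ''E''}" "wa (Expand src) = {''q''}"
  by (auto simp: Expand_def)

text \<open>The expression \<open>e\<close> transforms a coordinate before it is weighted, so one
  loop computes both projections and keys. The accumulator is not reset, so that a key can start
  with the contribution of its scale.\<close>

definition Dot :: "aexp \<Rightarrow> com" where
  "Dot e = For ''dc'' ''D'' (Load ''x'' ''q'' (R ''dc'') ;; Load ''y'' ''u'' (R ''dc'') ;;
     Assign ''acc'' (R ''acc'' \<oplus> R ''y'' \<otimes> e))"

lemma wr_Dot [simp]: "wr (Dot e) = {''dc'', ''x'', ''y'', ''acc''}" "wa (Dot e) = {}"
  by (auto simp: Dot_def)

definition Norm :: com where
  "Norm = Assign ''nv'' (Const 0) ;;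
    For ''nt'' ''L'' (
      Assign ''nacc'' (Const 0) ;;
      For ''nc'' ''d'' (
        Load ''x'' ''q'' (R ''nt'' \<otimes> R ''d'' \<oplus> R ''nc'') ;;
        Load ''y'' ''P'' (R ''row'' \<otimes> R ''D'' \<oplus> (R ''nt'' \<otimes> R ''d'' \<oplus> R ''nc'')) ;;
        Assign ''nacc'' (R ''nacc'' \<oplus> (R ''x'' \<ominus> R ''y'') \<otimes> (R ''x'' \<ominus> R ''y''))) ;;
      Cond (Less (R ''nv'') (R ''nacc'')) (Assign ''nv'' (R ''nacc'')) Skip) ;;
    Assign ''nv'' (Sqrt (R ''nv''))"

lemma wr_Norm [simp]: "wr Norm = {''nv'', ''nt'', ''nacc'', ''nc'', ''x'', ''y''}" "wa Norm = {}"
  by (auto simp: Norm_def)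

lemma wp_SeqI:
  "wp \<omega> A c1 Q1 s \<Longrightarrow> (\<And>t s'. Q1 t s' \<Longrightarrow> wp \<omega> A c2 (\<lambda>t'. Q (t + t')) s') \<Longrightarrow> wp \<omega> A (c1 ;; c2) Q s"
  by (simp add: wp_mono)

lemma wp_Dot:
  assumes D: "reg s ''D'' = real D" "D \<le> A"
    and e: "\<And>s'. same {''dc'', ''x'', ''y'', ''acc''} {} s s' \<Longrightarrow> aval e (reg s') = f (reg s' ''x'')"
  shows "wp \<omega> A (Dot e) (\<lambda>t s'. t \<le> 5 * D + 2 \<and> same {''dc'', ''x'', ''y'', ''acc''} {} s s' \<and>
     reg s' ''acc'' = reg s ''acc'' + (\<Sum>i<D. arr s ''u'' i * f (arr s ''q'' i))) s"
  unfolding Dot_def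
proof (rule wp_For[where n=D and T=3 and I="\<lambda>j s'. reg s' ''acc'' = reg s ''acc'' + (\<Sum>i<j. arr s ''u'' i * f (arr s ''q'' i))"], goal_cases)
  case (6 j s')
  have s1: "same {''dc'', ''x'', ''y'', ''acc''} {} s s'" using 6(4) by (simp add: insert_commute)
  have a: "arr s' ''q'' = arr s ''q''" "arr s' ''u'' = arr s ''u''" using same_arr[OF s1] by auto
  have [simp]: "addr (R ''dc'') s'' = j" if "reg s'' ''dc'' = real j" for s'' using that by (intro addrI) simp
  have "same {''dc'', ''x'', ''y'', ''acc''} {} s (set_reg ''y'' a (set_reg ''x'' b s'))" for a b
    using s1 by (auto simp: same_def)
  from e[OF this] have e': "aval e (reg (set_reg ''y'' a (set_reg ''x'' b s'))) = f b" for a b by simp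
  show ?case using 6(1-3) D(2) by (simp add: a e')
next
  case (7 t s')
  then have "same {''dc'', ''x'', ''y'', ''acc''} {} s s'" by (simp add: insert_commute)
  then show ?case using 7 by simp
qed (use D in auto)

lemma less_mult_add: "i < (a :: nat) \<Longrightarrow> j < b \<Longrightarrow> i * b + j < a * b"
proof -
  assume *: "i < a" "j < b"
  then have "i * b + j < Suc i * b" by simp
  also have "\<dots> \<le> a * b" using * by (intro mult_le_mono1) simp
  finally show ?thesis .
qed

lemma wp_Norm:
  assumes r: "reg s ''D'' = real (L * d)" "reg s ''L'' = real L" "reg s ''d'' = real d" "reg s ''row'' = real ro"
    and A: "(ro + 1) * (L * d) \<le> A" and L: "0 < L"
  shows "wp \<omega> A Norm (\<lambda>t s'. t \<le> L * (5 * d + 7) + 4 \<and> same {''nv'', ''nt'', ''nacc'', ''nc'', ''x'', ''y''} {} s s' \<and>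
     reg s' ''nv'' = nrm d L (\<lambda>i. arr s ''q'' i - arr s ''P'' (ro * (L * d) + i))) s"
proof -
  define v where "v i = arr s ''q'' i - arr s ''P'' (ro * (L * d) + i)" for i
  define S where "S t = (\<Sum>c<d. (v (t * d + c))\<^sup>2)" for t
  have S0: "0 \<le> S t" for t unfolding S_def by (intro sum_nonneg) simp
  let ?X = "{''nv'', ''nt'', ''nacc'', ''nc'', ''x'', ''y''}"
  \<comment> \<open>The extra 0 is the initial value of the register; it leaves the maximum
    unchanged because the sums of squares are nonnegative.\<close>
  define mx where "mx j = Max (insert 0 (S ` {..<j}))" for j :: nat
  have mx_Suc: "mx (Suc j) = max (S j) (mx j)" for j
    by (simp add: mx_def lessThan_Suc Max_insert[symmetric] insert_commute del: Max_insert)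
  define I where "I j s' \<longleftrightarrow> reg s' ''nv'' = mx j" for j and s' :: state
  let ?in = "For ''nc'' ''d'' (
        Load ''x'' ''q'' (R ''nt'' \<otimes> R ''d'' \<oplus> R ''nc'') ;;
        Load ''y'' ''P'' (R ''row'' \<otimes> R ''D'' \<oplus> (R ''nt'' \<otimes> R ''d'' \<oplus> R ''nc'')) ;;
        Assign ''nacc'' (R ''nacc'' \<oplus> (R ''x'' \<ominus> R ''y'') \<otimes> (R ''x'' \<ominus> R ''y'')))"
  have inner: "wp \<omega> A ?in (\<lambda>t s''. t \<le> d * 5 + 2 \<and> reg s'' ''nacc'' = S j \<and> reg s'' ''nv'' = reg s' ''nv'') s'"
    if j: "j < L" and s': "same ?X {} s s'" "reg s' ''nt'' = real j" "reg s' ''nacc'' = 0" for j s'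
  proof (rule wp_For[where n=d and T=3 and I="\<lambda>i s''. reg s'' ''nacc'' = (\<Sum>c<i. (v (j * d + c))\<^sup>2)"], goal_cases)
    case (6 c s'')
    have sm: "same ?X {} s s''" by (rule same_trans[OF s'(1) 6(4)]) auto
    have R: "reg s'' ''D'' = real (L * d)" "reg s'' ''d'' = real d" "reg s'' ''row'' = real ro"
      "reg s'' ''nt'' = real j" using same_reg[OF sm] same_reg[OF 6(4)] r s' by auto
    have a: "arr s'' ''q'' = arr s ''q''" "arr s'' ''P'' = arr s ''P''" using same_arr[OF sm] by auto
    have lt: "j * d + c < L * d" using j 6(1) by (rule less_mult_add)
    have lt2: "ro * (L * d) + (j * d + c) < A" using lt A by simp
    have ad: "addr (R ''nt'' \<otimes> R ''d'' \<oplus> R ''nc'') s'' = j * d + c"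
      by (rule addrI) (use R 6(3) in simp)
    have ad2: "addr (R ''row'' \<otimes> R ''D'' \<oplus> (R ''nt'' \<otimes> R ''d'' \<oplus> R ''nc'')) (set_reg ''x'' a s'') = ro * (L * d) + (j * d + c)" for a
      by (rule addrI) (use R 6(3) in simp)
    show ?case using lt lt2 6(2) by (simp add: ad ad2 a v_def power2_eq_square)
  next
    case (7 t s'')
    show ?case using 7(1,2) same_reg[OF 7(3), of "''nv''"] by (simp add: S_def)
  qed (use s' same_reg[OF s'(1)] r in auto)
  have "wp \<omega> A (For ''nt'' ''L'' (Assign ''nacc'' (Const 0) ;; ?in ;;
      Cond (Less (R ''nv'') (R ''nacc'')) (Assign ''nv'' (R ''nacc'')) Skip))
    (\<lambda>t s'. t \<le> L * (5 * d + 7) + 2 \<and> I L s') (set_reg ''nv'' 0 s)"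
  proof (rule wp_For[where n=L and T="5 * d + 5" and I=I], goal_cases)
    case (6 j s')
    define s1 where "s1 = set_reg ''nacc'' 0 s'"
    have sm: "same ?X {} s s1" using 6(4) by (auto simp: same_def s1_def)
    have "wp \<omega> A ?in (\<lambda>t'. wp \<omega> A (Cond (Less (R ''nv'') (R ''nacc'')) (Assign ''nv'' (R ''nacc'')) Skip)
        (\<lambda>t'' s''. 1 + (t' + t'') \<le> 5 * d + 5 \<and> I (Suc j) (set_reg ''nt'' (real j + 1) s''))) s1"
      by (rule wp_mono[OF inner[OF 6(1) sm]]) (use 6(2,3) in \<open>auto simp: s1_def I_def mx_Suc max_def\<close>)
    then show ?case unfolding wp_Seq wp_Assign s1_def by (simp only: aval.simps of_int_0)
  next
    case (7 t s')
    then show ?case by (simp add: algebra_simps)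
  qed (use r in \<open>auto simp: I_def mx_def\<close>)
  then have "wp \<omega> A Norm (\<lambda>t s'. t \<le> L * (5 * d + 7) + 4 \<and> reg s' ''nv'' = sqrt (Max (insert 0 (S ` {..<L})))) s"
    unfolding Norm_def by (simp del: wp_Cond, elim wp_mono) (auto simp: I_def mx_def)
  moreover have "sqrt (Max (insert 0 (S ` {..<L}))) = nrm d L v"
  proof -
    have ne: "S ` {..<L} \<noteq> {}" "finite (S ` {..<L})" using L by auto
    have "0 \<le> Max (S ` {..<L})" using L S0[of 0] by (intro order_trans[OF S0 Max_ge]) auto
    then have "Max (insert 0 (S ` {..<L})) = Max (S ` {..<L})" using ne by (simp add: Max_insert max_def)
    also have "sqrt \<dots> = Max (sqrt ` S ` {..<L})" using ne by (intro mono_Max_commute) (auto simp: mono_def)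
    finally show ?thesis by (simp add: nrm_def L2_set_def S_def image_image)
  qed
  ultimately have "wp \<omega> A Norm (\<lambda>t s'. t \<le> L * (5 * d + 7) + 4 \<and> reg s' ''nv'' = nrm d L v) s" by simp
  then show ?thesis by (rule wp_same) (auto simp: v_def[abs_def])
qed

lemma floor_half_int: "\<lfloor>real_of_int E / 2\<rfloor> = E div 2"
  using floor_divide_of_int_eq[of E 2, where 'a=real] by simp

lemma wp_Expand:
  assumes r: "reg s ''L'' = real L" "reg s ''d'' = real d" "reg s ''off'' = real off" "reg s ''ln'' = real len"
    "reg s ''E'' = real_of_int E"
    and len: "0 < len" and A: "(off + len) * d \<le> A" "L * d \<le> A" and src: "src \<noteq> ''q''"
  shows "wp \<omega> A (Expand src) (\<lambda>t s'. t \<le> L * (3 * (d + 3) + d) + 3 \<and>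
     same {''ix'', ''et'', ''ec'', ''x'', ''bt'', ''E''} {''q''} s s' \<and>
     (\<forall>t<L. \<forall>c<d. arr s' ''q'' (t * d + c) = arr s src ((off + walk len E t) * d + c))) s"
proof -
  let ?X = "{''ix'', ''et'', ''ec'', ''x'', ''bt'', ''E''}"
  define I where "I j s' \<longleftrightarrow> reg s' ''ix'' = real (walk len E j) \<and> reg s' ''E'' = real_of_int (E div 2 ^ j) \<and>
    (\<forall>t<j. \<forall>c<d. arr s' ''q'' (t * d + c) = arr s src ((off + walk len E t) * d + c))" for j and s' :: state
  let ?in = "For ''ec'' ''d'' (
        Load ''x'' src ((R ''off'' \<oplus> R ''ix'') \<otimes> R ''d'' \<oplus> R ''ec'') ;;
        Store ''q'' (R ''et'' \<otimes> R ''d'' \<oplus> R ''ec'') (R ''x''))"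
  have inner: "wp \<omega> A ?in (\<lambda>t s''. t \<le> d * 4 + 2 \<and> same {''ec'', ''x''} {''q''} s' s'' \<and>
     (\<forall>t<Suc j. \<forall>c<d. arr s'' ''q'' (t * d + c) = arr s src ((off + walk len E t) * d + c))) s'"
    if j: "j < L" and s': "same ?X {''q''} s s'" "reg s' ''et'' = real j" "I j s'" for j s'
  proof (rule wp_For[where n=d and T=2 and I="\<lambda>i s''. (\<forall>t<j. \<forall>c<d. arr s'' ''q'' (t * d + c) = arr s src ((off + walk len E t) * d + c)) \<and>
      (\<forall>c<i. arr s'' ''q'' (j * d + c) = arr s src ((off + walk len E j) * d + c))"], goal_cases)
    case (5)
    then show ?case using s'(3) by (simp add: I_def)
  next
    case (6 c s'')
    have sm: "same ?X {''q''} s s''" by (rule same_trans[OF s'(1) 6(4)]) auto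
    have R: "reg s'' ''d'' = real d" "reg s'' ''off'' = real off" "reg s'' ''et'' = real j" "reg s'' ''ix'' = real (walk len E j)"
      using same_reg[OF sm] same_reg[OF 6(4)] r s' by (auto simp: I_def)
    have a: "arr s'' src = arr s src" using same_arr[OF sm] src by auto
    have lt: "j * d + c < L * d" using j 6(1) by (rule less_mult_add)
    have lt2: "(off + walk len E j) * d + c < (off + len) * d"
      using walk_less[OF len, of E j] 6(1) by (intro less_mult_add) auto
    have ad: "addr (R ''et'' \<otimes> R ''d'' \<oplus> R ''ec'') (set_reg ''x'' a s'') = j * d + c" for a
      by (rule addrI) (use R 6(3) in simp)
    have ad2: "addr ((R ''off'' \<oplus> R ''ix'') \<otimes> R ''d'' \<oplus> R ''ec'') s'' = (off + walk len E j) * d + c"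
      by (rule addrI) (use R 6(3) in simp)
    have ne: "t * d + c' \<noteq> j * d + c" if "t < j" "c' < d" for t c'
      using less_mult_add[OF that] by simp
    show ?case using lt lt2 A 6(2) ne by (auto simp: ad ad2 a less_Suc_eq)
  next
    case (7 t s'')
    show ?case using 7 by (auto simp: less_Suc_eq insert_commute)
  qed (use s' same_reg[OF s'(1)] r in auto)
  have "wp \<omega> A (For ''et'' ''L'' (?in ;;
      Assign ''bt'' (R ''ix'' \<oplus> (R ''E'' \<ominus> Const 2 \<otimes> Floor (R ''E'' \<oslash> Const 2))) ;;
      Assign ''E'' (Floor (R ''E'' \<oslash> Const 2)) ;;
      Cond (Less (R ''bt'') (R ''ln'')) (Assign ''ix'' (R ''bt'')) Skip))
    (\<lambda>t s'. t \<le> L * (d * 4 + 8) + 2 \<and> I L s') (set_reg ''ix'' 0 s)"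
  proof (rule wp_For[where n=L and T="d * 4 + 6" and I=I], goal_cases)
    case (6 j s')
    have sm: "same ?X {''q''} s s'" using 6(4) by (auto simp: same_def)
    have bt: "real_of_int (E div 2 ^ j) - 2 * real_of_int (E div 2 ^ j div 2) = real (nat (E div 2 ^ j mod 2))"
      by (simp add: minus_mult_div_eq_mod[symmetric])
    have sh: "E div 2 ^ j div 2 = E div 2 ^ Suc j"
      by (simp add: zdiv_zmult2_eq[symmetric] mult.commute)
    have bt2: "real (walk len E j) + (real_of_int (E div 2 ^ j) - 2 * real_of_int (E div 2 ^ j div 2)) =
       real (walk len E j + nat (E div 2 ^ j mod 2))" unfolding bt by simp
    have *: "I (Suc j) s''" if "reg s'' ''ix'' = real (walk len E (Suc j))" "reg s'' ''E'' = real_of_int (E div 2 ^ j div 2)"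
      "\<forall>t<Suc j. \<forall>c<d. arr s'' ''q'' (t * d + c) = arr s src ((off + walk len E t) * d + c)" for s''
      using that unfolding I_def sh by blast
    show ?case unfolding wp_Seq
    proof (rule wp_mono[OF inner[OF 6(1) sm 6(3,2)]], elim conjE)
      fix t s'' assume s'': "t \<le> d * 4 + 2" "same {''ec'', ''x''} {''q''} s' s''"
        "\<forall>t<Suc j. \<forall>c<d. arr s'' ''q'' (t * d + c) = arr s src ((off + walk len E t) * d + c)"
      have R: "reg s'' ''ix'' = real (walk len E j)" "reg s'' ''E'' = real_of_int (E div 2 ^ j)" "reg s'' ''ln'' = real len"
        using 6(2) same_reg[OF s''(2)] same_reg[OF sm] r by (auto simp: I_def)
      show "wp \<omega> A (Assign ''bt'' (R ''ix'' \<oplus> (R ''E'' \<ominus> Const 2 \<otimes> Floor (R ''E'' \<oslash> Const 2)))) (\<lambda>t'. wp \<omega> A (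
        Assign ''E'' (Floor (R ''E'' \<oslash> Const 2))) (\<lambda>t''. wp \<omega> A (
        Cond (Less (R ''bt'') (R ''ln'')) (Assign ''ix'' (R ''bt'')) Skip) (\<lambda>t''' s''.
         t + (t' + (t'' + t''')) \<le> d * 4 + 6 \<and> I (Suc j) (set_reg ''et'' (real j + 1) s'')))) s''"
        using s''(1,3) by (auto simp: R floor_half_int bt2 Let_def simp del: of_nat_add intro!: *)
    qed
  next
    case (7 t s')
    then show ?case by (simp add: algebra_simps)
  qed (use r in \<open>auto simp: I_def\<close>)
  then have "wp \<omega> A (Expand src) (\<lambda>t s'. t \<le> L * (3 * (d + 3) + d) + 3 \<and> I L s') s"
    unfolding Expand_def by (subst wp_Seq) (simp del: wp_Seq, erule wp_mono, simp add: algebra_simps)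
  then show ?thesis by (rule wp_same) (auto simp: I_def)
qed

section \<open>The data structure\<close>

text \<open>
  With this congruence rule the simplifier executes only the head of a program and leaves the
  continuation alone.
\<close>

lemma wp_weak: "s = s' \<Longrightarrow> wp \<omega> A c Q s = wp \<omega> A c Q s'"
  by simp

lemma wp_mono_eq: "wp \<omega> A c Q s \<Longrightarrow> s = s' \<Longrightarrow> (\<And>t s''. Q t s'' \<Longrightarrow> Q' t s'') \<Longrightarrow> wp \<omega> A c Q' s'"
  using wp_mono by blast

lemmas wpx = wp_Skip[THEN fun_cong] wp_Assign[THEN fun_cong] wp_Load[THEN fun_cong] wp_Store[THEN fun_cong]
  wp_Uniform[THEN fun_cong] wp_Seq[THEN fun_cong] wp_Cond[THEN fun_cong]

text \<open>Powers are formed by repeated multiplication; the exponents are \<open>m\<close>,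
  \<open>D\<close> and \<open>k\<close>, for which linear time is affordable.\<close>

definition Power_Loop :: "string \<Rightarrow> aexp \<Rightarrow> string \<Rightarrow> com" where
  "Power_Loop r e nn = Assign r (Const 1) ;; For ''i'' nn (Assign r (R r \<otimes> e))"

lemma wr_Power_Loop [simp]: "wr (Power_Loop r e nn) = {r, ''i''}" "wa (Power_Loop r e nn) = {}"
  by (auto simp: Power_Loop_def)

lemma wp_Power_Loop:
  assumes "reg s nn = real n" "nn \<notin> {r, ''i''}" "r \<noteq> ''i''"
    and e: "\<And>s'. same {r, ''i''} {} s s' \<Longrightarrow> aval e (reg s') = real b"
  shows "wp \<omega> A (Power_Loop r e nn) (\<lambda>t s'. t \<le> 3 * n + 3 \<and> same {r, ''i''} {} s s' \<and> reg s' r = real (b ^ n)) s"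
proof -
  have "wp \<omega> A (For ''i'' nn (Assign r (R r \<otimes> e))) (\<lambda>t s'. t \<le> 3 * n + 2 \<and> reg s' r = real (b ^ n)) (set_reg r 1 s)"
  proof (rule wp_For[where n=n and T=1 and I="\<lambda>j s'. reg s' r = real (b ^ j)"], goal_cases)
    case (6 j s')
    have "same {r, ''i''} {} s s'" using 6(4) by (auto simp: same_def)
    from e[OF this] show ?case using 6(2) assms by simp
  qed (use assms in auto)
  then have "wp \<omega> A (Power_Loop r e nn) (\<lambda>t s'. t \<le> 3 * n + 3 \<and> reg s' r = real (b ^ n)) s"
    unfolding Power_Loop_def wp_Seq wp_Assign aval.simps of_int_1 by (rule wp_mono) simp
  then show ?thesis by (rule wp_same) simp
qed

text \<open>One variate per coordinate, used by projections and keys alike, and one more for the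
  scale index in the keys.\<close>

definition ParA :: com where
  "ParA = Assign ''L'' (Const 3 \<otimes> R ''m'') ;; Assign ''D'' (R ''L'' \<otimes> R ''d'') ;; Assign ''D1'' (R ''D'' \<oplus> Const 1) ;;
    For ''i'' ''D1'' (Uniform ''x'' ;; Store ''u'' (R ''i'') (R ''x''))"

text \<open>\<open>H\<close> is at least \<open>8 / \<epsilon>\<close>, so that a bounded number of
  errors of relative size \<open>1 / H\<close> add up to at most \<open>\<epsilon>\<close>. If a
  query lies within distance \<open>s\<close> of a point, their cells at scale \<open>s\<close>
  differ by at most \<open>d * H\<close> in each coordinate; \<open>b\<close> digits enumerate these
  offsets with one spare value at either end.\<close>

definition ParB :: com where
  "ParB = Power_Loop ''E4'' (Const 4) ''m'' ;;
    Assign ''N'' (R ''n'' \<otimes> R ''E4'') ;; Assign ''N1'' (R ''N'' \<ominus> Const 1) ;;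
    Assign ''H'' (Floor (Const 8 \<oslash> R ''eps'') \<oplus> Const 1) ;; Assign ''DH'' (R ''d'' \<otimes> R ''H'') ;;
    Assign ''b'' (Const 2 \<otimes> R ''DH'' \<oplus> Const 3) ;;
    Power_Loop ''BD'' (R ''b'') ''D''"

text \<open>\<open>De\<close> is \<open>d\<close> divided by the \<open>\<delta>\<close> of
  \<open>good_tapes\<close> for a set of \<open>(n + 1) * 4 ^ m\<close> points, the expansions of
  all input curves and of the query. The shape of \<open>al\<close> and \<open>be\<close> is
  dictated by the estimates in \<open>one_dim\<close>.\<close>

definition ParC :: com where
  "ParC = Assign ''B2'' (Const 2 \<otimes> R ''BD'') ;;
    Power_Loop ''De'' (Const 2) ''k'' ;;
    Assign ''De'' (R ''De'' \<otimes> (Const 2 \<otimes> R ''d'' \<otimes> ((R ''n'' \<oplus> Const 1) \<otimes> R ''E4'') \<otimes> ((R ''n'' \<oplus> Const 1) \<otimes> R ''E4''))) ;;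
    Assign ''al'' (Const 2 \<otimes> R ''D'' \<otimes> R ''D'' \<otimes> R ''De'') ;;
    Assign ''be'' (R ''D'' \<otimes> R ''N'' \<otimes> R ''H'' \<otimes> R ''De'' \<otimes> R ''De'')"

text \<open>\<open>W\<close> halvings cover the window of a gap, with a factor 2 to spare;
  \<open>H\<close> steps of ratio \<open>H / (H + 1)\<close> amount to at least one halving.\<close>

definition ParD :: com where
  "ParD = Assign ''W'' (Const 0) ;; Assign ''x'' (Const 1) ;;
    While (Neg (Less (Const 2 \<otimes> R ''al'' \<otimes> R ''be'') (R ''x'')))
      (Assign ''x'' (R ''x'' \<otimes> Const 2) ;; Assign ''W'' (R ''W'' \<oplus> Const 1)) ;;
    Assign ''Wn'' (R ''H'' \<otimes> R ''W'') ;; Assign ''Wn1'' (R ''Wn'' \<oplus> Const 1) ;;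
    Assign ''rr'' (R ''H'' \<oslash> (R ''H'' \<oplus> Const 1))"

lemma wr_Par [simp]:
  "wr ParA = {''L'', ''D'', ''D1'', ''i'', ''x''}" "wa ParA = {''u''}"
  "wr ParB = {''E4'', ''i'', ''N'', ''N1'', ''H'', ''DH'', ''b'', ''BD''}" "wa ParB = {}"
  "wr ParC = {''B2'', ''De'', ''i'', ''al'', ''be''}" "wa ParC = {}"
  "wr ParD = {''W'', ''x'', ''Wn'', ''Wn1'', ''rr''}" "wa ParD = {}"
  by (auto simp: ParA_def ParB_def ParC_def ParD_def)

definition Points :: com where
  "Points = Assign ''off'' (Const 0) ;; Assign ''row'' (Const 0) ;;
    For ''v'' ''n'' (
      Load ''ln'' ''len'' (R ''v'') ;;
      For ''e'' ''E4'' (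
        Assign ''E'' (R ''e'' \<ominus> R ''E4'') ;; Expand ''V'' ;;
        Assign ''acc'' (Const 0) ;; Dot (R ''x'') ;; Store ''X'' (R ''row'') (R ''acc'') ;;
        For ''i'' ''D'' (Load ''x'' ''q'' (R ''i'') ;; Store ''P'' (R ''row'' \<otimes> R ''D'' \<oplus> R ''i'') (R ''x'')) ;;
        Assign ''row'' (R ''row'' \<oplus> Const 1)) ;;
      Assign ''off'' (R ''off'' \<oplus> R ''ln''))"

text \<open>
  The key of a grid cell is a random linear form of its integer coordinates and of the index of
  its scale. Almost surely it is injective, so a single real number identifies the cell.
\<close>

definition Key :: com where
  "Key = Load ''y'' ''u'' (R ''D'') ;; Assign ''acc'' (R ''y'' \<otimes> R ''tl'') ;; Dot (Floor (R ''x'' \<oslash> R ''wd''))"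

text \<open>The digits of \<open>rem\<close> in base \<open>b\<close> are offsets from the cell of
  the point itself, shifted by \<open>d * H + 1\<close> to be nonnegative. Cells whose corner is too
  far from the point are left out, which turns each stored entry into a certificate of
  proximity.\<close>

definition CellBody :: com where
  "CellBody = For ''cc'' ''D'' (
      Load ''x'' ''P'' (R ''row'' \<otimes> R ''D'' \<oplus> R ''cc'') ;;
      Assign ''y'' (Floor (R ''rem'' \<oslash> R ''b'')) ;;
      Assign ''dg'' (R ''rem'' \<ominus> R ''b'' \<otimes> R ''y'') ;;
      Assign ''rem'' (R ''y'') ;;
      Store ''q'' (R ''cc'') (R ''wd'' \<otimes> (Floor (R ''x'' \<oslash> R ''wd'') \<oplus> R ''dg'' \<ominus> (R ''DH'' \<oplus> Const 1)))) ;;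
    Key ;; Norm ;;
    Cond (Less (R ''s'' \<otimes> (Const 1 \<oplus> Const 1 \<oslash> R ''H'')) (R ''nv'')) Skip
      (Store ''DK'' (R ''M'') (R ''acc'') ;; Store ''DV'' (R ''M'') (R ''row'') ;;
       Assign ''M'' (R ''M'' \<oplus> Const 1))"

text \<open>One counter enumerates pairs: its parity selects an endpoint of the gap, the rest
  encodes the cell.\<close>

definition Cell :: com where
  "Cell = Assign ''rem'' (Floor (R ''o'' \<oslash> Const 2)) ;;
    Load ''row'' ''S'' (R ''gg'' \<oplus> (R ''o'' \<ominus> Const 2 \<otimes> R ''rem'')) ;; CellBody"

text \<open>With side \<open>s / (d * H)\<close> a point is at distance at most \<open>s / H\<close>
  from the corner of its cell in every block.\<close>

definition Scale :: com where
  "Scale = Load ''s'' ''LK'' (R ''tl'') ;; Assign ''s'' (Const 0 \<ominus> R ''s'') ;; Assign ''wd'' (R ''s'' \<oslash> R ''DH'')"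

text \<open>Scales shrink by the ratio \<open>rr\<close>, but jump down to \<open>g * be\<close> if
  the next one would lie above the window of the current gap; thus ranges between windows cost no
  scales.\<close>

definition Push :: com where
  "Push = Cond (Less (R ''ag'') (R ''sg''))
    (Assign ''sg'' (R ''sg'' \<otimes> R ''rr'') ;;
     Cond (Less (R ''bg'') (R ''sg'')) (Assign ''sg'' (R ''bg'')) Skip ;;
     Store ''LK'' (R ''nl'') (Const 0 \<ominus> R ''sg'') ;; Assign ''nl'' (R ''nl'' \<oplus> Const 1)) Skip"

text \<open>The last scales of the ladder are addressed backwards, so the index is negative when the
  ladder is still short.\<close>

definition Insert :: com where
  "Insert = Assign ''tl'' (R ''nl'' \<ominus> Const 1 \<ominus> R ''w'') ;;
    Cond (Less (R ''tl'') (Const 0)) Skip (Scale ;; For ''o'' ''B2'' Cell)"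

definition GapBody :: com where
  "GapBody = For ''w'' ''Wn1'' Push ;; For ''w'' ''Wn'' Insert"

definition Gap :: com where
  "Gap = Load ''g'' ''GS'' (R ''gi'') ;; Assign ''g'' (Const 0 \<ominus> R ''g'') ;;
    Cond (Less (Const 0) (R ''g''))
     (Load ''gg'' ''GI'' (R ''gi'') ;;
      Assign ''ag'' (R ''g'' \<oslash> R ''al'') ;; Assign ''bg'' (R ''g'' \<otimes> R ''be'') ;; GapBody) Skip"

definition Gaps :: com where
  "Gaps = For ''i'' ''N1'' (Load ''x'' ''XS'' (R ''i'') ;; Load ''y'' ''XS'' (R ''i'' \<oplus> Const 1) ;;
      Store ''G'' (R ''i'') (R ''x'' \<ominus> R ''y''))"

definition LadderBody :: com where
  "LadderBody = For ''gi'' ''N1'' Gap ;; Sort ''DK'' ''M'' ''DS'' ''DI''"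

text \<open>The sorted gaps start with the largest one, so the first scale lies above all windows;
  dividing by \<open>rr\<close> leaves room for one full step down to the top of the first
  window.\<close>

definition Ladder :: com where
  "Ladder = Load ''g'' ''GS'' (Const 0) ;; Assign ''sg'' ((Const 0 \<ominus> R ''g'') \<otimes> R ''be'' \<oslash> R ''rr'') ;;
    Store ''LK'' (Const 0) (Const 0 \<ominus> R ''sg'') ;; Assign ''nl'' (Const 1) ;; Assign ''M'' (Const 0) ;; LadderBody"

definition Build :: com where
  "Build = Sort ''X'' ''N'' ''XS'' ''S'' ;; Gaps ;; Sort ''G'' ''N1'' ''GS'' ''GI'' ;; Ladder"

definition Preprocess :: com where
  "Preprocess = ParA ;; ParB ;; ParC ;; ParD ;; Points ;; Cond (Less (R ''k'') (R ''n'')) Build Skip"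

text \<open>Rows are grouped by curve, \<open>4 ^ m\<close> expansions each, so dividing the row by
  \<open>E4\<close> recovers the curve.\<close>

definition Update :: com where
  "Update = Norm ;; Cond (Conj (Neg (Less (R ''best'') (Const 0))) (Neg (Less (R ''nv'') (R ''best'')))) Skip
     (Assign ''best'' (R ''nv'') ;; Assign ''out'' (Floor (R ''row'' \<oslash> R ''E4'')))"

text \<open>The point of a stored cell is within \<open>s * (1 + 1 / H)\<close> of the corner and
  the query within \<open>s / H\<close>, whence the threshold. Measuring again guards against
  colliding keys on bad tapes.\<close>

definition Verify :: com where
  "Verify = Update ;;
    Cond (Less (R ''s'' \<otimes> (Const 1 \<oplus> Const 2 \<oslash> R ''H'')) (R ''nv'')) Skip (Assign ''fl'' (Const 1))"

text \<open>The search leaves \<open>lo\<close> at the first key that is at least \<open>ky\<close>,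
  so a single comparison decides equality.\<close>

definition Check :: com where
  "Check = Assign ''fl'' (Const 0) ;;
    Cond (Less (R ''lo'') (R ''M''))
      (Load ''x'' ''DS'' (R ''lo'') ;;
       Cond (Less (R ''ky'') (R ''x'')) Skip
        (Load ''x'' ''DI'' (R ''lo'') ;; Load ''row'' ''DV'' (R ''x'') ;; Verify)) Skip"

definition Find :: com where
  "Find = Binary_Search ''DS'' ''M'' ''ky'' ;; Check ;;
    Cond (Less (Const 0) (R ''fl'')) (Assign ''lj'' (R ''tl'')) (Assign ''hj'' (R ''tl''))"

definition LookupBody :: com where
  "LookupBody = Key ;; Assign ''ky'' (R ''acc'') ;; Find"

definition Lookup :: com where
  "Lookup = Assign ''tl'' (Floor ((R ''lj'' \<oplus> R ''hj'') \<oslash> Const 2)) ;; Scale ;; LookupBody"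

text \<open>Bisection between a scale at which the lookup succeeded and one at which it failed.
  Success may fail to be monotone in the scale; the analysis uses only that a success and a failure
  end up adjacent.\<close>

definition Refine :: com where
  "Refine = Binary_Search ''LK'' ''nl'' ''nr'' ;;
    Assign ''lj'' (R ''lo'') ;; Assign ''hj'' (R ''lj'' \<oplus> R ''Wn'') ;;
    Cond (Less (R ''nl'' \<ominus> Const 1) (R ''hj'')) (Assign ''hj'' (R ''nl'' \<ominus> Const 1)) Skip ;;
    While (Less (R ''lj'' \<oplus> Const 1) (R ''hj'')) Lookup"

definition Second :: com where
  "Second = Update ;; Cond (Less (R ''nv'') (R ''rho'')) (Assign ''rho'' (R ''nv'')) Skip ;;
    Assign ''nr'' (Const 0 \<ominus> R ''rho'') ;; Refine"

definition First :: com where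
  "First = Update ;; Assign ''rho'' (R ''nv'') ;;
    Cond (Less (Const 0) (R ''lo'')) (Assign ''po'' (R ''lo'' \<ominus> Const 1)) (Assign ''po'' (Const 0)) ;;
    Load ''row'' ''S'' (R ''po'') ;; Second"

definition Locate :: com where
  "Locate = Binary_Search ''XS'' ''N'' ''pq'' ;;
    Assign ''po'' (R ''lo'') ;; Cond (Less (R ''po'') (R ''N'')) Skip (Assign ''po'' (R ''N1'')) ;;
    Load ''row'' ''S'' (R ''po'') ;; First"

definition SearchBody :: com where
  "SearchBody = Dot (R ''x'') ;; Assign ''pq'' (R ''acc'') ;; Locate"

definition Search :: com where
  "Search = Assign ''acc'' (Const 0) ;; SearchBody"

definition QueryStep :: com where
  "QueryStep = Expand ''Q'' ;; Cond (Less (R ''k'') (R ''n'')) Search (For ''row'' ''N'' Update)"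

definition Query :: com where
  "Query = Assign ''best'' (Const (- 1)) ;; Assign ''off'' (Const 0) ;; Assign ''ln'' (R ''qlen'') ;;
    For ''e'' ''E4'' (Assign ''E'' (R ''e'' \<ominus> R ''E4'') ;; QueryStep)"

lemma wr_code [simp]:
  "wr Key = {''y'', ''acc'', ''dc'', ''x''}" "wa Key = {}"
  "wr Scale = {''s'', ''wd''}" "wa Scale = {}"
  "wr Push = {''sg'', ''nl''}" "wa Push = {''LK''}"
  "wr Update = {''nv'', ''nt'', ''nacc'', ''nc'', ''x'', ''y'', ''best'', ''out''}" "wa Update = {}"
  by (auto simp: Key_def Scale_def Push_def Update_def)

lemma wr_Cell [simp]:
  "wr Cell = {''rem'', ''row'', ''cc'', ''x'', ''y'', ''dg'', ''acc'', ''dc'', ''nv'', ''nt'', ''nacc'', ''nc'', ''M''}"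
  "wa Cell = {''q'', ''DK'', ''DV''}"
  by (auto simp: Cell_def CellBody_def)

lemma wr_Insert [simp]:
  "wr Insert = {''tl'', ''s'', ''wd'', ''o'', ''rem'', ''row'', ''cc'', ''x'', ''y'', ''dg'', ''acc'', ''dc'', ''nv'', ''nt'', ''nacc'', ''nc'', ''M''}"
  "wa Insert = {''q'', ''DK'', ''DV''}"
  by (auto simp: Insert_def)

lemma wr_Check [simp]:
  "wr Verify = {''nv'', ''nt'', ''nacc'', ''nc'', ''x'', ''y'', ''best'', ''out'', ''fl''}" "wa Verify = {}"
  "wr Check = {''nv'', ''nt'', ''nacc'', ''nc'', ''x'', ''y'', ''best'', ''out'', ''fl'', ''row''}" "wa Check = {}"
  by (auto simp: Verify_def Check_def)

lemma wr_Lookup [simp]: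
  "wr Lookup = {''tl'', ''s'', ''wd'', ''y'', ''acc'', ''dc'', ''x'', ''ky'', ''lo'', ''hi'', ''mi'', ''bx'', ''fl'', ''row'',
     ''nv'', ''nt'', ''nacc'', ''nc'', ''best'', ''out'', ''lj'', ''hj''}"
  "wa Lookup = {}"
  by (auto simp: Lookup_def LookupBody_def Find_def)

lemma wr_Gap [simp]:
  "wr Gap = {''g'', ''gg'', ''ag'', ''bg'', ''w'', ''sg'', ''nl'', ''tl'', ''s'', ''wd'', ''o'', ''rem'', ''row'', ''cc'', ''x'', ''y'', ''dg'', ''acc'', ''dc'', ''nv'', ''nt'', ''nacc'', ''nc'', ''M''}"
  "wa Gap = {''LK'', ''q'', ''DK'', ''DV''}"
  by (auto simp: Gap_def GapBody_def)

lemma wr_QueryStep [simp]: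
  "wr QueryStep = {''tl'', ''s'', ''wd'', ''y'', ''acc'', ''dc'', ''x'', ''ky'', ''lo'', ''hi'', ''mi'', ''bx'', ''fl'', ''row'',
     ''nv'', ''nt'', ''nacc'', ''nc'', ''best'', ''out'', ''lj'', ''hj'', ''pq'', ''po'', ''rho'', ''nr'', ''ix'', ''et'', ''ec'', ''bt'', ''E''}"
  "wa QueryStep = {''q''}"
  by (auto simp: QueryStep_def Search_def SearchBody_def Locate_def First_def Second_def Refine_def)

section \<open>Parameters and expanded points\<close>

locale ann =
  fixes d m k :: nat and \<epsilon> :: real and Vs :: "curve list" and \<omega> :: tape
  assumes d: "1 \<le> d" and m: "2 \<le> m" and k: "1 \<le> k" and eps: "0 < \<epsilon>" "\<epsilon> \<le> 1 / 2" and Vs: "Vs \<noteq> []"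
    and curves: "\<And>V. V \<in> set Vs \<Longrightarrow> is_curve d V \<and> length V \<le> m"
begin

text \<open>
  \<open>De\<close> bounds the distortion of the projection. For a gap \<open>g\<close> the scales between \<open>g / al\<close> and
  \<open>g * be\<close> are needed; as consecutive scales have the ratio \<open>HH / (HH + 1)\<close>, the last \<open>Wn\<close>
  of the ladder suffice. \<open>Mx\<close> bounds the size of the dictionary, \<open>AA\<close> every address in use.
\<close>

definition "nV = length Vs"
definition "LL = 3 * m"
definition "DD = LL * d"
definition "E4 = (4::nat) ^ m"
definition "NN = nV * E4"
definition "HH = nat \<lfloor>8 / \<epsilon>\<rfloor> + 1"
definition "bb = 2 * (d * HH) + 3"
definition "BD = bb ^ DD"
definition "De = 2 ^ k * (2 * d * ((nV + 1) * E4) * ((nV + 1) * E4))"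
definition "al = 2 * DD * DD * De"
definition "be = DD * NN * HH * De * De"
definition "WW = (LEAST w. 2 * al * be < 2 ^ w)"
definition "Wn = HH * WW"
definition "Mx = NN * (Wn * (2 * BD))"
definition "AA = 2 * NN + 2 * Mx + NN * DD + NN * (Wn + 2) + nV * (m * d) + DD + 20"

definition "pt r = expand d (Vs ! (r div E4)) (int (r mod E4) - int E4)"
definition "prj x = (\<Sum>i<DD. fst (\<omega> i) * x i)"

definition env0 :: "state \<Rightarrow> bool" where
  "env0 s \<longleftrightarrow> reg s ''n'' = real nV \<and> reg s ''m'' = real m \<and> reg s ''d'' = real d \<and> reg s ''k'' = real k \<and> reg s ''eps'' = \<epsilon>"
definition envA :: "state \<Rightarrow> bool" where
  "envA s \<longleftrightarrow> env0 s \<and> reg s ''L'' = real LL \<and> reg s ''D'' = real DD"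
definition envB :: "state \<Rightarrow> bool" where
  "envB s \<longleftrightarrow> envA s \<and> reg s ''E4'' = real E4 \<and> reg s ''N'' = real NN \<and> reg s ''N1'' = real (NN - 1) \<and>
    reg s ''H'' = real HH \<and> reg s ''DH'' = real (d * HH) \<and> reg s ''b'' = real bb \<and> reg s ''BD'' = real BD"
definition envC :: "state \<Rightarrow> bool" where
  "envC s \<longleftrightarrow> envB s \<and> reg s ''B2'' = real (2 * BD) \<and> reg s ''al'' = real al \<and> reg s ''be'' = real be"
definition env :: "state \<Rightarrow> bool" where
  "env s \<longleftrightarrow> envC s \<and> reg s ''Wn'' = real Wn \<and> reg s ''Wn1'' = real (Wn + 1) \<and> reg s ''rr'' = real HH / (real HH + 1)"

text \<open>The registers that stay constant once the parameters are set; a program writing none of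
  them preserves \<open>env\<close>.\<close>

definition PN :: "string set" where
  "PN = {''n'', ''m'', ''d'', ''k'', ''eps'', ''L'', ''D'', ''E4'', ''N'', ''N1'', ''H'', ''DH'', ''b'', ''BD'', ''B2'', ''al'', ''be'', ''Wn'', ''Wn1'', ''rr''}"

definition us :: "state \<Rightarrow> bool" where
  "us s \<longleftrightarrow> (\<forall>i\<le>DD. arr s ''u'' i = fst (\<omega> i))"
definition inputs :: "state \<Rightarrow> bool" where
  "inputs s \<longleftrightarrow> arr s ''len'' = array_of (map (real \<circ> length) Vs) \<and> arr s ''V'' = array_of (concat (concat Vs))"
definition pts :: "state \<Rightarrow> bool" where
  "pts s \<longleftrightarrow> (\<forall>r<NN. \<forall>i<DD. arr s ''P'' (r * DD + i) = pt r i)"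

lemmas env_defs = env_def envC_def envB_def envA_def env0_def

lemma envD:
  assumes "env s"
  shows "reg s ''n'' = real nV" "reg s ''m'' = real m" "reg s ''d'' = real d" "reg s ''k'' = real k" "reg s ''eps'' = \<epsilon>"
    "reg s ''L'' = real LL" "reg s ''D'' = real DD" "reg s ''E4'' = real E4" "reg s ''N'' = real NN" "reg s ''N1'' = real (NN - 1)"
    "reg s ''H'' = real HH" "reg s ''DH'' = real (d * HH)" "reg s ''b'' = real bb" "reg s ''BD'' = real BD"
    "reg s ''B2'' = real (2 * BD)" "reg s ''al'' = real al" "reg s ''be'' = real be"
    "reg s ''Wn'' = real Wn" "reg s ''Wn1'' = real (Wn + 1)" "reg s ''rr'' = real HH / (real HH + 1)"
  using assms unfolding env_defs by blast+

lemma env_same: assumes "env s" "same X Y s s'" "X \<inter> PN = {}" shows "env s'"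
proof -
  have *: "reg s' x = reg s x" if "x \<in> PN" for x using assms that by (intro same_reg[OF assms(2)]) auto
  show ?thesis unfolding env_defs using assms(1) unfolding env_defs by (simp add: * PN_def)
qed

lemma us_same: "us s \<Longrightarrow> same X Y s s' \<Longrightarrow> ''u'' \<notin> Y \<Longrightarrow> us s'"
  and inputs_same: "inputs s \<Longrightarrow> same X Y s s' \<Longrightarrow> ''len'' \<notin> Y \<Longrightarrow> ''V'' \<notin> Y \<Longrightarrow> inputs s'"
  and pts_same: "pts s \<Longrightarrow> same X Y s s' \<Longrightarrow> ''P'' \<notin> Y \<Longrightarrow> pts s'"
  by (simp_all add: us_def inputs_def pts_def same_arr)

lemma E4_ge: "16 \<le> E4"
  using power_increasing[of 2 m "4::nat"] m by (simp add: E4_def)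

lemma nV_pos: "1 \<le> nV"
  using Vs by (simp add: nV_def Suc_le_eq)

lemma NN_ge: "16 \<le> NN"
  using E4_ge nV_pos unfolding NN_def by (metis mult.commute mult_le_mono nat_mult_1_right)

lemma LL_pos: "0 < LL" and DD_pos: "0 < DD" and HH_pos: "0 < HH"
  using m d by (auto simp: LL_def DD_def HH_def)

lemma HH_ge: "8 / \<epsilon> \<le> real HH"
proof -
  have "0 \<le> \<lfloor>8 / \<epsilon>\<rfloor>" using eps by simp
  then show ?thesis unfolding HH_def by linarith
qed

lemma De_pos: "0 < De"
  using d nV_pos E4_ge by (simp add: De_def)

lemma wp_ParA:
  assumes "env0 s" "drawn s = 0"
  shows "wp \<omega> AA ParA (\<lambda>t s'. t \<le> 4 * DD + 9 \<and> same {''L'', ''D'', ''D1'', ''i'', ''x''} {''u''} s s' \<and> envA s' \<and> us s') s"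
proof -
  let ?c = "Uniform ''x'' ;; Store ''u'' (R ''i'') (R ''x'')"
  define s1 where "s1 = set_reg ''D1'' (real (DD + 1)) (set_reg ''D'' (real DD) (set_reg ''L'' (real LL) s))"
  have "wp \<omega> AA (For ''i'' ''D1'' ?c) (\<lambda>t s'. t \<le> (DD + 1) * 4 + 2 \<and> env0 s' \<and> reg s' ''L'' = real LL \<and> reg s' ''D'' = real DD \<and> us s') s1"
  proof (rule wp_For[where n="DD + 1" and T=2 and I="\<lambda>j s'. drawn s' = j \<and> (\<forall>i<j. arr s' ''u'' i = fst (\<omega> i))"], goal_cases)
    case (6 j s')
    then show ?case by (auto simp: addr_def less_Suc_eq AA_def)
  next
    case (7 t s')
    have "reg s' x = reg s1 x" if "x \<notin> {''i'', ''x''}" for x using same_reg[OF 7(3)] that by simp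
    then show ?case using 7 assms by (simp add: env0_def us_def less_Suc_eq_le s1_def)
  qed (use assms in \<open>auto simp: s1_def\<close>)
  note main = this
  have "wp \<omega> AA ParA (\<lambda>t s'. t \<le> 4 * DD + 9 \<and> envA s' \<and> us s') s"
    unfolding ParA_def using assms
    by (simp add: wpx env0_def cong: wp_weak, intro wp_mono_eq[OF main]) (auto simp: envA_def s1_def LL_def DD_def add.commute)
  then show ?thesis by (rule wp_same) simp
qed

lemma wp_ParB:
  assumes "envA s"
  shows "wp \<omega> AA ParB (\<lambda>t s'. t \<le> 3 * m + 3 * DD + 11 \<and>
    same {''E4'', ''i'', ''N'', ''N1'', ''H'', ''DH'', ''b'', ''BD''} {} s s' \<and> envB s') s"
proof -
  have r: "reg s ''n'' = real nV" "reg s ''m'' = real m" "reg s ''d'' = real d" "reg s ''k'' = real k" "reg s ''eps'' = \<epsilon>"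
    "reg s ''L'' = real LL" "reg s ''D'' = real DD" using assms unfolding env_defs by auto
  have H: "real_of_int \<lfloor>8 / \<epsilon>\<rfloor> + 1 = real HH" using eps by (simp add: HH_def)
  have N: "real nV * real E4 - 1 = real (NN - 1)" 
  proof -
    have "real nV * real E4 = real NN" by (simp add: NN_def)
    then show ?thesis using NN_ge by (simp add: of_nat_diff)
  qed
  have "wp \<omega> AA ParB (\<lambda>t s'. t \<le> 3 * m + 3 * DD + 11 \<and> envB s') s"
    unfolding ParB_def
  proof (rule wp_SeqI[OF wp_Power_Loop[of s "''m''" m "''E4''" _ 4]], goal_cases)
    case (5 t s1)
    then have sm: "same {''E4'', ''i''} {} s s1" and E4: "reg s1 ''E4'' = real E4" by (auto simp: E4_def)
    note r1 = same_reg[OF sm]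
    define s2 where "s2 = set_reg ''b'' (real bb) (set_reg ''DH'' (real (d * HH)) (set_reg ''H'' (real HH)
      (set_reg ''N1'' (real (NN - 1)) (set_reg ''N'' (real NN) s1))))"
    have main: "wp \<omega> AA (Power_Loop ''BD'' (R ''b'') ''D'') (\<lambda>t'. \<lambda>s'. t + (5 + t') \<le> 3 * m + 3 * DD + 11 \<and> envB s') s2"
    proof (rule wp_mono[OF wp_Power_Loop[of s2 "''D''" DD "''BD''" _ bb]], goal_cases)
      case (4 s')
      then show ?case using same_reg[OF 4, of "''b''"] by (simp add: s2_def)
    next
      case (5 t' s')
      then have "reg s' x = reg s2 x" if "x \<notin> {''BD'', ''i''}" for x using same_reg that by blast
      then show ?case using 5 \<open>t \<le> _ \<and> _\<close> by (simp add: env_defs s2_def r r1 E4 BD_def)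
    qed (use r r1 in \<open>auto simp: s2_def\<close>)
    show ?case using H N
      by (simp add: wpx r r1 E4 cong: wp_weak, intro wp_mono_eq[OF main]) (auto simp: s2_def NN_def bb_def)
  qed (use r in auto)
  then show ?thesis by (rule wp_same) simp
qed

lemma wp_ParC:
  assumes "envB s"
  shows "wp \<omega> AA ParC (\<lambda>t s'. t \<le> 3 * k + 10 \<and>
    same {''B2'', ''De'', ''i'', ''al'', ''be''} {} s s' \<and> envC s') s"
proof -
  have r: "reg s ''n'' = real nV" "reg s ''m'' = real m" "reg s ''d'' = real d" "reg s ''k'' = real k" "reg s ''eps'' = \<epsilon>"
    "reg s ''L'' = real LL" "reg s ''D'' = real DD" "reg s ''E4'' = real E4" "reg s ''N'' = real NN" "reg s ''N1'' = real (NN - 1)"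
    "reg s ''H'' = real HH" "reg s ''DH'' = real (d * HH)" "reg s ''b'' = real bb" "reg s ''BD'' = real BD"
    using assms unfolding env_defs by auto
  define s1 where "s1 = set_reg ''B2'' (real (2 * BD)) s"
  have "wp \<omega> AA (Power_Loop ''De'' (Const 2) ''k'' ;;
    Assign ''De'' (R ''De'' \<otimes> (Const 2 \<otimes> R ''d'' \<otimes> ((R ''n'' \<oplus> Const 1) \<otimes> R ''E4'') \<otimes> ((R ''n'' \<oplus> Const 1) \<otimes> R ''E4''))) ;;
    Assign ''al'' (Const 2 \<otimes> R ''D'' \<otimes> R ''D'' \<otimes> R ''De'') ;;
    Assign ''be'' (R ''D'' \<otimes> R ''N'' \<otimes> R ''H'' \<otimes> R ''De'' \<otimes> R ''De'')) (\<lambda>t s'. Suc t \<le> 3 * k + 10 \<and> envC s') s1"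
  proof (rule wp_SeqI[OF wp_Power_Loop[of s1 "''k''" k "''De''" _ 2]], goal_cases)
    case (5 t s')
    then have "reg s' x = reg s1 x" if "x \<notin> {''De'', ''i''}" for x using same_reg that by blast
    then show ?case using 5 r by (simp add: wpx env_defs s1_def De_def al_def be_def cong: wp_weak) (simp add: algebra_simps)?
  qed (use r in \<open>auto simp: s1_def\<close>)
  then have "wp \<omega> AA ParC (\<lambda>t s'. t \<le> 3 * k + 10 \<and> envC s') s"
    unfolding ParC_def using r by (simp add: wpx s1_def cong: wp_weak)
  then show ?thesis by (rule wp_same) simp
qed

lemma WW: "2 * al * be < 2 ^ WW" "\<And>j. j < WW \<Longrightarrow> 2 ^ j \<le> 2 * al * be"
proof -
  have "2 * al * be < 2 ^ (2 * al * be)" by simp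
  then show "2 * al * be < 2 ^ WW" unfolding WW_def by (rule LeastI)
  show "\<And>j. j < WW \<Longrightarrow> 2 ^ j \<le> 2 * al * be" unfolding WW_def using not_less_Least by fastforce
qed

lemma wp_ParD:
  assumes "envC s"
  shows "wp \<omega> AA ParD (\<lambda>t s'. t \<le> 3 * WW + 6 \<and>
    same {''W'', ''x'', ''Wn'', ''Wn1'', ''rr''} {} s s' \<and> env s') s"
proof -
  have r: "reg s ''n'' = real nV" "reg s ''m'' = real m" "reg s ''d'' = real d" "reg s ''k'' = real k" "reg s ''eps'' = \<epsilon>"
    "reg s ''L'' = real LL" "reg s ''D'' = real DD" "reg s ''E4'' = real E4" "reg s ''N'' = real NN" "reg s ''N1'' = real (NN - 1)"
    "reg s ''H'' = real HH" "reg s ''DH'' = real (d * HH)" "reg s ''b'' = real bb" "reg s ''BD'' = real BD"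
    "reg s ''B2'' = real (2 * BD)" "reg s ''al'' = real al" "reg s ''be'' = real be"
    using assms unfolding env_defs by auto
  define s1 where "s1 = set_reg ''x'' 1 (set_reg ''W'' 0 s)"
  let ?b = "Neg (Less (Const 2 \<otimes> R ''al'' \<otimes> R ''be'') (R ''x''))"
  let ?c = "Assign ''x'' (R ''x'' \<otimes> Const 2) ;; Assign ''W'' (R ''W'' \<oplus> Const 1)"
  define J where "J i s' \<longleftrightarrow> i \<le> WW \<and> reg s' ''x'' = real (2 ^ i) \<and> reg s' ''W'' = real i \<and> same {''W'', ''x''} {} s s'" for i s'
  have bv: "bval ?b (reg s') \<longleftrightarrow> 2 ^ i \<le> 2 * al * be" if "J i s'" for i s'
  proof -
    have "reg s' ''al'' = real al" "reg s' ''be'' = real be" using that r by (auto simp: J_def same_reg)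
    then have "bval ?b (reg s') \<longleftrightarrow> \<not> real (2 * al * be) < real (2 ^ i)" using that by (simp add: J_def)
    then show ?thesis by (simp only: of_nat_less_iff not_less)
  qed
  have "wp \<omega> AA (While ?b ?c) (\<lambda>t s'. t \<le> WW * (2 + 1) + 1 \<and> (\<exists>i\<le>WW. J i s') \<and> \<not> bval ?b (reg s')) s1"
  proof (rule wp_While)
    show "J 0 s1" by (simp add: J_def s1_def same_def)
    fix i s' assume J: "J i s'" and b: "bval ?b (reg s')"
    then have "2 ^ i \<le> 2 * al * be" using bv by simp
    then have "i \<noteq> WW" using WW(1) by auto
    then have "i < WW" using J by (simp add: J_def)
    then show "i < WW \<and> wp \<omega> AA ?c (\<lambda>t s'. t \<le> 2 \<and> J (Suc i) s') s'"
      using J by (simp add: wpx J_def same_def cong: wp_weak)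
  qed
  then have "wp \<omega> AA (While ?b ?c) (\<lambda>t s'. t \<le> 3 * WW + 1 \<and> reg s' ''W'' = real WW \<and> same {''W'', ''x''} {} s s') s1"
  proof (rule wp_mono, elim conjE exE)
    fix t s' i assume *: "t \<le> WW * (2 + 1) + 1" "i \<le> WW" "J i s'" "\<not> bval ?b (reg s')"
    then have "i = WW" using bv WW(2)[of i] by (metis le_neq_implies_less)
    then show "t \<le> 3 * WW + 1 \<and> reg s' ''W'' = real WW \<and> same {''W'', ''x''} {} s s'" using * by (simp add: J_def)
  qed
  then have "wp \<omega> AA (While ?b ?c ;; Assign ''Wn'' (R ''H'' \<otimes> R ''W'') ;; Assign ''Wn1'' (R ''Wn'' \<oplus> Const 1) ;;
    Assign ''rr'' (R ''H'' \<oslash> (R ''H'' \<oplus> Const 1))) (\<lambda>t s'. 1 + (1 + t) \<le> 3 * WW + 6 \<and> env s') s1"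
  proof (rule wp_SeqI, goal_cases)
    case (1 t s')
    then have "reg s' x = reg s x" if "x \<notin> {''W'', ''x''}" for x using same_reg that by blast
    then show ?case using 1 r by (simp add: wpx env_defs Wn_def cong: wp_weak)
  qed
  then have "wp \<omega> AA ParD (\<lambda>t s'. t \<le> 3 * WW + 6 \<and> env s') s"
    unfolding ParD_def s1_def by (simp only: wpx aval.simps of_int_0 of_int_1)
  then show ?thesis by (rule wp_same) simp
qed

end

section \<open>Expanding and projecting the input curves\<close>

lemma concat_nth_const:
  assumes "\<And>x. x \<in> set xs \<Longrightarrow> length x = d" "j < length xs" "c < d"
  shows "concat xs ! (j * d + c) = xs ! j ! c \<and> j * d + c < length (concat xs)"
  using assms
proof (induction xs arbitrary: j)
  case (Cons x xs)
  show ?case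
  proof (cases j)
    case 0
    then show ?thesis using Cons.prems by (simp add: nth_append)
  next
    case (Suc j')
    then have "concat xs ! (j' * d + c) = xs ! j' ! c \<and> j' * d + c < length (concat xs)"
      using Cons.prems by (intro Cons.IH) auto
    then show ?thesis using Suc Cons.prems(1)[of x] by (simp add: nth_append)
  qed
qed simp

lemma concat_nth_take:
  assumes "v < length Vs" "j < length (Vs ! v)"
  shows "concat Vs ! (length (concat (take v Vs)) + j) = Vs ! v ! j \<and> length (concat (take v Vs)) + j < length (concat Vs)"
  using assms
proof (induction Vs arbitrary: v)
  case (Cons V Vs)
  then show ?case by (cases v) (auto simp: nth_append)
qed simp

context ann
begin

lemma length_concat_Vs: "length (concat (take v Vs)) \<le> v * m"
proof (induction v)
  case (Suc v)
  show ?case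
  proof (cases "v < length Vs")
    case True
    then have "length (Vs ! v) \<le> m" using curves by simp
    then show ?thesis using Suc True by (simp add: take_Suc_conv_app_nth)
  next
    case False
    then show ?thesis using Suc by simp
  qed
qed simp

lemma array_V:
  assumes "inputs s" "v < nV" "j < length (Vs ! v)" "c < d"
  shows "arr s ''V'' ((length (concat (take v Vs)) + j) * d + c) = Vs ! v ! j ! c"
proof -
  have v: "v < length Vs" using assms by (simp add: nV_def)
  have "length x = d" if "x \<in> set (concat Vs)" for x using that curves by (auto simp: is_curve_def)
  note 1 = concat_nth_const[OF this _ assms(4)] and 2 = concat_nth_take[OF v assms(3)]
  show ?thesis using 1[OF _ conjunct2[OF 2]] 2 assms(1) by (simp add: inputs_def array_of_def)
qed

lemma pt_eq: "v < nV \<Longrightarrow> e < E4 \<Longrightarrow> pt (v * E4 + e) = expand d (Vs ! v) (int e - int E4)"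
  by (simp add: pt_def)

lemma index_split: "i < DD \<Longrightarrow> i div d < LL \<and> i mod d < d \<and> i div d * d + i mod d = i"
  using d by (simp add: DD_def less_mult_imp_div_less)

definition rows :: "nat \<Rightarrow> state \<Rightarrow> bool" where
  "rows r s \<longleftrightarrow> (\<forall>j<r. (\<forall>i<DD. arr s ''P'' (j * DD + i) = pt j i) \<and> arr s ''X'' j = prj (pt j))"

lemma wp_Points:
  assumes s: "env s" "us s" "inputs s"
  shows "wp \<omega> AA Points (\<lambda>t s'. t \<le> NN * (40 * DD) \<and> env s' \<and> us s' \<and> rows NN s') s"
proof -
  let ?cp = "For ''i'' ''D'' (Load ''x'' ''q'' (R ''i'') ;; Store ''P'' (R ''row'' \<otimes> R ''D'' \<oplus> R ''i'') (R ''x''))"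
  let ?c = "Assign ''E'' (R ''e'' \<ominus> R ''E4'') ;; Expand ''V'' ;;
        Assign ''acc'' (Const 0) ;; Dot (R ''x'') ;; Store ''X'' (R ''row'') (R ''acc'') ;; ?cp ;;
        Assign ''row'' (R ''row'' \<oplus> Const 1)"
  let ?v = "Load ''ln'' ''len'' (R ''v'') ;; For ''e'' ''E4'' ?c ;; Assign ''off'' (R ''off'' \<oplus> R ''ln'')"
  have DD: "6 \<le> DD" using m d mult_le_mono[of 6 LL 1 d] by (simp add: DD_def LL_def)
  have NDA: "NN * DD + NN \<le> AA" "DD < AA" "nV * (m * d) + nV \<le> AA"
  proof -
    have "nV \<le> NN" using E4_ge by (simp add: NN_def)
    then show "NN * DD + NN \<le> AA" "DD < AA" "nV * (m * d) + nV \<le> AA" unfolding AA_def by linarith+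
  qed
  define base where "base s' \<longleftrightarrow> env s' \<and> us s' \<and> inputs s'" for s'
  have base_same: "base s'" if "base s''" "same X Y s'' s'" "X \<inter> PN = {}" "''u'' \<notin> Y" "''len'' \<notin> Y" "''V'' \<notin> Y" for X Y s' s''
    using that unfolding base_def by (blast intro: env_same us_same inputs_same)
  have body: "wp \<omega> AA ?c (\<lambda>t s'. t \<le> 22 * DD + 12 \<and> rows (v * E4 + j + 1) s' \<and> reg s' ''row'' = real (v * E4 + j + 1)) s"
    if v: "v < nV" "j < E4" and s: "base s" "reg s ''e'' = real j" "reg s ''off'' = real (length (concat (take v Vs)))"
      "reg s ''ln'' = real (length (Vs ! v))" "reg s ''row'' = real (v * E4 + j)" "rows (v * E4 + j) s" for v j s
  proof -
    define r where "r = v * E4 + j"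
    have r: "r < NN" using less_mult_add[OF v] by (simp add: r_def NN_def)
    have len: "0 < length (Vs ! v)" "length (Vs ! v) \<le> m"
      using curves[of "Vs ! v"] v by (auto simp: nV_def is_curve_def)
    have off: "(length (concat (take v Vs)) + length (Vs ! v)) * d \<le> AA"
    proof -
      have "length (concat (take v Vs)) + length (Vs ! v) \<le> Suc v * m" using length_concat_Vs[of v] len by simp
      also have "\<dots> \<le> nV * m" using v by (intro mult_le_mono1) simp
      finally have "(length (concat (take v Vs)) + length (Vs ! v)) * d \<le> nV * m * d" by (rule mult_le_mono1)
      also have "nV * m * d \<le> AA" using NDA(3) by (simp only: mult.assoc)
      finally show ?thesis .
    qed
    define s1 where "s1 = set_reg ''E'' (real_of_int (int j - int E4)) s"
    have e: "env s" "us s" "inputs s" using s(1) by (auto simp: base_def)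
    have "wp \<omega> AA (Expand ''V'' ;; Assign ''acc'' (Const 0) ;; Dot (R ''x'') ;; Store ''X'' (R ''row'') (R ''acc'') ;; ?cp ;;
        Assign ''row'' (R ''row'' \<oplus> Const 1)) (\<lambda>t s'. 1 + t \<le> 22 * DD + 12 \<and> rows (r + 1) s' \<and> reg s' ''row'' = real (r + 1)) s1"
    proof (rule wp_SeqI[OF wp_Expand[of s1 LL d "length (concat (take v Vs))" "length (Vs ! v)" "int j - int E4"]], goal_cases)
      case (10 t1 s2)
      have sm2: "same {''ix'', ''et'', ''ec'', ''x'', ''bt'', ''E''} {''q''} s1 s2" using 10 by simp
      then have sm2': "same {''ix'', ''et'', ''ec'', ''x'', ''bt'', ''E''} {''q''} s s2" by (auto simp: same_def s1_def)
      have q2: "arr s2 ''q'' i = pt r i" if "i < DD" for i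
      proof -
        have w: "walk (length (Vs ! v)) (int j - int E4) (i div d) < length (Vs ! v)" using len(1) by (rule walk_less)
        have "arr s2 ''q'' (i div d * d + i mod d) = arr s ''V'' ((length (concat (take v Vs)) + walk (length (Vs ! v)) (int j - int E4) (i div d)) * d + i mod d)"
        proof -
          have "\<forall>t<LL. \<forall>c<d. arr s2 ''q'' (t * d + c) = arr s ''V'' ((length (concat (take v Vs)) + walk (length (Vs ! v)) (int j - int E4) t) * d + c)"
            using 10 by (simp add: s1_def)
          then show ?thesis using index_split[OF that] by blast
        qed
        also have "\<dots> = pt r i" using array_V[OF e(3) v(1) w] index_split[OF that] v by (simp add: r_def pt_eq expand_def)
        finally show ?thesis using index_split[OF that] by simp
      qed
      define s3 where "s3 = set_reg ''acc'' 0 s2"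
      have b3: "base s3" by (rule base_same[OF s(1), of "insert ''acc'' {''ix'', ''et'', ''ec'', ''x'', ''bt'', ''E''}" "{''q''}"])
          (use sm2' in \<open>auto simp: same_def s3_def PN_def\<close>)
      have "wp \<omega> AA (Dot (R ''x'') ;; Store ''X'' (R ''row'') (R ''acc'') ;; ?cp ;; Assign ''row'' (R ''row'' \<oplus> Const 1))
        (\<lambda>t s'. 1 + (t1 + (1 + t)) \<le> 22 * DD + 12 \<and> rows (r + 1) s' \<and> reg s' ''row'' = real (r + 1)) s3"
      proof (rule wp_SeqI[OF wp_Dot[of s3 DD _ _ "\<lambda>x. x"]], goal_cases)
        case (4 t2 s4)
        have sm4: "same {''dc'', ''x'', ''y'', ''acc''} {} s3 s4" using 4 by simp
        have sm: "same {''dc'', ''x'', ''y'', ''acc'', ''ix'', ''et'', ''ec'', ''bt'', ''E''} {''q''} s s4"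
          using sm2' sm4 by (auto simp: same_def s3_def)
        have b4: "base s4" by (rule base_same[OF b3 sm4]) (auto simp: PN_def)
        have row4: "reg s4 ''row'' = real r" using same_reg[OF sm] s by (simp add: r_def)
        have acc: "reg s4 ''acc'' = prj (pt r)"
        proof -
          have "(\<Sum>i<DD. arr s3 ''u'' i * arr s3 ''q'' i) = prj (pt r)"
            using b3 unfolding prj_def by (intro sum.cong) (auto simp: q2 s3_def base_def us_def)
          then show ?thesis using 4 by (simp add: s3_def)
        qed
        define s5 where "s5 = set_arr ''X'' r (prj (pt r)) s4"
        have D5: "reg s5 ''D'' = real DD" using b4 by (simp add: s5_def base_def envD)
        have "wp \<omega> AA ?cp (\<lambda>t' s'. t' \<le> DD * 4 + 2 \<and> rows (r + 1) s' \<and> reg s' ''row'' = real r) s5"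
        proof (rule wp_For[where n=DD and T=2 and I="\<lambda>i s'. rows r s' \<and> arr s' ''X'' r = prj (pt r) \<and> (\<forall>l<i. arr s' ''P'' (r * DD + l) = pt r l)"], goal_cases)
          case 5
          have "rows r s" using s(6) by (simp add: r_def)
          then show ?case using same_arr[OF sm, of "''P''"] same_arr[OF sm, of "''X''"]
            by (auto simp: rows_def s5_def)
        next
          case (6 i s')
          have a: "reg s' ''row'' = real r" "reg s' ''D'' = real DD" "arr s' ''q'' = arr s2 ''q''"
            using same_reg[OF 6(4)] same_arr[OF 6(4)] row4 D5 same_arr[OF sm4] by (auto simp: s5_def s3_def arr_set_arr_fun)
          have ad: "addr (R ''row'' \<otimes> R ''D'' \<oplus> R ''i'') (set_reg ''x'' x s') = r * DD + i" for x
            by (rule addrI) (use a 6(3) in simp)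
          have ad2: "addr (R ''i'') s' = i" by (rule addrI) (use 6(3) in simp)
          have lt: "r * DD + i < AA" "i < AA" using less_mult_add[OF r 6(1)] NDA 6(1) by simp_all
          have ne: "j' * DD + i' \<noteq> r * DD + i" if "j' < r" "i' < DD" for j' i'
            using less_mult_add[OF that] by simp
          show ?case using 6(1,2) lt ne q2[OF 6(1)] by (auto simp: wpx ad ad2 a rows_def less_Suc_eq)
        next
          case (7 t s')
          then show ?case using same_reg[OF 7(3), of "''row''"] row4 by (auto simp: rows_def less_Suc_eq s5_def)
        qed (use D5 in auto)
        then have main: "wp \<omega> AA (?cp ;; Assign ''row'' (R ''row'' \<oplus> Const 1))
            (\<lambda>t s'. t \<le> DD * 4 + 3 \<and> rows (r + 1) s' \<and> reg s' ''row'' = real (r + 1)) s5"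
          by (rule wp_SeqI) (auto simp: wpx rows_def)
        have "addr (R ''row'') s4 = r" using row4 by (intro addrI) simp
        moreover have "r < AA" using r NDA(1) by simp
        moreover have "t1 + t2 \<le> 18 * DD + 5"
        proof -
          have "LL * (3 * (d + 3) + d) \<le> 13 * DD" using d by (simp add: DD_def algebra_simps)
          then show ?thesis using 4 10 by simp
        qed
        ultimately show ?case
          by (simp add: wpx acc cong: wp_weak, intro wp_mono_eq[OF main[unfolded wp_Seq]]) (auto simp: s5_def)
      qed (use b3 NDA in \<open>auto simp: base_def envD\<close>)
      note main = this
      show ?case by (simp add: wpx cong: wp_weak, intro wp_mono_eq[OF main[unfolded wp_Seq]]) (auto simp: s3_def)
    qed (use s e len off NDA in \<open>auto simp: s1_def envD DD_def[symmetric]\<close>)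
    note main = this
    show ?thesis using s e
      by (simp add: wpx envD cong: wp_weak, intro wp_mono_eq[OF main[unfolded wp_Seq]]) (auto simp: s1_def r_def)
  qed
  have vbody: "wp \<omega> AA ?v (\<lambda>t s'. t \<le> E4 * (22 * DD + 14) + 4 \<and> rows (Suc v * E4) s' \<and> reg s' ''row'' = real (Suc v * E4) \<and>
      reg s' ''off'' = real (length (concat (take (Suc v) Vs)))) s"
    if v: "v < nV" and s: "base s" "reg s ''v'' = real v" "reg s ''off'' = real (length (concat (take v Vs)))"
      "reg s ''row'' = real (v * E4)" "rows (v * E4) s" for v s
  proof -
    have lv: "arr s ''len'' v = real (length (Vs ! v))" using s(1) v by (simp add: base_def inputs_def array_of_def nV_def)
    define s1 where "s1 = set_reg ''ln'' (real (length (Vs ! v))) s"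
    have sm1: "same {''ln''} {} s s1" by (simp add: same_def s1_def)
    have b1: "base s1" by (rule base_same[OF s(1) sm1]) (auto simp: PN_def)
    have r1: "reg s1 ''ln'' = real (length (Vs ! v))" "reg s1 ''off'' = real (length (concat (take v Vs)))" "reg s1 ''row'' = real (v * E4)"
      "rows (v * E4) s1" using s by (auto simp: s1_def rows_def)
    have "wp \<omega> AA (For ''e'' ''E4'' ?c) (\<lambda>t s'. t \<le> E4 * (22 * DD + 14) + 2 \<and> rows (v * E4 + E4) s' \<and> reg s' ''row'' = real (v * E4 + E4) \<and>
      reg s' ''off'' = reg s1 ''off'' \<and> reg s' ''ln'' = reg s1 ''ln'') s1"
    proof (rule wp_For[where n=E4 and T="22 * DD + 12" and I="\<lambda>j s'. rows (v * E4 + j) s' \<and> reg s' ''row'' = real (v * E4 + j)"], goal_cases)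
      case (6 j s')
      have b: "base s'" by (rule base_same[OF b1 6(4)]) (auto simp: PN_def)
      show ?case
        by (rule wp_mono[OF body[OF v 6(1) b 6(3)]]) (use 6(2) same_reg[OF 6(4)] r1 in \<open>auto simp: rows_def\<close>)
    next
      case (7 t s')
      then show ?case using same_reg[OF 7(3)] by (auto simp: algebra_simps)
    qed (use b1 r1 in \<open>auto simp: base_def envD rows_def\<close>)
    note main = this
    have "wp \<omega> AA (For ''e'' ''E4'' ?c ;; Assign ''off'' (R ''off'' \<oplus> R ''ln'')) (\<lambda>t s'. t \<le> E4 * (22 * DD + 14) + 3 \<and> rows (Suc v * E4) s' \<and> reg s' ''row'' = real (Suc v * E4) \<and>
      reg s' ''off'' = real (length (concat (take (Suc v) Vs)))) s1"
      by (rule wp_SeqI[OF main]) (use v r1 in \<open>auto simp: wpx rows_def add.commute take_Suc_conv_app_nth nV_def\<close>)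
    note main2 = this
    have "addr (R ''v'') s = v" using s by (intro addrI) simp
    moreover have "v < AA" using v NDA(3) by simp
    ultimately show ?thesis
      by (simp add: wpx lv cong: wp_weak, intro wp_mono_eq[OF main2[unfolded wp_Seq]]) (auto simp: s1_def)
  qed
  define s0 where "s0 = set_reg ''row'' 0 (set_reg ''off'' 0 s)"
  have b0: "base s0" by (rule base_same[of s "{''row'', ''off''}" "{}"]) (use s in \<open>auto simp: base_def same_def s0_def PN_def\<close>)
  have n0: "reg s0 ''n'' = real nV" using b0 by (simp add: base_def envD)
  have "wp \<omega> AA (For ''v'' ''n'' ?v) (\<lambda>t s'. t \<le> nV * (E4 * (22 * DD + 14) + 6) + 2 \<and> base s' \<and> rows NN s') s0"
  proof (rule wp_For[where n=nV and T="E4 * (22 * DD + 14) + 4" and I="\<lambda>v s'. rows (v * E4) s' \<and> reg s' ''row'' = real (v * E4) \<and>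
      reg s' ''off'' = real (length (concat (take v Vs)))"], goal_cases)
    case (6 v s')
    have b: "base s'" by (rule base_same[OF b0 6(4)]) (auto simp: PN_def)
    show ?case by (rule wp_mono[OF vbody[OF 6(1) b 6(3)]]) (use 6(2) in \<open>auto simp: rows_def\<close>)
  next
    case (7 t s')
    have "base s'" by (rule base_same[OF b0 7(3)]) (auto simp: PN_def)
    then show ?case using 7 by (simp add: NN_def algebra_simps)
  qed (use n0 in \<open>auto simp: rows_def s0_def\<close>)
  note main = this
  have T: "nV * (E4 * (22 * DD + 14) + 6) + 4 \<le> NN * (40 * DD)"
  proof -
    have 1: "nV \<le> NN" using E4_ge by (simp add: NN_def)
    have "nV * (E4 * (22 * DD + 14) + 6) + 4 = NN * (22 * DD + 14) + 6 * nV + 4" by (simp add: NN_def algebra_simps)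
    also have "\<dots> \<le> NN * (22 * DD + 14) + 6 * NN + NN" using 1 NN_ge by linarith
    also have "\<dots> = NN * (22 * DD + 21)" by (simp add: algebra_simps)
    also have "\<dots> \<le> NN * (40 * DD)" using DD by (intro mult_le_mono2) linarith
    finally show ?thesis .
  qed
  show ?thesis
    unfolding Points_def by (simp add: wpx cong: wp_weak, intro wp_mono_eq[OF main]) (use T in \<open>auto simp: s0_def base_def\<close>)
qed


section \<open>Keys and grid cells at one scale\<close>

definition "key t z = fst (\<omega> DD) * real t + (\<Sum>i<DD. fst (\<omega> i) * real_of_int (z i))"
definition "corner \<sigma> z i = \<sigma> / real (d * HH) * real_of_int (z i)"
definition "near \<sigma> r z \<longleftrightarrow> nrm d LL (\<lambda>i. corner \<sigma> z i - pt r i) \<le> \<sigma> * (1 + 1 / real HH)"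
definition "cel \<sigma> r a i = \<lfloor>pt r i / (\<sigma> / real (d * HH))\<rfloor> + int (a div bb ^ i mod bb) - int (d * HH + 1)"
definition entry :: "state \<Rightarrow> nat \<Rightarrow> nat \<Rightarrow> (nat \<Rightarrow> int) \<Rightarrow> nat \<Rightarrow> bool" where
  "entry s e t z r \<longleftrightarrow> arr s ''DK'' e = key t z \<and> arr s ''DV'' e = real r"
text \<open>Entries below \<open>M\<close> are never overwritten, so what is known about them
  persists while the dictionary is filled.\<close>

definition grow :: "nat \<Rightarrow> state \<Rightarrow> state \<Rightarrow> bool" where
  "grow M s s' \<longleftrightarrow> (\<forall>e<M. arr s' ''DK'' e = arr s ''DK'' e \<and> arr s' ''DV'' e = arr s ''DV'' e)"
definition scal :: "nat \<Rightarrow> real \<Rightarrow> state \<Rightarrow> bool" where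
  "scal t \<sigma> s \<longleftrightarrow> reg s ''tl'' = real t \<and> reg s ''s'' = \<sigma> \<and> reg s ''wd'' = \<sigma> / real (d * HH)"
definition base :: "state \<Rightarrow> bool" where
  "base s \<longleftrightarrow> env s \<and> us s \<and> pts s"

lemma base_same: "base s \<Longrightarrow> same X Y s s' \<Longrightarrow> X \<inter> PN = {} \<Longrightarrow> ''u'' \<notin> Y \<Longrightarrow> ''P'' \<notin> Y \<Longrightarrow> base s'"
  unfolding base_def by (blast intro: env_same us_same pts_same)

lemma baseD: "base s \<Longrightarrow> env s" "base s \<Longrightarrow> us s" "base s \<Longrightarrow> pts s"
  by (auto simp: base_def)

lemma AA_bounds: "NN * DD \<le> AA" "DD + 1 < AA" "NN < AA" "Mx < AA" "2 * NN + 1 < AA" "2 * Mx + 1 < AA" "NN * (Wn + 2) < AA"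
  by (simp_all add: AA_def)

lemma wp_Key:
  assumes "base s" "reg s ''tl'' = real t" "reg s ''wd'' = w"
  shows "wp \<omega> AA Key (\<lambda>t' s'. t' \<le> 5 * DD + 4 \<and> same {''y'', ''acc'', ''dc'', ''x''} {} s s' \<and>
    reg s' ''acc'' = key t (\<lambda>i. \<lfloor>arr s ''q'' i / w\<rfloor>)) s"
proof -
  have D: "reg s ''D'' = real DD" and u: "\<And>i. i \<le> DD \<Longrightarrow> arr s ''u'' i = fst (\<omega> i)"
    using baseD[OF assms(1)] by (auto simp: envD us_def)
  define s1 where "s1 = set_reg ''acc'' (fst (\<omega> DD) * real t) (set_reg ''y'' (fst (\<omega> DD)) s)"
  have "wp \<omega> AA (Dot (Floor (R ''x'' \<oslash> R ''wd''))) (\<lambda>t' s'. t' \<le> 5 * DD + 2 \<and> reg s' ''acc'' = key t (\<lambda>i. \<lfloor>arr s ''q'' i / w\<rfloor>)) s1"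
  proof (rule wp_mono[OF wp_Dot[of s1 DD _ _ "\<lambda>x. real_of_int \<lfloor>x / w\<rfloor>"]], goal_cases)
    case (3 s')
    then show ?case using same_reg[OF 3, of "''wd''"] assms(3) by (simp add: s1_def)
  next
    case (4 t' s')
    then show ?case using u by (auto simp: s1_def key_def intro!: sum.cong)
  qed (use D AA_bounds in \<open>auto simp: s1_def\<close>)
  note main = this
  have "addr (R ''D'') s = DD" using D by (intro addrI) simp
  then have "wp \<omega> AA Key (\<lambda>t' s'. t' \<le> 5 * DD + 4 \<and> reg s' ''acc'' = key t (\<lambda>i. \<lfloor>arr s ''q'' i / w\<rfloor>)) s"
    unfolding Key_def using AA_bounds u[of DD] assms(2)
    by (simp add: wpx cong: wp_weak, intro wp_mono_eq[OF main]) (auto simp: s1_def)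
  then show ?thesis by (rule wp_same) simp
qed

lemma wp_Norm':
  assumes "base s" "reg s ''row'' = real r" "r < NN"
  shows "wp \<omega> AA Norm (\<lambda>t s'. t \<le> 12 * DD + 4 \<and> same {''nv'', ''nt'', ''nacc'', ''nc'', ''x'', ''y''} {} s s' \<and>
     reg s' ''nv'' = nrm d LL (\<lambda>i. arr s ''q'' i - pt r i)) s"
proof (rule wp_mono[OF wp_Norm[of s LL d r]], goal_cases)
  case 5
  have "(r + 1) * (LL * d) \<le> NN * (LL * d)" using assms(3) by (intro mult_le_mono1) simp
  then show ?case using AA_bounds(1) by (simp add: DD_def)
next
  case (7 t s')
  have "LL * (5 * d + 7) \<le> 12 * DD" using d by (simp add: DD_def algebra_simps)
  moreover have "nrm d LL (\<lambda>i. arr s ''q'' i - arr s ''P'' (r * (LL * d) + i)) = nrm d LL (\<lambda>i. arr s ''q'' i - pt r i)"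
    by (rule nrm_cong) (use assms baseD(3)[OF assms(1)] in \<open>simp add: pts_def DD_def\<close>)
  ultimately show ?case using 7 by simp
qed (use envD[OF baseD(1)[OF assms(1)]] assms LL_pos in \<open>auto simp: DD_def\<close>)

lemma cell_digits:
  assumes s: "base s" "reg s ''row'' = real r" "r < NN" "reg s ''rem'' = real a" "reg s ''wd'' = \<sigma> / real (d * HH)"
  shows "wp \<omega> AA (For ''cc'' ''D'' (
      Load ''x'' ''P'' (R ''row'' \<otimes> R ''D'' \<oplus> R ''cc'') ;;
      Assign ''y'' (Floor (R ''rem'' \<oslash> R ''b'')) ;;
      Assign ''dg'' (R ''rem'' \<ominus> R ''b'' \<otimes> R ''y'') ;;
      Assign ''rem'' (R ''y'') ;;
      Store ''q'' (R ''cc'') (R ''wd'' \<otimes> (Floor (R ''x'' \<oslash> R ''wd'') \<oplus> R ''dg'' \<ominus> (R ''DH'' \<oplus> Const 1)))))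
    (\<lambda>t s'. t \<le> DD * 7 + 2 \<and> same {''cc'', ''x'', ''y'', ''dg'', ''rem''} {''q''} s s' \<and> (\<forall>i<DD. arr s' ''q'' i = corner \<sigma> (cel \<sigma> r a) i)) s"
proof (rule wp_For[where n=DD and T=5 and I="\<lambda>j s'. reg s' ''rem'' = real (a div bb ^ j) \<and> (\<forall>i<j. arr s' ''q'' i = corner \<sigma> (cel \<sigma> r a) i)"], goal_cases)
  case (6 j s')
  have sm: "same {''cc'', ''x'', ''y'', ''dg'', ''rem''} {''q''} s s'" using 6(4) by (simp add: insert_commute)
  have b: "base s'" by (rule base_same[OF s(1) sm]) (auto simp: PN_def)
  note e = envD[OF baseD(1)[OF b]]
  have r: "reg s' ''row'' = real r" "reg s' ''wd'' = \<sigma> / real (d * HH)" using same_reg[OF sm] s by auto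
  have ad: "addr (R ''row'' \<otimes> R ''D'' \<oplus> R ''cc'') s' = r * DD + j"
    by (rule addrI) (use r e 6(3) in simp)
  have ad2: "addr (R ''cc'') s'' = j" if "reg s'' ''cc'' = real j" for s'' using that by (intro addrI) simp
  have lt: "r * DD + j < AA" "j < AA" using less_mult_add[OF s(3) 6(1)] AA_bounds 6(1) by linarith+
  have P: "arr s' ''P'' (r * DD + j) = pt r j" using baseD(3)[OF b] s(3) 6(1) by (simp add: pts_def)
  have y: "\<lfloor>real (a div bb ^ j) / real bb\<rfloor> = int (a div bb ^ Suc j)"
    by (simp only: floor_divide_of_nat_eq div_mult2_eq[symmetric] power_Suc mult.commute)
  have dg: "real (a div bb ^ j) - real bb * real (a div bb ^ Suc j) = real (a div bb ^ j mod bb)"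
  proof -
    have "a div bb ^ Suc j = a div bb ^ j div bb" by (simp only: div_mult2_eq[symmetric] power_Suc mult.commute)
    moreover have "real (a div bb ^ j) = real (bb * (a div bb ^ j div bb) + a div bb ^ j mod bb)" by simp
    ultimately show ?thesis by (simp only: of_nat_add of_nat_mult)
  qed
  have c: "corner \<sigma> (cel \<sigma> r a) j = \<sigma> / real (d * HH) * (real_of_int \<lfloor>pt r j / (\<sigma> / real (d * HH))\<rfloor> +
      (real (a div bb ^ j) - real bb * real (a div bb ^ Suc j)) - (real (d * HH) + 1))"
    unfolding dg by (simp add: corner_def cel_def)
  show ?case using 6(1-3) lt by (simp add: wpx ad ad2 r e P y less_Suc_eq c del: of_nat_mult of_nat_Suc power_Suc of_nat_power of_nat_add cong: wp_weak)
next
  case (7 t s')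
  then show ?case by (simp add: insert_commute)
qed (use s envD[OF baseD(1)[OF s(1)]] in auto)

text \<open>The last two conjuncts serve opposite ends: new entries are sound, and a cell near its
  point is present afterwards.\<close>

lemma wp_Cell:
  assumes s: "base s" "scal t \<sigma> s" "reg s ''gg'' = real j" "reg s ''o'' = real a" "reg s ''M'' = real M"
    and S: "arr s ''S'' (j + a mod 2) = real r" "r < NN" "j + a mod 2 < NN" and \<sigma>: "0 < \<sigma>" and M: "M < Mx"
  shows "wp \<omega> AA Cell (\<lambda>T s'. T \<le> 24 * DD + 20 \<and> (\<exists>M'. reg s' ''M'' = real M' \<and> M \<le> M' \<and> M' \<le> M + 1 \<and> grow M s s' \<and>
      (\<forall>e. M \<le> e \<longrightarrow> e < M' \<longrightarrow> entry s' e t (cel \<sigma> r (a div 2)) r \<and> near \<sigma> r (cel \<sigma> r (a div 2))) \<and>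
      (near \<sigma> r (cel \<sigma> r (a div 2)) \<longrightarrow> (\<exists>e<M'. entry s' e t (cel \<sigma> r (a div 2)) r)))) s"
proof -
  let ?z = "cel \<sigma> r (a div 2)"
  let ?dig = "For ''cc'' ''D'' (
      Load ''x'' ''P'' (R ''row'' \<otimes> R ''D'' \<oplus> R ''cc'') ;;
      Assign ''y'' (Floor (R ''rem'' \<oslash> R ''b'')) ;;
      Assign ''dg'' (R ''rem'' \<ominus> R ''b'' \<otimes> R ''y'') ;;
      Assign ''rem'' (R ''y'') ;;
      Store ''q'' (R ''cc'') (R ''wd'' \<otimes> (Floor (R ''x'' \<oslash> R ''wd'') \<oplus> R ''dg'' \<ominus> (R ''DH'' \<oplus> Const 1))))"
  let ?fin = "Cond (Less (R ''s'' \<otimes> (Const 1 \<oplus> Const 1 \<oslash> R ''H'')) (R ''nv'')) Skip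
      (Store ''DK'' (R ''M'') (R ''acc'') ;; Store ''DV'' (R ''M'') (R ''row'') ;;
       Assign ''M'' (R ''M'' \<oplus> Const 1))"
  let ?Q = "\<lambda>s'. \<exists>M'. reg s' ''M'' = real M' \<and> M \<le> M' \<and> M' \<le> M + 1 \<and> grow M s s' \<and>
      (\<forall>e. M \<le> e \<longrightarrow> e < M' \<longrightarrow> entry s' e t ?z r \<and> near \<sigma> r ?z) \<and>
      (near \<sigma> r ?z \<longrightarrow> (\<exists>e<M'. entry s' e t ?z r))"
  define s1 where "s1 = set_reg ''row'' (real r) (set_reg ''rem'' (real (a div 2)) s)"
  have sm1: "same {''row'', ''rem''} {} s s1" by (simp add: same_def s1_def)
  have b1: "base s1" by (rule base_same[OF s(1) sm1]) (auto simp: PN_def)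
  have wd: "\<sigma> / real (d * HH) \<noteq> 0" using \<sigma> d HH_pos by simp
  have "wp \<omega> AA (?dig ;; Key ;; Norm ;; ?fin) (\<lambda>T s'. 2 + T \<le> 24 * DD + 20 \<and> ?Q s') s1"
  proof (rule wp_SeqI[OF cell_digits[OF b1, of r "a div 2" \<sigma>]], goal_cases)
    case (5 T1 s2)
    then have sm2: "same {''cc'', ''x'', ''y'', ''dg'', ''rem'', ''row''} {''q''} s s2" and sm2': "same {''cc'', ''x'', ''y'', ''dg'', ''rem''} {''q''} s1 s2"
      and q2: "\<And>i. i < DD \<Longrightarrow> arr s2 ''q'' i = corner \<sigma> ?z i" by (auto simp: same_def s1_def)
    have b2: "base s2" by (rule base_same[OF s(1) sm2]) (auto simp: PN_def)
    have z: "\<lfloor>arr s2 ''q'' i / (\<sigma> / real (d * HH))\<rfloor> = ?z i" if "i < DD" for i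
      using q2[OF that] wd by (simp add: corner_def)
    show ?case
    proof (rule wp_SeqI[OF wp_Key[OF b2, of t "\<sigma> / real (d * HH)"]], goal_cases)
      case (3 T2 s3)
      have sm3: "same {''cc'', ''x'', ''y'', ''dg'', ''rem'', ''row'', ''acc'', ''dc''} {''q''} s s3" and sm3': "same {''y'', ''acc'', ''dc'', ''x''} {} s2 s3"
        using 3 sm2 by (auto simp: same_def)
      have b3: "base s3" by (rule base_same[OF s(1) sm3]) (auto simp: PN_def)
      have acc: "reg s3 ''acc'' = key t ?z" using 3 z by (simp add: key_def)
      have row3: "reg s3 ''row'' = real r" using same_reg[OF sm3'] same_reg[OF sm2'] by (simp add: s1_def)
      show ?case
      proof (rule wp_SeqI[OF wp_Norm'[OF b3 row3 S(2)]], goal_cases)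
        case (1 T3 s4)
        then have sm4': "same {''nv'', ''nt'', ''nacc'', ''nc'', ''x'', ''y''} {} s3 s4" by simp
        have sm4: "same {''cc'', ''x'', ''y'', ''dg'', ''rem'', ''row'', ''acc'', ''dc'', ''nv'', ''nt'', ''nacc'', ''nc''} {''q''} s s4"
          using sm3 sm4' by (auto simp: same_def)
        have q3: "arr s3 ''q'' = arr s2 ''q''" using same_arr[OF sm3'] by simp
        have nv: "reg s4 ''nv'' = nrm d LL (\<lambda>i. corner \<sigma> ?z i - pt r i)"
        proof -
          have "nrm d LL (\<lambda>i. arr s3 ''q'' i - pt r i) = nrm d LL (\<lambda>i. corner \<sigma> ?z i - pt r i)"
            by (rule nrm_cong) (simp add: q3 q2 DD_def)
          then show ?thesis using 1 by simp
        qed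
        have r4: "reg s4 ''s'' = \<sigma>" "reg s4 ''H'' = real HH" "reg s4 ''M'' = real M" "reg s4 ''acc'' = key t ?z" "reg s4 ''row'' = real r"
          using same_reg[OF sm4] same_reg[OF sm4'] s acc row3 envD[OF baseD(1)[OF s(1)]] by (auto simp: scal_def)
        have a4: "arr s4 ''DK'' = arr s ''DK''" "arr s4 ''DV'' = arr s ''DV''" using same_arr[OF sm4] by auto
        have ad: "addr (R ''M'') s'' = M" if "reg s'' ''M'' = real M" for s'' using that by (intro addrI) simp
        have T: "T1 + T2 + T3 \<le> 24 * DD + 10" using 1 3 5 by simp
        have M': "M < AA" using M AA_bounds by simp
        show ?case
        proof (cases "near \<sigma> r ?z")
          case True
          then show ?thesis using T M' r4 nv
            by (simp add: wpx ad near_def cong: wp_weak) (intro exI[of _ "M + 1"]; auto simp: grow_def a4 entry_def less_Suc_eq)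
        next
          case False
          then show ?thesis using T r4 nv
            by (simp add: wpx ad near_def cong: wp_weak) (simp add: grow_def a4)
        qed
      qed
    qed (use s same_reg[OF sm2] in \<open>auto simp: scal_def\<close>)
  qed (use s S in \<open>auto simp: s1_def scal_def\<close>)
  then have main: "wp \<omega> AA CellBody (\<lambda>T s'. 2 + T \<le> 24 * DD + 20 \<and> ?Q s') s1"
    unfolding CellBody_def .
  have fl: "\<lfloor>real a / 2\<rfloor> = int (a div 2)" by (rule floor_half)
  have "addr (R ''gg'' \<oplus> (R ''o'' \<ominus> Const 2 \<otimes> R ''rem'')) (set_reg ''rem'' (real (a div 2)) s) = j + a mod 2"
  proof (rule addrI)
    have "real a = real (2 * (a div 2) + a mod 2)" by simp
    then have "real a - 2 * real (a div 2) = real (a mod 2)" by (simp only: of_nat_add of_nat_mult)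
    then show "aval (R ''gg'' \<oplus> (R ''o'' \<ominus> Const 2 \<otimes> R ''rem'')) (reg (set_reg ''rem'' (real (a div 2)) s)) = real (j + a mod 2)"
      using s by simp
  qed
  then show ?thesis unfolding Cell_def using s S AA_bounds
    by (simp add: wpx fl cong: wp_weak, intro wp_mono_eq[OF main]) (auto simp: s1_def)
qed


section \<open>A decreasing ladder of scales\<close>

definition "rr = real HH / (real HH + 1)"
text \<open>Scales are stored with the opposite sign, because the binary search expects increasing arrays.\<close>

definition sg :: "state \<Rightarrow> nat \<Rightarrow> real" where
  "sg s t = - arr s ''LK'' t"
definition sorted_pts :: "state \<Rightarrow> (nat \<Rightarrow> nat) \<Rightarrow> bool" where
  "sorted_pts s p \<longleftrightarrow> bij_betw p {..<NN} {..<NN} \<and> (\<forall>i<NN. arr s ''S'' i = real (p i) \<and> arr s ''XS'' i = prj (pt (p i))) \<and>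
     (\<forall>i j. i \<le> j \<longrightarrow> j < NN \<longrightarrow> arr s ''XS'' i \<le> arr s ''XS'' j)"
text \<open>Scale and cell of an entry are not stored. On a good tape the key determines them, and
  then the entry certifies that its point is close to that cell.\<close>

definition sound :: "state \<Rightarrow> nat \<Rightarrow> nat \<Rightarrow> bool" where
  "sound s nl M \<longleftrightarrow> (\<forall>e<M. \<exists>t<nl. \<exists>z r. r < NN \<and> 0 < sg s t \<and> entry s e t z r \<and> near (sg s t) r z)"
definition filled :: "state \<Rightarrow> nat \<Rightarrow> nat \<Rightarrow> nat \<Rightarrow> nat \<Rightarrow> bool" where
  "filled s M t r a \<longleftrightarrow> (near (sg s t) r (cel (sg s t) r a) \<longrightarrow> (\<exists>e<M. entry s e t (cel (sg s t) r a) r))"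

lemma sorted_pts_same: "sorted_pts s p \<Longrightarrow> same X Y s s' \<Longrightarrow> ''S'' \<notin> Y \<Longrightarrow> ''XS'' \<notin> Y \<Longrightarrow> sorted_pts s' p"
  unfolding sorted_pts_def using same_arr[of X Y s s' "''S''"] same_arr[of X Y s s' "''XS''"] by metis

lemma rr: "0 < rr" "rr < 1"
  using HH_pos by (simp_all add: rr_def)

lemma al_pos: "0 < real al" and be_pos: "0 < real be"
  using DD_pos De_pos NN_ge HH_pos by (simp_all add: al_def be_def)

text \<open>By Bernoulli's inequality \<open>(1 + 1 / HH) ^ HH\<close> is at least 2, so
  \<open>Wn = HH * WW\<close> steps shrink a scale by \<open>2 ^ WW\<close>, which exceeds
  \<open>2 * al * be\<close>.\<close>

lemma rr_power: "2 * real al * real be * rr ^ Wn < 1"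
proof -
  have "2 = 1 + real HH * (1 / real HH)" using HH_pos by simp
  also have "\<dots> \<le> (1 + 1 / real HH) ^ HH" by (rule Bernoulli_inequality) (rule order_trans[of _ 0], simp_all)
  also have "1 + 1 / real HH = 1 / rr" using HH_pos by (simp add: rr_def field_simps)
  finally have "2 \<le> (1 / rr) ^ HH" .
  then have "2 ^ WW \<le> ((1 / rr) ^ HH) ^ WW" by (rule power_mono) simp
  also have "\<dots> = (1 / rr) ^ Wn" by (simp add: Wn_def power_mult)
  finally have "2 ^ WW \<le> 1 / rr ^ Wn" by (simp add: power_one_over)
  moreover have "real (2 * al * be) < 2 ^ WW" using WW(1) by (metis of_nat_less_iff of_nat_numeral of_nat_power)
  ultimately have "2 * real al * real be < 1 / rr ^ Wn" by simp
  then show ?thesis using rr by (simp add: field_simps)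
qed

lemma entry_grow: "grow M s s' \<Longrightarrow> e < M \<Longrightarrow> entry s' e t z r = entry s e t z r"
  by (simp add: grow_def entry_def)

lemma filled_mono:
  "filled s M t r a \<Longrightarrow> grow M s s' \<Longrightarrow> M \<le> M' \<Longrightarrow> sg s' t = sg s t \<Longrightarrow> filled s' M' t r a"
  unfolding filled_def by (metis entry_grow order_less_le_trans)

lemma sound_mono:
  assumes "sound s nl M" "grow M s s'" "\<And>t. t < nl \<Longrightarrow> sg s' t = sg s t" "nl \<le> nl'"
    "\<And>e. M \<le> e \<Longrightarrow> e < M' \<Longrightarrow> \<exists>t<nl'. \<exists>z r. r < NN \<and> 0 < sg s' t \<and> entry s' e t z r \<and> near (sg s' t) r z"
  shows "sound s' nl' M'"
  unfolding sound_def
proof (intro allI impI)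
  fix e assume e: "e < M'"
  show "\<exists>t<nl'. \<exists>z r. r < NN \<and> 0 < sg s' t \<and> entry s' e t z r \<and> near (sg s' t) r z"
  proof (cases "e < M")
    case True
    then obtain t z r where "t < nl" "r < NN" "0 < sg s t" "entry s e t z r" "near (sg s t) r z"
      using assms(1) unfolding sound_def by blast
    then show ?thesis using assms(3,4) entry_grow[OF assms(2) True] by (intro exI[of _ t]) auto
  qed (use assms(5) e in auto)
qed

lemma grow_trans: "grow M s s' \<Longrightarrow> grow M' s' s'' \<Longrightarrow> M \<le> M' \<Longrightarrow> grow M s s''"
  by (auto simp: grow_def)

lemma wp_Insert:
  assumes s: "base s" "sorted_pts s p" "reg s ''gg'' = real j" "reg s ''nl'' = real nl" "reg s ''w'' = real w" "reg s ''M'' = real M"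
    and j: "j + 1 < NN" and nl: "nl < AA" "\<And>t. t < nl \<Longrightarrow> 0 < sg s t" and M: "M + 2 * BD \<le> Mx" "sound s nl M"
  shows "wp \<omega> AA Insert (\<lambda>T s'. T \<le> 2 * BD * (24 * DD + 22) + 10 \<and> (\<exists>M'. reg s' ''M'' = real M' \<and> M \<le> M' \<and> M' \<le> M + 2 * BD \<and>
     grow M s s' \<and> sound s' nl M' \<and> (w < nl \<longrightarrow> (\<forall>a<2 * BD. filled s' M' (nl - 1 - w) (p (j + a mod 2)) (a div 2))))) s"
proof (cases "w < nl")
  case False
  then have "real nl - 1 - real w < 0" by simp
  then show ?thesis unfolding Insert_def using s M(2) False
    by (simp add: wpx cong: wp_weak) (simp add: grow_def sound_def sg_def entry_def)
next
  case True
  define t where "t = nl - 1 - w"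
  define \<sigma> where "\<sigma> = sg s t"
  have t: "real nl - 1 - real w = real t" "t < nl" using True by (auto simp: t_def of_nat_diff)
  have \<sigma>: "0 < \<sigma>" using nl(2) t by (simp add: \<sigma>_def)
  define s1 where "s1 = set_reg ''wd'' (\<sigma> / real (d * HH)) (set_reg ''s'' \<sigma> (set_reg ''s'' (arr s ''LK'' t) (set_reg ''tl'' (real t) s)))"
  have sm1: "same {''wd'', ''s'', ''tl''} {} s s1" by (simp add: same_def s1_def)
  have b1: "base s1" by (rule base_same[OF s(1) sm1]) (auto simp: PN_def)
  have sc1: "scal t \<sigma> s1" by (simp add: scal_def s1_def)
  let ?I = "\<lambda>a s'. \<exists>M'. reg s' ''M'' = real M' \<and> M \<le> M' \<and> M' \<le> M + a \<and> grow M s s' \<and> sound s' nl M' \<and>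
      (\<forall>a'<a. filled s' M' t (p (j + a' mod 2)) (a' div 2))"
  have "wp \<omega> AA (For ''o'' ''B2'' Cell) (\<lambda>T s'. T \<le> 2 * BD * (24 * DD + 22) + 2 \<and> ?I (2 * BD) s') s1"
  proof (rule wp_For[where n="2 * BD" and T="24 * DD + 20" and I="?I"], goal_cases)
    case 5
    then show ?case using s M by (auto simp: s1_def grow_def sound_def sg_def entry_def intro!: exI[of _ M])
  next
    case (6 a s')
    then obtain M' where I: "reg s' ''M'' = real M'" "M \<le> M'" "M' \<le> M + a" "grow M s s'" "sound s' nl M'"
      "\<And>a'. a' < a \<Longrightarrow> filled s' M' t (p (j + a' mod 2)) (a' div 2)" by blast
    have LK: "sg s' t' = sg s t'" for t' using same_arr[OF 6(4), of "''LK''"] by (simp add: sg_def s1_def)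
    have b: "base s'" by (rule base_same[OF b1 6(4)]) (auto simp: PN_def)
    have sc: "scal t \<sigma> s'" using sc1 same_reg[OF 6(4)] by (simp add: scal_def)
    have "a mod 2 < 2" by simp
    then have jj: "j + a mod 2 < NN" using j by linarith
    define r where "r = p (j + a mod 2)"
    have S: "arr s' ''S'' (j + a mod 2) = real r" "r < NN"
      using s(2) jj same_arr[OF 6(4), of "''S''"] by (auto simp: sorted_pts_def s1_def r_def bij_betw_def)
    have gg: "reg s' ''gg'' = real j" using same_reg[OF 6(4), of "''gg''"] s by (simp add: s1_def)
    have Mlt: "M' < Mx" using I(3) 6(1) M by simp
    show ?case
    proof (rule wp_same[OF wp_Cell[OF b sc gg 6(3) I(1) S jj \<sigma> Mlt]], elim conjE exE)
      fix T s'' M'' assume T: "T \<le> 24 * DD + 20" and sm: "same (wr Cell) (wa Cell) s' s''" and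
        C: "reg s'' ''M'' = real M''" "M' \<le> M''" "M'' \<le> M' + 1" "grow M' s' s''"
        "\<forall>e. M' \<le> e \<longrightarrow> e < M'' \<longrightarrow> entry s'' e t (cel \<sigma> r (a div 2)) r \<and> near \<sigma> r (cel \<sigma> r (a div 2))"
        "near \<sigma> r (cel \<sigma> r (a div 2)) \<longrightarrow> (\<exists>e<M''. entry s'' e t (cel \<sigma> r (a div 2)) r)"
      have LK'': "sg s'' t' = sg s t'" for t' using same_arr[OF sm, of "''LK''"] LK[of t'] by (simp add: sg_def)
      have "sound s'' nl M''"
      proof (rule sound_mono[OF I(5) C(4)])
        fix e assume "M' \<le> e" "e < M''"
        then have "entry s'' e t (cel \<sigma> r (a div 2)) r \<and> near \<sigma> r (cel \<sigma> r (a div 2))" using C(5) by blast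
        moreover have "sg s'' t = \<sigma>" by (simp add: LK'' \<sigma>_def)
        ultimately show "\<exists>t<nl. \<exists>z r. r < NN \<and> 0 < sg s'' t \<and> entry s'' e t z r \<and> near (sg s'' t) r z"
          using t(2) S(2) \<sigma> by metis
      qed (auto simp: LK LK'')
      moreover have "filled s'' M'' t (p (j + a' mod 2)) (a' div 2)" if "a' < Suc a" for a'
      proof (cases "a' = a")
        case True
        then show ?thesis using C(6) by (simp add: filled_def LK'' \<sigma>_def[symmetric] r_def[symmetric])
      next
        case False
        then have "a' < a" using that by simp
        from filled_mono[OF I(6)[OF this] C(4,2)] show ?thesis by (simp add: LK LK'')
      qed
      ultimately have "?I (Suc a) s''" using C grow_trans[OF I(4) C(4) I(2)] I(2,3) by (intro exI[of _ M'']) auto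
      then show "T \<le> 24 * DD + 20 \<and> ?I (Suc a) (set_reg ''o'' (real a + 1) s'')"
        using T by (simp add: grow_def sound_def filled_def sg_def entry_def)
    qed
  next
    case (7 T s')
    then show ?case by (simp add: algebra_simps)
  qed (use envD[OF baseD(1)[OF b1]] in auto)
  note main = this
  have "addr (R ''tl'') (set_reg ''tl'' (real t) s) = t" by (rule addrI) simp
  moreover have "t < AA" using t nl by simp
  moreover have "reg s ''DH'' = real (d * HH)" using envD[OF baseD(1)[OF s(1)]] by simp
  moreover have "nl - Suc w = t" by (simp add: t_def)
  ultimately show ?thesis unfolding Insert_def Scale_def using s t True
    by (simp add: wpx cong: wp_weak, intro wp_mono_eq[OF main]) (auto simp: s1_def \<sigma>_def sg_def)
qed

text \<open>Above \<open>g * be\<close> the steps may be larger than \<open>rr\<close>, because of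
  jumps made for larger gaps; below it the ratio is exact. That all scales but the last exceed
  \<open>g / al\<close> bounds the number of scales in the window.\<close>

definition lad :: "state \<Rightarrow> nat \<Rightarrow> real \<Rightarrow> bool" where
  "lad s nl g \<longleftrightarrow> 1 \<le> nl \<and> g * real be \<le> rr * sg s 0 \<and>
    (\<forall>t. 0 < t \<longrightarrow> t < nl \<longrightarrow> sg s t \<le> rr * sg s (t - 1) \<and> (sg s t = rr * sg s (t - 1) \<or> g * real be \<le> sg s t)) \<and>
    (\<forall>t. t + 1 < nl \<longrightarrow> g / real al < sg s t) \<and> (\<forall>t<nl. 0 < sg s t)"

lemma lad_cong: "lad s nl g \<Longrightarrow> (\<And>t. t < nl \<Longrightarrow> sg s' t = sg s t) \<Longrightarrow> lad s' nl g"
  by (auto simp: lad_def)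

text \<open>The condition weakens as the gap shrinks. This is why the gaps are processed in
  decreasing order.\<close>

lemma lad_mono: assumes "lad s nl g" "g' \<le> g" shows "lad s nl g'"
proof -
  have "g' * real be \<le> g * real be" "g' / real al \<le> g / real al"
    using assms(2) al_pos be_pos by (simp_all add: mult_right_mono divide_right_mono)
  then show ?thesis using assms(1) unfolding lad_def by (meson order_trans order_le_less_trans)
qed

text \<open>If the last scale is still above \<open>g / al\<close>, the first push brings it to at
  most \<open>g * be\<close>, and \<open>Wn\<close> further pushes bring it below
  \<open>g / al\<close> by \<open>rr_power\<close>; hence \<open>Wn + 1\<close> rounds.\<close>

lemma wp_Pushes:
  assumes s: "base s" "reg s ''nl'' = real nl" "reg s ''sg'' = sg s (nl - 1)" "reg s ''ag'' = g / real al" "reg s ''bg'' = g * real be"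
    and g: "0 < g" and lad: "lad s nl g" and nl: "nl + Wn + 1 < AA"
  shows "wp \<omega> AA (For ''w'' ''Wn1'' Push) (\<lambda>T s'. T \<le> (Wn + 1) * 8 + 2 \<and> (\<exists>nl'. reg s' ''nl'' = real nl' \<and> nl \<le> nl' \<and> nl' \<le> nl + (Wn + 1) \<and>
     reg s' ''sg'' = sg s' (nl' - 1) \<and> lad s' nl' g \<and> (\<forall>t<nl. sg s' t = sg s t) \<and> sg s' (nl' - 1) \<le> g / real al)) s"
proof -
  define I where "I w s' \<longleftrightarrow> (\<exists>nl'. reg s' ''nl'' = real nl' \<and> nl \<le> nl' \<and> nl' \<le> nl + w \<and>
     reg s' ''sg'' = sg s' (nl' - 1) \<and> lad s' nl' g \<and> (\<forall>t<nl. sg s' t = sg s t) \<and>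
     (sg s' (nl' - 1) \<le> g / real al \<or> w = 0 \<or> sg s' (nl' - 1) \<le> g * real be * rr ^ (w - 1)))" for w s'
  have sgw: "sg (set_reg ''w'' x s') = sg s'" for x s' by (rule ext) (simp add: sg_def)
  have Iw: "I w (set_reg ''w'' x s') = I w s'" for w x s' by (simp add: I_def sgw lad_def)
  show ?thesis
proof (rule wp_For[where n="Wn + 1" and T=6 and I=I], goal_cases)
  case 5
  show ?case unfolding Iw using s lad by (auto simp: I_def)
next
  case (6 w s')
  then obtain nl' where I: "reg s' ''nl'' = real nl'" "nl \<le> nl'" "nl' \<le> nl + w" "reg s' ''sg'' = sg s' (nl' - 1)" "lad s' nl' g"
    "\<And>t. t < nl \<Longrightarrow> sg s' t = sg s t" "sg s' (nl' - 1) \<le> g / real al \<or> w = 0 \<or> sg s' (nl' - 1) \<le> g * real be * rr ^ (w - 1)" unfolding I_def by blast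
  have b: "base s'" by (rule base_same[OF s(1) 6(4)]) (auto simp: PN_def)
  have r: "reg s' ''ag'' = g / real al" "reg s' ''bg'' = g * real be" "reg s' ''rr'' = rr"
    using same_reg[OF 6(4)] s envD[OF baseD(1)[OF b]] by (auto simp: rr_def)
  have nl1: "1 \<le> nl'" using I(5) by (simp add: lad_def)
  show ?case
  proof (cases "g / real al < sg s' (nl' - 1)")
    case False
    then have "I (Suc w) s'" using I unfolding I_def by (intro exI[of _ nl']) auto
    then show ?thesis unfolding Push_def using r I False
      by (simp add: wpx Iw cong: wp_weak)
  next
    case True
    define v where "v = min (sg s' (nl' - 1) * rr) (g * real be)"
    have p: "0 < sg s' (nl' - 1)" using I(5) nl1 by (simp add: lad_def)
    have v: "0 < v" "v \<le> rr * sg s' (nl' - 1)" "v = rr * sg s' (nl' - 1) \<or> g * real be \<le> v"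
      using p rr g be_pos by (auto simp: v_def min_def mult.commute)
    have Q: "I (Suc w) s''"
      if s'': "reg s'' ''nl'' = real (nl' + 1)" "reg s'' ''sg'' = v" "sg s'' nl' = v" "\<And>t. t < nl' \<Longrightarrow> sg s'' t = sg s' t" for s''
      unfolding I_def
    proof (intro exI[of _ "nl' + 1"] conjI)
      show "lad s'' (nl' + 1) g"
        unfolding lad_def
      proof (intro conjI allI impI)
        show "g * real be \<le> rr * sg s'' 0" using I(5) nl1 s''(4)[of 0] by (simp add: lad_def)
        fix t
        show "sg s'' t \<le> rr * sg s'' (t - 1)" "sg s'' t = rr * sg s'' (t - 1) \<or> g * real be \<le> sg s'' t" if "0 < t" "t < nl' + 1"
          using that I(5) v s''(3) s''(4)[of t] s''(4)[of "t - 1"] unfolding lad_def by (cases "t = nl'"; auto)+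
        show "g / real al < sg s'' t" if "t + 1 < nl' + 1"
          using that I(5) True s''(4)[of t] unfolding lad_def by (cases "t = nl' - 1") auto
        show "0 < sg s'' t" if "t < nl' + 1"
          using that I(5) v s''(3) s''(4)[of t] unfolding lad_def by (cases "t = nl'") auto
      qed simp
      show "\<forall>t<nl. sg s'' t = sg s t" using s''(4) I(2,6) by auto
      show "sg s'' (nl' + 1 - 1) \<le> g / real al \<or> Suc w = 0 \<or> sg s'' (nl' + 1 - 1) \<le> g * real be * rr ^ (Suc w - 1)"
      proof (cases "w = 0")
        case True
        then show ?thesis using s''(3) by (simp add: v_def)
      next
        case False
        then have "sg s' (nl' - 1) \<le> g * real be * rr ^ (w - 1)" using I(7) \<open>g / real al < _\<close> by auto
        then have "rr * sg s' (nl' - 1) \<le> rr * (g * real be * rr ^ (w - 1))" using rr by (intro mult_left_mono) auto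
        also have "\<dots> = g * real be * rr ^ w" using False by (cases w) auto
        finally show ?thesis using v(2) s''(3) by simp
      qed
    qed (use s'' I in auto)
    have ad: "addr (R ''nl'') s'' = nl'" if "reg s'' ''nl'' = real nl'" for s'' using that by (intro addrI) simp
    have lt: "nl' < AA" using I(3) nl 6(1) by simp
    show ?thesis
    proof (cases "g * real be < sg s' (nl' - 1) * rr")
      case c: True
      then have "v = g * real be" by (simp add: v_def)
      with c True r I lt show ?thesis unfolding Push_def
        by (simp add: wpx ad Iw cong: wp_weak) (rule Q, auto simp: sg_def)
    next
      case c: False
      then have "v = sg s' (nl' - 1) * rr" by (simp add: v_def)
      with c True r I lt show ?thesis unfolding Push_def
        by (simp add: wpx ad Iw cong: wp_weak) (rule Q, auto simp: sg_def)
    qed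
  qed
next
  case (7 T s')
  then obtain nl' where I: "reg s' ''nl'' = real nl'" "nl \<le> nl'" "nl' \<le> nl + (Wn + 1)" "reg s' ''sg'' = sg s' (nl' - 1)" "lad s' nl' g"
    "\<forall>t<nl. sg s' t = sg s t" "sg s' (nl' - 1) \<le> g / real al \<or> Wn + 1 = 0 \<or> sg s' (nl' - 1) \<le> g * real be * rr ^ (Wn + 1 - 1)" unfolding I_def by blast
  have "g * real be * rr ^ Wn \<le> g / real al"
  proof -
    have "0 \<le> real al * real be * rr ^ Wn" using rr by simp
    then have "real al * real be * rr ^ Wn \<le> 1" using rr_power by linarith
    then have "(real al * real be * rr ^ Wn) * g \<le> 1 * g" using g by (intro mult_right_mono) auto
    then show ?thesis using al_pos by (simp add: field_simps)
  qed
  then have "sg s' (nl' - 1) \<le> g / real al" using I(7) by auto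
  then show ?case using I 7(1) by auto
qed (use envD[OF baseD(1)[OF s(1)]] in auto)
qed

lemma lad_iter:
  assumes "lad s nl g" "t + i < nl"
  shows "sg s (t + i) \<le> rr ^ i * sg s t"
  using assms(2)
proof (induction i)
  case (Suc i)
  have "sg s (t + Suc i) \<le> rr * sg s (t + i)" using assms(1) Suc.prems unfolding lad_def by (metis add_Suc_right diff_Suc_1 zero_less_Suc)
  also have "\<dots> \<le> rr * (rr ^ i * sg s t)" using Suc rr by (intro mult_left_mono) auto
  finally show ?case by (simp add: mult.assoc)
qed simp

text \<open>If the scale were further from the end, \<open>Wn\<close> steps of ratio at most
  \<open>rr\<close> would lead from at most \<open>g * be\<close> to more than
  \<open>rr * g / al\<close>, that is, \<open>rr < al * be * rr ^ Wn\<close>. But \<open>rr\<close>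
  is at least 1/2, and the spare factor 2 in \<open>rr_power\<close> puts the right side below
  1/2.\<close>

lemma lad_window:
  assumes "lad s nl g" "0 < g" "sg s (nl - 1) \<le> g / real al" "t < nl" "g / real al < sg s t" "sg s t \<le> g * real be"
  shows "nl - 1 - t < Wn"
proof (rule ccontr)
  assume n: "\<not> nl - 1 - t < Wn"
  have "t \<noteq> nl - 1" using assms by auto
  then have t: "t + (nl - 2 - t) < nl" "t + (nl - 2 - t) = nl - 2" "nl - 1 - t = Suc (nl - 2 - t)" using assms(4) by auto
  have "g / real al < sg s (nl - 2)" using assms(1) t by (simp add: lad_def)
  also have "\<dots> \<le> rr ^ (nl - 2 - t) * sg s t" using lad_iter[OF assms(1) t(1)] t by simp
  finally have "rr * (g / real al) < rr * (rr ^ (nl - 2 - t) * sg s t)" using rr by (intro mult_strict_left_mono) auto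
  also have "\<dots> = rr ^ (nl - 1 - t) * sg s t" unfolding t(3) by simp
  also have "\<dots> \<le> rr ^ Wn * (g * real be)"
    using n rr assms(2,5,6) al_pos by (intro mult_mono power_decreasing) (auto intro: order_trans[of _ "g / real al"])
  finally have "rr < real al * real be * rr ^ Wn" using assms(2) al_pos by (simp add: field_simps)
  moreover have "1 / 2 \<le> rr" using HH_pos by (simp add: rr_def field_simps)
  ultimately show False using rr_power by linarith
qed

end

text \<open>Sequencing that passes the frame of the first command on to the second.\<close>

lemma wp_SeqS:
  "wp \<omega> A c1 Q1 s \<Longrightarrow> (\<And>t s'. Q1 t s' \<Longrightarrow> same (wr c1) (wa c1) s s' \<Longrightarrow> wp \<omega> A c2 (\<lambda>t'. Q (t + t')) s') \<Longrightarrow> wp \<omega> A (c1 ;; c2) Q s"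
  by (simp add: wp_same)

context ann
begin

section \<open>The windows of all gaps\<close>

definition "gapv p j = prj (pt (p (j + 1))) - prj (pt (p j))"

definition sorted_gaps :: "state \<Rightarrow> (nat \<Rightarrow> nat) \<Rightarrow> (nat \<Rightarrow> nat) \<Rightarrow> bool" where
  "sorted_gaps s p pg \<longleftrightarrow> bij_betw pg {..<NN - 1} {..<NN - 1} \<and>
     (\<forall>i<NN - 1. arr s ''GI'' i = real (pg i) \<and> arr s ''GS'' i = - gapv p (pg i)) \<and>
     (\<forall>i i'. i \<le> i' \<longrightarrow> i' < NN - 1 \<longrightarrow> gapv p (pg i') \<le> gapv p (pg i))"

definition dec :: "state \<Rightarrow> nat \<Rightarrow> bool" where
  "dec s nl \<longleftrightarrow> 1 \<le> nl \<and> (\<forall>t<nl. 0 \<le> sg s t) \<and> (\<forall>t. 0 < t \<longrightarrow> t < nl \<longrightarrow> sg s t \<le> rr * sg s (t - 1))"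

text \<open>
  Within the window of the gap \<open>j\<close> consecutive scales have exactly the ratio \<open>rr\<close>, and all cells
  near the two endpoints of the gap are in the dictionary.
\<close>

definition gapok :: "state \<Rightarrow> nat \<Rightarrow> nat \<Rightarrow> (nat \<Rightarrow> nat) \<Rightarrow> nat \<Rightarrow> bool" where
  "gapok s nl M p j \<longleftrightarrow> (0 < gapv p j \<longrightarrow>
     sg s (nl - 1) \<le> gapv p j / real al \<and> gapv p j * real be < sg s 0 \<and>
     (\<forall>t<nl. 0 < t \<longrightarrow> gapv p j / real al < sg s (t - 1) \<longrightarrow> sg s t < gapv p j * real be \<longrightarrow> sg s t = rr * sg s (t - 1)) \<and>
     (\<forall>t<nl. gapv p j / real al < sg s t \<longrightarrow> sg s t \<le> gapv p j * real be \<longrightarrow>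
        (\<forall>a<2 * BD. filled s M t (p (j + a mod 2)) (a div 2))))"

lemma sorted_gaps_same: "sorted_gaps s p pg \<Longrightarrow> same X Y s s' \<Longrightarrow> ''GI'' \<notin> Y \<Longrightarrow> ''GS'' \<notin> Y \<Longrightarrow> sorted_gaps s' p pg"
  unfolding sorted_gaps_def using same_arr[of X Y s s' "''GI''"] same_arr[of X Y s s' "''GS''"] by metis

lemma dec_antimono:
  assumes "dec s nl" "i \<le> t" "t < nl"
  shows "sg s t \<le> sg s i"
  using assms(2,3)
proof (induction t rule: dec_induct)
  case (step t)
  have "sg s (Suc t) \<le> rr * sg s t" using assms(1) step.prems unfolding dec_def by (metis diff_Suc_1 zero_less_Suc)
  also have "\<dots> \<le> 1 * sg s t" using assms(1) step.prems rr by (intro mult_right_mono) (auto simp: dec_def)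
  finally show ?case using step by simp
qed simp

lemma lad_dec: "lad s nl g \<Longrightarrow> dec s nl"
  unfolding lad_def dec_def by (simp add: less_imp_le)

text \<open>Scales appended later are at most the last old one, hence at most \<open>g / al\<close>,
  and fall outside the window of an earlier gap.\<close>

lemma gapok_mono:
  assumes g: "gapok s nl M p j" and sg: "\<And>t. t < nl \<Longrightarrow> sg s' t = sg s t" and "1 \<le> nl" "nl \<le> nl'" "grow M s s'" "M \<le> M'" "dec s' nl'"
  shows "gapok s' nl' M' p j"
  unfolding gapok_def
proof (intro impI)
  assume pos: "0 < gapv p j"
  have 1: "sg s (nl - 1) \<le> gapv p j / real al" "gapv p j * real be < sg s 0"
    "\<And>t. t < nl \<Longrightarrow> 0 < t \<Longrightarrow> gapv p j / real al < sg s (t - 1) \<Longrightarrow> sg s t < gapv p j * real be \<Longrightarrow> sg s t = rr * sg s (t - 1)"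
    "\<And>t a. t < nl \<Longrightarrow> gapv p j / real al < sg s t \<Longrightarrow> sg s t \<le> gapv p j * real be \<Longrightarrow> a < 2 * BD \<Longrightarrow> filled s M t (p (j + a mod 2)) (a div 2)"
    using g pos unfolding gapok_def by blast+
  have small: "sg s' t \<le> gapv p j / real al" if "nl - 1 \<le> t" "t < nl'" for t
    using dec_antimono[OF assms(7) that] 1(1) sg[of "nl - 1"] assms(3) by simp
  show "sg s' (nl' - 1) \<le> gapv p j / real al \<and> gapv p j * real be < sg s' 0 \<and>
     (\<forall>t<nl'. 0 < t \<longrightarrow> gapv p j / real al < sg s' (t - 1) \<longrightarrow> sg s' t < gapv p j * real be \<longrightarrow> sg s' t = rr * sg s' (t - 1)) \<and>
     (\<forall>t<nl'. gapv p j / real al < sg s' t \<longrightarrow> sg s' t \<le> gapv p j * real be \<longrightarrow>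
        (\<forall>a<2 * BD. filled s' M' t (p (j + a mod 2)) (a div 2)))"
  proof (intro conjI allI impI)
    show "sg s' (nl' - 1) \<le> gapv p j / real al" using small[of "nl' - 1"] assms(3,4) by simp
    show "gapv p j * real be < sg s' 0" using 1(2) sg[of 0] assms(3) by simp
    fix t assume t: "t < nl'"
    show "sg s' t = rr * sg s' (t - 1)" if "0 < t" "gapv p j / real al < sg s' (t - 1)" "sg s' t < gapv p j * real be"
    proof -
      have "t - 1 < nl - 1" using small[of "t - 1"] that t by (meson leI linorder_not_le order_less_trans less_imp_diff_less)
      then have "t < nl" using that by simp
      then show ?thesis using 1(3)[of t] that sg[of t] sg[of "t - 1"] by simp
    qed
    show "filled s' M' t (p (j + a mod 2)) (a div 2)"
      if "gapv p j / real al < sg s' t" "sg s' t \<le> gapv p j * real be" "a < 2 * BD" for a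
    proof -
      have "t < nl - 1" using small[of t] that t by (meson leI linorder_not_le)
      then have "t < nl" by simp
      then show ?thesis using 1(4)[of t a] that sg[of t] by (intro filled_mono[OF _ assms(5,6)]) auto
    qed
  qed
qed

definition "TI = 2 * BD * (24 * DD + 22) + 10"
definition "TG = (Wn + 1) * (2 * BD * (24 * DD + 22) + 30)"

lemma wp_Inserts:
  assumes s: "base s" "sorted_pts s p" "reg s ''gg'' = real j" "reg s ''nl'' = real nl" "reg s ''M'' = real M"
    and j: "j + 1 < NN" and nl: "nl < AA" "\<And>t. t < nl \<Longrightarrow> 0 < sg s t" and M: "M + Wn * (2 * BD) \<le> Mx" "sound s nl M"
  shows "wp \<omega> AA (For ''w'' ''Wn'' Insert) (\<lambda>T s'. T \<le> Wn * (TI + 2) + 2 \<and> (\<exists>M'. reg s' ''M'' = real M' \<and> M \<le> M' \<and> M' \<le> M + Wn * (2 * BD) \<and>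
     grow M s s' \<and> sound s' nl M' \<and> (\<forall>w<Wn. w < nl \<longrightarrow> (\<forall>a<2 * BD. filled s' M' (nl - 1 - w) (p (j + a mod 2)) (a div 2))))) s"
proof -
  define I where "I w s' \<longleftrightarrow> (\<exists>M'. reg s' ''M'' = real M' \<and> M \<le> M' \<and> M' \<le> M + w * (2 * BD) \<and>
     grow M s s' \<and> sound s' nl M' \<and> (\<forall>w'<w. w' < nl \<longrightarrow> (\<forall>a<2 * BD. filled s' M' (nl - 1 - w') (p (j + a mod 2)) (a div 2))))" for w s'
  have Iw: "I w (set_reg ''w'' x s') = I w s'" for w x s'
    by (simp add: I_def grow_def sound_def filled_def sg_def entry_def)
  show ?thesis
  proof (rule wp_For[where n=Wn and T=TI and I=I], goal_cases)
    case 5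
    show ?case unfolding Iw using s M by (auto simp: I_def grow_def)
  next
    case (6 w s')
    then obtain M' where I: "reg s' ''M'' = real M'" "M \<le> M'" "M' \<le> M + w * (2 * BD)" "grow M s s'" "sound s' nl M'"
      "\<And>w' a. w' < w \<Longrightarrow> w' < nl \<Longrightarrow> a < 2 * BD \<Longrightarrow> filled s' M' (nl - 1 - w') (p (j + a mod 2)) (a div 2)" unfolding I_def by blast
    have b: "base s'" by (rule base_same[OF s(1) 6(4)]) (auto simp: PN_def)
    have sp: "sorted_pts s' p" by (rule sorted_pts_same[OF s(2) 6(4)]) auto
    have r: "reg s' ''gg'' = real j" "reg s' ''nl'' = real nl" using same_reg[OF 6(4)] s by auto
    have LK: "sg s' t = sg s t" for t using same_arr[OF 6(4), of "''LK''"] by (simp add: sg_def)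
    have "Suc w * (2 * BD) \<le> Wn * (2 * BD)" using 6(1) by (intro mult_le_mono1) simp
    then have M': "M' + 2 * BD \<le> Mx" using I(3) M(1) by simp
    show ?case unfolding Iw
    proof (rule wp_same[OF wp_Insert[OF b sp r 6(3) I(1) j nl(1) _ M' I(5)]], goal_cases)
      case (2 T s'')
      then obtain M'' where C: "reg s'' ''M'' = real M''" "M' \<le> M''" "M'' \<le> M' + 2 * BD" "grow M' s' s''" "sound s'' nl M''"
        "w < nl \<Longrightarrow> (\<forall>a<2 * BD. filled s'' M'' (nl - 1 - w) (p (j + a mod 2)) (a div 2))" by blast
      have LK'': "sg s'' t = sg s' t" for t using same_arr[OF 2(2), of "''LK''"] by (simp add: sg_def)
      have "filled s'' M'' (nl - 1 - w') (p (j + a mod 2)) (a div 2)" if "w' < Suc w" "w' < nl" "a < 2 * BD" for w' a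
      proof (cases "w' = w")
        case True
        then show ?thesis using C(6) that by blast
      next
        case False
        then show ?thesis using that by (intro filled_mono[OF I(6) C(4,2) LK'']) auto
      qed
      then have "I (Suc w) s''" unfolding I_def
        using C I(2,3) grow_trans[OF I(4) C(4) I(2)] by (intro exI[of _ M'']) auto
      then show ?case using 2 by (simp add: TI_def)
    qed (use nl LK in auto)
  next
    case (7 T s')
    then show ?case unfolding I_def by simp
  qed (use envD[OF baseD(1)[OF s(1)]] in auto)
qed

text \<open>Each gap costs at most \<open>Wn + 1\<close> scales and \<open>Wn * (2 * BD)\<close>
  entries, whatever the geometry of the input. Gaps of length 0 have no window and are exempt from
  \<open>lad\<close>.\<close>

definition gapinv :: "(nat \<Rightarrow> nat) \<Rightarrow> (nat \<Rightarrow> nat) \<Rightarrow> nat \<Rightarrow> state \<Rightarrow> bool" where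
  "gapinv p pg i s \<longleftrightarrow> (\<exists>nl M. reg s ''nl'' = real nl \<and> reg s ''M'' = real M \<and> nl \<le> i * (Wn + 1) + 1 \<and> M \<le> i * (Wn * (2 * BD)) \<and>
     reg s ''sg'' = sg s (nl - 1) \<and> dec s nl \<and> sound s nl M \<and> (\<forall>i'<i. gapok s nl M p (pg i')) \<and>
     (\<forall>i'. i \<le> i' \<longrightarrow> i' < NN - 1 \<longrightarrow> 0 < gapv p (pg i') \<longrightarrow> lad s nl (gapv p (pg i'))))"

lemma gapinv_set: "''nl'' \<noteq> x \<Longrightarrow> ''M'' \<noteq> x \<Longrightarrow> ''sg'' \<noteq> x \<Longrightarrow> gapinv p pg i (set_reg x v s) = gapinv p pg i s"
  by (simp add: gapinv_def dec_def sound_def gapok_def lad_def filled_def sg_def entry_def)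

lemma wp_Gap:
  assumes s: "base s" "sorted_pts s p" "sorted_gaps s p pg" "reg s ''gi'' = real i" "i < NN - 1" and inv: "gapinv p pg i s"
  shows "wp \<omega> AA Gap (\<lambda>T s'. T \<le> TG \<and> gapinv p pg (Suc i) s') s"
proof -
  from inv obtain nl M where I: "reg s ''nl'' = real nl" "reg s ''M'' = real M" "nl \<le> i * (Wn + 1) + 1" "M \<le> i * (Wn * (2 * BD))"
     "reg s ''sg'' = sg s (nl - 1)" "dec s nl" "sound s nl M" "\<And>i'. i' < i \<Longrightarrow> gapok s nl M p (pg i')"
     "\<And>i'. i \<le> i' \<Longrightarrow> i' < NN - 1 \<Longrightarrow> 0 < gapv p (pg i') \<Longrightarrow> lad s nl (gapv p (pg i'))" unfolding gapinv_def by blast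
  define g where "g = gapv p (pg i)"
  have G: "arr s ''GS'' i = - g" "arr s ''GI'' i = real (pg i)" "pg i < NN - 1"
    using s(3,5) by (auto simp: sorted_gaps_def g_def bij_betw_def)
  have ad: "addr (R ''gi'') s' = i" if "reg s' ''gi'' = real i" for s' using that by (intro addrI) simp
  have iA: "i < AA" using s(5) AA_bounds by simp
  show ?thesis
  proof (cases "0 < g")
    case False
    have "gapinv p pg (Suc i) s" unfolding gapinv_def
    proof (rule exI[of _ nl], rule exI[of _ M], intro conjI allI impI)
      fix i' assume "i' < Suc i"
      then show "gapok s nl M p (pg i')" using I(8)[of i'] False by (cases "i' = i") (auto simp: gapok_def g_def)
    qed (use I in auto)
    moreover have "6 \<le> TG" by (simp add: TG_def)
    ultimately show ?thesis unfolding Gap_def using False s(4) G iA by (simp add: wpx ad gapinv_set cong: wp_weak)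
  next
    case True
    define s1 where "s1 = set_reg ''bg'' (g * real be) (set_reg ''ag'' (g / real al) (set_reg ''gg'' (real (pg i)) (set_reg ''g'' g (set_reg ''g'' (- g) s))))"
    have sm1: "same {''bg'', ''ag'', ''gg'', ''g''} {} s s1" by (simp add: same_def s1_def)
    have b1: "base s1" by (rule base_same[OF s(1) sm1]) (auto simp: PN_def)
    have sg1: "sg s1 = sg s" by (rule ext) (simp add: sg_def s1_def)
    have lad1: "lad s1 nl g" by (rule lad_cong) (use I(9)[of i] s(5) True sg1 in \<open>auto simp: g_def\<close>)
    have iN: "(i + 1) * (Wn + 1) + 1 \<le> NN * (Wn + 2)"
    proof -
      have "(i + 1) * (Wn + 1) \<le> NN * (Wn + 1)" using s(5) by (intro mult_le_mono1) simp
      then show ?thesis using NN_ge by simp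
    qed
    have nlA: "nl + Wn + 1 < AA" using I(3) iN AA_bounds(7) by simp
    have "wp \<omega> AA GapBody (\<lambda>T s'. T + 6 \<le> TG \<and> gapinv p pg (Suc i) s') s1"
      unfolding GapBody_def
    proof (rule wp_SeqS[OF wp_Pushes[OF b1 _ _ _ _ True lad1 nlA]], goal_cases)
      case (5 T1 s2)
      then obtain nl2 where P: "T1 \<le> (Wn + 1) * 8 + 2" "reg s2 ''nl'' = real nl2" "nl \<le> nl2" "nl2 \<le> nl + (Wn + 1)"
        "reg s2 ''sg'' = sg s2 (nl2 - 1)" "lad s2 nl2 g" "\<And>t. t < nl \<Longrightarrow> sg s2 t = sg s1 t" "sg s2 (nl2 - 1) \<le> g / real al"
        and sm2: "same (wr (For ''w'' ''Wn1'' Push)) (wa (For ''w'' ''Wn1'' Push)) s1 s2" by blast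
      have sm2': "same {''w'', ''sg'', ''nl'', ''bg'', ''ag'', ''gg'', ''g''} {''LK''} s s2"
        by (rule same_trans[OF sm1 sm2]) auto
      have b2: "base s2" by (rule base_same[OF s(1) sm2']) (auto simp: PN_def)
      have sp2: "sorted_pts s2 p" by (rule sorted_pts_same[OF s(2) sm2']) auto
      have r2: "reg s2 ''gg'' = real (pg i)" "reg s2 ''M'' = real M"
        using same_reg[OF sm2, of "''gg''"] same_reg[OF sm2', of "''M''"] I by (auto simp: s1_def)
      have gr: "grow M s s2" using same_arr[OF sm2'] by (simp add: grow_def)
      have sg2: "\<And>t. t < nl \<Longrightarrow> sg s2 t = sg s t" using P(7) sg1 by simp
      have dec2: "dec s2 nl2" by (rule lad_dec[OF P(6)])
      have snd2: "sound s2 nl2 M" by (rule sound_mono[OF I(7) gr sg2 P(3)]) auto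
      have nl2A: "nl2 < AA" using P(4) nlA by simp
      have M2: "M + Wn * (2 * BD) \<le> Mx"
      proof -
        have "(i + 1) * (Wn * (2 * BD)) \<le> NN * (Wn * (2 * BD))" using s(5) by (intro mult_le_mono1) simp
        then show ?thesis using I(4) by (simp add: Mx_def)
      qed
      have j2: "pg i + 1 < NN" using G(3) by simp
      have pos2: "\<And>t. t < nl2 \<Longrightarrow> 0 < sg s2 t" using P(6) by (simp add: lad_def)
      show ?case
      proof (rule wp_same[OF wp_Inserts[OF b2 sp2 r2(1) P(2) r2(2) j2 nl2A pos2 M2 snd2]], goal_cases)
        case (1 t)
        then show ?case .
      next
        case (2 T2 s3)
        then obtain M3 where Q: "T2 \<le> Wn * (TI + 2) + 2" "reg s3 ''M'' = real M3" "M \<le> M3" "M3 \<le> M + Wn * (2 * BD)" "grow M s2 s3" "sound s3 nl2 M3"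
          "\<And>w a. w < Wn \<Longrightarrow> w < nl2 \<Longrightarrow> a < 2 * BD \<Longrightarrow> filled s3 M3 (nl2 - 1 - w) (p (pg i + a mod 2)) (a div 2)"
          and sm3: "same (wr (For ''w'' ''Wn'' Insert)) (wa (For ''w'' ''Wn'' Insert)) s2 s3" by blast
        have sg3: "sg s3 t = sg s2 t" for t using same_arr[OF sm3, of "''LK''"] by (simp add: sg_def)
        have lad3: "lad s3 nl2 g" by (rule lad_cong[OF P(6) sg3])
        have nl1: "1 \<le> nl" using I(6) by (simp add: dec_def)
        have old: "gapok s3 nl2 M3 p (pg i')" if "i' < i" for i'
          by (rule gapok_mono[OF I(8)[OF that] _ nl1 P(3) _ Q(3) lad_dec[OF lad3]])
            (use sg3 sg2 grow_trans[OF gr Q(5)] in auto)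
        have new: "gapok s3 nl2 M3 p (pg i)"
          unfolding gapok_def g_def[symmetric]
        proof (intro impI conjI allI)
          show "sg s3 (nl2 - 1) \<le> g / real al" using P(8) sg3 by simp
          have "0 < sg s3 0" "g * real be \<le> rr * sg s3 0" using lad3 by (auto simp: lad_def)
          moreover have "rr * sg s3 0 < 1 * sg s3 0" using rr \<open>0 < sg s3 0\<close> by (intro mult_strict_right_mono) auto
          ultimately show "g * real be < sg s3 0" by linarith
          fix t assume t: "t < nl2"
          show "sg s3 t = rr * sg s3 (t - 1)" if "0 < t" "g / real al < sg s3 (t - 1)" "sg s3 t < g * real be"
            using lad3 that t unfolding lad_def by (meson linorder_not_le)
          show "filled s3 M3 t (p (pg i + a mod 2)) (a div 2)" if "g / real al < sg s3 t" "sg s3 t \<le> g * real be" "a < 2 * BD" for a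
          proof -
            have "nl2 - 1 - t < Wn" using lad_window[OF lad3 True _ t that(1,2)] P(8) sg3 by simp
            moreover have "nl2 - 1 - (nl2 - 1 - t) = t" "nl2 - 1 - t < nl2" using t by auto
            ultimately show ?thesis using Q(7)[of "nl2 - 1 - t" a] that(3) by simp
          qed
        qed
        have "gapinv p pg (Suc i) s3" unfolding gapinv_def
        proof (rule exI[of _ nl2], rule exI[of _ M3], intro conjI allI impI)
          show "reg s3 ''nl'' = real nl2" "reg s3 ''sg'' = sg s3 (nl2 - 1)" using same_reg[OF sm3] P(2,5) sg3 by auto
          show "nl2 \<le> Suc i * (Wn + 1) + 1" using P(4) I(3) by simp
          show "M3 \<le> Suc i * (Wn * (2 * BD))" using Q(4) I(4) by simp
          show "dec s3 nl2" by (rule lad_dec[OF lad3])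
          show "gapok s3 nl2 M3 p (pg i')" if "i' < Suc i" for i' using old[of i'] new that by (cases "i' = i") auto
          show "lad s3 nl2 (gapv p (pg i'))" if "Suc i \<le> i'" "i' < NN - 1" for i'
          proof (rule lad_mono[OF lad3])
            show "gapv p (pg i') \<le> g" using s(3) that unfolding sorted_gaps_def g_def by auto
          qed
        qed (use Q in auto)
        moreover have "T1 + T2 + 6 \<le> TG"
        proof -
          have "T1 + T2 + 6 \<le> (Wn + 1) * 8 + Wn * (TI + 2) + 10" using P(1) Q(1) by simp
          also have "\<dots> \<le> (Wn + 1) * 8 + (Wn + 1) * (TI + 2) + (Wn + 1) * 10" by simp
          also have "\<dots> = (Wn + 1) * (TI + 20)" by (simp add: algebra_simps)
          also have "\<dots> = TG" by (simp add: TI_def TG_def)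
          finally show ?thesis .
        qed
        ultimately show ?case by simp
      qed
    qed (use I sg1 in \<open>auto simp: s1_def\<close>)
    note main = this
    show ?thesis unfolding Gap_def using True s(4) G iA envD[OF baseD(1)[OF s(1)]]
      by (simp add: wpx ad cong: wp_weak, intro wp_mono_eq[OF main]) (auto simp: s1_def)
  qed
qed


section \<open>Assembling the preprocessing\<close>

definition "KM = (LEAST w. 2 * Mx + 2 * NN \<le> 2 ^ w)"

lemma KM: "2 * Mx + 2 * NN \<le> 2 ^ KM"
proof -
  have "2 * Mx + 2 * NN \<le> 2 ^ (2 * Mx + 2 * NN)" by (rule less_imp_le) simp
  then show ?thesis unfolding KM_def by (rule LeastI)
qed

definition sorted_dict :: "state \<Rightarrow> nat \<Rightarrow> (nat \<Rightarrow> nat) \<Rightarrow> bool" where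
  "sorted_dict s M q \<longleftrightarrow> bij_betw q {..<M} {..<M} \<and> (\<forall>i<M. arr s ''DI'' i = real (q i) \<and> arr s ''DS'' i = arr s ''DK'' (q i)) \<and>
     (\<forall>i j. i \<le> j \<longrightarrow> j < M \<longrightarrow> arr s ''DS'' i \<le> arr s ''DS'' j)"

definition db :: "state \<Rightarrow> (nat \<Rightarrow> nat) \<Rightarrow> nat \<Rightarrow> nat \<Rightarrow> (nat \<Rightarrow> nat) \<Rightarrow> bool" where
  "db s p nl M q \<longleftrightarrow> sorted_pts s p \<and> reg s ''nl'' = real nl \<and> reg s ''M'' = real M \<and> nl \<le> NN * (Wn + 2) \<and> M \<le> Mx \<and>
     dec s nl \<and> sound s nl M \<and> (\<forall>j<NN - 1. gapok s nl M p j) \<and> sorted_dict s M q"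

definition "TL = NN * (TG + 2) + Mx * (8 * KM + 30) + 20"

lemma wp_Ladder:
  assumes s: "base s" "sorted_pts s p" "sorted_gaps s p pg"
  shows "wp \<omega> AA Ladder (\<lambda>T s'. T \<le> TL \<and> base s' \<and> (\<exists>nl M q. db s' p nl M q)) s"
proof -
  define g where "g = gapv p (pg 0)"
  have N1: "0 < NN - 1" using NN_ge by simp
  have G: "arr s ''GS'' 0 = - g" using s(3) N1 by (auto simp: sorted_gaps_def g_def)
  have gmax: "gapv p (pg i) \<le> g" if "i < NN - 1" for i using s(3) that by (auto simp: sorted_gaps_def g_def)
  \<comment> \<open>If even the largest gap is 0, the ladder is the single scale 0:
    \<open>dec\<close> admits it, and \<open>lad\<close> is claimed only for positive gaps.\<close>
  have g0: "0 \<le> g"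
  proof -
    have j: "pg 0 < NN - 1" using s(3) N1 by (auto simp: sorted_gaps_def bij_betw_def)
    then have "pg 0 \<le> pg 0 + 1" "pg 0 + 1 < NN" by auto
    then have "arr s ''XS'' (pg 0) \<le> arr s ''XS'' (pg 0 + 1)" using s(2) unfolding sorted_pts_def by blast
    then show ?thesis using s(2) j by (simp add: sorted_pts_def g_def gapv_def)
  qed
  define v where "v = g * real be / rr"
  define s1 where "s1 = set_reg ''M'' 0 (set_reg ''nl'' 1 (set_arr ''LK'' 0 (- v) (set_reg ''sg'' v (set_reg ''g'' (- g) s))))"
  have sm1: "same {''M'', ''nl'', ''sg'', ''g''} {''LK''} s s1" by (simp add: same_def s1_def arr_set_arr_fun)
  have b1: "base s1" by (rule base_same[OF s(1) sm1]) (auto simp: PN_def)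
  have inv0: "gapinv p pg 0 s1" unfolding gapinv_def
  proof (rule exI[of _ 1], rule exI[of _ 0], intro conjI allI impI)
    have sv: "sg s1 0 = v" by (simp add: sg_def s1_def)
    have v0: "0 \<le> v" using g0 rr be_pos by (simp add: v_def)
    show "dec s1 1" using v0 sv by (simp add: dec_def)
    show "reg s1 ''sg'' = sg s1 (1 - 1)" by (simp add: sg_def s1_def)
    show "lad s1 1 (gapv p (pg i'))" if "i' < NN - 1" "0 < gapv p (pg i')" for i'
    proof -
      have "0 < g" using that gmax[OF that(1)] by simp
      then have "0 < v" "g * real be \<le> rr * v" using rr be_pos by (simp_all add: v_def)
      then have "lad s1 1 g" using sv by (simp add: lad_def)
      then show ?thesis using gmax[OF that(1)] by (rule lad_mono)
    qed
  qed (auto simp: s1_def sound_def)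
  have "wp \<omega> AA LadderBody (\<lambda>T s'. T + 5 \<le> TL \<and> base s' \<and> (\<exists>nl M q. db s' p nl M q)) s1"
    unfolding LadderBody_def
  proof (rule wp_SeqS[OF wp_For[where n="NN - 1" and T=TG and I="gapinv p pg" and Q="\<lambda>t s'. t \<le> (NN - 1) * (TG + 2) + 2 \<and> gapinv p pg (NN - 1) s'"]], goal_cases)
    case (5)
    then show ?case using inv0 by (simp add: gapinv_set)
  next
    case (6 i s')
    have b: "base s'" by (rule base_same[OF b1 6(4)]) (auto simp: PN_def)
    have sm: "same ({''M'', ''nl'', ''sg'', ''g''} \<union> insert ''gi'' (wr Gap)) ({''LK''} \<union> wa Gap) s s'" by (rule same_trans[OF sm1 6(4)]) auto
    have sp: "sorted_pts s' p" by (rule sorted_pts_same[OF s(2) sm]) auto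
    have sgp: "sorted_gaps s' p pg" by (rule sorted_gaps_same[OF s(3) sm]) auto
    show ?case by (rule wp_mono[OF wp_Gap[OF b sp sgp 6(3,1,2)]]) (simp add: gapinv_set)
  next
    case (8 T1 s2)
    have sm2: "same (insert ''gi'' (wr Gap)) (wa Gap) s1 s2" using 8(2) by simp
    have b2: "base s2" by (rule base_same[OF b1 sm2]) (auto simp: PN_def)
    have sm: "same ({''M'', ''nl'', ''sg'', ''g''} \<union> insert ''gi'' (wr Gap)) ({''LK''} \<union> wa Gap) s s2" by (rule same_trans[OF sm1 sm2]) auto
    have sp2: "sorted_pts s2 p" by (rule sorted_pts_same[OF s(2) sm]) auto
    from 8(1) obtain nl M where I: "T1 \<le> (NN - 1) * (TG + 2) + 2" "reg s2 ''nl'' = real nl" "reg s2 ''M'' = real M" "nl \<le> (NN - 1) * (Wn + 1) + 1" "M \<le> (NN - 1) * (Wn * (2 * BD))"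
      "dec s2 nl" "sound s2 nl M" "\<And>i'. i' < NN - 1 \<Longrightarrow> gapok s2 nl M p (pg i')" unfolding gapinv_def by blast
    have "(NN - 1) * (Wn * (2 * BD)) \<le> Mx" unfolding Mx_def by (intro mult_le_mono1) simp
    then have M: "M \<le> Mx" using I(5) by simp
    have nl: "nl \<le> NN * (Wn + 2)"
    proof -
      have "(NN - 1) * (Wn + 1) \<le> NN * (Wn + 1)" by (intro mult_le_mono1) simp
      then show ?thesis using I(4) NN_ge by simp
    qed
    show ?case
    proof (rule wp_mono[OF wp_Sort[of s2 "''M''" M AA KM "''DK''" "''DS''" "''DI''"]], goal_cases)
      case 2 then show ?case using M AA_bounds by simp
    next
      case 3 then show ?case using M KM by simp
    next
      case (8 T2 s3)
      then obtain q where Q: "T2 \<le> M * (8 * KM + 30) + 10" "sorted_dict s3 M q"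
        and sm3: "same {''big'', ''si'', ''kx'', ''ti'', ''ka'', ''kb'', ''ix''} {''TK'', ''TI'', ''DS'', ''DI''} s2 s3"
        unfolding sorted_dict_def using same_arr[of "{''big'', ''si'', ''kx'', ''ti'', ''ka'', ''kb'', ''ix''}" "{''TK'', ''TI'', ''DS'', ''DI''}" s2 s3 "''DK''"] by auto
      have b3: "base s3" by (rule base_same[OF b2 sm3]) (auto simp: PN_def)
      have sg3: "sg s3 = sg s2" and en: "entry s3 = entry s2" using same_arr[OF sm3] by (auto simp: sg_def entry_def fun_eq_iff)
      have "gapok s3 nl M p j" if "j < NN - 1" for j
      proof -
        have "j \<in> pg ` {..<NN - 1}" using s(3) that by (auto simp: sorted_gaps_def bij_betw_def)
        then have "gapok s2 nl M p j" using I(8) by auto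
        then show ?thesis by (simp add: gapok_def filled_def sg3 en)
      qed
      then have "db s3 p nl M q" unfolding db_def
        using Q(2) I same_reg[OF sm3] M nl sorted_pts_same[OF sp2 sm3] by (simp add: dec_def sound_def sg3 en)
      moreover have "T1 + T2 + 5 \<le> TL"
      proof -
        have "M * (8 * KM + 30) \<le> Mx * (8 * KM + 30)" using M by (intro mult_le_mono1)
        moreover have "(NN - 1) * (TG + 2) \<le> NN * (TG + 2)" by (intro mult_le_mono1) simp
        ultimately show ?thesis using Q(1) I(1) unfolding TL_def by linarith
      qed
      ultimately show ?case using b3 by auto
    qed (use I in auto)
  qed (use b1 envD[OF baseD(1)[OF b1]] in auto)
  note main = this
  have ad: "addr (Const 0) s' = 0" for s' by (rule addrI) simp
  have A0: "0 < AA" using AA_bounds by simp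
  show ?thesis unfolding Ladder_def using G A0 envD[OF baseD(1)[OF s(1)]]
    by (simp add: wpx ad cong: wp_weak, intro wp_mono_eq[OF main]) (auto simp: s1_def v_def rr_def)
qed

definition "TB = 2 * (NN * (8 * KM + 30) + 10) + (NN * 5 + 2) + TL"

lemma wp_Build:
  assumes s: "base s" "rows NN s"
  shows "wp \<omega> AA Build (\<lambda>T s'. T \<le> TB \<and> base s' \<and> (\<exists>p nl M q. db s' p nl M q)) s"
  unfolding Build_def
proof (rule wp_SeqI[OF wp_Sort[of s "''N''" NN AA KM "''X''" "''XS''" "''S''"]], goal_cases)
  case 2 then show ?case using AA_bounds by simp
next
  case 3 then show ?case using KM by simp
next
  case (8 T1 s1)
  then obtain p where P: "T1 \<le> NN * (8 * KM + 30) + 10" "bij_betw p {..<NN} {..<NN}"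
    "\<forall>i<NN. arr s1 ''S'' i = real (p i) \<and> arr s1 ''XS'' i = arr s ''X'' (p i)" "\<forall>i j. i \<le> j \<longrightarrow> j < NN \<longrightarrow> arr s1 ''XS'' i \<le> arr s1 ''XS'' j"
    and sm1: "same {''big'', ''si'', ''kx'', ''ti'', ''ka'', ''kb'', ''ix''} {''TK'', ''TI'', ''XS'', ''S''} s s1" by blast
  have b1: "base s1" by (rule base_same[OF s(1) sm1]) (auto simp: PN_def)
  have "arr s1 ''XS'' i = prj (pt (p i))" if "i < NN" for i
  proof -
    have "p i < NN" using P(2) that by (auto simp: bij_betw_def)
    then show ?thesis using P(3) that s(2) by (simp add: rows_def)
  qed
  then have sp1: "sorted_pts s1 p" unfolding sorted_pts_def using P by metis
  have "wp \<omega> AA Gaps (\<lambda>T s'. T \<le> NN * 5 + 2 \<and> (\<forall>j<NN - 1. arr s' ''G'' j = - gapv p j)) s1"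
    unfolding Gaps_def
  proof (rule wp_For[where n="NN - 1" and T=3 and I="\<lambda>i s'. \<forall>j<i. arr s' ''G'' j = - gapv p j"], goal_cases)
    case (6 i s')
    have sp: "sorted_pts s' p" by (rule sorted_pts_same[OF sp1 6(4)]) auto
    have ad: "addr (R ''i'') s'' = i" "addr (R ''i'' \<oplus> Const 1) s'' = i + 1" if "reg s'' ''i'' = real i" for s''
      using that by (auto intro!: addrI)
    have "arr s' ''XS'' i = prj (pt (p i))" "arr s' ''XS'' (i + 1) = prj (pt (p (i + 1)))" using sp 6(1) by (auto simp: sorted_pts_def)
    moreover have "i + 1 < AA" using 6(1) AA_bounds by simp
    ultimately show ?case using 6(2,3) by (auto simp: wpx ad gapv_def less_Suc_eq)
  next
    case (7 T s')
    have "(NN - 1) * (3 + 2) \<le> NN * 5" by simp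
    then show ?case using 7 by auto
  qed (use envD[OF baseD(1)[OF b1]] in auto)
  note gaps = this
  show ?case
  proof (rule wp_SeqS[OF gaps], goal_cases)
    case (1 T2 s2)
    have sm2: "same {''i'', ''x'', ''y''} {''G''} s1 s2" using 1(2) by (simp add: Gaps_def insert_commute)
    have b2: "base s2" by (rule base_same[OF b1 sm2]) (auto simp: PN_def)
    have sp2: "sorted_pts s2 p" by (rule sorted_pts_same[OF sp1 sm2]) auto
    have G2: "\<And>j. j < NN - 1 \<Longrightarrow> arr s2 ''G'' j = - gapv p j" using 1 by blast
    show ?case
    proof (rule wp_SeqI[OF wp_Sort[of s2 "''N1''" "NN - 1" AA KM "''G''" "''GS''" "''GI''"]], goal_cases)
      case 2 then show ?case using AA_bounds by simp
    next
      case 3 then show ?case using KM by simp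
    next
      case (8 T3 s3)
      then obtain pg where Q: "T3 \<le> (NN - 1) * (8 * KM + 30) + 10" "bij_betw pg {..<NN - 1} {..<NN - 1}"
        "\<forall>i<NN - 1. arr s3 ''GI'' i = real (pg i) \<and> arr s3 ''GS'' i = arr s2 ''G'' (pg i)" "\<forall>i j. i \<le> j \<longrightarrow> j < NN - 1 \<longrightarrow> arr s3 ''GS'' i \<le> arr s3 ''GS'' j"
        and sm3: "same {''big'', ''si'', ''kx'', ''ti'', ''ka'', ''kb'', ''ix''} {''TK'', ''TI'', ''GS'', ''GI''} s2 s3" by blast
      have b3: "base s3" by (rule base_same[OF b2 sm3]) (auto simp: PN_def)
      have sp3: "sorted_pts s3 p" by (rule sorted_pts_same[OF sp2 sm3]) auto
      have gs: "arr s3 ''GS'' i = - gapv p (pg i)" if "i < NN - 1" for i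
      proof -
        have "pg i < NN - 1" using Q(2) that by (auto simp: bij_betw_def)
        then show ?thesis using Q(3) that G2 by simp
      qed
      have "gapv p (pg i') \<le> gapv p (pg i)" if "i \<le> i'" "i' < NN - 1" for i i'
      proof -
        have "arr s3 ''GS'' i \<le> arr s3 ''GS'' i'" using Q(4) that by blast
        then show ?thesis using gs[of i] gs[of i'] that by simp
      qed
      then have sgp: "sorted_gaps s3 p pg" unfolding sorted_gaps_def using Q gs by blast
      have "(NN - 1) * (8 * KM + 30) \<le> NN * (8 * KM + 30)" by (intro mult_le_mono1) simp
      \<comment> \<open>The products are abstracted to variables, which keeps the arithmetic
        linear.\<close>
      moreover have "T1 + T2 + T3 + c \<le> 2 * (z + 10) + (w + 2) + c"
        if "y \<le> z" "T1 \<le> z + 10" "T3 \<le> y + 10" "T2 \<le> w + 2" for y z w c :: nat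
      proof -
        have "T1 + T3 \<le> (z + 10) + (z + 10)" using that(1-3) by (intro add_mono) auto
        then show ?thesis using that(4) by simp
      qed
      ultimately have T: "T1 + T2 + T3 + TL \<le> TB" using P(1) Q(1) conjunct1[OF 1(1)] unfolding TB_def by blast
      show ?case by (rule wp_mono[OF wp_Ladder[OF b3 sp3 sgp]]) (use T in auto)
    qed (use envD[OF baseD(1)[OF b2]] in auto)
  qed
qed (use envD[OF baseD(1)[OF s(1)]] in auto)

definition "TP = 4 * DD + 9 + (3 * m + 3 * DD + 11) + (3 * k + 10) + (3 * WW + 6) + NN * (40 * DD) + 1 + (if k < nV then TB else 1)"

lemma wp_Preprocess:
  "wp \<omega> AA Preprocess (\<lambda>T s'. T \<le> TP \<and> base s' \<and> (k < nV \<longrightarrow> (\<exists>p nl M q. db s' p nl M q))) (data_state d m k \<epsilon> Vs)"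
  unfolding Preprocess_def
proof (rule wp_SeqI[OF wp_ParA], goal_cases)
  case 1
  show ?case by (simp add: env0_def data_state_def nV_def)
next
  case 2
  show ?case by (simp add: data_state_def)
next
  case (3 T1 s1)
  have in0: "inputs (data_state d m k \<epsilon> Vs)" by (simp add: inputs_def data_state_def)
  have 31: "T1 \<le> 4 * DD + 9" "envA s1" "us s1" and sm1: "same {''L'', ''D'', ''D1'', ''i'', ''x''} {''u''} (data_state d m k \<epsilon> Vs) s1"
    using 3 by auto
  have in1: "inputs s1" by (rule inputs_same[OF in0 sm1]) auto
  show ?case
  proof (rule wp_SeqI[OF wp_ParB[OF 31(2)]], goal_cases)
    case (1 T2 s2)
    then have us2: "us s2" and in2: "inputs s2" and B: "envB s2" using us_same[OF 31(3)] inputs_same[OF in1] by blast+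
    note T2 = 1
    show ?case
    proof (rule wp_SeqI[OF wp_ParC[OF B]], goal_cases)
      case (1 T3 s3)
      then have us3: "us s3" and in3: "inputs s3" and C: "envC s3" using us_same[OF us2] inputs_same[OF in2] by blast+
      note T3 = 1
      show ?case
      proof (rule wp_SeqI[OF wp_ParD[OF C]], goal_cases)
        case (1 T4 s4)
        then have us4: "us s4" and in4: "inputs s4" and D: "env s4" using us_same[OF us3] inputs_same[OF in3] by blast+
        note T4 = 1
        show ?case
        proof (rule wp_SeqI[OF wp_Points[OF D us4 in4]], goal_cases)
          case (1 T5 s5)
          then have b5: "base s5" by (simp add: base_def pts_def rows_def)
          have r5: "rows NN s5" using 1 by simp
          have T: "T1 + (T2 + (T3 + (T4 + T5))) + (if k < nV then TB else 1) + 1 \<le> TP"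
            using 31 T2 T3 T4 1 by (simp add: TP_def)
          show ?case
          proof (cases "k < nV")
            case True
            have "wp \<omega> AA Build (\<lambda>T s'. T1 + (T2 + (T3 + (T4 + (T5 + (T + 1))))) \<le> TP \<and> base s' \<and> (k < nV \<longrightarrow> (\<exists>p nl M q. db s' p nl M q))) s5"
              by (rule wp_mono[OF wp_Build[OF b5 r5]]) (use True T in auto)
            then show ?thesis using True envD[OF baseD(1)[OF b5]] by (simp add: wpx cong: wp_weak)
          next
            case False
            then show ?thesis using T b5 envD[OF baseD(1)[OF b5]] by (simp add: wpx cong: wp_weak)
          qed
        qed
      qed
    qed
  qed
qed


section \<open>One expansion of the query: candidates, lookups and bisection\<close>

definition "KW = (LEAST w. Wn \<le> 2 ^ w)"

lemma KW: "Wn \<le> 2 ^ KW"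
  unfolding KW_def by (rule LeastI[of _ Wn]) (simp add: less_imp_le)

text \<open>A negative best distance means that no candidate has been seen.\<close>

definition improves :: "real \<Rightarrow> real \<Rightarrow> bool" where
  "improves b b' \<longleftrightarrow> 0 \<le> b' \<and> (0 \<le> b \<longrightarrow> b' \<le> b)"

lemma improves_trans: "improves a b \<Longrightarrow> improves b c \<Longrightarrow> improves a c"
  by (auto simp: improves_def)

context
  fixes Q :: curve
begin

definition "qv e = expand d Q (int e - int E4)"
definition "dq e r = nrm d LL (\<lambda>i. qv e i - pt r i)"
definition witness :: "state \<Rightarrow> bool" where
  "witness s \<longleftrightarrow> (0 \<le> reg s ''best'' \<longrightarrow> (\<exists>r<NN. \<exists>e<E4. reg s ''best'' = dq e r \<and> reg s ''out'' = real (r div E4)))"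
definition holds :: "nat \<Rightarrow> state \<Rightarrow> bool" where
  "holds e s \<longleftrightarrow> base s \<and> e < E4 \<and> (\<forall>i<DD. arr s ''q'' i = qv e i)"

lemma holds_same: "holds e s \<Longrightarrow> same X Y s s' \<Longrightarrow> X \<inter> PN = {} \<Longrightarrow> Y \<inter> {''u'', ''P'', ''q''} = {} \<Longrightarrow> holds e s'"
  using base_same[of s X Y s'] same_arr[of X Y s s' "''q''"] by (auto simp: holds_def)

lemma witness_cong: "witness s \<Longrightarrow> reg s' ''best'' = reg s ''best'' \<Longrightarrow> reg s' ''out'' = reg s ''out'' \<Longrightarrow> witness s'"
  by (simp add: witness_def)

lemma db_same:
  assumes "db s p nl M q" "same X Y s s'" "X \<inter> {''nl'', ''M''} = {}" "Y \<inter> {''S'', ''XS'', ''LK'', ''DK'', ''DV'', ''DI'', ''DS''} = {}"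
  shows "db s' p nl M q"
proof -
  have a: "arr s' B = arr s B" if "B \<in> {''S'', ''XS'', ''LK'', ''DK'', ''DV'', ''DI'', ''DS''}" for B
    using same_arr[OF assms(2)] that assms(4) by blast
  have sg: "sg s' = sg s" and en: "entry s' = entry s" by (auto simp: fun_eq_iff sg_def entry_def a)
  have r: "reg s' ''nl'' = reg s ''nl''" "reg s' ''M'' = reg s ''M''" using same_reg[OF assms(2)] assms(3) by auto
  have "sorted_pts s' p = sorted_pts s p" unfolding sorted_pts_def by (simp only: a insert_iff simp_thms)
  moreover have "sorted_dict s' M q = sorted_dict s M q" unfolding sorted_dict_def by (simp only: a insert_iff simp_thms)
  moreover have "dec s' nl = dec s nl" "sound s' nl M = sound s nl M" "gapok s' nl M p = gapok s nl M p"
    by (simp_all only: dec_def sound_def gapok_def filled_def sg en fun_eq_iff simp_thms)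
  ultimately show ?thesis using assms(1) by (simp add: db_def r)
qed

lemma wp_Update:
  assumes s: "holds e s" "reg s ''row'' = real r" "r < NN" "witness s"
  shows "wp \<omega> AA Update (\<lambda>T s'. T \<le> 12 * DD + 7 \<and> reg s' ''nv'' = dq e r \<and> improves (reg s ''best'') (reg s' ''best'') \<and>
    reg s' ''best'' \<le> dq e r \<and> witness s') s"
  unfolding Update_def
proof (rule wp_SeqS[OF wp_Norm'[OF _ s(2,3)]], goal_cases)
  case 1
  show ?case using s(1) by (simp add: holds_def)
next
  case (2 T s1)
  have sm: "same {''nv'', ''nt'', ''nacc'', ''nc'', ''x'', ''y''} {} s s1" using 2 by simp
  have nv: "reg s1 ''nv'' = dq e r"
  proof -
    have "nrm d LL (\<lambda>i. arr s ''q'' i - pt r i) = dq e r"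
      unfolding dq_def by (rule nrm_cong) (use s(1) in \<open>simp add: holds_def DD_def\<close>)
    then show ?thesis using 2 by simp
  qed
  have r: "reg s1 ''best'' = reg s ''best''" "reg s1 ''out'' = reg s ''out''" "reg s1 ''row'' = real r" "reg s1 ''E4'' = real E4"
    using same_reg[OF sm] s envD[of s] by (auto simp: holds_def base_def)
  have d0: "0 \<le> dq e r" unfolding dq_def by (rule nrm_nonneg[OF LL_pos])
  have fl: "\<lfloor>real r / real E4\<rfloor> = int (r div E4)" by (simp add: floor_divide_of_nat_eq)
  have e: "e < E4" using s(1) by (simp add: holds_def)
  show ?case
  proof (cases "0 \<le> reg s ''best'' \<and> reg s ''best'' \<le> dq e r")
    case True
    then show ?thesis using 2 s(4) by (simp add: wpx r nv improves_def not_less witness_def cong: wp_weak)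
  next
    case False
    have "witness (set_reg ''out'' (real (r div E4)) (set_reg ''best'' (dq e r) s1))"
      unfolding witness_def using e s(3) by auto
    then show ?thesis using False 2 d0 by (auto simp: wpx r nv fl improves_def not_less cong: wp_weak)
  qed
qed

definition zq :: "nat \<Rightarrow> real \<Rightarrow> nat \<Rightarrow> int" where
  "zq e \<sigma> i = \<lfloor>qv e i / (\<sigma> / real (d * HH))\<rfloor>"
text \<open>The second alternative, a hit whose point is too far away, can arise only from a
  collision of keys; \<open>fails_far\<close> excludes it on good tapes.\<close>

definition fails :: "state \<Rightarrow> nat \<Rightarrow> nat \<Rightarrow> nat \<Rightarrow> bool" where
  "fails s M e t \<longleftrightarrow> (\<forall>n<M. arr s ''DK'' n \<noteq> key t (zq e (sg s t))) \<or>
    (\<exists>n<M. \<exists>r<NN. arr s ''DK'' n = key t (zq e (sg s t)) \<and> arr s ''DV'' n = real r \<and> sg s t * (1 + 2 / real HH) < dq e r)"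

lemma sg_same: "same X Y s s' \<Longrightarrow> ''LK'' \<notin> Y \<Longrightarrow> sg s' = sg s"
  by (simp add: sg_def fun_eq_iff same_arr)

lemma wp_Check:
  assumes s: "holds e s" "db s p nl M q" "witness s" "0 \<le> reg s ''best''" "reg s ''s'' = sg s t" "reg s ''ky'' = key t (zq e (sg s t))"
    and lo: "reg s ''lo'' = real l" "l \<le> M" "\<And>i. i < l \<Longrightarrow> arr s ''DS'' i < reg s ''ky''" "\<And>i. l \<le> i \<Longrightarrow> i < M \<Longrightarrow> reg s ''ky'' \<le> arr s ''DS'' i"
  shows "wp \<omega> AA Check (\<lambda>T s'. T \<le> 12 * DD + 17 \<and> improves (reg s ''best'') (reg s' ''best'') \<and> witness s' \<and>
    (reg s' ''fl'' = 1 \<and> reg s' ''best'' \<le> sg s t * (1 + 2 / real HH) \<or> reg s' ''fl'' = 0 \<and> fails s M e t)) s"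
proof -
  let ?ky = "key t (zq e (sg s t))"
  have q: "bij_betw q {..<M} {..<M}" "\<And>i. i < M \<Longrightarrow> arr s ''DI'' i = real (q i)" "\<And>i. i < M \<Longrightarrow> arr s ''DS'' i = arr s ''DK'' (q i)"
    "\<And>i j. i \<le> j \<Longrightarrow> j < M \<Longrightarrow> arr s ''DS'' i \<le> arr s ''DS'' j"
    using s(2) unfolding db_def sorted_dict_def by blast+
  have M: "reg s ''M'' = real M" "M < AA" using s(2) AA_bounds by (auto simp: db_def)
  have none: "fails s M e t" if "\<And>i. i < M \<Longrightarrow> arr s ''DS'' i \<noteq> ?ky"
  proof -
    have "arr s ''DK'' n \<noteq> ?ky" if n: "n < M" for n
    proof -
      from n have "n \<in> q ` {..<M}" using q(1) by (simp add: bij_betw_def)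
      then show ?thesis using q(3) \<open>\<And>i. i < M \<Longrightarrow> arr s ''DS'' i \<noteq> ?ky\<close> by auto
    qed
    then show ?thesis by (simp add: fails_def)
  qed
  have ad: "addr (R ''lo'') s' = l" if "reg s' ''lo'' = real l" for s' using that by (intro addrI) simp
  consider "l = M" | "l < M" "?ky < arr s ''DS'' l" | "l < M" "arr s ''DS'' l = ?ky"
    using lo(2) lo(4)[of l] s(6) by fastforce
  then show ?thesis
  proof cases
    case 1
    have "fails s M e t" by (rule none) (use lo(3) s(6) 1 in force)
    then show ?thesis unfolding Check_def using 1 s M lo(1)
      by (simp add: wpx improves_def cong: wp_weak) (simp add: witness_def)
  next
    case 2
    have "fails s M e t"
    proof (rule none)
      fix i assume "i < M"
      then show "arr s ''DS'' i \<noteq> ?ky" using lo(3)[of i] q(4)[of l i] 2 s(6) by (cases "i < l") auto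
    qed
    then show ?thesis unfolding Check_def using 2 s M lo(1)
      by (simp add: wpx ad improves_def cong: wp_weak) (simp add: witness_def)
  next
    case 3
    define n where "n = q l"
    have n: "n < M" "arr s ''DI'' l = real n" "arr s ''DK'' n = ?ky" using q 3 by (auto simp: n_def bij_betw_def)
    obtain r where r: "r < NN" "arr s ''DV'' n = real r"
      using s(2) n(1) unfolding db_def sound_def entry_def by blast
    define s1 where "s1 = set_reg ''row'' (real r) (set_reg ''x'' (real n) (set_reg ''x'' ?ky (set_reg ''fl'' 0 s)))"
    have sm1: "same {''row'', ''x'', ''fl''} {} s s1" by (simp add: same_def s1_def)
    have h1: "holds e s1" by (rule holds_same[OF s(1) sm1]) (auto simp: PN_def)
    have w1: "witness s1" by (rule witness_cong[OF s(3)]) (simp_all add: s1_def)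
    have "wp \<omega> AA Verify (\<lambda>T s'. T \<le> 12 * DD + 9 \<and> improves (reg s ''best'') (reg s' ''best'') \<and> witness s' \<and>
       (reg s' ''fl'' = 1 \<and> reg s' ''best'' \<le> sg s t * (1 + 2 / real HH) \<or> reg s' ''fl'' = 0 \<and> fails s M e t)) s1"
      unfolding Verify_def
    proof (rule wp_SeqS[OF wp_Update[OF h1 _ r(1) w1]], goal_cases)
      case 1
      show ?case by (simp add: s1_def)
    next
      case (2 T s2)
      have sm2: "same (wr Update) (wa Update) s1 s2" using 2 by simp
      have r2: "reg s2 ''s'' = sg s t" "reg s2 ''H'' = real HH" "reg s2 ''fl'' = 0" "reg s1 ''best'' = reg s ''best''"
        using same_reg[OF sm2] s(5) envD[of s] s(1) by (auto simp: s1_def holds_def base_def)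
      show ?case
      proof (cases "sg s t * (1 + 2 / real HH) < dq e r")
        case True
        then have "fails s M e t" unfolding fails_def using n r by blast
        then show ?thesis using 2 True r2 by (simp add: wpx cong: wp_weak)
      next
        case False
        then show ?thesis using 2 r2 by (simp add: wpx witness_def cong: wp_weak)
      qed
    qed
    note main = this
    have adx: "addr (R ''x'') s' = n" if "reg s' ''x'' = real n" for s' using that by (intro addrI) simp
    show ?thesis unfolding Check_def using 3 s M lo(1) n r
      by (simp add: wpx ad adx cong: wp_weak, intro wp_mono_eq[OF main]) (auto simp: s1_def)
  qed
qed

text \<open>One logarithm serves every binary search: the ladder is covered because
  \<open>NN * (Wn + 2)\<close> is at most \<open>Mx\<close>.\<close>

lemma KM_bounds: "Mx < 2 ^ KM" "NN < 2 ^ KM" "NN * (Wn + 2) < 2 ^ KM"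
proof -
  show "Mx < 2 ^ KM" "NN < 2 ^ KM" using KM NN_ge by linarith+
  have al1: "1 \<le> al" "1 \<le> be" using al_pos be_pos by linarith+
  then have "1 \<le> al * be" using mult_le_mono[OF al1] by (simp only: mult_1)
  moreover have "2 * al * be = 2 * (al * be)" by simp
  ultimately have "1 < (2::nat) ^ WW" using WW(1) by linarith
  then have "0 < WW" by (cases WW) auto
  then have "1 \<le> Wn" using HH_pos by (simp add: Wn_def Suc_le_eq)
  moreover have "2 \<le> BD"
  proof -
    have "bb \<le> BD" unfolding BD_def using DD_pos by (intro self_le_power) (auto simp: bb_def)
    then show ?thesis by (simp add: bb_def)
  qed
  ultimately have "Wn + 2 \<le> Wn * (2 * BD)"
  proof -
    have "Wn * 4 \<le> Wn * (2 * BD)" using \<open>2 \<le> BD\<close> by (intro mult_le_mono2) simp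
    then show ?thesis using \<open>1 \<le> Wn\<close> by linarith
  qed
  then have "NN * (Wn + 2) \<le> Mx" unfolding Mx_def by (rule mult_le_mono2)
  then show "NN * (Wn + 2) < 2 ^ KM" using \<open>Mx < 2 ^ KM\<close> by simp
qed

lemma wp_Find:
  assumes s: "holds e s" "db s p nl M q" "witness s" "0 \<le> reg s ''best''" "reg s ''s'' = sg s t" "reg s ''ky'' = key t (zq e (sg s t))"
    and r: "reg s ''tl'' = real t" "reg s ''lj'' = real a" "reg s ''hj'' = real b"
  shows "wp \<omega> AA Find (\<lambda>T s'. T \<le> 12 * DD + 5 * KM + 22 \<and> improves (reg s ''best'') (reg s' ''best'') \<and> witness s' \<and>
    (reg s' ''lj'' = real t \<and> reg s' ''hj'' = real b \<and> reg s' ''best'' \<le> sg s t * (1 + 2 / real HH) \<or>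
     reg s' ''lj'' = real a \<and> reg s' ''hj'' = real t \<and> fails s M e t)) s"
  unfolding Find_def
proof (rule wp_SeqI[OF wp_Binary_Search[of s "''M''" M AA KM]], goal_cases)
  case 1 then show ?case using s(2) by (simp add: db_def)
next
  case 2 then show ?case using s(2) AA_bounds by (simp add: db_def)
next
  case 3 then show ?case using s(2) KM_bounds by (simp add: db_def)
next
  case (6 i j) then show ?case using s(2) unfolding db_def sorted_dict_def by blast
next
  case (7 T1 s1)
  then obtain l where l: "T1 \<le> 5 * KM + 3" "l \<le> M" "reg s1 ''lo'' = real l" "\<forall>i<l. arr s ''DS'' i < reg s ''ky''" "\<forall>i. l \<le> i \<longrightarrow> i < M \<longrightarrow> reg s ''ky'' \<le> arr s ''DS'' i"
    and sm: "same {''lo'', ''hi'', ''mi'', ''bx''} {} s s1" by blast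
  have h1: "holds e s1" by (rule holds_same[OF s(1) sm]) (auto simp: PN_def)
  have d1: "db s1 p nl M q" by (rule db_same[OF s(2) sm]) auto
  have r1: "reg s1 x = reg s x" if "x \<notin> {''lo'', ''hi'', ''mi'', ''bx''}" for x using same_reg[OF sm that] .
  have sg1: "sg s1 = sg s" by (rule sg_same[OF sm]) simp
  have w1: "witness s1" by (rule witness_cong[OF s(3)]) (simp_all add: r1)
  have f1: "fails s M e t" if "fails s1 M e t" using that same_arr[OF sm] by (simp add: fails_def sg1)
  show ?case
  proof (rule wp_SeqS[OF wp_Check[OF h1 d1 w1, of t l]], goal_cases)
    case (8 T2 s2)
    have r2: "reg s2 ''tl'' = real t" "reg s2 ''lj'' = real a" "reg s2 ''hj'' = real b"
      using same_reg[OF 8(2)] r by (auto simp: r1)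
    have "witness (set_reg ''lj'' x s2)" "witness (set_reg ''hj'' x s2)" for x using 8(1) by (auto simp: witness_def)
    then show ?case using 8(1) l(1) f1 by (auto simp: wpx r2 r1 sg1 cong: wp_weak)
  qed (use s l same_arr[OF sm, of "''DS''"] in \<open>auto simp: r1 sg1\<close>)
qed (auto)

lemma wp_Lookup:
  assumes s: "holds e s" "db s p nl M q" "witness s" "0 \<le> reg s ''best''" and r: "reg s ''lj'' = real a" "reg s ''hj'' = real b"
    and b: "b \<le> nl" "a < b"
  shows "wp \<omega> AA Lookup (\<lambda>T s'. T \<le> 17 * DD + 5 * KM + 31 \<and> improves (reg s ''best'') (reg s' ''best'') \<and> witness s' \<and>
    (reg s' ''lj'' = real ((a + b) div 2) \<and> reg s' ''hj'' = real b \<and> reg s' ''best'' \<le> sg s ((a + b) div 2) * (1 + 2 / real HH) \<or>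
     reg s' ''lj'' = real a \<and> reg s' ''hj'' = real ((a + b) div 2) \<and> fails s M e ((a + b) div 2))) s"
proof -
  define t where "t = (a + b) div 2"
  have t: "t < nl" using b by (simp add: t_def)
  define s1 where "s1 = set_reg ''wd'' (sg s t / real (d * HH)) (set_reg ''s'' (sg s t) (set_reg ''s'' (arr s ''LK'' t) (set_reg ''tl'' (real t) s)))"
  have sm1: "same {''wd'', ''s'', ''tl''} {} s s1" by (simp add: same_def s1_def)
  have h1: "holds e s1" by (rule holds_same[OF s(1) sm1]) (auto simp: PN_def)
  have "wp \<omega> AA LookupBody (\<lambda>T s'. T + 4 \<le> 17 * DD + 5 * KM + 31 \<and> improves (reg s ''best'') (reg s' ''best'') \<and> witness s' \<and>
    (reg s' ''lj'' = real t \<and> reg s' ''hj'' = real b \<and> reg s' ''best'' \<le> sg s t * (1 + 2 / real HH) \<or>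
     reg s' ''lj'' = real a \<and> reg s' ''hj'' = real t \<and> fails s M e t)) s1"
    unfolding LookupBody_def
  proof (rule wp_SeqI[OF wp_Key[of s1 t "sg s t / real (d * HH)"]], goal_cases)
    case 1
    then show ?case using h1 by (simp add: holds_def)
  next
    case (4 T1 s2)
    define s3 where "s3 = set_reg ''ky'' (reg s2 ''acc'') s2"
    have sm2: "same {''y'', ''acc'', ''dc'', ''x''} {} s1 s2" using 4 by blast
    have sm3: "same {''y'', ''acc'', ''dc'', ''x'', ''ky'', ''wd'', ''s'', ''tl''} {} s s3" using sm1 sm2 by (auto simp: same_def s3_def)
    have h3: "holds e s3" by (rule holds_same[OF s(1) sm3]) (auto simp: PN_def)
    have d3: "db s3 p nl M q" by (rule db_same[OF s(2) sm3]) auto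
    have w3: "witness s3" by (rule witness_cong[OF s(3)]) (use same_reg[OF sm3] in auto)
    have sg3: "sg s3 = sg s" by (rule sg_same[OF sm3]) simp
    have ky: "reg s3 ''ky'' = key t (zq e (sg s t))"
    proof -
      have "arr s1 ''q'' i = qv e i" if "i < DD" for i using h1 that by (simp add: holds_def)
      then have "key t (\<lambda>i. \<lfloor>arr s1 ''q'' i / (sg s t / real (d * HH))\<rfloor>) = key t (zq e (sg s t))" by (simp add: key_def zq_def)
      then show ?thesis using 4 by (simp add: s3_def)
    qed
    have r3: "reg s3 ''best'' = reg s ''best''" "reg s3 ''lj'' = real a" "reg s3 ''hj'' = real b" "reg s3 ''s'' = sg s t" "reg s3 ''tl'' = real t"
      using same_reg[OF sm3] r same_reg[OF sm2] by (auto simp: s3_def s1_def)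
    have f3: "fails s M e t" if "fails s3 M e t" using that same_arr[OF sm3] by (simp add: fails_def sg3)
    have "wp \<omega> AA Find (\<lambda>T s'. T1 + (1 + T) + 4 \<le> 17 * DD + 5 * KM + 31 \<and> improves (reg s ''best'') (reg s' ''best'') \<and> witness s' \<and>
      (reg s' ''lj'' = real t \<and> reg s' ''hj'' = real b \<and> reg s' ''best'' \<le> sg s t * (1 + 2 / real HH) \<or>
       reg s' ''lj'' = real a \<and> reg s' ''hj'' = real t \<and> fails s M e t)) s3"
      by (rule wp_mono[OF wp_Find[OF h3 d3 w3, of t a b]]) (use s(4) ky r3 sg3 4 f3 in auto)
    note main = this
    show ?case by (simp add: wpx cong: wp_weak, intro wp_mono_eq[OF main]) (auto simp: s3_def)
  qed (auto simp: s1_def)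
  note main = this
  have fl: "\<lfloor>(real a + real b) / 2\<rfloor> = int t" using floor_half[of "a + b"] by (simp add: t_def)
  have "addr (R ''tl'') (set_reg ''tl'' (real t) s) = t" by (rule addrI) simp
  moreover have "t < AA" using t s(2) AA_bounds(7) by (simp add: db_def)
  moreover have "reg s ''DH'' = real (d * HH)" using s(1) envD[of s] by (simp add: holds_def base_def)
  ultimately show ?thesis unfolding Lookup_def Scale_def t_def[symmetric] using r
    by (simp add: wpx fl cong: wp_weak, intro wp_mono_eq[OF main]) (auto simp: s1_def sg_def)
qed

end


definition "TS = 29 * DD + 10 * KM + 70 + KW * (17 * DD + 5 * KM + 32)"

context
  fixes Q :: curve
begin

text \<open>Invariant of the bisection. At the two initial ends nothing has been looked up; there
  the estimate \<open>\<rho>\<close> stands in for a success, and the length of the window for a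
  failure.\<close>

definition bracket :: "state \<Rightarrow> nat \<Rightarrow> nat \<Rightarrow> nat \<Rightarrow> nat \<Rightarrow> real \<Rightarrow> real \<Rightarrow> nat \<Rightarrow> nat \<Rightarrow> bool" where
  "bracket s nl M e t0 \<rho> b lj hj \<longleftrightarrow> b \<le> \<rho> \<and> t0 \<le> lj \<and> hj \<le> min (t0 + Wn) (nl - 1) \<and>
     (lj = t0 \<or> lj < nl \<and> b \<le> sg s lj * (1 + 2 / real HH)) \<and> (hj = min (t0 + Wn) (nl - 1) \<or> t0 \<le> hj \<and> fails Q s M e hj)"

definition refined :: "state \<Rightarrow> nat \<Rightarrow> nat \<Rightarrow> nat \<Rightarrow> real \<Rightarrow> real \<Rightarrow> bool" where
  "refined s nl M e \<rho> b \<longleftrightarrow> (\<exists>t0\<le>nl. (\<forall>t<t0. \<rho> < sg s t) \<and> (\<forall>t. t0 \<le> t \<longrightarrow> t < nl \<longrightarrow> sg s t \<le> \<rho>) \<and>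
     (\<exists>lj hj. hj \<le> lj + 1 \<and> bracket s nl M e t0 \<rho> b lj hj))"

lemma refined_eq:
  "sg s' = sg s \<Longrightarrow> (\<And>t. fails Q s' M e t = fails Q s M e t) \<Longrightarrow> refined s' nl M e \<rho> b = refined s nl M e \<rho> b"
  by (simp add: refined_def bracket_def)

lemma wp_Refine:
  assumes s: "holds Q e s" "db s p nl M q" "witness Q s" "0 \<le> reg s ''best''" "reg s ''best'' \<le> \<rho>" "reg s ''nr'' = - \<rho>"
  shows "wp \<omega> AA Refine (\<lambda>T s'. T \<le> 5 * KM + 10 + KW * (17 * DD + 5 * KM + 32) \<and> improves (reg s ''best'') (reg s' ''best'') \<and> witness Q s' \<and>
    refined s nl M e \<rho> (reg s' ''best'')) s"
  unfolding Refine_def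
proof (rule wp_SeqI[OF wp_Binary_Search[of s "''nl''" nl AA KM]], goal_cases)
  case 1 then show ?case using s(2) by (simp add: db_def)
next
  case 2
  have "nl \<le> NN * (Wn + 2)" using s(2) unfolding db_def by blast
  then show ?case using AA_bounds(7) by linarith
next
  case 3
  have "nl \<le> NN * (Wn + 2)" using s(2) unfolding db_def by blast
  then show ?case using KM_bounds(3) by linarith
next
  case (6 i j)
  have "sg s j \<le> sg s i" using s(2) 6 unfolding db_def by (blast intro: dec_antimono)
  then show ?case by (simp add: sg_def)
next
  case (7 T1 s1)
  then obtain t0 where t0: "T1 \<le> 5 * KM + 3" "t0 \<le> nl" "reg s1 ''lo'' = real t0" "\<forall>i<t0. arr s ''LK'' i < reg s ''nr''" "\<forall>i. t0 \<le> i \<longrightarrow> i < nl \<longrightarrow> reg s ''nr'' \<le> arr s ''LK'' i"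
    and sm: "same {''lo'', ''hi'', ''mi'', ''bx''} {} s s1" by blast
  have cut: "\<And>i. i < t0 \<Longrightarrow> \<rho> < sg s i" "\<And>i. t0 \<le> i \<Longrightarrow> i < nl \<Longrightarrow> sg s i \<le> \<rho>"
    using t0(4,5) s(6) by (auto simp: sg_def)
  have nl: "1 \<le> nl" "reg s1 ''nl'' = real nl" using s(2) same_reg[OF sm] by (auto simp: db_def dec_def)
  have Wn: "reg s1 ''Wn'' = real Wn" using same_reg[OF sm, of "''Wn''"] s(1) envD[of s] by (simp add: holds_def base_def)
  define t1 where "t1 = min (t0 + Wn) (nl - 1)"
  define s2 where "s2 = set_reg ''hj'' (real t1) (set_reg ''lj'' (real t0) s1)"
  define J where "J i s' \<longleftrightarrow> (\<exists>a b. reg s' ''lj'' = real a \<and> reg s' ''hj'' = real b \<and> bracket s nl M e t0 \<rho> (reg s' ''best'') a b \<and>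
     (b - a \<le> 2 ^ (KW - i)) \<and> improves (reg s ''best'') (reg s' ''best'') \<and> witness Q s' \<and>
     same (insert ''lo'' (insert ''hi'' (insert ''mi'' (insert ''bx'' (insert ''lj'' (insert ''hj'' (wr Lookup))))))) {} s s')" for i s'
  have loop: "wp \<omega> AA (While (Less (R ''lj'' \<oplus> Const 1) (R ''hj'')) Lookup) (\<lambda>T s'. T \<le> KW * ((17 * DD + 5 * KM + 31) + 1) + 1 \<and> (\<exists>i\<le>KW. J i s') \<and>
     \<not> bval (Less (R ''lj'' \<oplus> Const 1) (R ''hj'')) (reg s')) s'" if "J 0 s'" for s'
  proof (rule wp_While)
    show "J 0 s'" by fact
    fix i s' assume J: "J i s'" and bv: "bval (Less (R ''lj'' \<oplus> Const 1) (R ''hj'')) (reg s')"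
    then obtain a b where ab: "reg s' ''lj'' = real a" "reg s' ''hj'' = real b" "bracket s nl M e t0 \<rho> (reg s' ''best'') a b" "b - a \<le> 2 ^ (KW - i)"
      "improves (reg s ''best'') (reg s' ''best'')" "witness Q s'" and
      sm': "same (insert ''lo'' (insert ''hi'' (insert ''mi'' (insert ''bx'' (insert ''lj'' (insert ''hj'' (wr Lookup))))))) {} s s'" unfolding J_def by blast
    have lt: "a + 1 < b" using bv ab by simp
    have i: "i < KW"
    proof (rule ccontr)
      assume "\<not> i < KW" then show False using ab(4) lt by simp
    qed
    then have pow: "2 ^ (KW - i) = 2 * (2::nat) ^ (KW - Suc i)" by (metis Suc_diff_Suc power_Suc)
    define t where "t = (a + b) div 2"
    have t: "a < t" "t < b" "b - t \<le> 2 ^ (KW - Suc i)" "t - a \<le> 2 ^ (KW - Suc i)" using lt ab(4) unfolding pow t_def by linarith+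
    have bn: "b \<le> nl - 1" "t < nl" using ab(3) t nl(1) by (auto simp: bracket_def)
    have h: "holds Q e s'" by (rule holds_same[OF s(1) sm']) (auto simp: PN_def)
    have d: "db s' p nl M q" by (rule db_same[OF s(2) sm']) auto
    have sgs: "sg s' = sg s" by (rule sg_same[OF sm']) simp
    have b0: "0 \<le> reg s' ''best''" using ab(5) by (simp add: improves_def)
    have "wp \<omega> AA Lookup (\<lambda>T s''. T \<le> 17 * DD + 5 * KM + 31 \<and> J (Suc i) s'') s'"
    proof (rule wp_same[OF wp_Lookup[OF h d ab(6) b0 ab(1,2)]], goal_cases)
      case (3 T s'')
      have sm'': "same (insert ''lo'' (insert ''hi'' (insert ''mi'' (insert ''bx'' (insert ''lj'' (insert ''hj'' (wr Lookup))))))) {} s s''"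
        by (rule same_trans[OF sm' 3(2)]) auto
      have imp: "improves (reg s ''best'') (reg s'' ''best'')" using ab(5) 3(1) improves_trans by blast
      have le: "reg s'' ''best'' \<le> reg s' ''best''" using 3(1) b0 by (simp add: improves_def)
      from 3(1) consider "reg s'' ''lj'' = real t" "reg s'' ''hj'' = real b" "reg s'' ''best'' \<le> sg s t * (1 + 2 / real HH)"
        | "reg s'' ''lj'' = real a" "reg s'' ''hj'' = real t" "fails Q s' M e t" unfolding t_def sgs by blast
      then have "J (Suc i) s''"
      proof cases
        case 1
        have "bracket s nl M e t0 \<rho> (reg s'' ''best'') t b" using ab(3) 1(3) le t bn unfolding bracket_def by auto
        then show ?thesis unfolding J_def using 1 t imp sm'' 3(1) by blast
      next
        case 2
        have "fails Q s M e t" using 2(3) same_arr[OF sm'] by (simp add: fails_def sgs)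
        then have "bracket s nl M e t0 \<rho> (reg s'' ''best'') a t" using ab(3) le t bn unfolding bracket_def by auto
        then show ?thesis unfolding J_def using 2 t imp sm'' 3(1) by blast
      qed
      then show ?case using 3 by simp
    qed (use bn lt in auto)
    then show "i < KW \<and> wp \<omega> AA Lookup (\<lambda>T s''. T \<le> 17 * DD + 5 * KM + 31 \<and> J (Suc i) s'') s'" using i by simp
  qed
  have main: "wp \<omega> AA (While (Less (R ''lj'' \<oplus> Const 1) (R ''hj'')) Lookup) (\<lambda>T s'. T \<le> KW * (17 * DD + 5 * KM + 32) + 1 \<and>
    improves (reg s ''best'') (reg s' ''best'') \<and> witness Q s' \<and> refined s nl M e \<rho> (reg s' ''best'')) s'" if "J 0 s'" for s'
  proof (rule wp_mono[OF loop[OF that]], elim conjE exE)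
    fix T s' i assume *: "T \<le> KW * ((17 * DD + 5 * KM + 31) + 1) + 1" "J i s'" "\<not> bval (Less (R ''lj'' \<oplus> Const 1) (R ''hj'')) (reg s')"
    then obtain a b where ab: "reg s' ''lj'' = real a" "reg s' ''hj'' = real b" "bracket s nl M e t0 \<rho> (reg s' ''best'') a b"
      "improves (reg s ''best'') (reg s' ''best'')" "witness Q s'" unfolding J_def by blast
    have "b \<le> a + 1" using *(3) ab by simp
    then have "refined s nl M e \<rho> (reg s' ''best'')" unfolding refined_def using t0(2) cut ab(3) by blast
    then show "T \<le> KW * (17 * DD + 5 * KM + 32) + 1 \<and>
      improves (reg s ''best'') (reg s' ''best'') \<and> witness Q s' \<and> refined s nl M e \<rho> (reg s' ''best'')" using * ab by (simp add: add.commute add.left_commute)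
  qed
  have J0: "J 0 s'" if "reg s' ''lj'' = real t0" "reg s' ''hj'' = real t1" "\<And>x. x \<notin> {''lj'', ''hj'', ''lo'', ''hi'', ''mi'', ''bx''} \<Longrightarrow> reg s' x = reg s x" "arr s' = arr s" for s'
    unfolding J_def
  proof (rule exI[of _ t0], rule exI[of _ t1], intro conjI)
    show "bracket s nl M e t0 \<rho> (reg s' ''best'') t0 t1" using that s(5) by (simp add: bracket_def t1_def)
    show "t1 - t0 \<le> 2 ^ (KW - 0)" using KW by (simp add: t1_def)
    show "witness Q s'" by (rule witness_cong[OF s(3)]) (use that in auto)
  qed (use that s(4) in \<open>simp_all add: improves_def same_def\<close>)
  have arr1: "arr s1 = arr s" using sm by (simp add: same_def fun_eq_iff)
  have n1: "real nl - 1 = real (nl - 1)" using nl by (simp add: of_nat_diff)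
  have s1x: "reg s1 x = reg s x" if "x \<notin> {''lo'', ''hi'', ''mi'', ''bx''}" for x using same_reg[OF sm that] .
  show ?case
  proof (cases "nl - 1 < t0 + Wn")
    case True
    then have t1: "t1 = nl - 1" by (simp add: t1_def)
    have rt1: "real t1 = real nl - 1" unfolding t1 n1 ..
    have "real nl - 1 < real t0 + real Wn" using True unfolding n1 by (metis of_nat_add of_nat_less_iff)
    moreover have "J 0 (set_reg ''hj'' (real nl - 1) (set_reg ''hj'' (real t0 + real Wn) (set_reg ''lj'' (real t0) s1)))"
      by (rule J0) (simp_all add: rt1 arr1 s1x)
    note m = main[OF this]
    ultimately show ?thesis using t0(1,3) nl(2) Wn
      by (simp add: wpx cong: wp_weak) (rule wp_mono_eq[OF m], simp_all)
  next
    case False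
    then have t1: "t1 = t0 + Wn" by (simp add: t1_def)
    have "\<not> real nl - 1 < real t0 + real Wn" using False unfolding n1 by (metis of_nat_add of_nat_less_iff)
    moreover have "J 0 (set_reg ''hj'' (real t0 + real Wn) (set_reg ''lj'' (real t0) s1))"
      by (rule J0) (simp_all add: t1 arr1 s1x)
    note m = main[OF this]
    ultimately show ?thesis using t0(1,3) nl(2) Wn
      by (simp add: wpx cong: wp_weak) (rule wp_mono_eq[OF m], simp_all)
  qed
qed (use s in auto)

text \<open>The two neighbours of the query on the line, with indices clamped so that at either end
  of the line both are the same point.\<close>

definition near1 :: "state \<Rightarrow> (nat \<Rightarrow> nat) \<Rightarrow> nat \<Rightarrow> real \<Rightarrow> bool" where
  "near1 s p e \<rho> \<longleftrightarrow> (\<exists>l\<le>NN. (\<forall>i<l. prj (pt (p i)) < prj (qv Q e)) \<and> (\<forall>i. l \<le> i \<longrightarrow> i < NN \<longrightarrow> prj (qv Q e) \<le> prj (pt (p i))) \<and>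
     \<rho> = min (dq Q e (p (min l (NN - 1)))) (dq Q e (p (l - 1))))"

lemma wp_Second:
  assumes s: "holds Q e s" "db s p nl M q" "witness Q s" "0 \<le> reg s ''best''" "reg s ''best'' \<le> \<rho>" "reg s ''rho'' = \<rho>" "reg s ''row'' = real r" "r < NN"
  shows "wp \<omega> AA Second (\<lambda>T s'. T \<le> 12 * DD + 10 + (5 * KM + 10 + KW * (17 * DD + 5 * KM + 32)) \<and> improves (reg s ''best'') (reg s' ''best'') \<and> witness Q s' \<and>
    refined s nl M e (min \<rho> (dq Q e r)) (reg s' ''best'')) s"
  unfolding Second_def
proof (rule wp_SeqS[OF wp_Update[OF s(1,7,8,3)]], goal_cases)
  case (1 T1 s1)
  define s2 where "s2 = set_reg ''nr'' (- min \<rho> (dq Q e r)) (set_reg ''rho'' (min \<rho> (dq Q e r)) s1)"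
  have sm1: "same (wr Update) (wa Update) s s1" using 1 by simp
  have sm2: "same (insert ''nr'' (insert ''rho'' (wr Update))) {} s s2" using sm1 by (auto simp: same_def s2_def)
  have h2: "holds Q e s2" by (rule holds_same[OF s(1) sm2]) (auto simp: PN_def)
  have d2: "db s2 p nl M q" by (rule db_same[OF s(2) sm2]) auto
  have w2: "witness Q s2" by (rule witness_cong[of Q s1]) (use 1 in \<open>auto simp: s2_def\<close>)
  have b2: "0 \<le> reg s2 ''best''" "reg s2 ''best'' \<le> min \<rho> (dq Q e r)" "improves (reg s ''best'') (reg s2 ''best'')"
    using 1 s(4,5) by (auto simp: s2_def improves_def)
  have rf: "refined s2 nl M e \<rho>' b = refined s nl M e \<rho>' b" for \<rho>' b
    by (rule refined_eq) (use sg_same[OF sm2] same_arr[OF sm2] in \<open>auto simp: fails_def\<close>)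
  have main: "wp \<omega> AA Refine (\<lambda>T s'. T1 + T + 3 \<le> 12 * DD + 10 + (5 * KM + 10 + KW * (17 * DD + 5 * KM + 32)) \<and> improves (reg s ''best'') (reg s' ''best'') \<and> witness Q s' \<and>
    refined s nl M e (min \<rho> (dq Q e r)) (reg s' ''best'')) s3" if "s3 = s2" for s3
    unfolding that
  proof (rule wp_mono[OF wp_Refine[OF h2 d2 w2 b2(1,2)]], goal_cases)
    case (2 T s')
    then show ?case using conjunct1[OF 1(1)] improves_trans[OF b2(3)] by (simp add: rf)
  qed (simp add: s2_def)
  have r1: "reg s1 ''rho'' = \<rho>" using same_reg[OF sm1] s by simp
  show ?case
  proof (cases "dq Q e r < \<rho>")
    case True
    have "set_reg ''nr'' (- dq Q e r) (set_reg ''rho'' (dq Q e r) s1) = s2" using True by (simp add: s2_def)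
    note m = main[OF this]
    show ?thesis using 1 r1 True by (simp add: wpx cong: wp_weak, intro wp_mono_eq[OF m]) auto
  next
    case False
    have "set_reg ''rho'' \<rho> s1 = s1" unfolding r1[symmetric] by (simp add: set_reg_def)
    then have "set_reg ''nr'' (- \<rho>) s1 = s2" using False by (simp add: s2_def)
    note m = main[OF this]
    show ?thesis using 1 r1 False by (simp add: wpx cong: wp_weak, intro wp_mono_eq[OF m]) auto
  qed
qed

lemma wp_Search:
  assumes s: "holds Q e s" "db s p nl M q" "witness Q s"
  shows "wp \<omega> AA Search (\<lambda>T s'. T \<le> TS \<and> improves (reg s ''best'') (reg s' ''best'') \<and> witness Q s' \<and>
    (\<exists>\<rho>. near1 s p e \<rho> \<and> refined s nl M e \<rho> (reg s' ''best''))) s"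
proof -
  have sp: "sorted_pts s p" using s(2) by (simp add: db_def)
  have b: "base s" using s(1) by (simp add: holds_def)
  note ev = envD[OF baseD(1)[OF b]]
  define s1 where "s1 = set_reg ''acc'' 0 s"
  have "wp \<omega> AA SearchBody (\<lambda>T s'. T + 1 \<le> TS \<and> improves (reg s ''best'') (reg s' ''best'') \<and> witness Q s' \<and>
    (\<exists>\<rho>. near1 s p e \<rho> \<and> refined s nl M e \<rho> (reg s' ''best''))) s1"
    unfolding SearchBody_def
  proof (rule wp_SeqI[OF wp_Dot[of s1 DD AA _ "\<lambda>x. x"]], goal_cases)
    case (4 T1 s2)
    have sm2: "same {''dc'', ''x'', ''y'', ''acc''} {} s1 s2" using 4 by simp
    have acc: "reg s2 ''acc'' = prj (qv Q e)"
    proof -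
      have "(\<Sum>i<DD. arr s ''u'' i * arr s ''q'' i) = prj (qv Q e)"
        unfolding prj_def using s(1) by (intro sum.cong) (auto simp: holds_def base_def us_def)
      then show ?thesis using 4 by (simp add: s1_def)
    qed
    define s3 where "s3 = set_reg ''pq'' (prj (qv Q e)) s2"
    have sm3: "same {''dc'', ''x'', ''y'', ''acc'', ''pq''} {} s s3" using sm2 by (auto simp: same_def s1_def s3_def)
    have sp3: "sorted_pts s3 p" by (rule sorted_pts_same[OF sp sm3]) auto
    have "wp \<omega> AA Locate (\<lambda>T s'. T1 + (1 + T) + 1 \<le> TS \<and> improves (reg s ''best'') (reg s' ''best'') \<and> witness Q s' \<and>
      (\<exists>\<rho>. near1 s p e \<rho> \<and> refined s nl M e \<rho> (reg s' ''best''))) s3"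
      unfolding Locate_def
    proof (rule wp_SeqI[OF wp_Binary_Search[of s3 "''N''" NN AA KM]], goal_cases)
      case 1 then show ?case using ev same_reg[OF sm3] by simp
    next
      case 2 then show ?case using AA_bounds by simp
    next
      case 3 then show ?case using KM_bounds by simp
    next
      case (6 i j) then show ?case using sp3 unfolding sorted_pts_def by blast
    next
      case (7 T2 s4)
      then obtain l where l: "T2 \<le> 5 * KM + 3" "l \<le> NN" "reg s4 ''lo'' = real l" "\<forall>i<l. arr s3 ''XS'' i < reg s3 ''pq''" "\<forall>i. l \<le> i \<longrightarrow> i < NN \<longrightarrow> reg s3 ''pq'' \<le> arr s3 ''XS'' i"
        and sm4: "same {''lo'', ''hi'', ''mi'', ''bx''} {} s3 s4" by blast
      have sm4': "same {''dc'', ''x'', ''y'', ''acc'', ''pq'', ''lo'', ''hi'', ''mi'', ''bx''} {} s s4" by (rule same_trans[OF sm3 sm4]) auto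
      have XS: "\<And>i. i < NN \<Longrightarrow> arr s3 ''XS'' i = prj (pt (p i))" and S4: "\<And>i. i < NN \<Longrightarrow> arr s4 ''S'' i = real (p i)" and pN: "\<And>i. i < NN \<Longrightarrow> p i < NN"
        using sp3 same_arr[OF sm4, of "''S''"] by (auto simp: sorted_pts_def bij_betw_def)
      have pq: "reg s3 ''pq'' = prj (qv Q e)" by (simp add: s3_def)
      have cut: "\<forall>i<l. prj (pt (p i)) < prj (qv Q e)" "\<forall>i. l \<le> i \<longrightarrow> i < NN \<longrightarrow> prj (qv Q e) \<le> prj (pt (p i))"
        using l(2,4,5) XS pq by auto
      define i1 where "i1 = min l (NN - 1)"
      define i2 where "i2 = l - 1"
      have i: "i1 < NN" "i2 < NN" using l(2) NN_ge by (auto simp: i1_def i2_def)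
      define \<rho> where "\<rho> = min (dq Q e (p i1)) (dq Q e (p i2))"
      have n1: "near1 s p e \<rho>" unfolding near1_def using l(2) cut by (intro exI[of _ l]) (simp add: \<rho>_def i1_def i2_def)
      have r4: "reg s4 ''N'' = real NN" "reg s4 ''N1'' = real (NN - 1)" "reg s4 ''best'' = reg s ''best''" "reg s4 ''out'' = reg s ''out''" using same_reg[OF sm4'] ev by auto
      have first: "wp \<omega> AA First (\<lambda>T s'. T + T1 + T2 + 7 \<le> TS \<and> improves (reg s ''best'') (reg s' ''best'') \<and> witness Q s' \<and>
        (\<exists>\<rho>. near1 s p e \<rho> \<and> refined s nl M e \<rho> (reg s' ''best''))) s5"
        if s5: "reg s5 ''row'' = real (p i1)" "same {''dc'', ''x'', ''y'', ''acc'', ''pq'', ''lo'', ''hi'', ''mi'', ''bx'', ''po'', ''row''} {} s s5" "reg s5 ''lo'' = real l" for s5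
      proof -
        have h5: "holds Q e s5" by (rule holds_same[OF s(1) s5(2)]) (auto simp: PN_def)
        have w5: "witness Q s5" by (rule witness_cong[OF s(3)]) (use same_reg[OF s5(2)] in auto)
        show ?thesis unfolding First_def
        proof (rule wp_SeqS[OF wp_Update[OF h5 s5(1) pN[OF i(1)] w5]], goal_cases)
          case (1 T3 s6)
          have sm6: "same (wr Update) (wa Update) s5 s6" using 1 by simp
          define s7 where "s7 = set_reg ''row'' (real (p i2)) (set_reg ''po'' (real i2) (set_reg ''rho'' (dq Q e (p i1)) s6))"
          have sm7: "same ({''dc'', ''x'', ''y'', ''acc'', ''pq'', ''lo'', ''hi'', ''mi'', ''bx'', ''po'', ''row'', ''rho''} \<union> wr Update) {} s s7"
            using s5(2) sm6 by (auto simp: same_def s7_def)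
          have h7: "holds Q e s7" by (rule holds_same[OF s(1) sm7]) (auto simp: PN_def)
          have d7: "db s7 p nl M q" by (rule db_same[OF s(2) sm7]) auto
          have w7: "witness Q s7" by (rule witness_cong[of Q s6]) (use 1 in \<open>auto simp: s7_def\<close>)
          have b5: "reg s5 ''best'' = reg s ''best''" using same_reg[OF s5(2)] by simp
          have b7: "0 \<le> reg s7 ''best''" "reg s7 ''best'' \<le> dq Q e (p i1)" "improves (reg s ''best'') (reg s7 ''best'')"
            using 1 b5 by (auto simp: s7_def improves_def)
          have rf: "refined s7 nl M e \<rho>' b = refined s nl M e \<rho>' b" for \<rho>' b
            by (rule refined_eq) (use sg_same[OF sm7] same_arr[OF sm7] in \<open>auto simp: fails_def\<close>)
          have T: "T3 + T1 + T2 + (12 * DD + 10 + (5 * KM + 10 + KW * (17 * DD + 5 * KM + 32))) + 12 \<le> TS"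
            using 1 4 l(1) by (simp add: TS_def)
          have main: "wp \<omega> AA Second (\<lambda>T s'. T3 + T + 4 + T1 + T2 + 7 \<le> TS \<and> improves (reg s ''best'') (reg s' ''best'') \<and> witness Q s' \<and>
            (\<exists>\<rho>. near1 s p e \<rho> \<and> refined s nl M e \<rho> (reg s' ''best''))) s7"
          proof (rule wp_mono[OF wp_Second[OF h7 d7 w7 b7(1,2), of "p i2"]], goal_cases)
            case (4 T4 s8)
            have "improves (reg s ''best'') (reg s8 ''best'')" using b7(3) 4 improves_trans by blast
            moreover have "refined s nl M e \<rho> (reg s8 ''best'')" using 4 rf by (simp add: \<rho>_def)
            ultimately show ?case using 4 T n1 by auto
          qed (use pN i in \<open>auto simp: s7_def\<close>)
          have lo6: "reg s6 ''lo'' = real l" using same_reg[OF sm6] s5(3) by simp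
          have S6: "arr s6 ''S'' i2 = real (p i2)"
            using same_arr[OF sm6, of "''S''"] same_arr[OF s5(2), of "''S''"] same_arr[OF sm4', of "''S''"] S4[OF i(2)] by simp
          have i2A: "i2 < AA" using i AA_bounds by simp
          have ad: "addr (R ''po'') s'' = i2" if "reg s'' ''po'' = real i2" for s'' using that by (intro addrI) simp
          show ?case
          proof (cases "0 < l")
            case True
            then have "real l - 1 = real i2" by (simp add: i2_def of_nat_diff)
            then show ?thesis using 1 True lo6 S6 i2A
              by (simp add: wpx ad cong: wp_weak, intro wp_mono_eq[OF main]) (auto simp: s7_def)
          next
            case False
            then have "i2 = 0" by (simp add: i2_def)
            then show ?thesis using 1 False lo6 S6 i2A ad
              by (simp add: wpx cong: wp_weak, intro wp_mono_eq[OF main]) (auto simp: s7_def)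
          qed
        qed
      qed
      have i1A: "i1 < AA" using i AA_bounds by simp
      have ad: "addr (R ''po'') s'' = i1" if "reg s'' ''po'' = real i1" for s'' using that by (intro addrI) simp
      show ?case
      proof (cases "l < NN")
        case True
        then have i1: "i1 = l" by (simp add: i1_def)
        have "wp \<omega> AA First (\<lambda>T s'. T + T1 + T2 + 7 \<le> TS \<and> improves (reg s ''best'') (reg s' ''best'') \<and> witness Q s' \<and>
          (\<exists>\<rho>. near1 s p e \<rho> \<and> refined s nl M e \<rho> (reg s' ''best''))) (set_reg ''row'' (real (p i1)) (set_reg ''po'' (real i1) s4))"
          by (rule first) (use sm4' l(3) in \<open>auto simp: same_def\<close>)
        note m = this
        show ?thesis using True l(3) r4 i1A S4[OF i(1)] ad i1
          by (simp add: wpx cong: wp_weak, intro wp_mono_eq[OF m]) auto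
      next
        case False
        then have i1: "i1 = NN - 1" "l = NN" using l(2) by (auto simp: i1_def)
        have "wp \<omega> AA First (\<lambda>T s'. T + T1 + T2 + 7 \<le> TS \<and> improves (reg s ''best'') (reg s' ''best'') \<and> witness Q s' \<and>
          (\<exists>\<rho>. near1 s p e \<rho> \<and> refined s nl M e \<rho> (reg s' ''best''))) (set_reg ''row'' (real (p i1)) (set_reg ''po'' (real i1) (set_reg ''po'' (real l) s4)))"
          by (rule first) (use sm4' l(3) in \<open>auto simp: same_def\<close>)
        note m = this
        show ?thesis using False l(3) r4 i1A S4[OF i(1)] ad i1
          by (simp add: wpx cong: wp_weak, intro wp_mono_eq[OF m]) auto
      qed
    qed (auto)
    note m = this
    show ?case using acc by (simp add: wpx cong: wp_weak, intro wp_mono_eq[OF m]) (auto simp: s3_def)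
  qed (use ev AA_bounds in \<open>auto simp: s1_def\<close>)
  note m = this
  show ?thesis unfolding Search_def by (simp add: wpx cong: wp_weak, intro wp_mono_eq[OF m]) (auto simp: s1_def)
qed

end


section \<open>All expansions of the query\<close>

definition "TX = (if k < nV then TS else NN * (12 * DD + 9) + 2)"
definition "TQ = E4 * (13 * DD + 7 + TX) + 5"

context
  fixes Q :: curve
begin

text \<open>Here \<open>b'\<close> is the best distance right after expansion \<open>e\<close> has
  been searched; later expansions can only lower it to \<open>b\<close>.\<close>

definition covers :: "state \<Rightarrow> (nat \<Rightarrow> nat) \<Rightarrow> nat \<Rightarrow> nat \<Rightarrow> nat \<Rightarrow> real \<Rightarrow> bool" where
  "covers s p nl M e b \<longleftrightarrow> (if k < nV then \<exists>\<rho> b'. near1 Q s p e \<rho> \<and> refined Q s nl M e \<rho> b' \<and> b \<le> b' else \<forall>r<NN. b \<le> dq Q e r)"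

lemma covers_mono: "covers s p nl M e b \<Longrightarrow> b' \<le> b \<Longrightarrow> covers s p nl M e b'"
  unfolding covers_def by (auto split: if_splits intro: order_trans)

lemma covers_same: "same X Y s s' \<Longrightarrow> Y \<inter> {''LK'', ''DK'', ''DV''} = {} \<Longrightarrow> covers s' p nl M e b = covers s p nl M e b"
proof -
  assume *: "same X Y s s'" "Y \<inter> {''LK'', ''DK'', ''DV''} = {}"
  have "sg s' = sg s" by (rule sg_same[OF *(1)]) (use * in auto)
  then have "refined Q s' nl M e \<rho> b = refined Q s nl M e \<rho> b" for \<rho> b
    by (rule refined_eq) (use same_arr[OF *(1)] * \<open>sg s' = sg s\<close> in \<open>auto simp: fails_def\<close>)
  then show ?thesis by (simp add: covers_def near1_def)
qed

lemma wp_Scan: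
  assumes s: "holds Q e s" "witness Q s"
  shows "wp \<omega> AA (For ''row'' ''N'' Update) (\<lambda>T s'. T \<le> NN * (12 * DD + 9) + 2 \<and> improves (reg s ''best'') (reg s' ''best'') \<and> witness Q s' \<and>
    (\<forall>r<NN. reg s' ''best'' \<le> dq Q e r)) s"
proof (rule wp_For[where n=NN and T="12 * DD + 7" and I="\<lambda>j s'. (0 < j \<longrightarrow> 0 \<le> reg s' ''best'') \<and> (0 \<le> reg s ''best'' \<longrightarrow> reg s' ''best'' \<le> reg s ''best'' \<and> 0 \<le> reg s' ''best'') \<and>
    witness Q s' \<and> (\<forall>r<j. reg s' ''best'' \<le> dq Q e r)"], goal_cases)
  case 1 then show ?case using s(1) envD[of s] by (simp add: holds_def base_def)
next
  case 5 then show ?case using witness_cong[OF s(2), of "set_reg ''row'' 0 s"] by simp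
next
  case (6 j s')
  have h: "holds Q e s'" by (rule holds_same[OF s(1) 6(4)]) (auto simp: PN_def)
  show ?case
  proof (rule wp_mono[OF wp_Update[OF h 6(3,1)]], goal_cases)
    case 1 then show ?case using 6 by simp
  next
    case (2 T s'')
    have w: "witness Q (set_reg ''row'' (real j + 1) s'')" by (rule witness_cong[of Q s'']) (use 2 in auto)
    have l: "\<forall>r<Suc j. reg s'' ''best'' \<le> dq Q e r"
    proof (intro allI impI)
      fix r assume "r < Suc j"
      then show "reg s'' ''best'' \<le> dq Q e r"
      proof (cases "r = j")
        case False
        then have "reg s' ''best'' \<le> dq Q e r" "0 \<le> reg s' ''best''" using 6(2) \<open>r < Suc j\<close> by auto
        then show ?thesis using 2 by (auto simp: improves_def)
      qed (use 2 in simp)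
    qed
    show ?case using 6(2) 2 w l by (auto simp: improves_def)
  qed
next
  case (7 T s')
  then show ?case using NN_ge by (auto simp: improves_def algebra_simps)
qed auto

lemma wp_QueryStep:
  assumes Q: "is_curve d Q" "length Q \<le> m"
    and s: "base s" "e < E4" "k < nV \<Longrightarrow> db s p nl M q" "reg s ''E'' = real e - real E4" "reg s ''off'' = 0" "reg s ''ln'' = real (length Q)"
      "arr s ''Q'' = array_of (concat Q)" "witness Q s"
  shows "wp \<omega> AA QueryStep (\<lambda>T s'. T \<le> 13 * DD + 4 + TX \<and> improves (reg s ''best'') (reg s' ''best'') \<and> witness Q s' \<and>
    covers s p nl M e (reg s' ''best'')) s"
  unfolding QueryStep_def
proof (rule wp_SeqI[OF wp_Expand[of s LL d 0 "length Q" "int e - int E4"]], goal_cases)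
  case 6 then show ?case using Q by (auto simp: is_curve_def)
next
  case 7
  have "length Q * d \<le> m * d" using Q by simp
  also have "\<dots> \<le> DD" by (simp add: DD_def LL_def)
  finally show ?case using AA_bounds by simp
next
  case 8 then show ?case using AA_bounds by (simp add: DD_def)
next
  case (10 T1 s1)
  have sm: "same {''ix'', ''et'', ''ec'', ''x'', ''bt'', ''E''} {''q''} s s1" using 10 by blast
  have b1: "base s1" by (rule base_same[OF s(1) sm]) (auto simp: PN_def)
  have q1: "arr s1 ''q'' i = qv Q e i" if "i < DD" for i
  proof -
    have lQ: "0 < length Q" using Q by (auto simp: is_curve_def)
    have w: "walk (length Q) (int e - int E4) (i div d) < length Q" using lQ by (rule walk_less)
    have "arr s1 ''q'' (i div d * d + i mod d) = arr s ''Q'' ((0 + walk (length Q) (int e - int E4) (i div d)) * d + i mod d)"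
      using 10 index_split[OF that] by blast
    moreover have "length x = d" if "x \<in> set Q" for x using Q that by (auto simp: is_curve_def)
    note concat_nth_const[OF this w, of "i mod d"]
    ultimately show ?thesis using index_split[OF that] by (simp add: s(7) array_of_def qv_def expand_def)
  qed
  have h1: "holds Q e s1" using b1 s(2) q1 by (simp add: holds_def)
  have w1: "witness Q s1" by (rule witness_cong[OF s(8)]) (use same_reg[OF sm] in auto)
  have d1: "k < nV \<Longrightarrow> db s1 p nl M q" by (rule db_same[OF s(3) sm]) auto
  have r1: "reg s1 ''k'' = real k" "reg s1 ''n'' = real nV" "reg s1 ''best'' = reg s ''best''" using envD[of s1] b1 same_reg[OF sm] by (auto simp: base_def)
  have cv: "covers s1 p nl M e b = covers s p nl M e b" for b by (rule covers_same[OF sm]) auto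
  have T: "T1 \<le> 13 * DD + 3"
  proof -
    have "LL * (3 * (d + 3) + d) \<le> 13 * DD" using d by (simp add: DD_def algebra_simps)
    then show ?thesis using 10 by simp
  qed
  show ?case
  proof (cases "k < nV")
    case True
    have "wp \<omega> AA Search (\<lambda>T s'. T1 + (T + 1) \<le> 13 * DD + 4 + TX \<and> improves (reg s ''best'') (reg s' ''best'') \<and> witness Q s' \<and>
       covers s p nl M e (reg s' ''best'')) s1"
    proof (rule wp_mono[OF wp_Search[OF h1 d1[OF True] w1]], goal_cases)
      case (1 t s')
      then have "covers s1 p nl M e (reg s' ''best'')" using True by (auto simp: covers_def)
      then show ?case using 1 T True r1 cv by (simp add: TX_def)
    qed
    then show ?thesis using True r1 by (simp add: wpx cong: wp_weak)
  next
    case False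
    have "wp \<omega> AA (For ''row'' ''N'' Update) (\<lambda>T s'. T1 + (T + 1) \<le> 13 * DD + 4 + TX \<and> improves (reg s ''best'') (reg s' ''best'') \<and> witness Q s' \<and>
       covers s p nl M e (reg s' ''best'')) s1"
      by (rule wp_mono[OF wp_Scan[OF h1 w1]])
        (use T False r1 cv in \<open>auto simp: TX_def covers_def\<close>)
    then show ?thesis using False r1 by (simp add: wpx cong: wp_weak)
  qed
qed (use s envD[of s] in \<open>auto simp: base_def\<close>)

lemma wp_Query:
  assumes Q: "is_curve d Q" "length Q \<le> m" and s: "base s" "k < nV \<Longrightarrow> db s p nl M q"
  shows "wp \<omega> AA Query (\<lambda>T s'. T \<le> TQ \<and> (\<exists>b. (\<exists>r<NN. \<exists>e<E4. b = dq Q e r \<and> reg s' ''out'' = real (r div E4)) \<and>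
    (\<forall>e<E4. covers s p nl M e b))) (with_query Q s)"
proof -
  define s0 where "s0 = set_reg ''ln'' (real (length Q)) (set_reg ''off'' 0 (set_reg ''best'' (-1) (with_query Q s)))"
  have sm0: "same {''ln'', ''off'', ''best'', ''qlen''} {''Q''} s s0" by (simp add: same_def s0_def with_query_def)
  have b0: "base s0" by (rule base_same[OF s(1) sm0]) (auto simp: PN_def)
  let ?c = "Assign ''E'' (R ''e'' \<ominus> R ''E4'') ;; QueryStep"
  have "wp \<omega> AA (For ''e'' ''E4'' ?c) (\<lambda>T s'. 3 + T \<le> TQ \<and> (\<exists>b. (\<exists>r<NN. \<exists>e<E4. b = dq Q e r \<and> reg s' ''out'' = real (r div E4)) \<and>
    (\<forall>e<E4. covers s p nl M e b))) s0"
  proof (rule wp_For[where n=E4 and T="13 * DD + 5 + TX" and I="\<lambda>j s'. (0 < j \<longrightarrow> 0 \<le> reg s' ''best'') \<and> witness Q s' \<and>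
      (\<forall>e<j. covers s p nl M e (reg s' ''best''))"], goal_cases)
    case 1 then show ?case using envD[of s0] b0 by (simp add: base_def)
  next
    case 5 then show ?case by (simp add: witness_def s0_def)
  next
    case (6 j s')
    have sm: "same (insert ''qlen'' (insert ''ln'' (insert ''off'' (insert ''best'' (insert ''e'' (wr QueryStep)))))) {''q'', ''Q''} s s'"
      by (rule same_trans[OF sm0 6(4)]) auto
    define s1 where "s1 = set_reg ''E'' (real j - real E4) s'"
    have sm1: "same (insert ''qlen'' (insert ''ln'' (insert ''off'' (insert ''best'' (insert ''e'' (wr QueryStep)))))) {''q'', ''Q''} s s1"
      using sm by (auto simp: same_def s1_def)
    have b1: "base s1" by (rule base_same[OF s(1) sm1]) (auto simp: PN_def)
    have d1: "k < nV \<Longrightarrow> db s1 p nl M q" by (rule db_same[OF s(2) sm1]) auto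
    have w1: "witness Q s1" by (rule witness_cong[of Q s']) (use 6(2) in \<open>auto simp: s1_def\<close>)
    have r1: "reg s1 ''E'' = real j - real E4" "reg s1 ''off'' = 0" "reg s1 ''ln'' = real (length Q)" "arr s1 ''Q'' = array_of (concat Q)" "reg s1 ''best'' = reg s' ''best''"
      using same_reg[OF 6(4)] same_arr[OF 6(4)] by (auto simp: s1_def s0_def with_query_def)
    have cv: "covers s1 p nl M e b = covers s p nl M e b" for e b by (rule covers_same[OF sm1]) auto
    have "wp \<omega> AA QueryStep (\<lambda>T s''. 1 + T \<le> 13 * DD + 5 + TX \<and> (0 \<le> reg (set_reg ''e'' (real j + 1) s'') ''best'') \<and> witness Q (set_reg ''e'' (real j + 1) s'') \<and>
      (\<forall>e<Suc j. covers s p nl M e (reg (set_reg ''e'' (real j + 1) s'') ''best''))) s1"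
    proof (rule wp_mono[OF wp_QueryStep[OF Q b1 6(1) d1 r1(1-4) w1]], goal_cases)
      case (2 T s'')
      have w: "witness Q (set_reg ''e'' (real j + 1) s'')" by (rule witness_cong[of Q s'']) (use 2 in auto)
      have "covers s p nl M e (reg s'' ''best'')" if "e < Suc j" for e
      proof (cases "e = j")
        case True then show ?thesis using 2 cv by simp
      next
        case False
        then have e: "e < j" using that by simp
        then have "covers s p nl M e (reg s' ''best'')" "0 \<le> reg s' ''best''" using 6(2) by auto
        then show ?thesis using 2 r1(5) covers_mono[of s p nl M e "reg s' ''best''"] by (auto simp: improves_def)
      qed
      then show ?case using 2 w by (simp add: improves_def)
    qed
    note m = this
    have E4: "reg s' ''E4'' = real E4" using same_reg[OF sm, of "''E4''"] envD[of s] s(1) by (simp add: base_def)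
    show ?case using 6(3) E4 by (simp add: wpx cong: wp_weak, intro wp_mono_eq[OF m]) (auto simp: s1_def)
  next
    case (7 T s')
    have "0 < E4" using E4_ge by simp
    then have "\<exists>r<NN. \<exists>e<E4. reg s' ''best'' = dq Q e r \<and> reg s' ''out'' = real (r div E4)" using 7(2) by (auto simp: witness_def)
    then show ?case using 7 by (auto simp: TQ_def algebra_simps)
  qed auto
  note m = this
  show ?thesis unfolding Query_def
    by (simp add: wpx cong: wp_weak, intro wp_mono_eq[OF m]) (auto simp: s0_def with_query_def)
qed

end

end

section \<open>Correctness of the answer\<close>

lemma digits_exist:
  fixes f :: "nat \<Rightarrow> nat"
  assumes "\<And>i. i < n \<Longrightarrow> f i < b"
  shows "\<exists>a<b ^ n. \<forall>i<n. a div b ^ i mod b = f i"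
  using assms
proof (induction n arbitrary: f)
  case (Suc n)
  obtain a where a: "a < b ^ n" "\<forall>i<n. a div b ^ i mod b = f (Suc i)"
    using Suc.IH[of "\<lambda>i. f (Suc i)"] Suc.prems by auto
  have f0: "f 0 < b" using Suc.prems by simp
  have "f 0 + b * a < b * Suc a" using f0 by simp
  also have "\<dots> \<le> b * b ^ n" using a by (intro mult_le_mono2) simp
  finally have "f 0 + b * a < b ^ Suc n" by simp
  moreover have "(f 0 + b * a) div b ^ i mod b = f i" if "i < Suc n" for i
  proof (cases i)
    case (Suc i')
    have "(f 0 + b * a) div b ^ i = (f 0 + b * a) div b div b ^ i'" unfolding Suc by (simp add: div_mult2_eq)
    also have "(f 0 + b * a) div b = a" using f0 by simp
    finally show ?thesis using a Suc that by simp
  qed (use f0 in simp)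
  ultimately show ?case by blast
qed simp

context ann
begin

definition "dst x y = nrm d LL (\<lambda>i. x i - y i)"

lemma dst_nonneg: "0 \<le> dst x y"
  unfolding dst_def by (rule nrm_nonneg[OF LL_pos])

lemma dst_commute: "dst x y = dst y x"
  unfolding dst_def by (rule nrm_minus)

lemma dst_triangle: "dst x z \<le> dst x y + dst y z"
  unfolding dst_def by (rule nrm_diff_triangle[OF LL_pos])

text \<open>The three assumptions are what \<open>good_tapes\<close> provides; all that follows from
  them is deterministic.\<close>

context
  fixes Q :: curve
  assumes u01: "\<And>i. 0 \<le> fst (\<omega> i) \<and> fst (\<omega> i) \<le> 1"
    and sep: "\<And>z z'. z \<in> pt ` {..<NN} \<union> qv Q ` {..<E4} \<Longrightarrow> z' \<in> pt ` {..<NN} \<union> qv Q ` {..<E4} \<Longrightarrow>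
      dst z z' \<le> real De * \<bar>prj z - prj z'\<bar>"
    and inj: "\<And>v :: nat \<Rightarrow> int. (\<Sum>i<DD + 1. fst (\<omega> i) * real_of_int (v i)) = 0 \<Longrightarrow> (\<forall>c<DD + 1. v c = 0)"
begin

lemma dq_dst: "dq Q e r = dst (qv Q e) (pt r)"
  by (simp add: dq_def dst_def)

lemma prj_lipschitz: "\<bar>prj x - prj y\<bar> \<le> real DD * dst x y"
proof -
  have "\<bar>prj x - prj y\<bar> = \<bar>\<Sum>i<DD. fst (\<omega> i) * (x i - y i)\<bar>"
    by (simp add: prj_def sum_subtractf right_diff_distrib)
  also have "\<dots> \<le> (\<Sum>i<DD. \<bar>fst (\<omega> i) * (x i - y i)\<bar>)" by (rule sum_abs)
  also have "\<dots> \<le> (\<Sum>i<DD. dst x y)"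
  proof (rule sum_mono)
    fix i assume "i \<in> {..<DD}"
    then have "\<bar>x i - y i\<bar> \<le> dst x y" unfolding dst_def using abs_le_nrm[of i LL d "\<lambda>i. x i - y i"] by (simp add: DD_def)
    then have "\<bar>fst (\<omega> i)\<bar> * \<bar>x i - y i\<bar> \<le> 1 * dst x y" using u01[of i] by (intro mult_mono) auto
    then show "\<bar>fst (\<omega> i) * (x i - y i)\<bar> \<le> dst x y" by (simp add: abs_mult)
  qed
  finally show ?thesis by simp
qed

text \<open>Equal keys give a vanishing integer combination of \<open>DD + 1\<close> variates, the
  last of which belongs to the scale index.\<close>

lemma key_inj: assumes "key t z = key t' z'" shows "\<forall>i<DD. z i = z' i"
proof -
  define v where "v i = (if i = DD then int t - int t' else z i - z' i)" for i
  have "(\<Sum>i<DD + 1. fst (\<omega> i) * real_of_int (v i)) = fst (\<omega> DD) * (real t - real t') + (\<Sum>i<DD. fst (\<omega> i) * real_of_int (z i - z' i))"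
    by (simp add: v_def)
  also have "\<dots> = 0" using assms by (simp add: key_def right_diff_distrib sum_subtractf)
  finally have v: "\<forall>c<DD + 1. v c = 0" by (rule inj)
  show ?thesis
  proof (intro allI impI)
    fix i assume "i < DD"
    then show "z i = z' i" using v[rule_format, of i] by (simp add: v_def)
  qed
qed

text \<open>Rounding moves each coordinate by at most the side of a cell, and \<open>d\<close>
  coordinates enter a block.\<close>

lemma corner_zq:
  assumes "0 < \<sigma>"
  shows "dst (corner \<sigma> (zq Q e \<sigma>)) (qv Q e) \<le> \<sigma> / real HH"
proof -
  have dH: "0 < real (d * HH)" using d HH_pos by simp
  have "nrm d LL (\<lambda>i. corner \<sigma> (zq Q e \<sigma>) i - qv Q e i) \<le> real d * (\<sigma> / real (d * HH))"
  proof (rule nrm_le_max[OF LL_pos])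
    fix i
    define w where "w = \<sigma> / real (d * HH)"
    have w: "0 < w" using assms dH by (simp add: w_def)
    have "qv Q e i / w - 1 \<le> real_of_int (zq Q e \<sigma> i)" "real_of_int (zq Q e \<sigma> i) \<le> qv Q e i / w"
      unfolding zq_def w_def by linarith+
    then have "w * (qv Q e i / w - 1) \<le> w * real_of_int (zq Q e \<sigma> i)" "w * real_of_int (zq Q e \<sigma> i) \<le> w * (qv Q e i / w)"
      using w by (simp_all only: mult_left_mono less_imp_le)
    then show "\<bar>corner \<sigma> (zq Q e \<sigma>) i - qv Q e i\<bar> \<le> \<sigma> / real (d * HH)"
      unfolding corner_def w_def[symmetric] using w by (simp add: right_diff_distrib)
  qed
  also have "real d * (\<sigma> / real (d * HH)) = \<sigma> / real HH" using d by simp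
  finally show ?thesis by (simp add: dst_def)
qed

lemma corner_cong: "\<forall>i<DD. z i = z' i \<Longrightarrow> dst (corner \<sigma> z) x = dst (corner \<sigma> z') x"
  unfolding dst_def by (rule nrm_cong) (simp add: corner_def DD_def)

lemma near_dst: "near \<sigma> r z \<longleftrightarrow> dst (corner \<sigma> z) (pt r) \<le> \<sigma> * (1 + 1 / real HH)"
  by (simp add: near_def dst_def)

text \<open>Coordinates that differ by at most \<open>\<sigma>\<close> differ by at most
  \<open>d * HH\<close> sides, so the offsets of the query's cell are among the enumerated
  digits.\<close>

lemma cel_surj:
  assumes \<sigma>: "0 < \<sigma>" and r: "dq Q e r \<le> \<sigma>"
  shows "\<exists>a<BD. \<forall>i<DD. cel \<sigma> r a i = zq Q e \<sigma> i"
proof -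
  define w where "w = \<sigma> / real (d * HH)"
  define N where "N = d * HH"
  have dH: "0 < real N" using d HH_pos by (simp add: N_def)
  have w: "0 < w" "\<sigma> = w * real N" unfolding w_def N_def[symmetric] using \<sigma> dH by simp_all
  define f where "f i = nat (zq Q e \<sigma> i - \<lfloor>pt r i / w\<rfloor> + int (N + 1))" for i
  have f: "f i < bb \<and> int (f i) = zq Q e \<sigma> i - \<lfloor>pt r i / w\<rfloor> + int (N + 1)" if "i < DD" for i
  proof -
    have "\<bar>qv Q e i - pt r i\<bar> \<le> w * real N"
      using abs_le_nrm[of i LL d "\<lambda>i. qv Q e i - pt r i"] that r w by (simp add: DD_def dq_def)
    then have "qv Q e i \<le> pt r i + w * real N" "pt r i \<le> qv Q e i + w * real N" by linarith+
    then have "qv Q e i / w \<le> (pt r i + w * real N) / w" "pt r i / w \<le> (qv Q e i + w * real N) / w"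
      using w by (auto intro!: divide_right_mono)
    then have "qv Q e i / w \<le> pt r i / w + real N" "pt r i / w \<le> qv Q e i / w + real N"
      using w by (auto simp: add_divide_distrib)
    then have "zq Q e \<sigma> i - \<lfloor>pt r i / w\<rfloor> \<le> int N" "\<lfloor>pt r i / w\<rfloor> - zq Q e \<sigma> i \<le> int N"
      unfolding zq_def w_def[symmetric] by linarith+
    then show ?thesis by (auto simp: f_def bb_def N_def[symmetric])
  qed
  obtain a where a: "a < bb ^ DD" "\<forall>i<DD. a div bb ^ i mod bb = f i" using digits_exist[of DD f bb] f by blast
  have "cel \<sigma> r a i = zq Q e \<sigma> i" if "i < DD" for i
    unfolding cel_def w_def[symmetric] using a(2) f[OF that] that by (simp add: N_def)
  then show ?thesis using a by (auto simp: BD_def)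
qed

text \<open>Suppose an endpoint is within \<open>sg s t\<close> of the query. Then the query's cell
  was stored around it, so the lookup hits some entry. By injectivity of the keys that entry belongs
  to the same scale and cell, whose stored point is within \<open>\<sigma> * (1 + 2 / HH)\<close> of
  the query, and the lookup succeeds.\<close>

lemma fails_far:
  assumes s: "db s p nl M q" and t: "t < nl" "0 < sg s t" and f: "fails Q s M e t"
    and j: "j < NN - 1" "0 < gapv p j" "gapv p j / real al < sg s t" "sg s t \<le> gapv p j * real be" and r: "r = p j \<or> r = p (j + 1)"
  shows "sg s t < dq Q e r"
proof (rule ccontr)
  define \<sigma> where "\<sigma> = sg s t"
  assume "\<not> sg s t < dq Q e r"
  then have le: "dq Q e r \<le> \<sigma>" by (simp add: \<sigma>_def)
  have \<sigma>: "0 < \<sigma>" using t by (simp add: \<sigma>_def)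
  obtain a where a: "a < BD" "\<forall>i<DD. cel \<sigma> r a i = zq Q e \<sigma> i" using cel_surj[OF \<sigma> le] by blast
  have near: "near \<sigma> r (cel \<sigma> r a)"
  proof -
    have "dst (corner \<sigma> (cel \<sigma> r a)) (pt r) = dst (corner \<sigma> (zq Q e \<sigma>)) (pt r)" using a(2) by (rule corner_cong)
    also have "\<dots> \<le> \<sigma> / real HH + \<sigma>"
      using dst_triangle[of "corner \<sigma> (zq Q e \<sigma>)" "pt r" "qv Q e"] corner_zq[OF \<sigma>, of e] le by (simp add: dq_dst)
    finally show ?thesis by (simp add: near_dst algebra_simps)
  qed
  have gap: "gapok s nl M p j" using s j(1) by (simp add: db_def)
  obtain a' where a': "a' < 2 * BD" "a' div 2 = a" "p (j + a' mod 2) = r"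
  proof (cases "r = p j")
    case True then show ?thesis using a(1) by (intro that[of "2 * a"]) auto
  next
    case False then show ?thesis using a(1) r by (intro that[of "2 * a + 1"]) auto
  qed
  have "filled s M t r a" using gap j t a' unfolding gapok_def by metis
  then obtain n where n: "n < M" "arr s ''DK'' n = key t (cel \<sigma> r a)" using near by (auto simp: filled_def \<sigma>_def entry_def)
  have "key t (cel \<sigma> r a) = key t (zq Q e \<sigma>)" using a(2) by (simp add: key_def)
  then obtain n r' where n: "n < M" "r' < NN" "arr s ''DK'' n = key t (zq Q e \<sigma>)" "arr s ''DV'' n = real r'" "\<sigma> * (1 + 2 / real HH) < dq Q e r'"
    using f n unfolding fails_def \<sigma>_def by auto
  have "sound s nl M" using s by (simp add: db_def)
  then obtain t' z r'' where "entry s n t' z r''" "near (sg s t') r'' z" using n(1) unfolding sound_def by blast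
  then have z: "key t' z = key t (zq Q e \<sigma>)" "near (sg s t') r' z" using n by (auto simp: entry_def)
  show False
  proof (cases "t' = t")
    case True
    have "dst (corner \<sigma> (zq Q e \<sigma>)) (pt r') = dst (corner \<sigma> z) (pt r')" using key_inj[OF z(1)] by (intro corner_cong) simp
    also have "\<dots> \<le> \<sigma> * (1 + 1 / real HH)" using z(2) True by (simp add: near_dst \<sigma>_def)
    finally have "dq Q e r' \<le> \<sigma> / real HH + \<sigma> * (1 + 1 / real HH)"
      using dst_triangle[of "qv Q e" "pt r'" "corner \<sigma> (zq Q e \<sigma>)"] corner_zq[OF \<sigma>, of e] by (simp add: dq_dst dst_commute)
    also have "\<dots> = \<sigma> * (1 + 2 / real HH)" by (simp add: algebra_simps)
    finally show False using n by simp
  next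
    case False
    define v where "v i = (if i = DD then int t' - int t else z i - zq Q e \<sigma> i)" for i
    have "(\<Sum>i<DD + 1. fst (\<omega> i) * real_of_int (v i)) = 0"
      using z(1) by (simp add: v_def key_def right_diff_distrib sum_subtractf)
    then have "v DD = 0" using inj by auto
    then show False using False by (simp add: v_def)
  qed
qed

section \<open>Neighbours on the projected line\<close>

lemma gap_path:
  fixes X :: "nat \<Rightarrow> real"
  assumes "i \<le> j" "\<And>l. i \<le> l \<Longrightarrow> l < j \<Longrightarrow> X (l + 1) - X l \<le> \<tau>"
  shows "X j - X i \<le> real (j - i) * \<tau>"
  using assms
proof (induction j rule: dec_induct)
  case (step j)
  have "X (j + 1) - X j \<le> \<tau>" using step by simp
  moreover have "X j - X i \<le> real (j - i) * \<tau>" using step by simp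
  ultimately show ?case using step(1) by (simp add: Suc_diff_le algebra_simps)
qed simp

lemma last_large_gap:
  fixes X :: "nat \<Rightarrow> real"
  assumes "i \<le> j" "\<not> (\<forall>l. i \<le> l \<longrightarrow> l < j \<longrightarrow> X (l + 1) - X l \<le> \<tau>)"
  shows "\<exists>l. i \<le> l \<and> l < j \<and> \<tau> < X (l + 1) - X l \<and> (\<forall>l'. l + 1 \<le> l' \<longrightarrow> l' < j \<longrightarrow> X (l' + 1) - X l' \<le> \<tau>)"
  using assms
proof (induction j rule: dec_induct)
  case (step j)
  show ?case
  proof (cases "X (j + 1) - X j \<le> \<tau>")
    case True
    then have "\<not> (\<forall>l. i \<le> l \<longrightarrow> l < j \<longrightarrow> X (l + 1) - X l \<le> \<tau>)" using step.prems less_Suc_eq by auto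
    then obtain l where "i \<le> l" "l < j" "\<tau> < X (l + 1) - X l" "\<forall>l'. l + 1 \<le> l' \<longrightarrow> l' < j \<longrightarrow> X (l' + 1) - X l' \<le> \<tau>"
      using step.IH by blast
    then show ?thesis using True less_Suc_eq by (intro exI[of _ l]) auto
  next
    case False
    then show ?thesis using step by (intro exI[of _ j]) auto
  qed
qed simp

lemma first_large_gap:
  fixes X :: "nat \<Rightarrow> real"
  assumes "\<not> (\<forall>l. i \<le> l \<longrightarrow> l < j \<longrightarrow> X (l + 1) - X l \<le> \<tau>)"
  shows "\<exists>l. i \<le> l \<and> l < j \<and> \<tau> < X (l + 1) - X l \<and> (\<forall>l'. i \<le> l' \<longrightarrow> l' < l \<longrightarrow> X (l' + 1) - X l' \<le> \<tau>)"
proof -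
  let ?P = "\<lambda>l. i \<le> l \<and> l < j \<and> \<tau> < X (l + 1) - X l"
  have "\<exists>l. ?P l" using assms by (auto simp: not_le)
  then have P: "?P (LEAST l. ?P l)" by (rule LeastI_ex)
  moreover have "X (l' + 1) - X l' \<le> \<tau>" if "i \<le> l'" "l' < (LEAST l. ?P l)" for l'
    using not_less_Least[OF that(2)] P that by auto
  ultimately show ?thesis by blast
qed

text \<open>Let \<open>R\<close> be the distance to \<open>a\<close>. On the line, \<open>a\<close>
  is within \<open>DD * R\<close> of the query, so the neighbour on the side of \<open>a\<close> is
  within \<open>De * DD * R\<close> of the query in space, and \<open>\<rho>\<close> is at most
  that. Look at the gaps between this neighbour and \<open>a\<close>. If all are at most
  \<open>\<rho> / be\<close>, the neighbour is within \<open>R / HH\<close> of \<open>a\<close>.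
  Otherwise take the larger gap closest to \<open>a\<close>: small gaps join one of its endpoints to
  \<open>a\<close>, so this endpoint is nearly as good as \<open>a\<close>, and the gap itself is at
  most \<open>DD * R\<close>.\<close>

lemma one_dim:
  assumes s: "db s p nl M q" and n: "near1 Q s p e \<rho>" and e: "e < E4" and a: "a < NN"
  shows "\<rho> \<le> (1 + 1 / real HH) * dq Q e a \<or>
    (\<exists>j<NN - 1. \<exists>r. (r = p j \<or> r = p (j + 1)) \<and> 0 < gapv p j \<and> \<rho> < gapv p j * real be \<and> gapv p j / real al \<le> dq Q e a \<and>
      dq Q e r \<le> (1 + 1 / real HH) * dq Q e a)"
proof -
  define X where "X i = prj (pt (p i))" for i
  define x where "x = prj (qv Q e)"
  define R where "R = dq Q e a"
  define \<tau> where "\<tau> = \<rho> / real be"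
  have sp0: "sorted_pts s p" using s by (simp add: db_def)
  then have sp1: "bij_betw p {..<NN} {..<NN}" "\<And>i. i < NN \<Longrightarrow> arr s ''XS'' i = X i" "\<And>i j. i \<le> j \<Longrightarrow> j < NN \<Longrightarrow> arr s ''XS'' i \<le> arr s ''XS'' j"
    unfolding sorted_pts_def X_def by blast+
  have sp: "bij_betw p {..<NN} {..<NN}" "\<And>i j. i \<le> j \<Longrightarrow> j < NN \<Longrightarrow> X i \<le> X j"
  proof -
    show "X i \<le> X j" if "i \<le> j" "j < NN" for i j using sp1(3)[OF that] sp1(2)[of i] sp1(2)[of j] that by simp
  qed (rule sp1(1))
  have pN: "p i < NN" if "i < NN" for i using sp(1) that by (auto simp: bij_betw_def)
  obtain ja where ja: "ja < NN" "p ja = a" using sp(1) a unfolding bij_betw_def by (metis imageE lessThan_iff)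
  obtain l where l: "l \<le> NN" "\<And>i. i < l \<Longrightarrow> X i < x" "\<And>i. l \<le> i \<Longrightarrow> i < NN \<Longrightarrow> x \<le> X i"
    "\<rho> = min (dq Q e (p (min l (NN - 1)))) (dq Q e (p (l - 1)))"
    using n unfolding near1_def X_def x_def by blast
  have R0: "0 \<le> R" and \<rho>0: "0 \<le> \<rho>" using dst_nonneg by (auto simp: R_def l(4) dq_dst)
  have \<tau>0: "0 \<le> \<tau>" using \<rho>0 be_pos by (simp add: \<tau>_def)
  have pos: "0 < real DD" "0 < real De" "0 < real NN" "0 < real HH" using DD_pos De_pos NN_ge HH_pos by auto
  have far: "\<bar>x - X ja\<bar> \<le> real DD * R" unfolding x_def X_def R_def dq_dst ja(2) by (rule prj_lipschitz)
  have sepq: "dq Q e (p i) \<le> real De * \<bar>x - X i\<bar>" if "i < NN" for i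
    unfolding dq_dst x_def X_def using e pN[OF that] by (intro sep) auto
  have sepp: "dst (pt (p i)) (pt (p i')) \<le> real De * \<bar>X i - X i'\<bar>" if "i < NN" "i' < NN" for i i'
    unfolding X_def using pN that by (intro sep) auto
  define flat where "flat i i' \<longleftrightarrow> (\<forall>l. i \<le> l \<longrightarrow> l < i' \<longrightarrow> X (l + 1) - X l \<le> \<tau>)" for i i'
  have chain: "dq Q e (p i) \<le> (1 + 1 / real HH) * R" if "i < NN" "flat (min i ja) (max i ja)" "\<rho> \<le> real De * real DD * R" for i
  proof -
    have "X (max i ja) - X (min i ja) \<le> real (max i ja - min i ja) * \<tau>" using that(2) by (intro gap_path) (auto simp: flat_def)
    also have "\<dots> \<le> real NN * \<tau>" using \<tau>0 ja(1) that(1) by (intro mult_right_mono) auto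
    finally have "\<bar>X i - X ja\<bar> \<le> real NN * \<tau>" using sp(2)[of "min i ja" "max i ja"] that(1) ja(1) by (cases "i \<le> ja") auto
    then have "real De * \<bar>X i - X ja\<bar> \<le> real De * (real NN * \<tau>)" using pos by (intro mult_left_mono) auto
    \<comment> \<open>The origin of \<open>be\<close>: \<open>NN\<close> cancels the number of gaps,
      one \<open>De\<close> pays for the return from the line to space, and the remaining
      \<open>De * DD * HH\<close> turns the bound on \<open>\<rho>\<close> into
      \<open>R / HH\<close>.\<close>
    also have "\<dots> = \<rho> / (real De * real DD * real HH)" using pos by (simp add: \<tau>_def be_def field_simps)
    also have "\<dots> \<le> R / real HH" using pos that(3) by (simp add: field_simps)
    finally have "dst (pt (p i)) (pt a) \<le> R / real HH" using sepp[OF that(1) ja(1)] ja(2) by simp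
    then show ?thesis using dst_triangle[of "qv Q e" "pt (p i)" "pt a"] by (simp add: dq_dst R_def dst_commute algebra_simps)
  qed
  have big: "0 < X (j + 1) - X j \<and> \<rho> < (X (j + 1) - X j) * real be \<and> (X (j + 1) - X j) / real al \<le> R"
    if "\<tau> < X (j + 1) - X j" "X (j + 1) - X j \<le> real DD * R" for j
  proof -
    have "(X (j + 1) - X j) / real al \<le> real DD * R / real al" using that al_pos by (intro divide_right_mono) auto
    also have "\<dots> = R / (2 * real DD * real De)" using pos by (simp add: al_def field_simps)
    also have "\<dots> \<le> R / 1"
    proof (rule divide_left_mono)
      have "1 \<le> DD * De" using DD_pos De_pos by (simp add: Suc_le_eq)
      then have "1 \<le> real (DD * De)" by (metis of_nat_1 of_nat_le_iff)
      then show "1 \<le> 2 * real DD * real De" by simp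
    qed (use R0 pos in auto)
    finally have "(X (j + 1) - X j) / real al \<le> R" by simp
    moreover have "0 < X (j + 1) - X j" using that(1) \<tau>0 by linarith
    moreover have "\<rho> < (X (j + 1) - X j) * real be" using that(1) be_pos by (simp add: \<tau>_def pos_divide_less_eq)
    ultimately show ?thesis by blast
  qed
  show ?thesis
  proof (cases "l \<le> ja")
    case True
    then have ln: "l < NN" "min l (NN - 1) = l" using ja by auto
    have xl: "x \<le> X l" "X l \<le> X ja" using l(3)[of l] ln sp(2)[OF True ja(1)] by auto
    have \<rho>l: "\<rho> \<le> dq Q e (p l)" using l(4) ln by simp
    also have "\<dots> \<le> real De * \<bar>x - X l\<bar>" using ln by (intro sepq)
    also have "\<dots> \<le> real De * (real DD * R)" using pos xl far by (intro mult_left_mono) auto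
    finally have \<rho>R: "\<rho> \<le> real De * real DD * R" by simp
    show ?thesis
    proof (cases "flat l ja")
      case True
      then have "dq Q e (p l) \<le> (1 + 1 / real HH) * R" using \<open>l \<le> ja\<close> ln \<rho>R by (intro chain) auto
      then show ?thesis using \<rho>l by (simp add: R_def)
    next
      case False
      then obtain j where j: "l \<le> j" "j < ja" "\<tau> < X (j + 1) - X j" "flat (j + 1) ja"
        using last_large_gap[OF True, of X \<tau>] unfolding flat_def by blast
      have jN: "j + 1 < NN" using j ja by simp
      have "x \<le> X j" "X (j + 1) \<le> X ja" using l(3)[of j] j jN sp(2)[of "j + 1" ja] ja by auto
      then have "X (j + 1) - X j \<le> real DD * R" using far by linarith
      note b = big[OF j(3) this]
      have "dq Q e (p (j + 1)) \<le> (1 + 1 / real HH) * R" using j jN \<rho>R by (intro chain) auto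
      moreover have "j < NN - 1" using jN by simp
      ultimately show ?thesis using b unfolding gapv_def X_def[symmetric] R_def[symmetric] by blast
    qed
  next
    case False
    then have jl: "ja \<le> l - 1" "l - 1 < l" "l - 1 < NN" using l(1) by auto
    have xl: "X (l - 1) < x" "X ja \<le> X (l - 1)" using l(2)[OF jl(2)] sp(2)[OF jl(1,3)] by auto
    have \<rho>l: "\<rho> \<le> dq Q e (p (l - 1))" using l(4) by simp
    also have "\<dots> \<le> real De * \<bar>x - X (l - 1)\<bar>" using jl by (intro sepq)
    also have "\<dots> \<le> real De * (real DD * R)" using pos xl far by (intro mult_left_mono) auto
    finally have \<rho>R: "\<rho> \<le> real De * real DD * R" by simp
    show ?thesis
    proof (cases "flat ja (l - 1)")
      case True
      then have "dq Q e (p (l - 1)) \<le> (1 + 1 / real HH) * R" using jl \<rho>R by (intro chain) (auto simp: max_def min_def)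
      then show ?thesis using \<rho>l by (simp add: R_def)
    next
      case False
      then obtain j where j: "ja \<le> j" "j < l - 1" "\<tau> < X (j + 1) - X j" "flat ja j"
        using first_large_gap[of ja "l - 1" X \<tau>] unfolding flat_def by blast
      have jN: "j + 1 < NN" using j jl by simp
      have "X (j + 1) < x" "X ja \<le> X j" using l(2)[of "j + 1"] j jN sp(2)[of ja j] by auto
      then have "X (j + 1) - X j \<le> real DD * R" using far by linarith
      note b = big[OF j(3) this]
      have "dq Q e (p j) \<le> (1 + 1 / real HH) * R" using j jN \<rho>R by (intro chain) (auto simp: max_def min_def)
      moreover have "j < NN - 1" using jN by simp
      ultimately show ?thesis using b unfolding gapv_def X_def[symmetric] R_def[symmetric] by blast
    qed
  qed
qed

text \<open>The bisection ends with a candidate for scale \<open>lj\<close> and an index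
  \<open>hj\<close> of at most \<open>lj + 1\<close>. If \<open>hj\<close> lies in the window of the
  gap, the lookup failed there, so the good endpoint is farther than \<open>sg s hj\<close>, and one
  step of the ladder loses a factor \<open>1 + 1 / HH\<close>. Below the window every scale is at
  most \<open>g / al\<close>, hence at most \<open>R\<close>.\<close>

lemma refine_bound:
  fixes R :: real
  assumes s: "db s p nl M q" and rf: "refined Q s nl M e \<rho> b"
    and j: "j < NN - 1" "0 < gapv p j" "\<rho> < gapv p j * real be" and r: "r = p j \<or> r = p (j + 1)"
    and R: "gapv p j / real al \<le> R" "dq Q e r \<le> (1 + 1 / real HH) * R"
  shows "b \<le> (1 + 2 / real HH) * (1 + 1 / real HH) ^ 2 * R"
proof -
  define g where "g = gapv p j"
  define \<eta> where "\<eta> = 1 / real HH"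
  have \<eta>: "0 < \<eta>" "rr * (1 + \<eta>) = 1"
  proof -
    have H: "0 < real HH" using HH_pos by simp
    then show "0 < \<eta>" by (simp add: \<eta>_def)
    have "1 + \<eta> = (real HH + 1) / real HH" using H by (simp add: \<eta>_def field_simps)
    then show "rr * (1 + \<eta>) = 1" using H by (simp add: rr_def)
  qed
  obtain t0 lj hj where t0: "t0 \<le> nl" "\<And>t. t < t0 \<Longrightarrow> \<rho> < sg s t" "\<And>t. t0 \<le> t \<Longrightarrow> t < nl \<Longrightarrow> sg s t \<le> \<rho>" "hj \<le> lj + 1"
    and br: "bracket Q s nl M e t0 \<rho> b lj hj" using rf unfolding refined_def by blast
  have br': "b \<le> \<rho>" "t0 \<le> lj" "hj \<le> t0 + Wn" "hj \<le> nl - 1" "lj = t0 \<or> lj < nl \<and> b \<le> sg s lj * (1 + 2 * \<eta>)"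
    "hj = min (t0 + Wn) (nl - 1) \<or> t0 \<le> hj \<and> fails Q s M e hj" using br by (auto simp: bracket_def \<eta>_def)
  have dec: "dec s nl" using s by (simp add: db_def)
  have nl: "1 \<le> nl" using dec by (simp add: dec_def)
  have gok: "gapok s nl M p j" using s j by (simp add: db_def)
  have G: "sg s (nl - 1) \<le> g / real al" "g * real be < sg s 0"
    "\<And>t. t < nl \<Longrightarrow> 0 < t \<Longrightarrow> g / real al < sg s (t - 1) \<Longrightarrow> sg s t < g * real be \<Longrightarrow> sg s t = rr * sg s (t - 1)"
    using gok j(2) unfolding gapok_def g_def by blast+
  have step: "sg s (t - 1) = (1 + \<eta>) * sg s t" if "t < nl" "0 < t" "g / real al < sg s (t - 1)" "sg s t < g * real be" for t
  proof -
    have "(1 + \<eta>) * sg s t = rr * (1 + \<eta>) * sg s (t - 1)" using G(3)[OF that] by (simp only: ac_simps)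
    then show ?thesis using \<eta> by simp
  qed
  have ga: "0 < g / real al" "g / real al \<le> R" using j R al_pos by (auto simp: g_def)
  then have R0: "0 < R" by linarith
  have one: "1 \<le> 1 + 2 * \<eta>" "1 \<le> (1 + \<eta>) ^ 2" "1 + \<eta> \<le> (1 + \<eta>) ^ 2"
    using \<eta> by (auto intro!: one_le_power simp: power2_eq_square algebra_simps)
  have K: "R \<le> (1 + 2 * \<eta>) * (1 + \<eta>) ^ 2 * R" "(1 + 2 * \<eta>) * x \<le> (1 + 2 * \<eta>) * (1 + \<eta>) ^ 2 * R" if "x \<le> (1 + \<eta>) ^ 2 * R" for x
  proof -
    have "1 * 1 \<le> (1 + 2 * \<eta>) * (1 + \<eta>) ^ 2" using one \<eta> by (intro mult_mono) auto
    then show "R \<le> (1 + 2 * \<eta>) * (1 + \<eta>) ^ 2 * R" using R0 by simp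
    show "(1 + 2 * \<eta>) * x \<le> (1 + 2 * \<eta>) * (1 + \<eta>) ^ 2 * R" using mult_left_mono[OF that, of "1 + 2 * \<eta>"] \<eta> by (simp add: mult.assoc)
  qed
  have KR: "R \<le> (1 + 2 * \<eta>) * (1 + \<eta>) ^ 2 * R" by (rule K(1)[of 0]) (use R0 in simp)
  have small: "b \<le> (1 + 2 * \<eta>) * (1 + \<eta>) ^ 2 * R" if "b \<le> g / real al" using that ga KR by linarith
  have "b \<le> (1 + 2 * \<eta>) * (1 + \<eta>) ^ 2 * R"
  proof (cases "t0 = nl")
    case True
    then have "\<rho> < sg s (nl - 1)" using nl by (intro t0(2)) simp
    then show ?thesis using small G(1) br'(1) by linarith
  next
    case False
    then have tn: "t0 < nl" using t0(1) by simp
    \<comment> \<open>The scale at index 0 exceeds \<open>g * be\<close> and therefore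
      \<open>\<rho>\<close>.\<close>
    have tpos: "0 < t0" using t0(3)[of 0] G(2) j(3) tn by (cases t0) (auto simp: g_def)
    show ?thesis
    proof (cases "g / real al < sg s (t0 - 1)")
      case False
      have "\<rho> < sg s (t0 - 1)" using tpos by (intro t0(2)) simp
      then show ?thesis using False small br'(1) by linarith
    next
      case tg: True
      have lo: "sg s t < g * real be" if "t0 \<le> t" "t < nl" for t using t0(3)[OF that] j(3) by (simp add: g_def)
      have lj: "lj < nl \<and> b \<le> (1 + 2 * \<eta>) * sg s lj"
      proof (cases "lj = t0")
        case True
        \<comment> \<open>No lookup took place at the left end, but the scale just before
          \<open>t0\<close> exceeds \<open>\<rho>\<close> and is only one step larger than that at
          \<open>t0\<close>.\<close>
        have "b < sg s (t0 - 1)" using t0(2)[of "t0 - 1"] tpos br'(1) by simp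
        also have "\<dots> = (1 + \<eta>) * sg s t0" using tn tpos tg lo by (intro step) auto
        also have "\<dots> \<le> (1 + 2 * \<eta>) * sg s t0" using dec tn \<eta> by (intro mult_right_mono) (auto simp: dec_def)
        finally show ?thesis using True tn by simp
      qed (use br'(5) in \<open>auto simp: mult.commute\<close>)
      have "sg s lj \<le> (1 + \<eta>) ^ 2 * R"
      proof (cases "g / real al < sg s lj")
        case False
        moreover have "1 * R \<le> (1 + \<eta>) ^ 2 * R" using one R0 by (intro mult_right_mono) auto
        ultimately show ?thesis using ga by linarith
      next
        case True
        have hjn: "hj < nl" using br'(4) nl by simp
        have hb: "sg s hj \<le> (1 + \<eta>) * R"
        proof (cases "sg s hj \<le> g / real al")
          case True
          moreover have "1 * R \<le> (1 + \<eta>) * R" using \<eta> R0 by (intro mult_right_mono) auto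
          ultimately show ?thesis using ga by linarith
        next
          case False
          \<comment> \<open>If the right end never moved, its scale is at most
            \<open>g / al\<close>: either it is the last scale, or it is \<open>Wn\<close> steps
            below \<open>\<rho>\<close>, which is less than \<open>g * be\<close>.\<close>
          have "t0 \<le> hj \<and> fails Q s M e hj"
          proof (rule ccontr)
            assume "\<not> (t0 \<le> hj \<and> fails Q s M e hj)"
            then have h: "hj = min (t0 + Wn) (nl - 1)" using br'(6) by blast
            show False
            proof (cases "hj = nl - 1")
              case True then show False using False G(1) by simp
            next
              case False': False
              then have h': "hj = t0 + Wn" using h by (simp add: min_def split: if_splits)
              have it: "sg s (t0 + i) \<le> rr ^ i * \<rho>" if "t0 + i < nl" for i
                using that
              proof (induction i)
                case 0 then show ?case using t0(3)[of t0] by simp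
              next
                case (Suc i)
                have "sg s (t0 + Suc i) \<le> rr * sg s (t0 + Suc i - 1)" using dec Suc.prems unfolding dec_def by blast
                also have "\<dots> \<le> rr * (rr ^ i * \<rho>)" using Suc rr by (intro mult_left_mono) auto
                finally show ?case by (simp add: mult.assoc)
              qed
              have "sg s hj \<le> rr ^ Wn * \<rho>" using it[of Wn] h' hjn by simp
              also have "\<dots> \<le> rr ^ Wn * (g * real be)" using j(3) rr by (intro mult_left_mono) (auto simp: g_def)
              also have "\<dots> = g / real al * (2 * real al * real be * rr ^ Wn) / 2" using al_pos by (simp add: field_simps)
              also have "\<dots> \<le> g / real al * 1 / 2" using rr_power ga by (intro divide_right_mono mult_left_mono) auto
              also have "\<dots> \<le> g / real al" using ga by simp
              finally show False using False by simp
            qed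
          qed
          then have h: "t0 \<le> hj" "fails Q s M e hj" by auto
          have "sg s hj < dq Q e r"
            using False ga lo[OF h(1) hjn] by (intro fails_far[OF s hjn _ h(2) j(1,2) _ _ r]) (auto simp: g_def)
          then show ?thesis using R(2) by (simp add: \<eta>_def)
        qed
        show ?thesis
        proof (cases "hj \<le> lj")
          case True
          then have "sg s lj \<le> sg s hj" using lj by (intro dec_antimono[OF dec]) auto
          then show ?thesis using hb mult_right_mono[OF one(3), of R] R0 by linarith
        next
          case False
          then have h: "hj = lj + 1" using t0(4) by simp
          have "sg s (hj - 1) = (1 + \<eta>) * sg s hj" using hjn h True lo[of hj] br'(2) by (intro step) auto
          also have "\<dots> \<le> (1 + \<eta>) * ((1 + \<eta>) * R)" using hb \<eta> by (intro mult_left_mono) auto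
          finally show ?thesis using h by (simp add: power2_eq_square mult.assoc)
        qed
      qed
      from K(2)[OF this] lj show ?thesis by linarith
    qed
  qed
  then show ?thesis by (simp add: \<eta>_def)
qed

text \<open>With \<open>\<eta> = 1 / HH\<close>, at most \<open>\<epsilon> / 8\<close> and at most
  1/16, the product is \<open>1 + 4 * \<eta>\<close> plus terms of higher order, and these are less
  than \<open>4 * \<eta>\<close>.\<close>

lemma approximation_factor: "(1 + 2 / real HH) * (1 + 1 / real HH) ^ 2 \<le> 1 + \<epsilon>" "1 + 1 / real HH \<le> 1 + \<epsilon>"
proof -
  define \<eta> where "\<eta> = 1 / real HH"
  have "8 \<le> real HH * \<epsilon>" using HH_ge eps by (simp add: field_simps)
  then have e8: "8 * \<eta> \<le> \<epsilon>" using HH_pos by (simp add: \<eta>_def field_simps)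
  have \<eta>: "0 < \<eta>" using HH_pos by (simp add: \<eta>_def)
  have \<eta>1: "\<eta> \<le> 1 / 16" using e8 eps by linarith
  have s: "\<eta> * \<eta> \<le> \<eta> * (1 / 16)" using \<eta> \<eta>1 by (intro mult_left_mono) auto
  have c: "\<eta> * \<eta> * \<eta> \<le> \<eta> * \<eta> * 1" using \<eta> \<eta>1 by (intro mult_left_mono) auto
  have "(1 + 2 * \<eta>) * (1 + \<eta>) ^ 2 = 1 + 4 * \<eta> + 5 * (\<eta> * \<eta>) + 2 * (\<eta> * \<eta> * \<eta>)" by (simp add: power2_eq_square algebra_simps)
  also have "\<dots> \<le> 1 + \<epsilon>" using s c e8 \<eta> by linarith
  finally show "(1 + 2 / real HH) * (1 + 1 / real HH) ^ 2 \<le> 1 + \<epsilon>" by (simp add: \<eta>_def)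
  show "1 + 1 / real HH \<le> 1 + \<epsilon>" using e8 \<eta> unfolding \<eta>_def by linarith
qed

lemma covers_bound:
  assumes s: "k < nV \<Longrightarrow> db s p nl M q" and c: "covers Q s p nl M e b" and e: "e < E4" and a: "a < NN"
  shows "b \<le> (1 + \<epsilon>) * dq Q e a"
proof -
  have R: "0 \<le> dq Q e a" using dst_nonneg by (simp add: dq_dst)
  show ?thesis
  proof (cases "k < nV")
    case False
    then have "b \<le> 1 * dq Q e a" using c a by (simp add: covers_def)
    also have "\<dots> \<le> (1 + \<epsilon>) * dq Q e a" using R eps by (intro mult_right_mono) auto
    finally show ?thesis .
  next
    case True
    then obtain \<rho> b' where b': "near1 Q s p e \<rho>" "refined Q s nl M e \<rho> b'" "b \<le> b'" using c by (auto simp: covers_def)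
    have "b' \<le> \<rho>" using b'(2) by (auto simp: refined_def bracket_def)
    from one_dim[OF s[OF True] b'(1) e a] consider "\<rho> \<le> (1 + 1 / real HH) * dq Q e a"
      | j r where "j < NN - 1" "r = p j \<or> r = p (j + 1)" "0 < gapv p j" "\<rho> < gapv p j * real be" "gapv p j / real al \<le> dq Q e a"
        "dq Q e r \<le> (1 + 1 / real HH) * dq Q e a" by blast
    then show ?thesis
    proof cases
      assume "\<rho> \<le> (1 + 1 / real HH) * dq Q e a"
      then show ?thesis using b'(3) \<open>b' \<le> \<rho>\<close> mult_right_mono[OF approximation_factor(2) R] by linarith
    next
      fix j r assume *: "j < NN - 1" "r = p j \<or> r = p (j + 1)" "0 < gapv p j" "\<rho> < gapv p j * real be" "gapv p j / real al \<le> dq Q e a"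
        "dq Q e r \<le> (1 + 1 / real HH) * dq Q e a"
      have "b' \<le> (1 + 2 / real HH) * (1 + 1 / real HH) ^ 2 * dq Q e a"
        by (rule refine_bound[OF s[OF True] b'(2) *(1,3,4,2,5,6)])
      also have "\<dots> \<le> (1 + \<epsilon>) * dq Q e a" by (rule mult_right_mono[OF approximation_factor(1) R])
      finally show ?thesis using b'(3) by simp
    qed
  qed
qed

text \<open>The distance of the two expansions behind the answer is an upper bound by
  \<open>frechet_le\<close>. For any input curve an optimal traversal is some pair of expansions,
  and the search for that expansion of the query covers it.\<close>

lemma answer_correct:
  assumes Q: "is_curve d Q" "length Q \<le> m" and s: "k < nV \<Longrightarrow> db s p nl M q"
    and c: "\<forall>e<E4. covers Q s p nl M e b" and w: "r < NN" "e < E4" "b = dq Q e r"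
  shows "ann_answer discrete_frechet \<epsilon> Vs Q (r div E4)"
  unfolding ann_answer_def
proof (intro conjI allI impI)
  have d0: "0 < d" using d by simp
  have E4: "int E4 = 4 ^ m" "0 < E4" using E4_ge by (simp_all add: E4_def)
  have rv: "r div E4 < nV" using w(1) by (simp add: NN_def less_mult_imp_div_less)
  then show l: "r div E4 < length Vs" by (simp add: nV_def)
  fix i assume i: "i < length Vs"
  have V: "is_curve d (Vs ! (r div E4))" "length (Vs ! (r div E4)) \<le> m" "is_curve d (Vs ! i)" "length (Vs ! i) \<le> m"
    using curves l i by auto
  have rm: "r mod E4 < E4" using E4 by simp
  have "discrete_frechet Q (Vs ! (r div E4)) \<le> b"
    unfolding w(3) dq_def qv_def pt_def LL_def
    by (rule frechet_le[OF Q V(1,2) d0]) (use w(2) E4 rm in linarith)+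
  moreover obtain E E' where E: "- (4 ^ m) \<le> E" "E \<le> - 1" "- (4 ^ m) \<le> E'" "E' \<le> - 1"
    "nrm d (3 * m) (\<lambda>i'. expand d Q E i' - expand d (Vs ! i) E' i') \<le> discrete_frechet Q (Vs ! i)"
    using frechet_attained[OF Q V(3,4) d0] by blast
  define e1 where "e1 = nat (E + int E4)"
  define e2 where "e2 = nat (E' + int E4)"
  have e: "e1 < E4" "int e1 - int E4 = E" "e2 < E4" "int e2 - int E4 = E'" using E E4 by (auto simp: e1_def e2_def)
  have a: "i * E4 + e2 < NN" using less_mult_add[OF _ e(3), of i nV] i by (simp add: NN_def nV_def)
  have "dq Q e1 (i * E4 + e2) \<le> discrete_frechet Q (Vs ! i)"
    using E(5) pt_eq[of i e2] i e by (simp add: dq_def qv_def LL_def nV_def)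
  then have "(1 + \<epsilon>) * dq Q e1 (i * E4 + e2) \<le> (1 + \<epsilon>) * discrete_frechet Q (Vs ! i)" using eps by (intro mult_left_mono) auto
  moreover have "b \<le> (1 + \<epsilon>) * dq Q e1 (i * E4 + e2)" using c e(1) by (intro covers_bound[OF s _ e(1) a]) auto
  ultimately show "discrete_frechet Q (Vs ! (r div E4)) \<le> (1 + \<epsilon>) * discrete_frechet Q (Vs ! i)" by linarith
qed

end


section \<open>From good tapes to the success probability\<close>

lemma preprocessing_run:
  obtains t a s where "run \<omega> Preprocess (data_state d m k \<epsilon> Vs) t a s" "t \<le> TP" "a \<le> AA" "base s"
    "k < nV \<Longrightarrow> \<exists>p nl M q. db s p nl M q"
  using wp_Preprocess unfolding wp_def by blast

lemma query_run:
  assumes Q: "is_curve d Q" "length Q \<le> m"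
  obtains t a s t' a' s' p nl M q b r e where "run \<omega> Preprocess (data_state d m k \<epsilon> Vs) t a s"
    "run \<omega> Query (with_query Q s) t' a' s'" "t' \<le> TQ" "a' \<le> AA" "k < nV \<Longrightarrow> db s p nl M q"
    "r < NN" "e < E4" "b = dq Q e r" "reg s' ''out'' = real (r div E4)" "\<forall>e<E4. covers Q s p nl M e b"
proof -
  obtain t a s where pre: "run \<omega> Preprocess (data_state d m k \<epsilon> Vs) t a s" "base s" "k < nV \<Longrightarrow> \<exists>p nl M q. db s p nl M q"
    by (rule preprocessing_run) blast
  then obtain p nl M q where d: "k < nV \<Longrightarrow> db s p nl M q" by blast
  from wp_Query[OF Q pre(2) d] obtain t' a' s' b r e where "run \<omega> Query (with_query Q s) t' a' s'" "t' \<le> TQ" "a' \<le> AA"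
    "r < NN" "e < E4" "b = dq Q e r" "reg s' ''out'' = real (r div E4)" "\<forall>e<E4. covers Q s p nl M e b"
    unfolding wp_def by blast
  with pre(1) d show ?thesis using that by blast
qed

text \<open>\<open>Z\<close> contains the expansions of the query, so the good event is chosen for
  each query separately; the guarantee is for a fixed query, not for all queries at once.\<close>

lemma success_probability:
  assumes Q: "is_curve d Q" "length Q \<le> m"
  shows "measure tape_measure {\<omega> \<in> space tape_measure. \<exists>j. reports \<omega> Preprocess Query (data_state d m k \<epsilon> Vs) Q j \<and>
    ann_answer discrete_frechet \<epsilon> Vs Q j} \<ge> 1 - (1 / 2) ^ k" (is "measure _ ?S \<ge> _")
proof -
  define Z where "Z = pt ` {..<NN} \<union> qv Q ` {..<E4}"
  have "pt 0 \<in> Z" using NN_ge by (auto simp: Z_def)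
  then have Z: "finite Z" "Z \<noteq> {}" by (auto simp: Z_def)
  have cZ: "card Z \<le> (nV + 1) * E4"
  proof -
    have "card Z \<le> card (pt ` {..<NN}) + card (qv Q ` {..<E4})" unfolding Z_def by (rule card_Un_le)
    also have "\<dots> \<le> NN + E4" using card_image_le[of "{..<NN}" pt] card_image_le[of "{..<E4}" "qv Q"] by simp
    finally show ?thesis by (simp add: NN_def)
  qed
  define \<delta> where "\<delta> = 1 / (2 ^ k * 2 * real (card Z) ^ 2)"
  have cpos: "0 < real (card Z)" using Z by (simp add: card_gt_0_iff)
  have \<delta>: "0 < \<delta>" using cpos by (simp add: \<delta>_def)
  obtain G where G: "G \<in> sets tape_measure" "measure tape_measure G \<ge> 1 - (1 / 2) ^ k"
    "\<forall>\<omega>\<in>G. (\<forall>i. 0 \<le> uni \<omega> i \<and> uni \<omega> i \<le> 1) \<and>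
      (\<forall>z\<in>Z. \<forall>z'\<in>Z. \<forall>c<DD. \<delta> * \<bar>z c - z' c\<bar> \<le> \<bar>\<Sum>i<DD. uni \<omega> i * (z i - z' i)\<bar>) \<and>
      (\<forall>v :: nat \<Rightarrow> int. (\<exists>c<DD + 1. v c \<noteq> 0) \<longrightarrow> (\<Sum>i<DD + 1. uni \<omega> i * real_of_int (v i)) \<noteq> 0)"
    using good_tapes[OF Z \<delta>_def, of DD "DD + 1"] by (elim bexE conjE) (rule that)
  have "G \<subseteq> ?S"
  proof
    fix \<omega>' assume g: "\<omega>' \<in> G"
    \<comment> \<open>The locale fixes one tape and is interpreted anew for each tape in
      \<open>G\<close>; the parameters and expansions do not mention the tape and are the same in
      both.\<close>
    interpret w: ann d m k \<epsilon> Vs \<omega>' by unfold_locales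
    have prj: "w.prj z - w.prj z' = (\<Sum>i<DD. uni \<omega>' i * (z i - z' i))" for z z'
      by (simp add: w.prj_def uni_def sum_subtractf right_diff_distrib)
    have u: "0 \<le> fst (\<omega>' i) \<and> fst (\<omega>' i) \<le> 1" for i using G(3) g by (auto simp: uni_def)
    have sep: "w.dst z z' \<le> real De * \<bar>w.prj z - w.prj z'\<bar>" if z: "z \<in> pt ` {..<NN} \<union> qv Q ` {..<E4}" "z' \<in> pt ` {..<NN} \<union> qv Q ` {..<E4}" for z z'
    proof -
      let ?p = "\<bar>w.prj z - w.prj z'\<bar>"
      have "w.dst z z' \<le> real d * (?p / \<delta>)" unfolding w.dst_def
      proof (rule nrm_le_max[OF LL_pos])
        fix i assume "i < LL * d"
        then have "i < DD" by (simp add: DD_def)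
        then have "\<delta> * \<bar>z i - z' i\<bar> \<le> ?p" unfolding prj using G(3) g z unfolding Z_def by blast
        then show "\<bar>z i - z' i\<bar> \<le> ?p / \<delta>" using \<delta> by (simp add: field_simps)
      qed
      also have "\<dots> = real d * (2 ^ k * 2 * real (card Z) ^ 2) * ?p" by (simp add: \<delta>_def)
      also have "\<dots> \<le> real De * ?p"
      proof (rule mult_right_mono)
        have "card Z ^ 2 \<le> ((nV + 1) * E4) ^ 2" using cZ by (rule power_mono) simp
        then have "d * (2 ^ k * 2 * card Z ^ 2) \<le> d * (2 ^ k * 2 * ((nV + 1) * E4) ^ 2)" by (intro mult_le_mono2)
        also have "\<dots> = De" by (simp add: De_def power2_eq_square)
        finally have "real (d * (2 ^ k * 2 * card Z ^ 2)) \<le> real De" by (rule of_nat_mono)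
        then show "real d * (2 ^ k * 2 * real (card Z) ^ 2) \<le> real De" by simp
      qed simp
      finally show ?thesis .
    qed
    have inj: "\<forall>c<DD + 1. v c = 0" if "(\<Sum>i<DD + 1. fst (\<omega>' i) * real_of_int (v i)) = 0" for v :: "nat \<Rightarrow> int"
      using G(3) g that unfolding uni_def by blast
    obtain t a s t' a' s' p nl M q b r e where r: "run \<omega>' Preprocess (data_state d m k \<epsilon> Vs) t a s"
      "run \<omega>' Query (with_query Q s) t' a' s'" "k < nV \<Longrightarrow> w.db s p nl M q"
      "r < NN" "e < E4" "b = dq Q e r" "reg s' ''out'' = real (r div E4)" "\<forall>e<E4. w.covers Q s p nl M e b"
      by (rule w.query_run[OF Q]) blast
    have "ann_answer discrete_frechet \<epsilon> Vs Q (r div E4)"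
      by (rule w.answer_correct[OF u sep inj Q r(3) r(8) r(4,5,6)]) auto
    moreover have "reports \<omega>' Preprocess Query (data_state d m k \<epsilon> Vs) Q (r div E4)" unfolding reports_def using r(1,2,7) by blast
    ultimately show "\<omega>' \<in> ?S" by auto
  qed
  then have "measure tape_measure G \<le> measure tape_measure ?S"
    using measurable_success by (intro tape.finite_measure_mono)
  then show ?thesis using G(2) by linarith
qed

end

section \<open>Resource bounds\<close>

text \<open>The tangent of the logarithm at 2, combined with \<open>ln 2 < 1\<close> and
  \<open>1 / 2 \<le> ln 2\<close>.\<close>

lemma le_two_powr: fixes x :: real shows "x \<le> 2 powr x"
proof (cases "0 < x")
  case True
  have l2: "1 / 2 \<le> ln (2::real)" using ln2_ge_two_thirds by simp
  have "ln x = ln 2 + ln (x / 2)" using True by (simp add: ln_div)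
  also have "\<dots> \<le> ln 2 + (x / 2 - 1)" using True by (intro add_left_mono ln_le_minus_one) simp
  also have "\<dots> \<le> x * (1 / 2)" using ln_2_less_1 by linarith
  also have "\<dots> \<le> x * ln 2" using True l2 by (intro mult_left_mono) auto
  finally have "exp (ln x) \<le> exp (x * ln 2)" by simp
  then show ?thesis using True by (simp add: powr_def)
next
  case False
  moreover have "0 < 2 powr x" by simp
  ultimately show ?thesis by linarith
qed

lemma log2_le: fixes x :: real shows "0 < x \<Longrightarrow> log 2 x \<le> x"
  using le_two_powr[of x] by (subst log_le_iff) auto

lemma Least_power_le:
  assumes "1 \<le> (x :: nat)" "w = (LEAST w. x \<le> 2 ^ w)"
  shows "real w \<le> 1 + log 2 (real x)"
proof (cases w)
  case 0
  then show ?thesis using assms(1) by simp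
next
  case (Suc v)
  then have "\<not> x \<le> 2 ^ v" using assms(2) not_less_Least[of v "\<lambda>w. x \<le> 2 ^ w"] by simp
  then have "real (2 ^ v) \<le> real x" by (simp only: of_nat_le_iff)
  then have "2 powr real v \<le> real x" by (simp add: powr_realpow)
  then have "real v \<le> log 2 (real x)" using assms(1) by (subst le_log_iff) auto
  then show ?thesis using Suc by simp
qed

text \<open>Sums of quantities that are at least 1 are bounded by multiples of their product; these
  facts hand such estimates to linear arithmetic.\<close>

lemma le_prod4:
  fixes a b c e :: real
  assumes "1 \<le> a" "1 \<le> b" "1 \<le> c" "1 \<le> e"
  shows "1 \<le> a * b * c * e" "a \<le> a * b * c * e" "b \<le> a * b * c * e" "c \<le> a * b * c * e" "e \<le> a * b * c * e"
proof -
  have *: "1 \<le> x * y" if "1 \<le> x" "1 \<le> y" for x y :: real using mult_mono[OF that] that by simp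
  have **: "x \<le> x * y" "y \<le> x * y" if "1 \<le> x" "1 \<le> y" for x y :: real
    using mult_left_mono[OF that(2), of x] mult_right_mono[OF that(1), of y] that by simp_all
  have ab: "1 \<le> a * b" "1 \<le> a * b * c" using * assms by blast+
  show "1 \<le> a * b * c * e" using * ab assms by blast
  show "a \<le> a * b * c * e" "b \<le> a * b * c * e" "c \<le> a * b * c * e" "e \<le> a * b * c * e"
    using **[OF assms(1,2)] **[OF ab(1) assms(3)] **[OF ab(2) assms(4)] by linarith+
qed

context ann
begin

section \<open>Logarithms of the parameters\<close>

definition "lam = log 2 (1 / \<epsilon>)"
text \<open>The logarithm that \<open>soft_O\<close> provides in the preprocessing bound.\<close>

definition "Lg = log 2 (real d * real m ^ 2 * real nV + 2)"

lemma lam: "1 \<le> lam" "lam \<le> 1 / \<epsilon>" "1 / \<epsilon> = 2 powr lam" "2 \<le> 1 / \<epsilon>"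
proof -
  show e: "2 \<le> 1 / \<epsilon>" using eps by (simp add: field_simps)
  show "1 \<le> lam" unfolding lam_def using e eps by (subst le_log_iff) auto
  show "lam \<le> 1 / \<epsilon>" unfolding lam_def using eps by (intro log2_le) auto
  show "1 / \<epsilon> = 2 powr lam" unfolding lam_def using e eps by simp
qed

lemma HH_le: "real HH \<le> 9 / \<epsilon>"
proof -
  have "real HH = real_of_int \<lfloor>8 / \<epsilon>\<rfloor> + 1" using eps by (simp add: HH_def)
  also have "\<dots> \<le> 8 / \<epsilon> + 1" by simp
  also have "\<dots> \<le> 9 / \<epsilon>" using eps by (simp add: field_simps)
  finally show ?thesis .
qed

lemma log_HH: "log 2 (real HH) \<le> 4 + lam"
proof -
  have "real HH \<le> 2 powr (4 + lam)"
  proof -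
    have "real HH \<le> 16 * (1 / \<epsilon>)" using HH_le eps by (simp add: field_simps)
    then show ?thesis by (simp add: powr_add flip: lam(3))
  qed
  then show ?thesis using HH_pos by (subst log_le_iff) auto
qed

lemma Lg: "1 \<le> Lg" "log 2 (real d) \<le> Lg" "log 2 (real m) \<le> Lg" "log 2 (real nV) \<le> Lg" "log 2 (real nV + 1) \<le> Lg"
proof -
  have r: "1 \<le> real d" "2 \<le> real m" "1 \<le> real nV" using d m nV_pos by auto
  have m4: "real m \<le> real m ^ 2" using mult_left_mono[of 1 "real m" "real m"] r by (simp add: power2_eq_square)
  have m1: "4 \<le> real m ^ 2" using power_mono[of 2 "real m" 2] r by simp
  have p: "real d \<le> real d * real m ^ 2 * real nV" "real m ^ 2 \<le> real d * real m ^ 2 * real nV" "real nV \<le> real d * real m ^ 2 * real nV"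
    using le_prod4[of "real d" "real m ^ 2" "real nV" 1] r m1 by auto
  have "2 powr 1 \<le> real d * real m ^ 2 * real nV + 2" using p m1 by simp
  moreover have "0 < real d * real m ^ 2 * real nV + 2" using p m1 by linarith
  ultimately show "1 \<le> Lg" unfolding Lg_def by (subst le_log_iff) auto
  have Lg: "log 2 x \<le> Lg" if "0 < x" "x \<le> real d * real m ^ 2 * real nV + 2" for x :: real
    unfolding Lg_def using that by (intro log_mono) auto
  show "log 2 (real d) \<le> Lg" using r p by (intro Lg) linarith+
  show "log 2 (real m) \<le> Lg" using r p m4 by (intro Lg) linarith+
  show "log 2 (real nV) \<le> Lg" using r p by (intro Lg) linarith+
  show "log 2 (real nV + 1) \<le> Lg" using r p by (intro Lg) linarith+
qed

text \<open>\<open>2 ^ k\<close> enters only through \<open>De\<close>, of which the logarithm is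
  taken; so \<open>k\<close> appears linearly in the number of scales.\<close>

lemma WW_le: "real WW \<le> 50 * (real k * real m * lam * Lg)"
proof -
  have pos: "0 < real d" "0 < real m" "0 < real nV" "0 < real HH" using d m nV_pos HH_pos by auto
  define X where "X = log 2 (real (2 * al * be))"
  have W1: "real WW \<le> 1 + X"
  proof (cases WW)
    case 0
    have "1 \<le> 2 * al * be" using al_pos be_pos by (simp add: Suc_le_eq)
    then have "1 \<le> real (2 * al * be)" by (metis of_nat_1 of_nat_le_iff)
    then have "0 \<le> log 2 (real (2 * al * be))" by (subst zero_le_log_cancel_iff) auto
    then show ?thesis using 0 by (simp add: X_def)
  next
    case (Suc v)
    then have "2 ^ v \<le> 2 * al * be" using WW(2) by simp
    then have "real (2 ^ v) \<le> real (2 * al * be)" by (simp only: of_nat_le_iff)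
    then have "2 powr real v \<le> real (2 * al * be)" by (simp add: powr_realpow)
    moreover have "0 < real (2 * al * be)" using al_pos be_pos by simp
    ultimately have "real v \<le> log 2 (real (2 * al * be))" by (subst le_log_iff) auto
    then show ?thesis using Suc by (simp add: X_def)
  qed
  have E4r: "real E4 = 2 powr real (2 * m)"
  proof -
    have "2 powr real (2 * m) = (2::real) ^ (2 * m)" by (rule powr_realpow) simp
    then show ?thesis by (simp add: E4_def power_mult)
  qed
  have De: "log 2 (real De) = real k + 1 + log 2 (real d) + 2 * log 2 (real nV + 1) + 4 * real m"
  proof -
    have "real De = 2 powr real k * 2 * real d * (real nV + 1) ^ 2 * 2 powr (4 * real m)"
    proof -
      have "2 powr (4 * real m) = real E4 * real E4" unfolding E4r by (simp flip: powr_add)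
      then show ?thesis by (simp add: De_def powr_realpow power2_eq_square algebra_simps)
    qed
    then show ?thesis using pos by (simp add: log_mult log_nat_power log_powr)
  qed
  have E4: "log 2 (real E4) = 2 * real m" unfolding E4r by simp
  have Dp: "0 < real De" "0 < real E4" "0 < real DD" using De_pos E4_ge DD_pos by auto
  have ab: "real (2 * al * be) = 4 * real DD ^ 3 * (real nV * real E4) * real HH * real De ^ 3"
    by (simp add: al_def be_def NN_def eval_nat_numeral)
  have "X = log 2 4 + 3 * log 2 (real DD) + (log 2 (real nV) + 2 * real m) + log 2 (real HH) + 3 * log 2 (real De)"
    unfolding X_def ab using pos Dp by (simp add: log_mult log_nat_power E4)
  also have "log 2 4 = (2::real)" using log_nat_power[of 2 2 2] by simp
  also have "log 2 (real DD) = log 2 3 + log 2 (real m) + log 2 (real d)" using pos by (simp add: DD_def LL_def log_mult)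
  finally have W2: "real WW \<le> 6 + 3 * real k + 14 * real m + 3 * log 2 3 + 3 * log 2 (real m) + 6 * log 2 (real d) + log 2 (real nV) + log 2 (real HH) + 6 * log 2 (real nV + 1)"
    using W1 unfolding De by (simp add: algebra_simps)
  have l3: "log 2 3 \<le> (2::real)" by (subst log_le_iff) auto
  have k1: "1 \<le> real k" "1 \<le> real m" using k m by auto
  note p = le_prod4[OF k1 lam(1) Lg(1)]
  show ?thesis using W2 l3 Lg log_HH p by linarith
qed


text \<open>
  All factors but \<open>k\<close>, \<open>nV\<close> and logarithms are absorbed into \<open>PP j\<close>, a power of the second factor
  of \<^const>\<open>preprocessing_bound\<close>.
\<close>

definition "Bs = real d / log 2 (real m) + 2"
definition "Ys = real m ^ 2 * real d * lam"
definition "PP j = Bs powr (j * Ys)"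

lemma log_m: "1 \<le> log 2 (real m)" "log 2 (real m) \<le> real m"
  using m by (auto intro: log2_le simp: le_log_iff)

text \<open>The base of the bound is about \<open>d / log m\<close>, smaller than the
  \<open>d\<close> of the enumerated cells. A factor \<open>m\<close> makes up for the logarithm and
  is cheap, since the exponent of the bound exceeds any multiple of \<open>m\<close> that
  occurs.\<close>

lemma Bs: "2 \<le> Bs" "real d \<le> real m * Bs"
proof -
  show B: "2 \<le> Bs" using log_m by (simp add: Bs_def)
  have "real d = log 2 (real m) * (real d / log 2 (real m))" using log_m(1) by simp
  also have "\<dots> \<le> real m * Bs" using log_m B by (intro mult_mono) (auto simp: Bs_def)
  finally show "real d \<le> real m * Bs" .
qed

lemma Ys: "4 \<le> Ys" "2 * real m \<le> Ys" "lam \<le> Ys" "real m * real d \<le> Ys" "real m * lam \<le> Ys"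
proof -
  have r: "1 \<le> real d" "2 \<le> real m" using d m by auto
  have 1: "Ys = real m * (real m * real d * lam)" "Ys = (real m * real d) * (real m * lam)" "Ys = (real m * lam) * (real m * real d)"
    by (simp_all add: Ys_def power2_eq_square ac_simps)
  have 2: "2 \<le> real m * real d" "2 \<le> real m * lam" using mult_mono[of 2 "real m" 1 "real d"] mult_mono[of 2 "real m" 1 lam] r lam(1) by auto
  have 3: "2 \<le> real m * real d * lam" using mult_mono[of 2 "real m * real d" 1 lam] 2 lam(1) by auto
  show "4 \<le> Ys" unfolding 1(2) using mult_mono[of 2 "real m * real d" 2 "real m * lam"] 2 by simp
  show "2 * real m \<le> Ys" unfolding 1(1) using mult_left_mono[OF 3, of "real m"] by simp
  show "real m * real d \<le> Ys" unfolding 1(2) using mult_left_mono[OF 2(2), of "real m * real d"] r by simp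
  show ml: "real m * lam \<le> Ys" unfolding 1(3) using mult_left_mono[OF 2(1), of "real m * lam"] r lam(1) by simp
  show "lam \<le> Ys" using ml mult_right_mono[of 1 "real m" lam] r lam(1) by linarith
qed

lemma PP_add: "PP (i + j) = PP i * PP j"
  by (simp add: PP_def distrib_right powr_add)

lemma PP_mono: "i \<le> j \<Longrightarrow> PP i \<le> PP j"
  unfolding PP_def using Bs Ys(1) by (intro powr_mono mult_right_mono) auto

lemma PP_ge: "x \<le> j * Ys \<Longrightarrow> Bs powr x \<le> PP j" "0 \<le> x \<Longrightarrow> x \<le> j * Ys \<Longrightarrow> 2 powr x \<le> PP j" "x \<le> j * Ys \<Longrightarrow> 0 < x \<Longrightarrow> x \<le> PP j"
proof -
  show 1: "Bs powr x \<le> PP j" if "x \<le> j * Ys" for x unfolding PP_def using that Bs by (intro powr_mono) auto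
  show 2: "2 powr x \<le> PP j" if "0 \<le> x" "x \<le> j * Ys" for x
    using powr_mono2[of x 2 Bs] Bs that 1[of x] by auto
  show "x \<le> PP j" if "x \<le> j * Ys" "0 < x" for x using le_two_powr[of x] 2[of x] that by linarith
qed

lemma PP_pos: "0 < PP j" "0 \<le> j \<Longrightarrow> 1 \<le> PP j"
proof -
  show "0 < PP j" using Bs by (simp add: PP_def)
  show "1 \<le> PP j" if "0 \<le> j" using PP_mono[OF that] Bs by (simp add: PP_def)
qed

text \<open>Since \<open>Ys\<close> is at least 4, a numerical factor 2 costs only a quarter in the
  index of \<open>PP\<close>.\<close>

lemma two_le_PP: "2 ^ j \<le> PP (real j / 4)"
proof -
  have "2 powr real j \<le> PP (real j / 4)" using mult_left_mono[OF Ys(1), of "real j / 4"] by (intro PP_ge) auto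
  then show ?thesis by (simp add: powr_realpow)
qed

lemma sizes_PP:
  "real m \<le> PP 1" "real d \<le> PP 1" "lam \<le> PP 1" "real DD \<le> PP 3" "real E4 \<le> PP 1" "real HH \<le> PP 2" "real BD \<le> PP 15"
proof -
  have r: "1 \<le> real d" "2 \<le> real m" using d m by auto
  show "real m \<le> PP 1" using Ys r by (intro PP_ge) auto
  have "real d \<le> real m * real d" using mult_right_mono[of 1 "real m" "real d"] r by simp
  then have "real d \<le> Ys" using Ys by linarith
  then show "real d \<le> PP 1" using r by (intro PP_ge) auto
  show "lam \<le> PP 1" using Ys lam by (intro PP_ge) auto
  show "real DD \<le> PP 3" using Ys r by (intro PP_ge) (auto simp: DD_def LL_def)
  show "real E4 \<le> PP 1"
  proof -
    have "real E4 = 2 powr (2 * real m)" using powr_realpow[of 2 "2 * m"] by (simp add: E4_def power_mult)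
    then show ?thesis using Ys PP_ge(2)[of "2 * real m" 1] by simp
  qed
  have "real HH \<le> 2 powr (4 + lam)" using log_HH HH_pos by (subst (asm) log_le_iff) auto
  also have "\<dots> \<le> PP 2" using Ys lam by (intro PP_ge) auto
  finally show "real HH \<le> PP 2" .
  have "1 \<le> d * HH" using d HH_pos by (simp add: Suc_le_eq)
  then have dH: "1 \<le> real (d * HH)" by (metis of_nat_1 of_nat_le_iff)
  have "real bb = 2 * real (d * HH) + 3" by (simp add: bb_def)
  also have "\<dots> \<le> 5 * real (d * HH)" using dH by simp
  \<comment> \<open>Here \<open>d\<close> becomes \<open>m * Bs\<close> and
    \<open>1 / \<epsilon>\<close> becomes \<open>2 powr lam\<close>. All factors are then powers of
    \<open>Bs\<close> with exponents of order \<open>m * lam\<close>, and the power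
    \<open>DD = 3 * m * d\<close> yields a multiple of \<open>Ys\<close>.\<close>
  also have "\<dots> \<le> 5 * (real m * Bs * (9 * 2 powr lam))" using Bs HH_le r unfolding lam(3)[symmetric]
    by (simp only: of_nat_mult) (intro mult_left_mono mult_mono, auto)
  also have "\<dots> \<le> 64 * (2 powr real m * Bs powr 1 * Bs powr lam)"
    using Bs lam by (simp, intro mult_mono le_two_powr powr_mono2) auto
  also have "\<dots> \<le> Bs powr 6 * (Bs powr real m * Bs powr 1 * Bs powr lam)"
  proof (intro mult_mono)
    have "(2::real) powr 6 = 64" by simp
    then show "64 \<le> Bs powr 6" using powr_mono2[of 6 2 Bs] Bs by simp
    show "2 powr real m \<le> Bs powr real m" using Bs by (intro powr_mono2) auto
  qed (use Bs in auto)
  also have "\<dots> = Bs powr (6 + (real m + 1 + lam))" by (simp only: powr_add mult.assoc)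
  also have "\<dots> \<le> Bs powr (5 * (real m * lam))"
  proof (intro powr_mono)
    have 1: "2 \<le> real m * lam" "real m \<le> real m * lam" "2 * lam \<le> real m * lam"
      using mult_mono[of 2 "real m" 1 lam] mult_left_mono[OF lam(1), of "real m"] mult_right_mono[OF r(2), of lam] r lam(1) by auto
    then show "6 + (real m + 1 + lam) \<le> 5 * (real m * lam)" by linarith
  qed (use Bs in auto)
  finally have "real bb ^ DD \<le> (Bs powr (5 * (real m * lam))) ^ DD" by (intro power_mono) auto
  also have "\<dots> = Bs powr (5 * (real m * lam) * real DD)" using Bs by (simp add: powr_powr flip: powr_realpow)
  also have "5 * (real m * lam) * real DD = 15 * Ys" by (simp add: DD_def LL_def Ys_def power2_eq_square)
  finally show "real BD \<le> PP 15" by (simp add: BD_def PP_def)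
qed


section \<open>Preprocessing time and space\<close>

definition "cst = (10 ^ 6 :: real)"
text \<open>One factor \<open>Lg\<close> comes from the number of scales, the other from sorting the
  dictionary.\<close>

definition "Vz j = real k * real nV * Lg * Lg * PP j"

lemma ones: "1 \<le> real k" "1 \<le> real nV" "1 \<le> Lg" "1 \<le> real m" "1 \<le> real d" "1 \<le> lam" "0 \<le> Lg" "0 \<le> PP j"
  using k nV_pos Lg m d lam PP_pos[of j] by auto

lemma PP_mult_le: "0 \<le> x \<Longrightarrow> x \<le> PP i \<Longrightarrow> 0 \<le> y \<Longrightarrow> y \<le> PP j \<Longrightarrow> i + j \<le> l \<Longrightarrow> x * y \<le> PP l"
  using mult_mono[of x "PP i" y "PP j"] PP_add[of i j] PP_mono[of "i + j" l] ones(8)[of i] by simp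

lemma Vz_mono: "i \<le> j \<Longrightarrow> Vz i \<le> Vz j"
  unfolding Vz_def using ones by (intro mult_left_mono PP_mono) auto

lemma Vz_ge:
  assumes "0 \<le> j"
  shows "1 \<le> Vz j" "PP j \<le> Vz j" "real k * PP j \<le> Vz j" "real nV * PP j \<le> Vz j" "real nV * Lg * PP j \<le> Vz j"
    "real k * Lg * PP j \<le> Vz j" "real k * real nV * Lg * PP j \<le> Vz j"
proof -
  let ?P = "PP j"
  have P: "1 \<le> ?P" using PP_pos assms by simp
  have *: "x * ?P \<le> Vz j" if "x \<le> real k * real nV * Lg * Lg" for x
    unfolding Vz_def using that P by (intro mult_right_mono) auto
  note p = le_prod4[of "real k" "real nV" Lg Lg]
  have p1: "1 \<le> real k * real nV * Lg * Lg" "real k \<le> real k * real nV * Lg * Lg" "real nV \<le> real k * real nV * Lg * Lg"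
    using p ones by auto
  have "real nV * Lg * 1 * 1 \<le> real nV * Lg * real k * Lg" using ones by (intro mult_mono) auto
  moreover have "real k * Lg * 1 * 1 \<le> real k * Lg * real nV * Lg" using ones by (intro mult_mono) auto
  moreover have "real k * real nV * Lg * 1 \<le> real k * real nV * Lg * Lg" using ones by (intro mult_left_mono) auto
  ultimately have p2: "real nV * Lg \<le> real k * real nV * Lg * Lg" "real k * Lg \<le> real k * real nV * Lg * Lg" "real k * real nV * Lg \<le> real k * real nV * Lg * Lg"
    by (simp_all add: ac_simps)
  show "PP j \<le> Vz j" using *[OF p1(1)] by simp
  then show "1 \<le> Vz j" using P by linarith
  show "real k * PP j \<le> Vz j" "real nV * PP j \<le> Vz j" "real nV * Lg * PP j \<le> Vz j"
    "real k * Lg * PP j \<le> Vz j" "real k * real nV * Lg * PP j \<le> Vz j"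
    using *[OF p1(2)] *[OF p1(3)] *[OF p2(1)] *[OF p2(2)] *[OF p2(3)] by auto
qed

lemma const_PP: "x \<le> 2 ^ j \<Longrightarrow> real j / 4 \<le> i \<Longrightarrow> x \<le> PP i"
  using two_le_PP[of j] PP_mono[of "real j / 4" i] by linarith

lemma WW_PP: "real WW \<le> real k * Lg * PP 4"
proof -
  have "50 \<le> PP 2" by (rule const_PP[of _ 6]) auto
  moreover have "real m * lam \<le> PP 2" using sizes_PP lam by (intro PP_mult_le) auto
  ultimately have "50 * (real m * lam) \<le> PP 4" using ones by (intro PP_mult_le[of 50 2 "real m * lam" 2]) auto
  then have "real k * Lg * (50 * (real m * lam)) \<le> real k * Lg * PP 4" using ones by (intro mult_left_mono) auto
  then show ?thesis using WW_le by (simp add: ac_simps)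
qed

lemma Wn_PP: "real Wn \<le> real k * Lg * PP 6"
proof -
  have "real HH * real WW \<le> PP 2 * (real k * Lg * PP 4)" using WW_PP sizes_PP ones by (intro mult_mono) auto
  also have "\<dots> = real k * Lg * (PP 2 * PP 4)" by simp
  also have "PP 2 * PP 4 = PP 6" by (simp flip: PP_add)
  finally show ?thesis by (simp add: Wn_def)
qed

lemma NN_PP: "real NN \<le> real nV * PP 1"
  using sizes_PP by (simp add: NN_def mult_left_mono)

lemma Mx_PP: "real Mx \<le> real k * real nV * Lg * PP 23"
proof -
  have "2 \<le> PP 1" by (rule const_PP[of _ 1]) auto
  then have "2 * real BD \<le> PP 16" using sizes_PP by (intro PP_mult_le) auto
  then have "real Wn * (2 * real BD) \<le> (real k * Lg * PP 6) * PP 16" using Wn_PP ones by (intro mult_mono) auto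
  then have "real NN * (real Wn * (2 * real BD)) \<le> (real nV * PP 1) * ((real k * Lg * PP 6) * PP 16)"
    using NN_PP ones by (intro mult_mono[of "real NN"]) auto
  also have "\<dots> = real k * real nV * Lg * (PP 1 * (PP 6 * PP 16))" by simp
  also have "PP 1 * (PP 6 * PP 16) = PP 23" by (simp flip: PP_add)
  finally show ?thesis by (simp add: Mx_def)
qed

lemma AA_Vz: "real AA \<le> 300 * Vz 28"
proof -
  have V: "Vz j \<le> Vz 28" if "j \<le> 28" for j using that by (rule Vz_mono)
  have 1: "real NN \<le> Vz 28" using NN_PP Vz_ge(4)[of 1] V[of 1] by simp
  have 2: "real Mx \<le> Vz 28" using Mx_PP Vz_ge(7)[of 23] V[of 23] by simp
  have "real NN * real DD \<le> (real nV * PP 1) * PP 3" using NN_PP sizes_PP ones by (intro mult_mono) auto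
  also have "\<dots> = real nV * PP 4" by (simp add: PP_add[of 1 3, simplified])
  finally have 3: "real NN * real DD \<le> Vz 28" using Vz_ge(4)[of 4] V[of 4] by simp
  have "real NN * real Wn \<le> (real nV * PP 1) * (real k * Lg * PP 6)" using NN_PP Wn_PP ones by (intro mult_mono) auto
  also have "\<dots> = real k * real nV * Lg * PP 7" by (simp add: PP_add[of 1 6, simplified])
  finally have 4: "real NN * real Wn \<le> Vz 28" using Vz_ge(7)[of 7] V[of 7] by simp
  have "real m * real d \<le> PP 2" using sizes_PP by (intro PP_mult_le) auto
  then have "real nV * (real m * real d) \<le> real nV * PP 2" by (intro mult_left_mono) auto
  then have 5: "real nV * (real m * real d) \<le> Vz 28" using Vz_ge(4)[of 2] V[of 2] by simp
  have 6: "real DD \<le> Vz 28" using sizes_PP(4) Vz_ge(2)[of 3] V[of 3] by simp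
  have "real AA = 2 * real NN + 2 * real Mx + real NN * real DD + (real NN * real Wn + 2 * real NN) + real nV * (real m * real d) + real DD + 20"
    by (simp add: AA_def algebra_simps)
  then show ?thesis using 1 2 3 4 5 6 Vz_ge(1)[of 28] by linarith
qed

text \<open>The structure is built only for \<open>k < nV\<close>, and then the logarithm of the
  factor \<open>k\<close> in the dictionary size is at most \<open>Lg\<close>.\<close>

lemma KM_PP: assumes "k < nV" shows "real KM \<le> Lg * PP 4"
proof -
  let ?x = "2 * Mx + 2 * NN"
  have "real KM \<le> 1 + log 2 (real ?x)" using NN_ge by (intro Least_power_le KM_def) auto
  also have "log 2 (real ?x) \<le> log 2 (4 * (real k * real nV * Lg * PP 23))"
  proof (intro log_mono)
    have "real nV * PP 1 \<le> real k * real nV * Lg * PP 23"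
    proof (rule mult_mono)
      show "real nV \<le> real k * real nV * Lg" using le_prod4[of "real k" "real nV" Lg 1] ones by auto
    qed (use ones PP_mono in auto)
    then have "real NN \<le> real k * real nV * Lg * PP 23" using NN_PP by linarith
    then show "real ?x \<le> 4 * (real k * real nV * Lg * PP 23)" using Mx_PP by simp
  qed (use NN_ge in auto)
  also have "\<dots> = 2 + log 2 (real k) + log 2 (real nV) + log 2 Lg + 23 * (Ys * log 2 Bs)"
  proof -
    have "log 2 4 = (2::real)" using log_nat_power[of 2 2 2] by simp
    moreover have "log 2 (PP 23) = 23 * (Ys * log 2 Bs)" using Bs by (simp add: PP_def log_powr)
    ultimately show ?thesis using ones PP_pos[of 23] by (simp add: log_mult)
  qed
  also have "\<dots> \<le> 2 + Lg + Lg + Lg + 23 * PP 2"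
  proof (intro add_mono mult_left_mono)
    have "log 2 (real k) \<le> log 2 (real nV)" using assms k by (intro log_mono) auto
    then show "log 2 (real k) \<le> Lg" using Lg by linarith
    show "log 2 (real nV) \<le> Lg" by (rule Lg)
    show "log 2 Lg \<le> Lg" using ones by (intro log2_le) auto
    have "log 2 Bs \<le> Bs" using Bs by (intro log2_le) auto
    also have "\<dots> \<le> PP 1" using PP_ge(1)[of 1 1] Ys Bs by simp
    finally have lB: "log 2 Bs \<le> PP 1" .
    have "0 \<le> log 2 Bs" using Bs by simp
    then show "Ys * log 2 Bs \<le> PP 2" using lB Ys PP_ge(3)[of Ys 1] by (intro PP_mult_le) auto
  qed auto
  also have "1 + (2 + Lg + Lg + Lg + 23 * PP 2) \<le> 29 * (Lg * PP 2)"
  proof -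
    have "1 \<le> PP 2" by (rule PP_pos) simp
    then have "Lg \<le> Lg * PP 2" "PP 2 \<le> Lg * PP 2" "1 \<le> Lg * PP 2" using le_prod4[of Lg "PP 2" 1 1] ones by auto
    then show ?thesis by linarith
  qed
  also have "\<dots> = Lg * (29 * PP 2)" by simp
  also have "\<dots> \<le> Lg * PP 4"
  proof (intro mult_left_mono PP_mult_le)
    show "29 \<le> PP 2" by (rule const_PP[of _ 5]) auto
  qed (use ones in auto)
  finally show ?thesis by simp
qed

lemma TG_PP: "real TG \<le> real k * Lg * PP 27"
proof -
  have "1 \<le> real k * Lg * PP 6" using le_prod4[of "real k" Lg "PP 6" 1] ones PP_pos[of 6] by auto
  then have 1: "real Wn + 1 \<le> 2 * (real k * Lg * PP 6)" using Wn_PP by linarith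
  have P3: "1 \<le> PP 3" "1 \<le> PP 18" by (auto intro: PP_pos)
  have "real BD * (24 * real DD + 22) \<le> PP 15 * (46 * PP 3)" using sizes_PP P3 ones by (intro mult_mono) auto
  also have "\<dots> = 46 * PP 18" by (simp add: PP_add[of 15 3, simplified])
  finally have "2 * real BD * (24 * real DD + 22) + 30 \<le> 122 * PP 18" using P3 by simp
  also have "\<dots> \<le> PP 20"
  proof (intro PP_mult_le)
    show "122 \<le> PP 2" by (rule const_PP[of _ 7]) auto
  qed (use ones in auto)
  finally have "(real Wn + 1) * (2 * real BD * (24 * real DD + 22) + 30) \<le> 2 * (real k * Lg * PP 6) * PP 20"
    using 1 ones by (intro mult_mono) auto
  also have "\<dots> = real k * Lg * (2 * (PP 6 * PP 20))" by simp
  also have "\<dots> \<le> real k * Lg * PP 27"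
  proof (intro mult_left_mono PP_mult_le)
    show "2 \<le> PP 1" by (rule const_PP[of _ 1]) auto
  qed (use ones in auto)
  finally show ?thesis by (simp add: TG_def algebra_simps)
qed

lemma TP_Vz: "real TP \<le> 300 * Vz 28"
proof -
  have V: "Vz j \<le> Vz 28" if "j \<le> 28" for j using that by (rule Vz_mono)
  have TB: "real TB \<le> 170 * Vz 28" if kn: "k < nV"
  proof -
    note KM = KM_PP[OF kn]
    have "1 \<le> Lg * PP 4" using le_prod4[of Lg "PP 4" 1 1] ones PP_pos[of 4] by auto
    then have K: "8 * real KM + 30 \<le> 38 * (Lg * PP 4)" using KM by linarith
    have "real NN * (8 * real KM + 30) \<le> (real nV * PP 1) * (38 * (Lg * PP 4))" using NN_PP K ones by (intro mult_mono) auto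
    also have "\<dots> = 38 * (real nV * Lg * PP 5)" by (simp add: PP_add[of 1 4, simplified])
    finally have 1: "real NN * (8 * real KM + 30) \<le> 38 * Vz 28" using Vz_ge(5)[of 5] V[of 5] by simp
    have "real Mx * (8 * real KM + 30) \<le> (real k * real nV * Lg * PP 23) * (38 * (Lg * PP 4))" using Mx_PP K ones by (intro mult_mono) auto
    also have "\<dots> = 38 * Vz 27" by (simp add: Vz_def PP_add[of 23 4, simplified])
    finally have 2: "real Mx * (8 * real KM + 30) \<le> 38 * Vz 28" using V[of 27] by simp
    have "1 \<le> real k * Lg * PP 27" using le_prod4[of "real k" Lg "PP 27" 1] ones PP_pos[of 27] by auto
    then have "real TG + 2 \<le> 3 * (real k * Lg * PP 27)" using TG_PP by linarith
    then have "real NN * (real TG + 2) \<le> (real nV * PP 1) * (3 * (real k * Lg * PP 27))" using NN_PP ones by (intro mult_mono) auto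
    also have "\<dots> = 3 * (real k * real nV * Lg * PP 28)" by (simp add: PP_add[of 1 27, simplified])
    finally have 3: "real NN * (real TG + 2) \<le> 3 * Vz 28" using Vz_ge(7)[of 28] by simp
    have 4: "real NN \<le> Vz 28" using NN_PP Vz_ge(4)[of 1] V[of 1] by simp
    have "real TB = 2 * (real NN * (8 * real KM + 30)) + 20 + 5 * real NN + 2 + (real NN * (real TG + 2) + real Mx * (8 * real KM + 30) + 20)"
      by (simp add: TB_def TL_def algebra_simps)
    then show ?thesis using 1 2 3 4 Vz_ge(1)[of 28] by linarith
  qed
  have 1: "real DD \<le> Vz 28" using sizes_PP(4) Vz_ge(2)[of 3] V[of 3] by simp
  have 2: "real m \<le> Vz 28" using sizes_PP(1) Vz_ge(2)[of 1] V[of 1] by simp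
  have 3: "real k \<le> Vz 28" using Vz_ge(3)[of 28] mult_left_mono[of 1 "PP 28" "real k"] PP_pos[of 28] by simp
  have 4: "real WW \<le> Vz 28" using WW_PP Vz_ge(6)[of 4] V[of 4] by simp
  have "real NN * real DD \<le> (real nV * PP 1) * PP 3" using NN_PP sizes_PP ones by (intro mult_mono) auto
  also have "\<dots> = real nV * PP 4" by (simp add: PP_add[of 1 3, simplified])
  finally have 5: "real NN * real DD \<le> Vz 28" using Vz_ge(4)[of 4] V[of 4] by simp
  have "real TP = 7 * real DD + 3 * real m + 3 * real k + 3 * real WW + 40 * (real NN * real DD) + 37 + (if k < nV then real TB else 1)"
    by (simp add: TP_def)
  then show ?thesis using 1 2 3 4 5 TB Vz_ge(1)[of 28] by (cases "k < nV") auto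
qed

text \<open>\<open>Lg * Lg\<close> fits under \<open>Lg powr cst\<close>, and the
  \<open>m ^ 2\<close> inside \<open>Ys\<close> under
  \<open>m powr (cst / \<epsilon>)\<close>.\<close>

lemma preprocessing_bound_ge:
  assumes "x \<le> 300 * Vz 28"
  shows "x \<le> real k * preprocessing_bound cst d m nV \<epsilon>"
proof -
  have c: "28 \<le> cst" "300 \<le> cst" by (simp_all add: cst_def)
  have e: "2 \<le> 1 / \<epsilon>" by (rule lam)
  have mp: "real m ^ 2 \<le> real m powr (cst / \<epsilon>)"
  proof -
    have "2 \<le> cst * (1 / \<epsilon>)" using mult_mono[OF c(1) e] c by simp
    then have "real m powr 2 \<le> real m powr (cst / \<epsilon>)" using m by (intro powr_mono) auto
    then show ?thesis using m by (simp add: powr_numeral)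
  qed
  have P: "PP 28 \<le> Bs powr (cst * (real m powr (cst / \<epsilon>) * real d * lam))"
    unfolding PP_def
  proof (intro powr_mono)
    show "28 * Ys \<le> cst * (real m powr (cst / \<epsilon>) * real d * lam)"
      unfolding Ys_def using c mp lam by (intro mult_mono) auto
  qed (use Bs in auto)
  have L: "Lg * Lg \<le> Lg powr cst"
  proof -
    have "Lg * Lg = Lg powr 2" using ones by (simp add: powr_numeral power2_eq_square)
    also have "\<dots> \<le> Lg powr cst" using ones c by (intro powr_mono) auto
    finally show ?thesis .
  qed
  have E: "1 \<le> (1 / \<epsilon>) powr cst" using e c by (intro ge_one_powr_ge_zero) auto
  have D: "1 \<le> real d * real m ^ 2" using mult_mono[of 1 "real d" 1 "real m ^ 2"] ones one_le_power[of "real m" 2] by simp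
  have "300 * Vz 28 = real k * ((300 * (1 * real nV) * (Lg * Lg) * 1) * PP 28)" by (simp add: Vz_def)
  also have "\<dots> \<le> real k * ((cst * (real d * real m ^ 2 * real nV) * Lg powr cst * (1 / \<epsilon>) powr cst) * Bs powr (cst * (real m powr (cst / \<epsilon>) * real d * lam)))"
    using c D L E P ones Bs eps by (intro mult_left_mono mult_mono mult_right_mono) (auto intro!: mult_nonneg_nonneg)
  also have "\<dots> = real k * preprocessing_bound cst d m nV \<epsilon>"
    by (simp add: preprocessing_bound_def soft_O_def Lg_def lam_def Bs_def)
  finally show ?thesis using assms by linarith
qed


section \<open>Query time\<close>

definition "ell = log 2 (real nV + 1)"
definition "fq = real d * real m powr (cst / \<epsilon>) * 2 ^ (4 * m) * ell"
definition "Fq = log 2 (fq + 2)"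
text \<open>Bounds the small logarithmic factors. Two copies occur: one from the bisection over the
  scales, one from the search in the dictionary.\<close>

definition "KF = (1 + log 2 (real k)) * Fq * (1 / \<epsilon>)"

lemma ell: "1 \<le> ell"
  unfolding ell_def using ones by (subst le_log_iff) auto

lemma fq: "real d * real m * (real E4 * real E4) * ell \<le> fq" "real d \<le> fq" "real m \<le> fq" "real d * real m * ell \<le> fq"
proof -
  have e: "2 \<le> 1 / \<epsilon>" by (rule lam)
  have "1 \<le> cst / \<epsilon>" using mult_mono[of 1 cst 1 "1 / \<epsilon>"] e by (simp add: cst_def)
  then have "real m powr 1 \<le> real m powr (cst / \<epsilon>)" using m by (intro powr_mono) auto
  then have mp: "real m \<le> real m powr (cst / \<epsilon>)" using m by simp
  have E: "(2::real) ^ (4 * m) = real E4 * real E4" by (simp add: E4_def power_mult flip: power_mult_distrib)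
  have E1: "1 \<le> real E4 * real E4" unfolding E[symmetric] by simp
  show f1: "real d * real m * (real E4 * real E4) * ell \<le> fq"
    unfolding fq_def E using mp ell by (intro mult_mono) auto
  note p = le_prod4[OF ones(5,4) E1 ell]
  show "real d \<le> fq" "real m \<le> fq" using p f1 by linarith+
  have "real d * real m * 1 * ell \<le> real d * real m * (real E4 * real E4) * ell"
    using E1 ell by (intro mult_right_mono mult_left_mono) auto
  then show "real d * real m * ell \<le> fq" using f1 by simp
qed

lemma Fq: "1 \<le> Fq" "0 < x \<Longrightarrow> x \<le> fq \<Longrightarrow> log 2 x \<le> Fq"
proof -
  have "1 \<le> fq" using fq(2) ones by linarith
  then show "1 \<le> Fq" unfolding Fq_def by (subst le_log_iff) auto
  show "log 2 x \<le> Fq" if "0 < x" "x \<le> fq" unfolding Fq_def using that by (intro log_mono) auto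
qed

lemma query_bound_ge:
  assumes "x \<le> 100000 * (real k * (real d * real m * (real E4 * real E4) * ell) * (Fq * Fq) * (1 / \<epsilon> * (1 / \<epsilon>)))"
  shows "x \<le> real k * query_bound cst d m nV \<epsilon>"
proof -
  have c: "2 \<le> cst" "100000 \<le> cst" by (simp_all add: cst_def)
  have e: "2 \<le> 1 / \<epsilon>" by (rule lam)
  have sq: "y * y \<le> y powr cst" if "1 \<le> y" for y :: real
  proof -
    have "y * y = y powr 2" using that by (simp add: powr_numeral power2_eq_square)
    also have "\<dots> \<le> y powr cst" using that c by (intro powr_mono) auto
    finally show ?thesis .
  qed
  have s1: "Fq * Fq \<le> Fq powr cst" "1 / \<epsilon> * (1 / \<epsilon>) \<le> (1 / \<epsilon>) powr cst" using e Fq by (auto intro!: sq simp del: times_divide_eq_left times_divide_eq_right)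
  have f0: "0 \<le> fq" using fq(2) ones by linarith
  have e0: "0 \<le> 1 / \<epsilon> * (1 / \<epsilon>)" by simp
  have "100000 * (real k * (real d * real m * (real E4 * real E4) * ell) * (Fq * Fq) * (1 / \<epsilon> * (1 / \<epsilon>))) =
    real k * (100000 * (real d * real m * (real E4 * real E4) * ell) * (Fq * Fq) * (1 / \<epsilon> * (1 / \<epsilon>)))" by (simp only: ac_simps)
  also have "\<dots> \<le> real k * (cst * fq * Fq powr cst * (1 / \<epsilon>) powr cst)"
    using c fq(1) s1 f0 e0 ell Fq(1) ones by (intro mult_left_mono mult_mono) (auto intro!: mult_nonneg_nonneg)
  also have "\<dots> = real k * query_bound cst d m nV \<epsilon>"
    by (simp add: query_bound_def soft_O_def fq_def Fq_def ell_def)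
  finally show ?thesis using assms by linarith
qed

text \<open>The query bound provides the logarithm of \<open>fq\<close>, not \<open>Lg\<close>. Only
  \<open>log 2 Lg\<close> has to be compared with it, so a crude estimate is good enough.\<close>

lemma Lg_le: "Lg \<le> 5 * (real d * real m * ell)"
proof -
  have nm: "1 \<le> real m ^ 2" using ones by simp
  have "2 * 1 * 1 \<le> 2 * real d * real m ^ 2" using ones nm by (intro mult_mono) auto
  then have "real d * real m ^ 2 * real nV + 2 \<le> 2 * real d * real m ^ 2 * (real nV + 1)"
    by (simp add: algebra_simps) (use ones in \<open>auto intro!: mult_nonneg_nonneg add_increasing\<close>)
  then have "Lg \<le> log 2 (2 * real d * real m ^ 2 * (real nV + 1))"
    unfolding Lg_def using ones by (intro log_mono) (auto intro!: add_nonneg_pos)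
  also have "\<dots> = 1 + log 2 (real d) + 2 * log 2 (real m) + ell"
    using ones by (simp add: log_mult log_nat_power ell_def)
  also have "\<dots> \<le> 1 + real d + 2 * real m + ell"
    using log2_le[of "real d"] log2_le[of "real m"] ones by linarith
  also have "\<dots> \<le> 5 * (real d * real m * ell)"
    using le_prod4[OF ones(5,4) ell order_refl] unfolding mult_1_right by linarith
  finally show ?thesis .
qed

lemma KF: "1 \<le> KF" "1 + log 2 (real k) \<le> KF" "Fq \<le> KF" "1 / \<epsilon> \<le> KF" "Fq * (1 / \<epsilon>) \<le> KF"
proof -
  have K: "1 \<le> 1 + log 2 (real k)" using k by simp
  have e: "1 \<le> 1 / \<epsilon>" using lam by linarith
  note p = le_prod4[OF K Fq(1) e order_refl]
  show "1 \<le> KF" "1 + log 2 (real k) \<le> KF" "Fq \<le> KF" "1 / \<epsilon> \<le> KF" using p unfolding KF_def by auto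
  have "1 * (Fq * (1 / \<epsilon>)) \<le> (1 + log 2 (real k)) * (Fq * (1 / \<epsilon>))" using K Fq(1) eps by (intro mult_right_mono) auto
  then show "Fq * (1 / \<epsilon>) \<le> KF" by (simp add: KF_def)
qed

lemma Wn_pos: "1 \<le> Wn"
proof -
  have al1: "1 \<le> al" "1 \<le> be" using al_pos be_pos by linarith+
  then have "1 \<le> al * be" using mult_le_mono[OF al1] by (simp only: mult_1)
  moreover have "2 * al * be = 2 * (al * be)" by simp
  ultimately have "1 < (2::nat) ^ WW" using WW(1) by linarith
  then have "0 < WW" by (cases WW) auto
  then show ?thesis using HH_pos by (simp add: Wn_def Suc_le_eq)
qed

text \<open>The number of scales is linear in \<open>Lg\<close> and in \<open>k\<close>, so
  bisecting over them costs a logarithm of \<open>k\<close> and an iterated logarithm of the number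
  of curves.\<close>

lemma log_Wn: "log 2 (real Wn) \<le> 18 * KF"
proof -
  have pos: "0 < real WW" "0 < real HH" using Wn_pos by (auto simp: Wn_def)
  have "log 2 (real WW) \<le> log 2 (50 * (real k * real m * lam * Lg))" using WW_le pos by (intro log_mono) auto
  also have "\<dots> = log 2 50 + log 2 (real k) + log 2 (real m) + log 2 lam + log 2 Lg" using ones by (simp add: log_mult)
  also have "\<dots> \<le> 6 + log 2 (real k) + Fq + lam + (3 + Fq)"
  proof (intro add_mono order_refl)
    show "log 2 50 \<le> (6::real)" by (subst log_le_iff) auto
    show "log 2 (real m) \<le> Fq" using ones fq by (intro Fq) auto
    show "log 2 lam \<le> lam" using ones by (intro log2_le) auto
    have "log 2 Lg \<le> log 2 (8 * (real d * real m * ell))" using Lg_le ones ell by (intro log_mono) auto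
    also have "\<dots> = 3 + log 2 (real d * real m * ell)" using ones ell log_nat_power[of 2 2 3] by (simp add: log_mult)
    also have "\<dots> \<le> 3 + Fq" using ones ell fq by (intro add_left_mono Fq) auto
    finally show "log 2 Lg \<le> 3 + Fq" .
  qed
  finally have "log 2 (real WW) \<le> 9 + log 2 (real k) + 2 * Fq + lam" by simp
  moreover have "log 2 (real Wn) = log 2 (real HH) + log 2 (real WW)" using pos by (simp add: Wn_def log_mult)
  ultimately show ?thesis using log_HH lam(2) KF by linarith
qed

lemma KW_le: "real KW \<le> 19 * KF"
  using Least_power_le[OF Wn_pos KW_def] log_Wn KF by linarith

text \<open>The dictionary is exponential in \<open>m * d\<close>, so a search in it costs about
  \<open>m * d\<close> small logarithms.\<close>

lemma KM_le: "real KM \<le> 49 * (real m * real d * ell * KF)"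
proof -
  have bd: "1 \<le> BD" by (simp add: BD_def bb_def)
  have "NN * 1 \<le> NN * (Wn * (2 * BD))" using Wn_pos bd by (intro mult_le_mono2) (simp add: Suc_le_eq)
  then have NM: "NN \<le> Mx" by (simp add: Mx_def)
  have "real KM \<le> 1 + log 2 (real (2 * Mx + 2 * NN))" using NN_ge by (intro Least_power_le KM_def) auto
  also have "log 2 (real (2 * Mx + 2 * NN)) \<le> log 2 (4 * (real NN * (real Wn * (2 * real BD))))"
  proof (rule log_mono)
    have "real NN * (real Wn * (2 * real BD)) = real Mx" by (simp add: Mx_def)
    then show "real (2 * Mx + 2 * NN) \<le> 4 * (real NN * (real Wn * (2 * real BD)))" using NM by simp
  qed (use NN_ge in auto)
  also have "\<dots> = 3 + log 2 (real NN) + log 2 (real Wn) + log 2 (real BD)"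
    using NN_ge Wn_pos bd log_nat_power[of 2 2 3] by (simp add: log_mult)
  also have "\<dots> \<le> 3 + (ell + 2 * real m) + 18 * KF + 24 * (real m * real d * KF)"
  proof (intro add_mono order_refl log_Wn)
    have "real E4 = 2 powr (2 * real m)" using powr_realpow[of 2 "2 * m"] by (simp add: E4_def power_mult)
    then have "log 2 (real NN) = log 2 (real nV) + 2 * real m" using ones by (simp add: NN_def log_mult)
    moreover have "log 2 (real nV) \<le> ell" unfolding ell_def using ones by (intro log_mono) auto
    ultimately show "log 2 (real NN) \<le> ell + 2 * real m" by simp
    have "1 \<le> d * HH" using d HH_pos by (simp add: Suc_le_eq)
    then have "1 \<le> real (d * HH)" by (metis of_nat_1 of_nat_le_iff)
    then have "real bb \<le> 5 * (real d * real HH)" by (simp add: bb_def)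
    then have "log 2 (real bb) \<le> log 2 (5 * (real d * real HH))" by (intro log_mono) (auto simp: bb_def)
    also have "\<dots> = log 2 5 + log 2 (real d) + log 2 (real HH)" using ones HH_pos by (simp add: log_mult)
    also have "\<dots> \<le> 3 + Fq + (4 + lam)"
    proof (intro add_mono log_HH)
      show "log 2 5 \<le> (3::real)" by (subst log_le_iff) auto
      show "log 2 (real d) \<le> Fq" using ones fq by (intro Fq) auto
    qed
    also have "\<dots> \<le> 8 * KF"
    proof -
      \<comment> \<open>For two numbers that are at least 1 the sum is at most the product plus
        1.\<close>
      have "Fq + 1 / \<epsilon> \<le> Fq * (1 / \<epsilon>) + 1"
        using mult_nonneg_nonneg[of "Fq - 1" "1 / \<epsilon> - 1"] Fq lam by (simp add: algebra_simps)
      then show ?thesis using KF lam(2,4) by linarith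
    qed
    finally have "log 2 (real bb) \<le> 8 * KF" .
    then have "real DD * log 2 (real bb) \<le> real DD * (8 * KF)" by (intro mult_left_mono) auto
    then show "log 2 (real BD) \<le> 24 * (real m * real d * KF)"
      by (simp add: BD_def log_nat_power bb_def DD_def LL_def mult.assoc)
  qed
  also have "1 + (3 + (ell + 2 * real m) + 18 * KF + 24 * (real m * real d * KF)) \<le> 49 * (real m * real d * ell * KF)"
  proof -
    note p = le_prod4[OF ones(4,5) ell KF(1)]
    have "real m * real d * 1 * KF \<le> real m * real d * ell * KF" using ell KF(1) ones by (intro mult_right_mono mult_left_mono) auto
    then show ?thesis using p by simp
  qed
  finally show ?thesis by simp
qed

text \<open>The linear scan pairs \<open>4 ^ m\<close> expansions of the query with
  \<open>4 ^ m\<close> of each curve, which exhausts \<open>2 ^ (4 * m)\<close>, and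
  \<open>nV \<le> k\<close> turns the number of curves into the factor \<open>k\<close>. With the
  structure a single factor \<open>4 ^ m\<close> is spent.\<close>

lemma TQ_le: "real TQ \<le> real k * query_bound cst d m nV \<epsilon>"
proof -
  define U where "U = real m * real d * ell * KF"
  define E where "E = real E4"
  have E1: "1 \<le> E" using E4_ge by (simp add: E_def)
  have DD: "real DD = 3 * (real m * real d)" by (simp add: DD_def LL_def)
  have md: "1 \<le> real m * real d" using le_prod4[of "real m" "real d" 1 1] ones by auto
  show ?thesis
  proof (cases "k < nV")
    case False
    define N where "N = real NN"
    have "1 \<le> N" using NN_ge by (simp add: N_def)
    moreover have "N \<le> real k * E" using False by (auto simp: N_def NN_def E_def mult_right_mono)
    ultimately have N: "1 \<le> N" "N \<le> real k * E" .
    define D where "D = real DD"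
    have D: "1 \<le> D" using md DD by (simp add: D_def)
    have "real TQ = E * (13 * D + 9 + N * (12 * D + 9)) + 5" using False by (simp add: TQ_def TX_def E_def D_def N_def algebra_simps)
    also have "\<dots> \<le> E * (43 * (N * D)) + 5 * (E * (N * D))"
    proof (intro add_mono mult_left_mono)
      have "D \<le> N * D" "N \<le> N * D" "1 \<le> N * D" using le_prod4[of N D 1 1] N D by auto
      then show "13 * D + 9 + N * (12 * D + 9) \<le> 43 * (N * D)" by (simp add: algebra_simps)
      show "5 \<le> 5 * (E * (N * D))" using le_prod4[of E N D 1] E1 N D by (simp add: ac_simps)
    qed (use E1 in auto)
    also have "\<dots> = 48 * (E * N * D)" by simp
    also have "\<dots> \<le> 48 * (E * (real k * E) * D)" using N E1 D by (intro mult_left_mono mult_right_mono) auto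
    also have "\<dots> = 144 * (real k * (real d * real m * (E * E) * 1) * (1 * 1) * (1 * 1))" by (simp add: D_def DD)
    also have "\<dots> \<le> 100000 * (real k * (real d * real m * (E * E) * ell) * (Fq * Fq) * (1 / \<epsilon> * (1 / \<epsilon>)))"
      using Fq(1) lam E1 ell ones by (intro mult_mono) (auto intro!: mult_nonneg_nonneg)
    finally show ?thesis unfolding E_def by (rule query_bound_ge)
  next
    case True
    have U: "1 \<le> U" "real m * real d \<le> U"
    proof -
      show "1 \<le> U" unfolding U_def using le_prod4[OF ones(4,5) ell KF(1)] by simp
      have "real m * real d * 1 * 1 \<le> real m * real d * ell * KF" using ell KF(1) ones by (intro mult_mono) auto
      then show "real m * real d \<le> U" by (simp add: U_def)
    qed
    have KM: "real KM \<le> 49 * U" using KM_le by (simp add: U_def)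
    have D: "real DD \<le> 3 * U" using U DD by simp
    have "17 * real DD + 5 * real KM + 32 \<le> 328 * U" using KM D U by linarith
    then have "real KW * (17 * real DD + 5 * real KM + 32) \<le> 19 * KF * (328 * U)" using KW_le KF(1) by (intro mult_mono) auto
    moreover have "U \<le> KF * U" using mult_right_mono[OF KF(1), of U] U by simp
    moreover have "real TS = 29 * real DD + 10 * real KM + 70 + real KW * (17 * real DD + 5 * real KM + 32)" by (simp add: TS_def)
    ultimately have TS: "real TS + 13 * real DD + 7 \<le> 6990 * (KF * U)" using KM D U by linarith
    have "real TQ = E * (real TS + 13 * real DD + 7) + 5" using True by (simp add: TQ_def TX_def E_def algebra_simps)
    also have "\<dots> \<le> E * (6990 * (KF * U)) + 5 * (E * (KF * U))"
    proof (intro add_mono mult_left_mono TS)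
      show "5 \<le> 5 * (E * (KF * U))" using le_prod4[of E KF U 1] E1 KF U by (simp add: ac_simps)
    qed (use E1 in auto)
    also have "\<dots> = 6995 * (E * (real m * real d * ell) * (KF * KF))" by (simp add: U_def)
    also have "KF * KF = ((1 + log 2 (real k)) * (1 + log 2 (real k))) * (Fq * Fq) * (1 / \<epsilon> * (1 / \<epsilon>))" by (simp add: KF_def)
    \<comment> \<open>the factor \<open>k\<close> of the bound pays for the two logarithms of \<open>k\<close>\<close>
    also have "6995 * (E * (real m * real d * ell) * \<dots>) \<le> 6995 * ((E * E) * (real m * real d * ell) * ((9 * real k) * (Fq * Fq) * (1 / \<epsilon> * (1 / \<epsilon>))))"
    proof -
      \<comment> \<open>Estimating the logarithm of the square root gives
        \<open>1 + log 2 k \<le> 3 * sqrt k\<close>, whose square is linear in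
        \<open>k\<close>.\<close>
      define r where "r = sqrt (real k)"
      have r: "1 \<le> r" "real k = r * r" using ones by (auto simp: r_def)
      have "log 2 (real k) = 2 * log 2 r" using r by (simp add: log_mult)
      then have "1 + log 2 (real k) \<le> 3 * r" using log2_le[of r] r by simp
      then have "(1 + log 2 (real k)) * (1 + log 2 (real k)) \<le> (3 * r) * (3 * r)" using ones r(1) by (intro mult_mono) auto
      then have k9: "(1 + log 2 (real k)) * (1 + log 2 (real k)) \<le> 9 * real k" unfolding r by simp
      have e2: "0 \<le> 1 / \<epsilon> * (1 / \<epsilon>)" by simp
      have mdl: "0 \<le> real m * real d * ell" using ell by simp
      have "E * 1 \<le> E * E" using E1 by (intro mult_left_mono) auto
      then have 1: "E * (real m * real d * ell) \<le> E * E * (real m * real d * ell)" using mdl by (intro mult_right_mono) auto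
      have "(1 + log 2 (real k)) * (1 + log 2 (real k)) * (Fq * Fq) \<le> 9 * real k * (Fq * Fq)" by (rule mult_right_mono[OF k9]) simp
      then have 2: "(1 + log 2 (real k)) * (1 + log 2 (real k)) * (Fq * Fq) * (1 / \<epsilon> * (1 / \<epsilon>)) \<le> 9 * real k * (Fq * Fq) * (1 / \<epsilon> * (1 / \<epsilon>))"
        using e2 by (rule mult_right_mono)
      have "E * (real m * real d * ell) * ((1 + log 2 (real k)) * (1 + log 2 (real k)) * (Fq * Fq) * (1 / \<epsilon> * (1 / \<epsilon>))) \<le>
        E * E * (real m * real d * ell) * (9 * real k * (Fq * Fq) * (1 / \<epsilon> * (1 / \<epsilon>)))"
        by (rule mult_mono[OF 1 2]) (use mdl in auto)
      then show ?thesis by simp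
    qed
    also have "\<dots> = 62955 * (real k * (real d * real m * (E * E) * ell) * (Fq * Fq) * (1 / \<epsilon> * (1 / \<epsilon>)))" by (simp add: ac_simps)
    also have "\<dots> \<le> 100000 * (real k * (real d * real m * (E * E) * ell) * (Fq * Fq) * (1 / \<epsilon> * (1 / \<epsilon>)))"
      using ell Fq(1) E1 by (intro mult_right_mono) (auto intro!: mult_nonneg_nonneg)
    finally show ?thesis unfolding E_def by (rule query_bound_ge)
  qed
qed

end

theorem theorem16:
  "\<exists>(pre :: com) (qry :: com) (c :: real). c > 0 \<and>
     (\<forall>(d :: nat) (m :: nat) (k :: nat) (\<epsilon> :: real) (Vs :: curve list).
        1 \<le> d \<longrightarrow> 2 \<le> m \<longrightarrow> 1 \<le> k \<longrightarrow> 0 < \<epsilon> \<longrightarrow> \<epsilon> \<le> 1 / 2 \<longrightarrow>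
        Vs \<noteq> [] \<longrightarrow> (\<forall>V \<in> set Vs. is_curve d V \<and> length V \<le> m) \<longrightarrow>
        (AE \<omega> in tape_measure.
           preprocessing_within \<omega> pre (data_state d m k \<epsilon> Vs)
             (real k * preprocessing_bound c d m (length Vs) \<epsilon>)
             (real k * preprocessing_bound c d m (length Vs) \<epsilon>)) \<and>
        (\<forall>Q. is_curve d Q \<longrightarrow> length Q \<le> m \<longrightarrow>
           (AE \<omega> in tape_measure.
              query_within \<omega> pre qry (data_state d m k \<epsilon> Vs) Q
                (real k * query_bound c d m (length Vs) \<epsilon>)
                (real k * preprocessing_bound c d m (length Vs) \<epsilon>)) \<and>
           measure tape_measure
             {\<omega> \<in> space tape_measure. \<exists>j.
                reports \<omega> pre qry (data_state d m k \<epsilon> Vs) Q j \<and>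
                ann_answer discrete_frechet \<epsilon> Vs Q j}
             \<ge> 1 - (1 / 2) ^ k))"
proof -
  define c :: real where "c = 10 ^ 6"
  have main: "(AE \<omega> in tape_measure. preprocessing_within \<omega> Preprocess (data_state d m k \<epsilon> Vs)
      (real k * preprocessing_bound c d m (length Vs) \<epsilon>) (real k * preprocessing_bound c d m (length Vs) \<epsilon>)) \<and>
    (\<forall>Q. is_curve d Q \<longrightarrow> length Q \<le> m \<longrightarrow>
      (AE \<omega> in tape_measure. query_within \<omega> Preprocess Query (data_state d m k \<epsilon> Vs) Q
        (real k * query_bound c d m (length Vs) \<epsilon>) (real k * preprocessing_bound c d m (length Vs) \<epsilon>)) \<and>
      measure tape_measure {\<omega> \<in> space tape_measure. \<exists>j.
        reports \<omega> Preprocess Query (data_state d m k \<epsilon> Vs) Q j \<and> ann_answer discrete_frechet \<epsilon> Vs Q j} \<ge> 1 - (1 / 2) ^ k)"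
    if a: "1 \<le> d" "2 \<le> m" "1 \<le> k" "0 < \<epsilon>" "\<epsilon> \<le> 1 / 2" "Vs \<noteq> []" "\<forall>V \<in> set Vs. is_curve d V \<and> length V \<le> m"
    for d m k :: nat and \<epsilon> :: real and Vs :: "curve list"
  proof (intro conjI allI impI AE_I2)
    \<comment> \<open>Halting and the resource bounds are shown for every tape, which is more than
      the almost sure statement.\<close>
    fix \<omega> :: tape
    interpret ann d m k \<epsilon> Vs \<omega> by unfold_locales (use a in auto)
    have c: "c = cst" by (simp add: c_def cst_def)
    have n: "length Vs = nV" by (simp add: nV_def)
    note A = preprocessing_bound_ge[OF AA_Vz] and T = preprocessing_bound_ge[OF TP_Vz]
    show "preprocessing_within \<omega> Preprocess (data_state d m k \<epsilon> Vs) (real k * preprocessing_bound c d m (length Vs) \<epsilon>)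
      (real k * preprocessing_bound c d m (length Vs) \<epsilon>)"
    proof (rule preprocessing_run)
      fix t a s assume r: "run \<omega> Preprocess (data_state d m k \<epsilon> Vs) t a s" "t \<le> TP" "a \<le> AA"
      then have "real t \<le> real TP" "real a \<le> real AA" by simp_all
      then show ?thesis unfolding preprocessing_within_def c n using r(1) A T by (meson order_trans)
    qed
    fix Q assume Q: "is_curve d Q" "length Q \<le> m"
    show "query_within \<omega> Preprocess Query (data_state d m k \<epsilon> Vs) Q
      (real k * query_bound c d m (length Vs) \<epsilon>) (real k * preprocessing_bound c d m (length Vs) \<epsilon>)"
    proof (rule query_run[OF Q])
      fix t a s t' a' s' assume r: "run \<omega> Preprocess (data_state d m k \<epsilon> Vs) t a s" "run \<omega> Query (with_query Q s) t' a' s'" "t' \<le> TQ" "a' \<le> AA"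
      then have "real t' \<le> real TQ" "real a' \<le> real AA" by simp_all
      then show ?thesis unfolding query_within_def c n using r(1,2) A TQ_le by (meson order_trans)
    qed
    show "1 - (1 / 2) ^ k \<le> measure tape_measure {\<omega> \<in> space tape_measure. \<exists>j.
        reports \<omega> Preprocess Query (data_state d m k \<epsilon> Vs) Q j \<and> ann_answer discrete_frechet \<epsilon> Vs Q j}"
      by (rule success_probability[OF Q])
  qed
  have "0 < c" by (simp add: c_def)
  with main show ?thesis by blast
qed

end
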